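(* Let $n, m, q$ be integers with $m \ge 1$, $q \ge 0$ and $m \le n-q$. Fix a $q$-dimensional linear subspace $Q \subseteq \mathbb{R}^n$ and a real number $r_0 \ge 0$. Then for every measurable non-negative function $f \colon (\mathbb{R}^n)^m \to \mathbb{R}$, $$\int_{(\mathbb{R}^n)^m} f(\mathbf{x}) \, d\mathbf{x} = \int_{L \in \mathcal{L}_m^{n-q}} \int_{r \ge r_0} \int_{z \in S(L)} \int_{\mathbf{u} \in S(L \oplus Q)^m} f\!\left(\sqrt{r^2-r_0^2}\, z + r\mathbf{u}\right) r^{m(n-1)+1} (r^2-r_0^2)^{\frac{m-2}{2}} \left[ m!\, \mathrm{Vol}_m\!\left(-\tfrac{\sqrt{r^2-r_0^2}}{r} z,\ \mathbf{u}^{L}\right) \right]^{n-q-m+1} d\mathbf{u}\, dz\, dr\, dL,$$ where $\mathcal{L}_m^{n-q}$ is the Grassmannian of $m$-dimensional linear subspaces of $\mathbb{R}^n$ orthogonal to $Q$ (that is, contained in $Q^\perp$), $S(L)$ is the unit sphere in $L$, $S(L\oplus Q)$ is the unit sphere in $L \oplus Q$, and $\mathbf{u}^L$ is the tuple of orthogonal projections of the points of $\mathbf{u}$ onto $L$.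
   Context: Integration over $(\mathbb{R}^n)^m$ is with respect to the $m$-fold product of Lebesgue measure on $\mathbb{R}^n$. For a tuple $\mathbf{u} = (u_1,\dots,u_m)$ of points, a point $z$ and reals $a, r$, the notation $a z + r\mathbf{u}$ means $(a z + r u_1, \dots, a z + r u_m)$, and $\mathbf{u}^L = (u_1^L,\dots,u_m^L)$, where $u_i^L$ is the orthogonal projection of $u_i$ onto $L$. For $m+1$ points $y_0,\dots,y_m$, $\mathrm{Vol}_m(y_0,\dots,y_m)$ is the $m$-dimensional volume of the simplex they span; $\mathrm{Vol}_m(y,\mathbf{u}^L)$ means $\mathrm{Vol}_m(y,u_1^L,\dots,u_m^L)$. Unit spheres carry the standard surface (Hausdorff) measure (on the $0$-dimensional unit sphere, consisting of two points, this is counting measure), and $S(\cdot)^m$ carries the $m$-fold product measure. Let $\sigma_j$ denote the surface area of the unit sphere in $\mathbb{R}^j$ (so $\sigma_1 = 2$). The Grassmannian of $k$-dimensional linear subspaces of an $N$-dimensional Euclidean space carries the rotation-invariant measure with total mass $\|\mathcal{L}_k^N\| = \frac{\sigma_N \sigma_{N-1}\cdots\sigma_{N-k+1}}{\sigma_1\sigma_2\cdots\sigma_k}$; here this is used with $k = m$ and the $(n-q)$-dimensional space $Q^\perp$. *)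

theory Defs
  imports "HOL-Analysis.Analysis"
begin

(* Hausdorff measure with the normalising factor vol(unit ball of R^d) / 2^d, which makes it
   agree with Lebesgue measure on d-dimensional subspaces.  The case U = {} is needed only for
   d = 0, where 0 ^ 0 = 1; it makes the 0-dimensional measure the counting measure. *)

definition hausdorff_gauge :: "nat \<Rightarrow> 'a::metric_space set \<Rightarrow> ennreal" where
  "hausdorff_gauge d U =
     (if U = {} then 0 else ennreal (unit_ball_vol (real d) * (diameter U / 2) ^ d))"

(* Boundedness is required because diameter is unspecified on unbounded sets. *)

definition hausdorff_content :: "nat \<Rightarrow> real \<Rightarrow> 'a::metric_space set \<Rightarrow> ennreal" where
  "hausdorff_content d \<delta> A =
     (INF U \<in> {U :: nat \<Rightarrow> 'a set. A \<subseteq> (\<Union>i. U i) \<and> (\<forall>i. bounded (U i) \<and> diameter (U i) \<le> \<delta>)}.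
        \<Sum>i. hausdorff_gauge d (U i))"

definition hausdorff_outer :: "nat \<Rightarrow> 'a::metric_space set \<Rightarrow> ennreal" where
  "hausdorff_outer d A = (SUP \<delta> \<in> {0<..}. hausdorff_content d \<delta> A)"

definition hausdorff_measure :: "nat \<Rightarrow> 'a::metric_space measure" where
  "hausdorff_measure d = measure_of UNIV (sets borel) (hausdorff_outer d)"

definition unit_sphere :: "'a::euclidean_space set \<Rightarrow> 'a set" where
  "unit_sphere V = {x \<in> V. norm x = 1}"

definition unit_sphere_measure :: "'a::euclidean_space set \<Rightarrow> 'a measure" where
  "unit_sphere_measure V = restrict_space (hausdorff_measure (dim V - 1)) (unit_sphere V)"

definition simplex_volume :: "nat \<Rightarrow> 'a::euclidean_space \<Rightarrow> (nat \<Rightarrow> 'a) \<Rightarrow> real" where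
  "simplex_volume m y0 y = measure (hausdorff_measure m) (convex hull (insert y0 (y ` {..<m})))"

definition orth_proj :: "'a::euclidean_space set \<Rightarrow> 'a \<Rightarrow> 'a" where
  "orth_proj L x = (THE y. y \<in> L \<and> x - y \<in> orthogonal_comp L)"

definition subspace_sum :: "'a::euclidean_space set \<Rightarrow> 'a set \<Rightarrow> 'a set" where
  "subspace_sum V W = {x + y | x y. x \<in> V \<and> y \<in> W}"

(* Surface area of the unit sphere in R^j, j >= 1. *)

definition sphere_area :: "nat \<Rightarrow> real" where
  "sphere_area j = 2 * pi powr (real j / 2) / Gamma (real j / 2)"

(* The Borel space of the Grassmannian, whose topology is the one obtained by identifying a
   subspace with the matrix of the orthogonal projection onto it. *)

definition grassmannian :: "nat \<Rightarrow> (real ^ 'n) set \<Rightarrow> (real ^ 'n) set set" where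
  "grassmannian k V = {L. subspace L \<and> L \<subseteq> V \<and> dim L = k}"

definition grassmannian_borel :: "nat \<Rightarrow> (real ^ 'n) set \<Rightarrow> (real ^ 'n) set measure" where
  "grassmannian_borel k V = vimage_algebra (grassmannian k V) (\<lambda>L. matrix (orth_proj L)) borel"

(* A rotation of V is represented by its extension to the whole space that is the identity on
   the orthogonal complement of V; it then has the same determinant. *)

definition rotations_of :: "(real ^ 'n) set \<Rightarrow> (real ^ 'n \<Rightarrow> real ^ 'n) set" where
  "rotations_of V =
     {T. orthogonal_transformation T \<and> det (matrix T) = 1 \<and> (\<forall>x \<in> orthogonal_comp V. T x = x)}"

(* These conditions determine \<nu> uniquely (as the normalised image of Haar measure). *)

definition is_grassmannian_measure ::
  "nat \<Rightarrow> (real ^ 'n) set \<Rightarrow> (real ^ 'n) set measure \<Rightarrow> bool" where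
  "is_grassmannian_measure k V \<nu> \<longleftrightarrow>
     sets \<nu> = sets (grassmannian_borel k V) \<and>
     (\<forall>T \<in> rotations_of V. \<forall>A \<in> sets \<nu>. emeasure \<nu> ((\<lambda>L. T ` L) ` A) = emeasure \<nu> A) \<and>
     emeasure \<nu> (grassmannian k V) =
       ennreal ((\<Prod>i<k. sphere_area (dim V - i)) / (\<Prod>i=1..k. sphere_area i))"

end

theory Submission imports Defs
begin

text \<open>Let \<open>V\<close> be the orthogonal complement of \<open>Q\<close>, \<open>N = n - q\<close>, and write \<open>vol\<close> for the volume of the
  parallelepiped spanned by \<open>m\<close> vectors. The formula is obtained in two steps.

  First, a Blaschke-Petkantschin formula replaces integration over \<open>m\<close> points of the whole space by integration over
  \<open>L\<close> and over \<open>m\<close> points of \<open>L + Q\<close>, with the density \<open>vol ^ (N - m)\<close> of the projections to \<open>V\<close>. A tuple is encoded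
  by the Gram-Schmidt frame of its projections to \<open>V\<close> and its coordinates with respect to this frame (its shape).
  Polar coordinates, applied to one vector at a time, show that both sides induce the same law of the shape.
  Conditioned on the shape, the frame is uniformly distributed on both sides by rotation invariance, so that the
  two laws agree by Christensen's uniqueness theorem.

  Second, inside \<open>L + Q\<close>, the points \<open>x i\<close> lie on a common sphere with centre \<open>c\<close> in \<open>L\<close> and radius \<open>r\<close>, where
  \<open>r\<^sup>2 = (norm c)\<^sup>2 + r0\<^sup>2\<close>, if and only if \<open>c\<close> solves \<open>m\<close> linear equations. Integrating over \<open>c\<close> an approximate delta
  function of these equations, exchanging the integrals and using polar coordinates around \<open>c\<close> gives a formula over
  \<open>c\<close> and the directions \<open>u i\<close>; polar coordinates in \<open>L\<close> for \<open>c = sqrt (r\<^sup>2 - r0\<^sup>2) z\<close> finish the proof.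

  Hausdorff measure enters through its agreement with Lebesgue measure on subspaces (by the isodiametric
  inequality) and with the cone measure on unit spheres.\<close>

\<comment> \<open>The measure on the Grassmannian is known only through its rotation invariance and
  its mass, so no parametrisation of \<open>L\<close> is at hand; this is why the first step
  compares two measures by a uniqueness theorem. Rotations have determinant 1 and carry any
  \<open>m\<close>-frame of \<open>V\<close> to any other only for \<open>m < dim V\<close>; for
  \<open>m = dim V\<close> the Grassmannian is a single point. The constants come from the
  Gram-Schmidt heights: inside a \<open>d\<close>-dimensional space the height \<open>s\<close> with
  index \<open>j\<close> (from 0) has density \<open>sphere_area (d - j) * s ^ (d - j - 1)\<close>.
  Dividing the densities for \<open>d = N\<close> and \<open>d = m\<close> leaves the power
  \<open>N - m\<close> of the product of the heights, which is \<open>vol\<close>, and a quotient of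
  sphere areas that is exactly the mass of the Grassmannian. In the second step the origin has the
  same power \<open>- r0\<^sup>2\<close> with respect to all admissible spheres, so the equations
  for the centre lose their quadratic term; the Jacobian of the remaining linear system is again
  \<open>vol\<close> and raises the exponent to \<open>N - m + 1\<close>.\<close>
syntax "_nnI" :: "pttrn => ennreal => 'a measure => ennreal" ("(2INT+(2 _./ _)/ wrt _)" [60,61] 110)
translations "INT+ x. f wrt M" => "CONST nn_integral M (%x. f)"

abbreviation (input) bPi :: "'i set => ('i => 'a::topological_space) measure" where "bPi I \<equiv> PiM I (%_. borel)"
abbreviation (input) lPi :: "'i set => ('i => 'a::euclidean_space) measure" where "lPi I \<equiv> PiM I (%_. lborel)"
abbreviation (input) bmeas :: "'a measure => ('a => 'b::topological_space) set" where "bmeas M \<equiv> borel_measurable M"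



section \<open>Hausdorff measures\<close>

lemma hausdorff_gauge_empty [simp]: "hausdorff_gauge d {} = 0"
 by (simp add: hausdorff_gauge_def)

lemma hausdorff_content_mono: "A \<subseteq> B ==> hausdorff_content d dl A \<le> hausdorff_content d dl B"
 unfolding hausdorff_content_def by (intro INF_superset_mono) auto

lemma hausdorff_content_antimono: "dl \<le> \<epsilon> ==> hausdorff_content d \<epsilon> A \<le> hausdorff_content d dl A"
 unfolding hausdorff_content_def by (rule INF_superset_mono[OF _ order_refl]) (auto intro: order_trans)

lemma hausdorff_content_le:
 assumes "A \<subseteq> (\<Union>i. U i)" "\<And>i::nat. bounded (U i)" "\<And>i. diameter (U i) \<le> dl"
 shows "hausdorff_content d dl A \<le> (\<Sum>i. hausdorff_gauge d (U i))"
 unfolding hausdorff_content_def using assms by (intro INF_lower) auto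

lemma hausdorff_content_lessD:
 assumes "hausdorff_content d dl A < c"
 obtains U :: "nat => 'a::metric_space set" where "A \<subseteq> (\<Union>i. U i)" "\<And>i. bounded (U i)"
  "\<And>i. diameter (U i) \<le> dl" "(\<Sum>i. hausdorff_gauge d (U i)) < c"
 using assms unfolding hausdorff_content_def by (auto simp: INF_less_iff)

lemma hausdorff_content_empty [simp]: "0 \<le> dl ==> hausdorff_content d dl {} = 0"
 using hausdorff_content_le[of "{}" "%_. {}" dl d] by simp

text \<open>Padding the one-set cover with empty sets costs nothing, even for \<open>d = 0\<close>,
  because the gauge of the empty set is 0.\<close>

lemma hausdorff_content_le_gauge:
 assumes "bounded U" "diameter U \<le> dl" "0 \<le> dl" "A \<subseteq> U"
 shows "hausdorff_content d dl A \<le> hausdorff_gauge d U"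
proof -
 have "hausdorff_content d dl A \<le> (\<Sum>i. hausdorff_gauge d (if i = 0 then U else {}))"
  by (rule hausdorff_content_le) (use assms in auto)
 also have "... = (\<Sum>i\<in>{0::nat}. hausdorff_gauge d (if i = 0 then U else {}))"
  by (rule suminf_finite) auto
 finally show ?thesis by simp
qed

text \<open>Near-optimal covers with errors \<open>e * (1/2)^Suc n\<close> are merged into one
  sequence by the pairing function of the naturals.\<close>

lemma hausdorff_content_UN:
 "hausdorff_content d dl (\<Union>n::nat. A n) \<le> (\<Sum>n. hausdorff_content d dl (A n))"
proof (rule ennreal_le_epsilon)
 fix e :: real assume fin: "(\<Sum>n. hausdorff_content d dl (A n)) < top" and e: "0 < e"
 have "\<exists>U. A n \<subseteq> (\<Union>i. U i) \<and> (\<forall>i. bounded (U i) \<and> diameter (U i) \<le> dl) \<and>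
   (\<Sum>i. hausdorff_gauge d (U i)) \<le> hausdorff_content d dl (A n) + ennreal (e * (1/2)^Suc n)" for n
 proof -
  have "hausdorff_content d dl (A n) < top"
   using fin by (meson ennreal_suminf_lessD)
  then have "hausdorff_content d dl (A n) < hausdorff_content d dl (A n) + ennreal (e * (1/2)^Suc n)"
   using e by (simp add: ennreal_add_left_cancel_less)
  then show ?thesis by (elim hausdorff_content_lessD) (metis less_imp_le)
 qed
 then obtain U where U: "\<And>n. A n \<subseteq> (\<Union>i. U n i)" "\<And>n i. bounded (U n i)" "\<And>n i. diameter (U n i) \<le> dl"
  "\<And>n. (\<Sum>i. hausdorff_gauge d (U n i)) \<le> hausdorff_content d dl (A n) + ennreal (e * (1/2)^Suc n)"
  by metis
 define V where "V k = (case prod_decode k of (n, i) => U n i)" for k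
 have "(\<Union>n. A n) \<subseteq> (\<Union>k. V k)"
 proof
  fix x assume "x \<in> (\<Union>n. A n)"
  then obtain n i where "x \<in> U n i" using U(1) by blast
  then have "x \<in> V (prod_encode (n, i))" by (simp add: V_def)
  then show "x \<in> (\<Union>k. V k)" by blast
 qed
 then have "hausdorff_content d dl (\<Union>n. A n) \<le> (\<Sum>k. hausdorff_gauge d (V k))"
  by (rule hausdorff_content_le) (auto simp: V_def U split: prod.split)
 also have "... = (\<Sum>k. (%p. hausdorff_gauge d (U (fst p) (snd p))) (prod_decode k))"
  by (simp add: V_def case_prod_beta)
 also have "... = (\<Sum>n. \<Sum>i. hausdorff_gauge d (U n i))"
  by (rule suminf_ennreal_2dimen) simp
 also have "... \<le> (\<Sum>n. hausdorff_content d dl (A n) + ennreal (e * (1/2)^Suc n))"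
  by (intro suminf_le U) auto
 also have "... = (\<Sum>n. hausdorff_content d dl (A n)) + (\<Sum>n. ennreal (e * (1/2)^Suc n))"
  by (rule suminf_add[symmetric]) auto
 also have "(\<Sum>n. ennreal (e * (1/2)^Suc n)) = ennreal e"
  using sums_mult[OF power_half_series, of e] e by (intro suminf_ennreal_eq) auto
 finally show "hausdorff_content d dl (\<Union>n. A n) \<le> (\<Sum>n. hausdorff_content d dl (A n)) + ennreal e" .
qed

lemma hausdorff_content_Un:
 assumes "0 \<le> dl"
 shows "hausdorff_content d dl (A \<union> B) \<le> hausdorff_content d dl A + hausdorff_content d dl B"
proof -
 let ?U = "%n::nat. if n = 0 then A else if n = 1 then B else {}"
 have "(\<Sum>n. hausdorff_content d dl (?U n)) = (\<Sum>n\<in>{0,1}. hausdorff_content d dl (?U n))"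
  by (rule suminf_finite) (use assms in auto)
 moreover have "(\<Union>n. ?U n) = A \<union> B" by (auto split: if_splits)
 ultimately show ?thesis using hausdorff_content_UN[of d dl ?U] by simp
qed

lemma hausdorff_content_UN_finite:
 assumes "0 \<le> dl" "finite I"
 shows "hausdorff_content d dl (\<Union>i\<in>I. A i) \<le> (\<Sum>i\<in>I. hausdorff_content d dl (A i))"
 using assms(2)
proof induction
 case (insert i I)
 show ?case
  using hausdorff_content_Un[OF assms(1), of d "A i" "\<Union>(A ` I)"] insert
  by (auto intro: order_trans add_left_mono)
qed (use assms(1) in simp)

lemma hausdorff_content_le_outer: "0 < dl ==> hausdorff_content d dl A \<le> hausdorff_outer d A"
 unfolding hausdorff_outer_def by (intro SUP_upper) auto

lemma hausdorff_outer_mono: "A \<subseteq> B ==> hausdorff_outer d A \<le> hausdorff_outer d B"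
 unfolding hausdorff_outer_def by (intro SUP_mono) (auto intro: hausdorff_content_mono)

lemma hausdorff_outer_empty [simp]: "hausdorff_outer d {} = 0"
 unfolding hausdorff_outer_def by (auto intro!: antisym SUP_least)

lemma hausdorff_outer_UN:
 "hausdorff_outer d (\<Union>n::nat. A n) \<le> (\<Sum>n. hausdorff_outer d (A n))"
 unfolding hausdorff_outer_def[of d "\<Union>n. A n"]
proof (rule SUP_least)
 fix dl :: real assume "dl \<in> {0<..}"
 then have "(\<Sum>n. hausdorff_content d dl (A n)) \<le> (\<Sum>n. hausdorff_outer d (A n))"
  by (intro suminf_le hausdorff_content_le_outer) auto
 then show "hausdorff_content d dl (\<Union>n. A n) \<le> (\<Sum>n. hausdorff_outer d (A n))"
  using hausdorff_content_UN order_trans by blast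
qed

lemma hausdorff_outer_Un: "hausdorff_outer d (A \<union> B) \<le> hausdorff_outer d A + hausdorff_outer d B"
proof -
 let ?U = "%n::nat. if n = 0 then A else if n = 1 then B else {}"
 have "(\<Sum>n. hausdorff_outer d (?U n)) = (\<Sum>n\<in>{0,1}. hausdorff_outer d (?U n))"
  by (rule suminf_finite) auto
 moreover have "(\<Union>n. ?U n) = A \<union> B" by (auto split: if_splits)
 ultimately show ?thesis using hausdorff_outer_UN[of d ?U] by simp
qed

text \<open>A set of diameter less than \<open>\<epsilon>\<close> cannot meet both \<open>A\<close>
  and \<open>B\<close>, so a fine cover of the union splits into a cover of each. This is the
  property of metric outer measures on which Caratheodory's criterion rests.\<close>

lemma hausdorff_outer_separated:
 fixes A B :: "'a::metric_space set"
 assumes "0 < \<epsilon>" and sep: "\<And>x y. x \<in> A ==> y \<in> B ==> \<epsilon> \<le> dist x y"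
 shows "hausdorff_outer d A + hausdorff_outer d B \<le> hausdorff_outer d (A \<union> B)"
proof -
 have small: "hausdorff_content d dl A + hausdorff_content d dl B \<le> hausdorff_content d dl (A \<union> B)"
  if "dl < \<epsilon>" "0 < dl" for dl
  unfolding hausdorff_content_def[of d dl "A \<union> B"]
 proof (rule INF_greatest, safe)
  fix U :: "nat => 'a set"
  assume U: "A \<union> B \<subseteq> (\<Union>i. U i)" "\<forall>i. bounded (U i) \<and> diameter (U i) \<le> dl"
  let ?A = "%i. if U i \<inter> A = {} then {} else U i" and ?B = "%i. if U i \<inter> B = {} then {} else U i"
  have one: "U i \<inter> A = {} \<or> U i \<inter> B = {}" for i
  proof (rule ccontr)
   assume "\<not> ?thesis"
   then obtain x y where "x \<in> A" "y \<in> B" "x \<in> U i" "y \<in> U i" by blast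
   then have "\<epsilon> \<le> dist x y" "dist x y \<le> dl"
    using sep U(2) diameter_bounded_bound[of "U i" x y] by (auto intro: order_trans)
   then show False using that by simp
  qed
  have "hausdorff_content d dl A + hausdorff_content d dl B
    \<le> (\<Sum>i. hausdorff_gauge d (?A i)) + (\<Sum>i. hausdorff_gauge d (?B i))"
  proof (intro add_mono hausdorff_content_le)
   show "A \<subseteq> (\<Union>i. ?A i)" "B \<subseteq> (\<Union>i. ?B i)" using U(1) by (force split: if_splits)+
  qed (use U(2) that in auto)
  also have "... = (\<Sum>i. hausdorff_gauge d (?A i) + hausdorff_gauge d (?B i))"
   by (rule suminf_add) auto
  also have "... \<le> (\<Sum>i. hausdorff_gauge d (U i))"
   using one by (intro suminf_le) auto
  finally show "hausdorff_content d dl A + hausdorff_content d dl B \<le> (\<Sum>i. hausdorff_gauge d (U i))" .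
 qed
 have "hausdorff_outer d A + hausdorff_outer d B
   = (SUP dl\<in>{0<..}. hausdorff_content d dl A + hausdorff_content d dl B)"
  unfolding hausdorff_outer_def
 proof (rule SUP_add_directed_ennreal[symmetric])
  fix i j :: real assume "i \<in> {0<..}" "j \<in> {0<..}"
  then show "\<exists>k\<in>{0<..}. hausdorff_content d i A + hausdorff_content d j B
    \<le> hausdorff_content d k A + hausdorff_content d k B"
   by (intro bexI[of _ "min i j"] add_mono hausdorff_content_antimono) auto
 qed
 also have "... \<le> hausdorff_outer d (A \<union> B)"
 proof (rule SUP_least)
  fix dl :: real assume "dl \<in> {0<..}"
  then have m: "0 < min dl (\<epsilon>/2)" "min dl (\<epsilon>/2) < \<epsilon>" using assms(1) by auto
  have "hausdorff_content d dl A + hausdorff_content d dl B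
   \<le> hausdorff_content d (min dl (\<epsilon>/2)) A + hausdorff_content d (min dl (\<epsilon>/2)) B"
   by (intro add_mono hausdorff_content_antimono) auto
  also have "... \<le> hausdorff_content d (min dl (\<epsilon>/2)) (A \<union> B)" using small m by blast
  also have "... \<le> hausdorff_outer d (A \<union> B)" using m by (intro hausdorff_content_le_outer)
  finally show "hausdorff_content d dl A + hausdorff_content d dl B \<le> hausdorff_outer d (A \<union> B)" .
 qed
 finally show ?thesis .
qed

text \<open>Caratheodory's criterion: the part of \<open>A\<close> near \<open>C\<close> is cut into shells, and every second
 shell is at a positive distance from the others, so the shell measures are summable.\<close>

lemma hausdorff_outer_closed_split:
 fixes A C :: "'a::metric_space set"
 assumes "closed C"
 shows "hausdorff_outer d (A \<inter> C) + hausdorff_outer d (A - C) \<le> hausdorff_outer d A"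
\<comment> \<open>The distance \<open>infdist\<close> to the empty set is 0 by convention and would
  not separate points from \<open>C\<close>; both exceptional cases are trivial.\<close>
proof (cases "C = {} \<or> hausdorff_outer d A = \<infinity>")
 case True
 then show ?thesis by auto
next
 case False
 let ?H = "hausdorff_outer d :: 'a set => ennreal"
 define g where "g x = infdist x C" for x
 define r where "r k = 1 / (real k + 1)" for k
 define R where "R k = {x \<in> A. r (Suc k) \<le> g x \<and> g x < r k}" for k
 define B where "B n = {x \<in> A. r n \<le> g x}" for n
 have HA: "?H A < \<infinity>" using False by (simp add: less_top)
 have rless: "r (Suc k) < r k" "0 < r k" for k by (auto simp: r_def field_simps)
 have rmono: "j \<le> k ==> r k \<le> r j" for j k by (auto simp: r_def field_simps)
 have lip: "g x \<le> g y + dist x y" for x y unfolding g_def by (rule infdist_triangle)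
 have g0: "x \<in> C ==> g x = 0" "x \<notin> C ==> g x > 0" for x
  using False assms in_closed_iff_infdist_zero[of C x] infdist_nonneg[of x C] by (auto simp: g_def less_eq_real_def)
 have alt: "(\<Sum>k<K. ?H (R (2*k+i))) \<le> ?H (\<Union>k<K. R (2*k+i))" for K i
 proof (induction K)
  case (Suc K)
  have "?H (\<Union>k<K. R (2*k+i)) + ?H (R (2*K+i)) \<le> ?H ((\<Union>k<K. R (2*k+i)) \<union> R (2*K+i))"
  proof (rule hausdorff_outer_separated)
   \<comment> \<open>For \<open>K = 0\<close> the union is empty and any positive gap will do,
     whereas the truncated index \<open>2*K+i-1\<close> could make the difference vanish.\<close>
   show "0 < (if K = 0 then 1 else r (2*K+i-1) - r (2*K+i))"
    using rless(1)[of "2*K+i-1"] by auto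
   fix x y assume "x \<in> (\<Union>k<K. R (2*k+i))" "y \<in> R (2*K+i)"
   then obtain k where k: "k < K" "r (Suc (2*k+i)) \<le> g x" "g y < r (2*K+i)" by (auto simp: R_def)
   have "r (2*K+i-1) \<le> r (Suc (2*k+i))" using k(1) by (intro rmono) linarith
   then show "(if K = 0 then 1 else r (2*K+i-1) - r (2*K+i)) \<le> dist x y"
    using k lip[of x y] by auto
  qed
  then show ?case
   using Suc by (auto simp: lessThan_Suc Un_commute add.commute intro: order_trans[OF add_left_mono])
 qed simp
 have alt2: "(\<Sum>k<K. ?H (R (2*k+i))) \<le> ?H A" for K i
  by (rule order_trans[OF alt hausdorff_outer_mono]) (auto simp: R_def)
 have part: "(\<Sum>k<2*K. ?H (R k)) \<le> ?H A + ?H A" for K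
 proof -
  have "(\<Sum>k<2*K. ?H (R k)) = (\<Sum>k<K. ?H (R (2*k+0))) + (\<Sum>k<K. ?H (R (2*k+1)))"
   by (induction K) (auto simp: algebra_simps)
  then show ?thesis using add_mono[OF alt2[of 0 K] alt2[of 1 K]] by simp
 qed
 have tot: "(\<Sum>k. ?H (R k)) \<le> ?H A + ?H A"
 proof (rule suminf_le_const)
  show "(\<Sum>k<n. ?H (R k)) \<le> ?H A + ?H A" for n
   by (rule order_trans[OF sum_mono2 part[of n]]) auto
 qed simp
 then have fin: "(\<Sum>k. ?H (R k)) < \<infinity>" by (rule order.strict_trans1) (use HA in simp)
 define \<rho> where "\<rho> k = enn2real (?H (R k))" for k
 have \<rho>: "?H (R k) = ennreal (\<rho> k)" "0 \<le> \<rho> k" for k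
  using fin ennreal_suminf_lessD[of "%k. ?H (R k)" \<infinity> k] by (auto simp: \<rho>_def)
 have sm: "summable \<rho>"
  using fin \<rho> by (intro summable_suminf_not_top) auto
 have tail: "(\<Sum>k. ?H (R (k + n))) = ennreal (\<Sum>k. \<rho> (k + n))" for n
  using \<rho> sm by (auto intro!: suminf_ennreal2 simp: summable_iff_shift)
 have cov: "A - C \<subseteq> B n \<union> (\<Union>k. R (k + n))" for n
 proof
  fix x assume x: "x \<in> A - C"
  show "x \<in> B n \<union> (\<Union>k. R (k + n))"
  proof (cases "r n \<le> g x")
   case False
   have "g x > 0" using g0 x by blast
   then obtain N where N: "r N \<le> g x"
    using reals_Archimedean[of "g x"] unfolding r_def inverse_eq_divide of_nat_Suc
    by (metis add.commute less_imp_le)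
   \<comment> \<open>As \<open>C\<close> is closed, a point outside it has positive distance, so
     some threshold \<open>r N\<close> is reached; the least such index determines the shell of the
     point.\<close>
   define j where "j = (LEAST j. r j \<le> g x)"
   have j: "r j \<le> g x" unfolding j_def using N by (rule LeastI)
   have "n < j" using False j rmono[of j n] by (meson leI order_trans)
   then have "\<not> r (j - 1) \<le> g x" unfolding j_def by (intro not_less_Least) auto
   then have "x \<in> R ((j - 1 - n) + n)" using j \<open>n < j\<close> x by (auto simp: R_def)
   then show ?thesis by blast
  qed (use x in \<open>auto simp: B_def\<close>)
 qed
 show ?thesis
 proof (rule ennreal_le_epsilon)
  fix e :: real assume "0 < e"
  then obtain n where n: "norm (\<Sum>k. \<rho> (k + n)) < e"
   using suminf_exist_split[OF \<open>0 < e\<close> sm] by auto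
  have "?H (A \<inter> C) + ?H (A - C) \<le> ?H (A \<inter> C) + (?H (B n) + ?H (\<Union>k. R (k + n)))"
   using order_trans[OF hausdorff_outer_mono[OF cov] hausdorff_outer_Un]
   by (intro add_left_mono)
  also have "... \<le> ?H (A \<inter> C) + (?H (B n) + (\<Sum>k. ?H (R (k + n))))"
   by (intro add_left_mono hausdorff_outer_UN)
  also have "... = (?H (A \<inter> C) + ?H (B n)) + (\<Sum>k. ?H (R (k + n)))" by (simp add: add.assoc)
  also have "... \<le> ?H (A \<inter> C \<union> B n) + ennreal e"
  proof (intro add_mono hausdorff_outer_separated)
   show "0 < r n" by (rule rless)
   fix x y assume "x \<in> A \<inter> C" "y \<in> B n"
   then show "r n \<le> dist x y" using g0(1)[of x] lip[of y x] by (auto simp: B_def dist_commute)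
  qed (use n tail in \<open>auto intro!: ennreal_leI\<close>)
  also have "... \<le> ?H A + ennreal e"
   by (intro add_right_mono hausdorff_outer_mono) (auto simp: B_def)
  finally show "?H (A \<inter> C) + ?H (A - C) \<le> ?H A + ennreal e" .
 qed
qed

text \<open>\<open>measure_of\<close> returns the given set function only if it is countably
  additive on the sigma-algebra. The splitting by closed sets places the Borel sets inside the
  Caratheodory sigma-algebra, where the outer measure is additive.\<close>

lemma emeasure_hausdorff_measure:
 fixes A :: "'a::metric_space set"
 assumes "A \<in> sets borel"
 shows "emeasure (hausdorff_measure d) A = hausdorff_outer d A"
proof -
 let ?H = "hausdorff_outer d :: 'a set => ennreal"
 interpret P: sigma_algebra "UNIV :: 'a set" "Pow UNIV" by (rule sigma_algebra_Pow)
 have oms: "outer_measure_space (Pow UNIV) ?H"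
  unfolding outer_measure_space_def positive_def increasing_def countably_subadditive_def
  by (auto intro: hausdorff_outer_mono hausdorff_outer_UN)
 let ?L = "lambda_system UNIV (Pow UNIV) ?H"
 have ms: "measure_space UNIV ?L ?H" using P.caratheodory_lemma[OF oms] .
 then interpret L: sigma_algebra UNIV ?L by (simp add: measure_space_def)
 have "C \<in> ?L" if "closed C" for C
 proof -
  have "?H (C \<inter> x) + ?H ((UNIV - C) \<inter> x) = ?H x" for x
  proof (rule antisym)
   have "(UNIV - C) \<inter> x = x - C" by auto
   then show "?H (C \<inter> x) + ?H ((UNIV - C) \<inter> x) \<le> ?H x"
    using hausdorff_outer_closed_split[OF that, of d x]
    by (simp add: Int_commute[of C])
   show "?H x \<le> ?H (C \<inter> x) + ?H ((UNIV - C) \<inter> x)"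
    by (rule order_trans[OF hausdorff_outer_mono hausdorff_outer_Un]) auto
  qed
  then show ?thesis by (auto simp: lambda_system_def)
 qed
 then have sub: "sets (borel :: 'a measure) \<subseteq> ?L"
  unfolding borel_eq_closed using L.sigma_sets_subset[of "Collect closed"]
  by (simp add: sets_measure_of) blast
 have "countably_additive (sets (borel :: 'a measure)) ?H"
  using ms sub unfolding measure_space_def countably_additive_def
  by (meson order_trans subsetD)
 moreover have "positive (sets (borel :: 'a measure)) ?H" by (simp add: positive_def)
 ultimately show ?thesis
  using assms sets.sigma_algebra_axioms[of "borel :: 'a measure"] unfolding hausdorff_measure_def
  by (intro emeasure_measure_of_sigma) auto
qed

lemma sets_hausdorff_measure [simp, measurable_cong]: "sets (hausdorff_measure d) = sets borel"
 unfolding hausdorff_measure_def by (metis sets.sets_measure_of_eq space_borel)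

lemma space_hausdorff_measure [simp]: "space (hausdorff_measure d) = UNIV"
 by (simp add: hausdorff_measure_def)

section \<open>Hausdorff measure under Lipschitz maps\<close>

lemma hausdorff_content_lipschitz_image:
 fixes f :: "'a::metric_space => 'b::metric_space"
 assumes K: "0 < K" and f: "\<And>x y. x \<in> A ==> y \<in> A ==> dist (f x) (f y) \<le> K * dist x y"
 shows "hausdorff_content d (K * dl) (f ` A) \<le> ennreal (K ^ d) * hausdorff_content d dl A"
proof -
 have "hausdorff_content d (K * dl) (f ` A) \<le> ennreal (K ^ d) * (\<Sum>i. hausdorff_gauge d (U i))"
  if U: "A \<subseteq> (\<Union>i. U i)" "\<forall>i. bounded (U i) \<and> diameter (U i) \<le> dl" for U :: "nat => 'a set"
 proof -
  \<comment> \<open>The covering sets are first cut down to \<open>A\<close>, where alone the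
    Lipschitz bound is available.\<close>
  have sub: "bounded (U i \<inter> A) \<and> diameter (U i \<inter> A) \<le> diameter (U i)" for i
   using U(2) by (auto intro: bounded_subset diameter_subset)
  have im: "dist (f x) (f y) \<le> K * diameter (U i)" if "x \<in> U i \<inter> A" "y \<in> U i \<inter> A" for x y i
  proof -
   have "dist x y \<le> diameter (U i)" using that U(2) by (intro diameter_bounded_bound) auto
   then show ?thesis using f[of x y] that K by (auto intro: order_trans mult_left_mono)
  qed
  have bd: "bounded (f ` (U i \<inter> A))" for i
  proof (cases "U i \<inter> A = {}")
   case False
   then obtain x where "x \<in> U i \<inter> A" by blast
   then show ?thesis unfolding bounded_def using im by blast
  qed simp
  have di: "diameter (f ` (U i \<inter> A)) \<le> K * diameter (U i)" for i
  proof (cases "U i \<inter> A = {}")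
   case True
   then show ?thesis using U(2) K by (simp add: diameter_ge_0)
  next
   case False
   then show ?thesis 
    using im unfolding diameter_def[of "f ` (U i \<inter> A)"] by (auto intro!: cSUP_least)
  qed
  have "hausdorff_content d (K * dl) (f ` A) \<le> (\<Sum>i. hausdorff_gauge d (f ` (U i \<inter> A)))"
  proof (rule hausdorff_content_le)
   show "f ` A \<subseteq> (\<Union>i. f ` (U i \<inter> A))" using U(1) by blast
   show "diameter (f ` (U i \<inter> A)) \<le> K * dl" for i
    using di[of i] U(2) K by (meson mult_left_mono less_imp_le order_trans)
  qed (rule bd)
  also have "... \<le> (\<Sum>i. ennreal (K ^ d) * hausdorff_gauge d (U i))"
  proof (intro suminf_le)
   fix i
   have "unit_ball_vol (real d) * (diameter (f ` (U i \<inter> A)) / 2) ^ d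
    \<le> unit_ball_vol (real d) * (K * diameter (U i) / 2) ^ d"
    using di[of i] diameter_ge_0[OF bd, of i] by (intro mult_left_mono power_mono) auto
   also have "... = K ^ d * (unit_ball_vol (real d) * (diameter (U i) / 2) ^ d)"
    by (simp add: power_mult_distrib power_divide)
   finally show "hausdorff_gauge d (f ` (U i \<inter> A)) \<le> ennreal (K ^ d) * hausdorff_gauge d (U i)"
    using K by (auto simp: hausdorff_gauge_def ennreal_mult'[symmetric] intro!: ennreal_leI)
  qed auto
  finally show ?thesis by simp
 qed
 note step = this
 show ?thesis
 proof (rule ennreal_le_epsilon)
  fix e :: real
  assume "ennreal (K ^ d) * hausdorff_content d dl A < top" "0 < e"
  then have "hausdorff_content d dl A < top"
   using K by (auto simp: ennreal_mult_less_top)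
  then have "hausdorff_content d dl A < hausdorff_content d dl A + ennreal (e / K ^ d)"
   using \<open>0 < e\<close> K by (simp add: ennreal_add_left_cancel_less)
  then obtain U where U: "A \<subseteq> (\<Union>i. U i)" "\<And>i. bounded (U i)" "\<And>i. diameter (U i) \<le> dl"
   "(\<Sum>i. hausdorff_gauge d (U i)) < hausdorff_content d dl A + ennreal (e / K ^ d)"
   by (rule hausdorff_content_lessD) blast
  have "hausdorff_content d (K * dl) (f ` A) \<le> ennreal (K ^ d) * (hausdorff_content d dl A + ennreal (e / K ^ d))"
   using U(1-3) by (intro order_trans[OF step[of U]] mult_left_mono less_imp_le[OF U(4)]) auto
  also have "... = ennreal (K ^ d) * hausdorff_content d dl A + ennreal e"
   using K \<open>0 < e\<close> by (simp add: distrib_left ennreal_mult'[symmetric])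
  finally show "hausdorff_content d (K * dl) (f ` A) \<le> ennreal (K ^ d) * hausdorff_content d dl A + ennreal e" .
 qed
qed

lemma hausdorff_outer_lipschitz_image:
 fixes f :: "'a::metric_space => 'b::metric_space"
 assumes K: "0 < K" and f: "\<And>x y. x \<in> A ==> y \<in> A ==> dist (f x) (f y) \<le> K * dist x y"
 shows "hausdorff_outer d (f ` A) \<le> ennreal (K ^ d) * hausdorff_outer d A"
 unfolding hausdorff_outer_def[of d "f ` A"]
proof (rule SUP_least)
 fix dl :: real assume dl: "dl \<in> {0<..}"
 then have "hausdorff_content d dl (f ` A) \<le> ennreal (K ^ d) * hausdorff_content d (dl / K) A"
  using hausdorff_content_lipschitz_image[OF assms, where d = d and dl = "dl / K"] K by simp
 also have "... \<le> ennreal (K ^ d) * hausdorff_outer d A"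
  using dl K by (intro mult_left_mono hausdorff_content_le_outer) auto
 finally show "hausdorff_content d dl (f ` A) \<le> ennreal (K ^ d) * hausdorff_outer d A" .
qed

lemma hausdorff_content_isometry_le:
 fixes f :: "'a::metric_space => 'b::metric_space"
 assumes f: "\<And>x y. x \<in> A ==> y \<in> A ==> dist (f x) (f y) \<le> dist x y"
 shows "hausdorff_content d dl (f ` A) \<le> hausdorff_content d dl A"
 using hausdorff_content_lipschitz_image[of 1 A f] f by simp

lemma hausdorff_outer_isometry_le:
 fixes f :: "'a::metric_space => 'b::metric_space"
 assumes f: "\<And>x y. x \<in> A ==> y \<in> A ==> dist (f x) (f y) \<le> dist x y"
 shows "hausdorff_outer d (f ` A) \<le> hausdorff_outer d A"
 using hausdorff_outer_lipschitz_image[of 1 A f] f by simp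

section \<open>The isodiametric inequality\<close>

text \<open>With \<open>P\<close> inside \<open>{a..b}\<close> and \<open>Q\<close> inside
  \<open>{c..d}\<close> for the extreme values, the hypothesis gives \<open>b - c \<le> D\<close>
  and \<open>d - a \<le> D\<close>, and these add up to the sum of the two lengths. This is the
  one-dimensional reason why symmetrisation does not increase the diameter.\<close>

lemma emeasure_pair_distance_le:
 fixes P Q :: "real set"
 assumes "P \<noteq> {}" "Q \<noteq> {}" and D: "\<And>p q. p \<in> P ==> q \<in> Q ==> \<bar>p - q\<bar> \<le> D"
 shows "emeasure lborel P + emeasure lborel Q \<le> ennreal (2 * D)"
proof -
 obtain p0 q0 where pq: "p0 \<in> P" "q0 \<in> Q" using assms by auto
 have "p \<le> q0 + D \<and> q0 - D \<le> p" if "p \<in> P" for p using D[OF that pq(2)] by auto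
 then have bP: "bdd_above P \<and> bdd_below P"
  by (intro conjI bdd_aboveI[of _ "q0 + D"] bdd_belowI[of _ "q0 - D"]) auto
 have "q \<le> p0 + D \<and> p0 - D \<le> q" if "q \<in> Q" for q using D[OF pq(1) that] by auto
 then have bQ: "bdd_above Q \<and> bdd_below Q"
  by (intro conjI bdd_aboveI[of _ "p0 + D"] bdd_belowI[of _ "p0 - D"]) auto
 define a b c d where "a = Inf P" and "b = Sup P" and "c = Inf Q" and "d = Sup Q"
 note abcd = this
 have P: "P \<subseteq> {a..b}" and Q: "Q \<subseteq> {c..d}"
  using bP bQ by (auto simp: abcd cInf_lower cSup_upper)
 have "b \<le> D + q" if "q \<in> Q" for q
  unfolding abcd using assms(1) D[OF _ that] by (intro cSup_least) fastforce+
 then have bc: "b - D \<le> c"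
  unfolding abcd using assms(2) by (intro cInf_greatest) (auto simp: algebra_simps)
 have "d \<le> D + p" if "p \<in> P" for p
  unfolding abcd using assms(2) D[OF that] by (intro cSup_least) fastforce+
 then have da: "d - D \<le> a"
  unfolding abcd using assms(1) by (intro cInf_greatest) (auto simp: algebra_simps)
 have le: "a \<le> b" "c \<le> d" using P Q pq by fastforce+
 have "emeasure lborel P + emeasure lborel Q \<le> emeasure lborel {a..b} + emeasure lborel {c..d}"
  by (intro add_mono emeasure_mono P Q) auto
 also have "... = ennreal ((b - a) + (d - c))" using le by (simp flip: ennreal_plus)
 also have "... \<le> ennreal (2 * D)" using bc da by (intro ennreal_leI) simp
 finally show ?thesis .
qed

section \<open>Steiner symmetrisation\<close>

definition fibre_length :: "('i => real) set => 'i => ('i => real) => ennreal" where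
 "fibre_length S i x = emeasure lborel {t. x(i := t) \<in> S}"

text \<open>Steiner symmetral: every fibre in direction \<open>i\<close> becomes the open interval
  of the same length centred at 0. The strict inequality removes null fibres altogether, so a point
  of the symmetral always lies over a nonempty fibre of \<open>S\<close>.\<close>

definition steiner :: "'i set => 'i => ('i => real) set => ('i => real) set" where
 "steiner I i S = {x \<in> space (lPi I). ennreal (2 * \<bar>x i\<bar>) < fibre_length S i x}"

text \<open>The function type carries no Euclidean metric over \<open>I\<close>, so the diameter
  bound is spelled out with squares.\<close>

definition diam_at_most :: "'i set => real => ('i => real) set => bool" where
 "diam_at_most I dl S \<longleftrightarrow> (\<forall>x\<in>S. \<forall>y\<in>S. (\<Sum>i\<in>I. (x i - y i)\<^sup>2) \<le> dl\<^sup>2)"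

lemma fibre_length_upd [simp]: "fibre_length S i (x(i := t)) = fibre_length S i x"
 by (simp add: fibre_length_def)

lemma fibre_length_eq_nn_integral:
 assumes "i \<in> I" "S \<in> sets (lPi I)" "x \<in> space (PiM (I - {i}) (%_. lborel)) \<or> x \<in> space (lPi I)"
 shows "fibre_length S i x = (INT+ t. indicator S (x(i := t)) wrt lborel)"
proof -
 have ii: "insert i I = I" "insert i (I - {i}) = I" using assms(1) by auto
 have m: "(%t. x(i := t)) \<in> lborel \<rightarrow>\<^sub>M lPi I"
  using assms(3)
 proof
  assume "x \<in> space (PiM (I - {i}) (%_. lborel))"
  then show ?thesis
   using measurable_comp[OF measurable_Pair1' measurable_add_dim[where I = "I - {i}" and M = "%_. lborel" and i = i]]
   by (simp add: comp_def ii)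
 next
  assume "x \<in> space (lPi I)"
  then show ?thesis
   using measurable_comp[OF measurable_Pair1' measurable_add_dim[where I = I and M = "%_. lborel" and i = i]]
   by (simp add: comp_def ii)
 qed
 have "{t. x(i := t) \<in> S} = (%t. x(i := t)) -` S \<inter> space lborel" by auto
 then have "{t. x(i := t) \<in> S} \<in> sets lborel" using measurable_sets[OF m assms(2)] by simp
 then have "fibre_length S i x = (INT+ t. indicator {t. x(i := t) \<in> S} t wrt lborel)"
  unfolding fibre_length_def by (simp add: nn_integral_indicator)
 then show ?thesis by (simp add: indicator_def)
qed

lemma fibre_length_measurable:
 assumes "i \<in> I" "S \<in> sets (lPi I)"
 shows "fibre_length S i \<in> bmeas (lPi I)"
proof -
 have ii: "insert i I = I" using assms(1) by auto
 note [measurable] = measurable_add_dim[where I = I and M = "%_. lborel :: real measure" and i = i, unfolded ii] assms(2)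
 have "(%x. INT+ t. indicator S ((%(f, y). f(i := y)) (x, t)) wrt lborel) \<in> bmeas (lPi I)"
  by measurable
 then show ?thesis
  by (subst measurable_cong[where g = "%x. INT+ t. indicator S (x(i := t)) wrt lborel"])
    (auto simp: fibre_length_eq_nn_integral[OF assms])
qed

lemma fibre_length_finite:
 assumes "finite I" "i \<in> I" "diam_at_most I dl S"
 shows "fibre_length S i x < \<infinity>"
proof (cases "{t. x(i := t) \<in> S} = {}")
 case True
 then show ?thesis unfolding fibre_length_def by (simp only: True) simp
next
 case False
 have "\<bar>p - q\<bar> \<le> \<bar>dl\<bar>" if "x(i := p) \<in> S" "x(i := q) \<in> S" for p q
 proof -
  have "(p - q)\<^sup>2 \<le> (\<Sum>j\<in>I. ((x(i := p)) j - (x(i := q)) j)\<^sup>2)"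
   using member_le_sum[of i I "%j. ((x(i := p)) j - (x(i := q)) j)\<^sup>2"] assms by auto
  also have "... \<le> dl\<^sup>2" using assms(3) that unfolding diam_at_most_def by blast
  finally show ?thesis by (simp add: abs_le_square_iff)
 qed
 \<comment> \<open>The two-set estimate is applied to the fibre and itself.\<close>
 then have "fibre_length S i x + fibre_length S i x \<le> ennreal (2 * \<bar>dl\<bar>)"
  unfolding fibre_length_def using False by (intro emeasure_pair_distance_le) auto
 then show ?thesis by (metis ennreal_less_top infinity_ennreal_def le_less_trans less_top ennreal_add_eq_top)
qed

lemma steiner_sets:
 assumes "i \<in> I" "S \<in> sets (lPi I)"
 shows "steiner I i S \<in> sets (lPi I)"
proof -
 note [measurable] = fibre_length_measurable[OF assms] assms(1)
 show ?thesis unfolding steiner_def by measurable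
qed

text \<open>By Tonelli the volume depends only on the fibre lengths. The diameter bound makes them
  finite, so that a symmetrised fibre is a genuine interval of the original length.\<close>

lemma emeasure_steiner:
 assumes "finite I" "i \<in> I" "S \<in> sets (lPi I)" "diam_at_most I dl S"
 shows "emeasure (lPi I) (steiner I i S) = emeasure (lPi I) S"
proof -
 interpret product_sigma_finite "%_. lborel :: real measure" by standard
 have I: "insert i (I - {i}) = I" using assms(2) by auto
 have slice: "emeasure (lPi I) A =
   (INT+ x. fibre_length A i x wrt PiM (I - {i}) (%_. lborel))" if "A \<in> sets (lPi I)" for A
 proof -
  have "emeasure (lPi I) A = (INT+ x. indicator A x wrt PiM (insert i (I - {i})) (%_. lborel))"
   unfolding I using that by simp
  also have "... = (INT+ x. (INT+ t. indicator A (x(i := t)) wrt lborel) wrt PiM (I - {i}) (%_. lborel))"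
   using assms(1) that by (intro product_nn_integral_insert) (simp_all only: I, auto)
  also have "... = (INT+ x. fibre_length A i x wrt PiM (I - {i}) (%_. lborel))"
   using fibre_length_eq_nn_integral[OF assms(2) that] by (intro nn_integral_cong) auto
  finally show ?thesis .
 qed
 have "fibre_length (steiner I i S) i x = fibre_length S i x" if x: "x \<in> space (PiM (I - {i}) (%_. lborel))" for x
 proof -
  have "x(i := t) \<in> space (lPi I)" for t
   using x assms(2) by (auto simp: space_PiM PiE_def extensional_def)
  then have e: "x(i := t) \<in> steiner I i S \<longleftrightarrow> ennreal (2 * \<bar>t\<bar>) < fibre_length S i x" for t
   by (simp add: steiner_def)
  obtain r where r: "fibre_length S i x = ennreal r" "0 \<le> r"
   using fibre_length_finite[OF assms(1,2,4), of x] by (cases "fibre_length S i x") auto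
  have "{t. x(i := t) \<in> steiner I i S} = {-r/2<..<r/2}"
   unfolding e r using r(2) by (auto simp: ennreal_less_iff abs_less_iff) 
  then have "fibre_length (steiner I i S) i x = emeasure lborel {-r/2<..<r/2}"
   by (simp add: fibre_length_def)
  then show ?thesis using r by simp
 qed
 then show ?thesis
  unfolding slice[OF steiner_sets[OF assms(2,3)]] slice[OF assms(3)] by (intro nn_integral_cong) auto
qed

text \<open>Let \<open>s\<close> be the contribution of the other coordinates. Any two points
  \<open>p\<close>, \<open>q\<close> of the original fibres over \<open>x\<close> and
  \<open>y\<close> satisfy \<open>\<bar>p - q\<bar> \<le> sqrt (dl\<^sup>2 - s)\<close>, which
  bounds the sum of the fibre lengths by twice this root; the new coordinates are bounded in
  absolute value by half the respective lengths.\<close>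

lemma diam_steiner:
 assumes "finite I" "i \<in> I" "diam_at_most I dl S"
 shows "diam_at_most I dl (steiner I i S)"
 unfolding diam_at_most_def
proof (intro ballI)
 fix x y assume xy: "x \<in> steiner I i S" "y \<in> steiner I i S"
 define s where "s = (\<Sum>j\<in>I-{i}. (x j - y j)\<^sup>2)"
 let ?P = "{t. x(i := t) \<in> S}" and ?Q = "{t. y(i := t) \<in> S}"
 have ne: "?P \<noteq> {}" "?Q \<noteq> {}"
  using xy by (auto simp: steiner_def fibre_length_def simp del: Collect_empty_eq) 
 have pq: "(p - q)\<^sup>2 + s \<le> dl\<^sup>2" if "p \<in> ?P" "q \<in> ?Q" for p q
 proof -
  have "(p - q)\<^sup>2 + s = (\<Sum>j\<in>I. ((x(i := p)) j - (y(i := q)) j)\<^sup>2)"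
   using assms(1,2) unfolding s_def by (subst sum.remove[of I i]) auto
  also have "... \<le> dl\<^sup>2" using that assms(3) unfolding diam_at_most_def by blast
  finally show ?thesis .
 qed
 have s: "s \<le> dl\<^sup>2" using ne pq by (smt (verit) all_not_in_conv zero_le_power2)
 define D where "D = sqrt (dl\<^sup>2 - s)"
 have "\<bar>p - q\<bar> \<le> D" if "p \<in> ?P" "q \<in> ?Q" for p q
  unfolding D_def using pq[OF that] by (intro real_le_rsqrt) auto
 then have "fibre_length S i x + fibre_length S i y \<le> ennreal (2 * D)"
  unfolding fibre_length_def by (intro emeasure_pair_distance_le ne) auto
 moreover have "ennreal (2 * \<bar>x i\<bar>) + ennreal (2 * \<bar>y i\<bar>) \<le> fibre_length S i x + fibre_length S i y"
  using xy by (intro add_mono) (auto simp: steiner_def)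
 ultimately have "ennreal (2 * \<bar>x i\<bar> + 2 * \<bar>y i\<bar>) \<le> ennreal (2 * D)"
  by (simp flip: ennreal_plus)
 moreover have "0 \<le> D" using s by (simp add: D_def)
 ultimately have "2 * \<bar>x i\<bar> + 2 * \<bar>y i\<bar> \<le> 2 * D" by (subst (asm) ennreal_le_iff) auto
 then have "\<bar>x i - y i\<bar> \<le> D" by simp
 then have "(x i - y i)\<^sup>2 \<le> D\<^sup>2" using \<open>0 \<le> D\<close> by (simp add: abs_le_square_iff[symmetric])
 then have "(x i - y i)\<^sup>2 + s \<le> dl\<^sup>2" using s by (simp add: D_def)
 then show "(\<Sum>j\<in>I. (x j - y j)\<^sup>2) \<le> dl\<^sup>2"
  using assms(1,2) unfolding s_def by (subst sum.remove[of I i]) auto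
qed

text \<open>After symmetrisation in every direction the set is invariant under all sign changes, in
  particular under the reflection in the origin. The distance from \<open>x\<close> to its
  reflection is twice the norm of \<open>x\<close>, so the set lies in the ball of radius
  \<open>dl / 2\<close>.\<close>

lemma isodiametric_PiM:
 fixes I :: "'i set"
 assumes I: "finite I" and S: "S \<in> sets (lPi I)" "diam_at_most I dl S" and dl: "0 \<le> dl"
 shows "emeasure (lPi I) S \<le> ennreal (unit_ball_vol (card I) * (dl/2) ^ card I)"
proof -
 let ?M = "PiM I (%_. lborel :: real measure)"
 have "\<exists>T. T \<in> sets ?M \<and> emeasure ?M T = emeasure ?M S \<and> diam_at_most I dl T \<and>
   (\<forall>j\<in>J. \<forall>x\<in>T. x(j := - x j) \<in> T)" if "J \<subseteq> I" for J
  using finite_subset[OF that I] that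
 proof (induction J rule: finite_induct)
  case empty
  then show ?case using S by auto
 next
  case (insert i J)
  then obtain T where T: "T \<in> sets ?M" "emeasure ?M T = emeasure ?M S" "diam_at_most I dl T"
   "\<And>j x. j \<in> J ==> x \<in> T ==> x(j := - x j) \<in> T" by blast
  have i: "i \<in> I" using insert by auto
  have sp: "x(j := - x j) \<in> space ?M" if "x \<in> space ?M" "j \<in> I" for x j
   using that by (auto simp: space_PiM PiE_def extensional_def)
  have "x(j := - x j) \<in> steiner I i T" if "j \<in> insert i J" "x \<in> steiner I i T" for j x
  proof (cases "j = i")
   case True
   then show ?thesis using that(2) sp[OF _ i] by (simp add: steiner_def)
  next
   case False
   then have j: "j \<in> J" using that by auto
   \<comment> \<open>A sign change in direction \<open>j\<close> permutes the fibres in direction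
     \<open>i\<close> and keeps their lengths, so symmetries already gained survive the next
     symmetrisation.\<close>
   have "x(j := - x j, i := t) \<in> T \<longleftrightarrow> x(i := t) \<in> T" for t
   proof -
    have "(x(j := - x j, i := t))(j := - (x(j := - x j, i := t)) j) = x(i := t)"
     "(x(i := t))(j := - (x(i := t)) j) = x(j := - x j, i := t)"
     using False by auto
    then show ?thesis using T(4)[OF j] by metis
   qed
   then have "fibre_length T i (x(j := - x j)) = fibre_length T i x"
    by (simp add: fibre_length_def)
   then show ?thesis using that(2) False j insert.prems sp[of x j] by (auto simp: steiner_def)
  qed
  moreover have "emeasure ?M (steiner I i T) = emeasure ?M S"
   using emeasure_steiner[OF I i T(1) T(3)] T(2) by simp
  ultimately show ?case
   using steiner_sets[OF i T(1)] diam_steiner[OF I i T(3)] by blast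
 qed
 from this[of I] obtain T where T: "T \<in> sets ?M" "emeasure ?M T = emeasure ?M S" "diam_at_most I dl T"
   "\<And>j x. j \<in> I ==> x \<in> T ==> x(j := - x j) \<in> T" by blast
 have flip: "(%i. if i \<in> J then - x i else x i) \<in> T" if "J \<subseteq> I" "x \<in> T" for J x
  using finite_subset[OF that(1) I] that
 proof (induction J rule: finite_induct)
  case (insert i J)
  let ?z = "%i. if i \<in> J then - x i else x i"
  have "?z(i := - ?z i) \<in> T" using insert by (intro T(4)) auto
  moreover have "?z(i := - ?z i) = (%k. if k \<in> insert i J then - x k else x k)"
   using insert.hyps by auto
  ultimately show ?case by metis
 qed simp
 have half: "sqrt (\<Sum>i\<in>I. (x i)\<^sup>2) \<le> dl / 2" if x: "x \<in> T" for x
 proof -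
  have "(\<Sum>i\<in>I. (x i - (if i \<in> I then - x i else x i))\<^sup>2) \<le> dl\<^sup>2"
   using T(3)[unfolded diam_at_most_def, rule_format, OF x flip[OF order_refl x]] .
  also have "(\<Sum>i\<in>I. (x i - (if i \<in> I then - x i else x i))\<^sup>2) = 4 * (\<Sum>i\<in>I. (x i)\<^sup>2)"
   unfolding sum_distrib_left by (intro sum.cong) (auto simp: power2_eq_square)
  finally have "(\<Sum>i\<in>I. (x i)\<^sup>2) \<le> (dl / 2)\<^sup>2" by (simp add: power_divide)
  then show ?thesis using dl by (intro real_le_lsqrt) auto
 qed
 \<comment> \<open>The volume formula for balls is stated for positive radii, while
   \<open>dl\<close> may be 0; hence a limit of radii decreasing to \<open>dl / 2\<close>.\<close>
 have le: "emeasure ?M S \<le> ennreal (unit_ball_vol (card I) * r ^ card I)" if r: "dl / 2 < r" for r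
 proof -
  have "emeasure ?M T \<le> emeasure ?M ({f. sqrt (\<Sum>i\<in>I. (f i)\<^sup>2) \<le> r} \<inter> space ?M)"
  proof (rule emeasure_mono)
   show "T \<subseteq> {f. sqrt (\<Sum>i\<in>I. (f i)\<^sup>2) \<le> r} \<inter> space ?M"
    using half r sets.sets_into_space[OF T(1)] by force
   have "{f \<in> space ?M. sqrt (\<Sum>i\<in>I. (f i)\<^sup>2) \<le> r} \<in> sets ?M" by measurable
   moreover have "{f. sqrt (\<Sum>i\<in>I. (f i)\<^sup>2) \<le> r} \<inter> space ?M = {f \<in> space ?M. sqrt (\<Sum>i\<in>I. (f i)\<^sup>2) \<le> r}"
    by blast
   ultimately show "{f. sqrt (\<Sum>i\<in>I. (f i)\<^sup>2) \<le> r} \<inter> space ?M \<in> sets ?M" by metis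
  qed
  also have "... = ennreal (unit_ball_vol (card I) * r ^ card I)"
   using r dl I by (intro emeasure_cball_aux) auto
  finally show ?thesis using T(2) by simp
 qed
 have "(%k. ennreal (unit_ball_vol (card I) * (dl/2 + 1 / Suc k) ^ card I))
   \<longlonglongrightarrow> ennreal (unit_ball_vol (card I) * (dl/2 + 0) ^ card I)"
  by (intro tendsto_ennrealI tendsto_intros LIMSEQ_Suc[OF lim_1_over_n])
 then show ?thesis
  by (intro LIMSEQ_le_const[of _ "ennreal (unit_ball_vol (card I) * (dl/2) ^ card I)"]) (auto intro!: le)
qed

section \<open>Transfer of integrals over finite products\<close>

text \<open>A substitution with weight in each single factor is iterated by Tonelli. It serves for
  affine substitutions, for projection kernels and for densities alike.\<close>

lemma nn_integral_PiM_transfer: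
 fixes M :: "'i => 'a measure" and N :: "'i => 'b measure"
 assumes "finite I" and M: "\<And>i. sigma_finite_measure (M i)" and N: "\<And>i. sigma_finite_measure (N i)"
  and "\<And>i. i \<in> I ==> h i \<in> M i \<rightarrow>\<^sub>M N i" "\<And>i. i \<in> I ==> w i \<in> bmeas (M i)"
  and "\<And>i G. i \<in> I ==> G \<in> bmeas (N i) ==> (INT+ y. G y wrt N i) = (INT+ x. G (h i x) * w i x wrt M i)"
  and "F \<in> bmeas (PiM I N)"
 shows "(INT+ y. F y wrt PiM I N) = (INT+ x. F (\<lambda>i\<in>I. h i (x i)) * (\<Prod>i\<in>I. w i (x i)) wrt PiM I M)"
 using assms(1,4-)
proof (induction I arbitrary: F rule: finite_induct)
 case empty
 interpret M: product_sigma_finite M using M by (simp add: product_sigma_finite_def)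
 interpret N: product_sigma_finite N using N by (simp add: product_sigma_finite_def)
 show ?case by (simp add: PiM_empty nn_integral_count_space_finite restrict_def)
next
 case (insert i I)
 interpret M: product_sigma_finite M using M by (simp add: product_sigma_finite_def)
 interpret N: product_sigma_finite N using N by (simp add: product_sigma_finite_def)
 note [measurable] = insert.prems(4)
 have h[measurable]: "h j \<in> M j \<rightarrow>\<^sub>M N j" and w[measurable]: "w j \<in> bmeas (M j)" if "j \<in> insert i I" for j
  using insert.prems that by auto
 have hi[measurable]: "h i \<in> M i \<rightarrow>\<^sub>M N i" and wi[measurable]: "w i \<in> bmeas (M i)" by (auto intro: h w)
 have upd: "(\<lambda>j\<in>insert i I. h j ((x(i := s)) j)) = (\<lambda>j\<in>I. h j (x j))(i := h i s)" for x s
  using insert.hyps by (auto simp: fun_eq_iff)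
 have hc: "(%x. h j (x j)) \<in> PiM (insert i I) M \<rightarrow>\<^sub>M N j"
  and wc: "(%x. w j (x j)) \<in> bmeas (PiM (insert i I) M)" if "j \<in> insert i I" for j
  using measurable_compose[OF measurable_component_singleton[OF that, of M] h[OF that]]
   measurable_compose[OF measurable_component_singleton[OF that, of M] w[OF that]] by auto
 have big: "(%x. F (\<lambda>j\<in>insert i I. h j (x j)) * (\<Prod>j\<in>insert i I. w j (x j))) \<in> bmeas (PiM (insert i I) M)"
  by (intro borel_measurable_times_ennreal borel_measurable_prod_ennreal measurable_compose[OF _ insert.prems(4)]
     measurable_restrict hc wc)
 have "(INT+ y. F y wrt PiM (insert i I) N) = (INT+ y. (INT+ t. F (y(i := t)) wrt N i) wrt PiM I N)"
  using insert by (intro N.product_nn_integral_insert) auto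
 also have "... = (INT+ x. (INT+ t. F ((\<lambda>j\<in>I. h j (x j))(i := t)) wrt N i) * (\<Prod>j\<in>I. w j (x j)) wrt PiM I M)"
 proof (rule insert.IH)
  show "(%y. INT+ t. F (y(i := t)) wrt N i) \<in> bmeas (PiM I N)"
   using measurable_compose[OF measurable_add_dim insert.prems(4)]
   by (intro sigma_finite_measure.borel_measurable_nn_integral[OF N]) (simp add: case_prod_beta')
 qed (use insert.prems in auto)
 also have "... = (INT+ x. (INT+ s. F (\<lambda>j\<in>insert i I. h j ((x(i := s)) j)) * (\<Prod>j\<in>insert i I. w j ((x(i := s)) j)) wrt M i) wrt PiM I M)"
 proof (rule nn_integral_cong)
  fix x assume x: "x \<in> space (PiM I M)"
  have sp: "(\<lambda>j\<in>I. h j (x j)) \<in> space (PiM I N)"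
   using x by (auto simp: space_PiM PiE_iff intro!: measurable_space[OF h])
  have m: "(%t. F ((\<lambda>j\<in>I. h j (x j))(i := t))) \<in> bmeas (N i)"
   by (rule measurable_compose[OF measurable_component_update[OF sp insert.hyps(2)] insert.prems(4)])
  have "(INT+ t. F ((\<lambda>j\<in>I. h j (x j))(i := t)) wrt N i)
    = (INT+ s. F ((\<lambda>j\<in>I. h j (x j))(i := h i s)) * w i s wrt M i)"
   by (rule insert.prems(3)[OF _ m]) simp
  then have "(INT+ t. F ((\<lambda>j\<in>I. h j (x j))(i := t)) wrt N i) * (\<Prod>j\<in>I. w j (x j))
    = (INT+ s. F ((\<lambda>j\<in>I. h j (x j))(i := h i s)) * w i s * (\<Prod>j\<in>I. w j (x j)) wrt M i)"
   using measurable_compose[OF hi m] by (simp add: nn_integral_multc)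
  also have "... = (INT+ s. F (\<lambda>j\<in>insert i I. h j ((x(i := s)) j)) * (\<Prod>j\<in>insert i I. w j ((x(i := s)) j)) wrt M i)"
  proof (rule nn_integral_cong)
   fix s
   have "(\<Prod>j\<in>I. w j ((x(i := s)) j)) = (\<Prod>j\<in>I. w j (x j))"
    using insert.hyps by (intro prod.cong) auto
   then show "F ((\<lambda>j\<in>I. h j (x j))(i := h i s)) * w i s * (\<Prod>j\<in>I. w j (x j))
    = F (\<lambda>j\<in>insert i I. h j ((x(i := s)) j)) * (\<Prod>j\<in>insert i I. w j ((x(i := s)) j))"
    unfolding upd using insert.hyps by (simp add: mult.assoc)
  qed
  finally show "(INT+ t. F ((\<lambda>j\<in>I. h j (x j))(i := t)) wrt N i) * (\<Prod>j\<in>I. w j (x j))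
    = (INT+ s. F (\<lambda>j\<in>insert i I. h j ((x(i := s)) j)) * (\<Prod>j\<in>insert i I. w j ((x(i := s)) j)) wrt M i)" .
 qed
 also have "... = (INT+ x. F (\<lambda>i\<in>insert i I. h i (x i)) * (\<Prod>i\<in>insert i I. w i (x i)) wrt PiM (insert i I) M)"
  using insert.hyps big by (intro M.product_nn_integral_insert[symmetric]) auto
 finally show ?case .
qed

lemma measurable_PiM_zip:
 "(%(a, b). \<lambda>i\<in>I. (a i, b i)) \<in> PiM I M1 \<Otimes>\<^sub>M PiM I M2 \<rightarrow>\<^sub>M PiM I (%i. M1 i \<Otimes>\<^sub>M M2 i)"
 unfolding case_prod_beta' by (intro measurable_restrict) measurable

text \<open>Regrouping a product of pairs as a pair of products; this is what later separates the
  directions of all points from their radii.\<close>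

lemma nn_integral_PiM_pair:
 fixes M1 :: "'i => 'a measure" and M2 :: "'i => 'b measure"
 assumes "finite I" and M1: "\<And>i. sigma_finite_measure (M1 i)" and M2: "\<And>i. sigma_finite_measure (M2 i)"
  and "F \<in> bmeas (PiM I (%i. M1 i \<Otimes>\<^sub>M M2 i))"
 shows "(INT+ y. F y wrt PiM I (%i. M1 i \<Otimes>\<^sub>M M2 i))
  = (INT+ a. (INT+ b. F (\<lambda>i\<in>I. (a i, b i)) wrt PiM I M2) wrt PiM I M1)"
 using assms(1,4)
proof (induction I arbitrary: F rule: finite_induct)
 case empty
 interpret M1: product_sigma_finite M1 using M1 by (simp add: product_sigma_finite_def)
 interpret M2: product_sigma_finite M2 using M2 by (simp add: product_sigma_finite_def)
 have "sigma_finite_measure (M1 i \<Otimes>\<^sub>M M2 i)" for i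
  by (intro sigma_finite_pair_measure M1 M2)
 then interpret P: product_sigma_finite "%i. M1 i \<Otimes>\<^sub>M M2 i" by (simp add: product_sigma_finite_def)
 show ?case by (simp add: PiM_empty nn_integral_count_space_finite restrict_def)
next
 case (insert i I)
 interpret M1: product_sigma_finite M1 using M1 by (simp add: product_sigma_finite_def)
 interpret M2: product_sigma_finite M2 using M2 by (simp add: product_sigma_finite_def)
 have sf: "sigma_finite_measure (M1 i \<Otimes>\<^sub>M M2 i)" for i
  by (intro sigma_finite_pair_measure M1 M2)
 then interpret P: product_sigma_finite "%i. M1 i \<Otimes>\<^sub>M M2 i" by (simp add: product_sigma_finite_def)
 interpret M1I: finite_product_sigma_finite M1 I using insert by unfold_locales
 interpret M2I: finite_product_sigma_finite M2 I using insert by unfold_locales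
 interpret Q: pair_sigma_finite "M1 i" "PiM I M2" by (intro pair_sigma_finite.intro M1 M2I.sigma_finite_measure_axioms)
 note F[measurable] = insert.prems
 have upd: "(\<lambda>j\<in>insert i I. ((a(i := s)) j, (b(i := t)) j)) = (\<lambda>j\<in>I. (a j, b j))(i := (s, t))" for a b s t
  using insert.hyps by (auto simp: fun_eq_iff)
 have z: "(%p. F (\<lambda>j\<in>insert i I. (fst p j, snd p j))) \<in> bmeas (PiM (insert i I) M1 \<Otimes>\<^sub>M PiM (insert i I) M2)"
  using measurable_compose[OF measurable_PiM_zip F] by (simp add: case_prod_beta')
 have F4: "(%q. F (\<lambda>j\<in>insert i I. (((fst q)(i := fst (snd q))) j, ((fst (snd (snd q)))(i := snd (snd (snd q)))) j)))
  \<in> bmeas (PiM I M1 \<Otimes>\<^sub>M (M1 i \<Otimes>\<^sub>M (PiM I M2 \<Otimes>\<^sub>M M2 i)))"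
 proof -
  have 1: "(%q. (fst q)(i := fst (snd q))) \<in> PiM I M1 \<Otimes>\<^sub>M (M1 i \<Otimes>\<^sub>M (PiM I M2 \<Otimes>\<^sub>M M2 i)) \<rightarrow>\<^sub>M PiM (insert i I) M1"
   using measurable_compose[OF _ measurable_add_dim[where I = I and M = M1 and i = i], of "%q. (fst q, fst (snd q))"] by simp
  have 2: "(%q. (fst (snd (snd q)))(i := snd (snd (snd q)))) \<in> PiM I M1 \<Otimes>\<^sub>M (M1 i \<Otimes>\<^sub>M (PiM I M2 \<Otimes>\<^sub>M M2 i)) \<rightarrow>\<^sub>M PiM (insert i I) M2"
   using measurable_compose[OF _ measurable_add_dim[where I = I and M = M2 and i = i], of "%q. (fst (snd (snd q)), snd (snd (snd q)))"] by simp
  show ?thesis using measurable_compose[OF measurable_Pair[OF 1 2] z] by simp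
 qed
 have "(INT+ y. F y wrt PiM (insert i I) (%i. M1 i \<Otimes>\<^sub>M M2 i))
  = (INT+ y. (INT+ p. F (y(i := p)) wrt (M1 i \<Otimes>\<^sub>M M2 i)) wrt PiM I (%i. M1 i \<Otimes>\<^sub>M M2 i))"
  using insert by (intro P.product_nn_integral_insert) auto
 also have "... = (INT+ a. (INT+ b. (INT+ p. F ((\<lambda>j\<in>I. (a j, b j))(i := p)) wrt (M1 i \<Otimes>\<^sub>M M2 i)) wrt PiM I M2) wrt PiM I M1)"
 proof (rule insert.IH)
  show "(%y. INT+ p. F (y(i := p)) wrt (M1 i \<Otimes>\<^sub>M M2 i)) \<in> bmeas (PiM I (%i. M1 i \<Otimes>\<^sub>M M2 i))"
   using measurable_compose[OF measurable_add_dim insert.prems]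
   by (intro sigma_finite_measure.borel_measurable_nn_integral[OF sf]) (simp add: case_prod_beta')
 qed
 also have "... = (INT+ a. (INT+ b. (INT+ s. (INT+ t. F (\<lambda>j\<in>insert i I. ((a(i := s)) j, (b(i := t)) j)) wrt M2 i) wrt M1 i) wrt PiM I M2) wrt PiM I M1)"
 proof (intro nn_integral_cong)
  fix a b assume ab: "a \<in> space (PiM I M1)" "b \<in> space (PiM I M2)"
  have sp: "(\<lambda>j\<in>I. (a j, b j)) \<in> space (PiM I (%i. M1 i \<Otimes>\<^sub>M M2 i))"
   using ab by (auto simp: space_PiM PiE_iff space_pair_measure)
  have "(%p. F ((\<lambda>j\<in>I. (a j, b j))(i := p))) \<in> bmeas (M1 i \<Otimes>\<^sub>M M2 i)"
   by (rule measurable_compose[OF measurable_component_update[OF sp insert.hyps(2)] F])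
  then show "(INT+ p. F ((\<lambda>j\<in>I. (a j, b j))(i := p)) wrt (M1 i \<Otimes>\<^sub>M M2 i))
   = (INT+ s. (INT+ t. F (\<lambda>j\<in>insert i I. ((a(i := s)) j, (b(i := t)) j)) wrt M2 i) wrt M1 i)"
   unfolding upd by (rule sigma_finite_measure.nn_integral_fst[OF M2, symmetric])
 qed
 \<comment> \<open>The only exchange of integrals in the induction: the new first component moves
   outside the old second components.\<close>
 also have "... = (INT+ a. (INT+ s. (INT+ b. (INT+ t. F (\<lambda>j\<in>insert i I. ((a(i := s)) j, (b(i := t)) j)) wrt M2 i) wrt PiM I M2) wrt M1 i) wrt PiM I M1)"
 proof (intro nn_integral_cong)
  fix a assume a: "a \<in> space (PiM I M1)"
  have "(%q. F (\<lambda>j\<in>insert i I. ((a(i := fst (fst q))) j, ((snd (fst q))(i := snd q)) j)))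
    \<in> bmeas ((M1 i \<Otimes>\<^sub>M PiM I M2) \<Otimes>\<^sub>M M2 i)"
   using measurable_compose[OF _ F4, of "%q. (a, fst (fst q), snd (fst q), snd q)"] a by simp
  then have "(%q. INT+ t. F (\<lambda>j\<in>insert i I. ((a(i := fst q)) j, ((snd q)(i := t)) j)) wrt M2 i) \<in> bmeas (M1 i \<Otimes>\<^sub>M PiM I M2)"
   by (intro sigma_finite_measure.borel_measurable_nn_integral[OF M2]) (simp add: case_prod_beta')
  then show "(INT+ b. (INT+ s. (INT+ t. F (\<lambda>j\<in>insert i I. ((a(i := s)) j, (b(i := t)) j)) wrt M2 i) wrt M1 i) wrt PiM I M2)
   = (INT+ s. (INT+ b. (INT+ t. F (\<lambda>j\<in>insert i I. ((a(i := s)) j, (b(i := t)) j)) wrt M2 i) wrt PiM I M2) wrt M1 i)"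
   by (intro Q.Fubini') (simp add: case_prod_beta')
 qed
 also have "... = (INT+ a. (INT+ s. (INT+ b. F (\<lambda>j\<in>insert i I. ((a(i := s)) j, b j)) wrt PiM (insert i I) M2) wrt M1 i) wrt PiM I M1)"
 proof (intro nn_integral_cong M2.product_nn_integral_insert[symmetric] insert.hyps)
  fix a s assume as: "a \<in> space (PiM I M1)" "s \<in> space (M1 i)"
  have "a(i := s) \<in> space (PiM (insert i I) M1)"
   using measurable_space[OF measurable_component_update[OF as(1) insert.hyps(2)] as(2)] .
  then show "(%b. F (\<lambda>j\<in>insert i I. ((a(i := s)) j, b j))) \<in> bmeas (PiM (insert i I) M2)"
   using measurable_compose[OF measurable_Pair1' z, of "a(i := s)"] by (simp del: fun_upd_apply)
 qed
 also have "... = (INT+ a. (INT+ b. F (\<lambda>j\<in>insert i I. (a j, b j)) wrt PiM (insert i I) M2) wrt PiM (insert i I) M1)"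
 proof (intro M1.product_nn_integral_insert[symmetric] insert.hyps)
  interpret M2J: finite_product_sigma_finite M2 "insert i I" using insert by unfold_locales auto
  show "(%a. INT+ b. F (\<lambda>j\<in>insert i I. (a j, b j)) wrt PiM (insert i I) M2) \<in> bmeas (PiM (insert i I) M1)"
   using z by (intro M2J.borel_measurable_nn_integral) (simp add: case_prod_beta')
 qed
 finally show ?case .
qed

text \<open>The form of the transfer in which one variable is replaced by two, as in polar
  coordinates, with all first components integrated outside all second ones.\<close>

lemma nn_integral_PiM_transfer_pair:
 fixes M1 :: "'i => 'a measure" and M2 :: "'i => 'b measure" and N :: "'i => 'c measure"
 assumes I: "finite I" and M1: "\<And>i. sigma_finite_measure (M1 i)" and M2: "\<And>i. sigma_finite_measure (M2 i)"
  and N: "\<And>i. sigma_finite_measure (N i)"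
  and h: "\<And>i. i \<in> I ==> (%p. h i (fst p) (snd p)) \<in> M1 i \<Otimes>\<^sub>M M2 i \<rightarrow>\<^sub>M N i"
  and w: "\<And>i. i \<in> I ==> (%p. w i (fst p) (snd p)) \<in> bmeas (M1 i \<Otimes>\<^sub>M M2 i)"
  and eq: "\<And>i G. i \<in> I ==> G \<in> bmeas (N i) ==>
    (INT+ y. G y wrt N i) = (INT+ a. (INT+ b. G (h i a b) * w i a b wrt M2 i) wrt M1 i)"
  and F: "F \<in> bmeas (PiM I N)"
 shows "(INT+ y. F y wrt PiM I N) = (INT+ a. (INT+ b. F (\<lambda>i\<in>I. h i (a i) (b i)) * (\<Prod>i\<in>I. w i (a i) (b i)) wrt PiM I M2) wrt PiM I M1)"
proof -
 have sf: "sigma_finite_measure (M1 i \<Otimes>\<^sub>M M2 i)" for i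
  by (intro sigma_finite_pair_measure M1 M2)
 have "(INT+ y. F y wrt PiM I N) = (INT+ x. F (\<lambda>i\<in>I. h i (fst (x i)) (snd (x i))) * (\<Prod>i\<in>I. w i (fst (x i)) (snd (x i))) wrt PiM I (%i. M1 i \<Otimes>\<^sub>M M2 i))"
 proof (rule nn_integral_PiM_transfer[OF I sf N, where h = "%i p. h i (fst p) (snd p)" and w = "%i p. w i (fst p) (snd p)"])
  fix i and G :: "'c => ennreal" assume i: "i \<in> I" and G: "G \<in> bmeas (N i)"
  have "(%p. G (h i (fst p) (snd p)) * w i (fst p) (snd p)) \<in> bmeas (M1 i \<Otimes>\<^sub>M M2 i)"
   using measurable_compose[OF h[OF i] G] w[OF i] by simp
  then show "(INT+ y. G y wrt N i) = (INT+ p. G (h i (fst p) (snd p)) * w i (fst p) (snd p) wrt (M1 i \<Otimes>\<^sub>M M2 i))"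
   unfolding eq[OF i G] by (subst sigma_finite_measure.nn_integral_fst[OF M2, symmetric]) simp_all
 qed (use h w F in auto)
 also have "... = (INT+ a. (INT+ b. F (\<lambda>i\<in>I. h i (fst ((\<lambda>i\<in>I. (a i, b i)) i)) (snd ((\<lambda>i\<in>I. (a i, b i)) i)))
   * (\<Prod>i\<in>I. w i (fst ((\<lambda>i\<in>I. (a i, b i)) i)) (snd ((\<lambda>i\<in>I. (a i, b i)) i))) wrt PiM I M2) wrt PiM I M1)"
 proof (rule nn_integral_PiM_pair[OF I M1 M2])
  let ?P = "%i. M1 i \<Otimes>\<^sub>M M2 i"
  have c: "(%x. h i (fst (x i)) (snd (x i))) \<in> PiM I ?P \<rightarrow>\<^sub>M N i"
   "(%x. w i (fst (x i)) (snd (x i))) \<in> bmeas (PiM I ?P)" if "i \<in> I" for i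
   using measurable_compose[OF measurable_component_singleton[OF that, of ?P] h[OF that]]
    measurable_compose[OF measurable_component_singleton[OF that, of ?P] w[OF that]] by auto
  show "(%x. F (\<lambda>i\<in>I. h i (fst (x i)) (snd (x i))) * (\<Prod>i\<in>I. w i (fst (x i)) (snd (x i))))
   \<in> bmeas (PiM I ?P)"
   by (intro borel_measurable_times_ennreal borel_measurable_prod_ennreal measurable_compose[OF measurable_restrict F] c)
 qed
 also have "... = (INT+ a. (INT+ b. F (\<lambda>i\<in>I. h i (a i) (b i)) * (\<Prod>i\<in>I. w i (a i) (b i)) wrt PiM I M2) wrt PiM I M1)"
  by (intro nn_integral_cong arg_cong2[where f = "(*)"] arg_cong[where f = F] prod.cong) (auto simp: fun_eq_iff)
 finally show ?thesis .
qed

section \<open>Lebesgue measure on a subspace\<close>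

definition onb :: "nat => (nat => 'a::euclidean_space) => 'a set => bool" where
 "onb d b W \<longleftrightarrow> (\<forall>i<d. \<forall>j<d. b i \<bullet> b j = (if i = j then 1 else 0)) \<and> span (b ` {..<d}) = W"

definition lincomb :: "nat => (nat => 'a::euclidean_space) => (nat => real) => 'a" where
 "lincomb d b a = (\<Sum>i<d. a i *\<^sub>R b i)"

definition frame_lborel :: "nat => (nat => 'a::euclidean_space) => 'a measure" where
 "frame_lborel d b = distr (lPi {..<d}) borel (lincomb d b)"

text \<open>The measure lives on the ambient space and is concentrated on \<open>W\<close>; its
  independence of the chosen basis is \<open>frame_lborel_unique\<close>.\<close>

definition leb :: "'a::euclidean_space set => 'a measure" where
 "leb W = frame_lborel (dim W) (SOME b. onb (dim W) b W)"

lemma lincomb_measurable [measurable]: "lincomb d b \<in> bmeas (lPi {..<d})"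
 unfolding lincomb_def[abs_def] by measurable

lemma onb_inner: "onb d b W ==> i < d ==> j < d ==> b i \<bullet> b j = (if i = j then 1 else 0)"
 by (simp add: onb_def)

lemma onb_subspace: "onb d b W ==> subspace W"
 by (auto simp: onb_def)

lemma onb_in: "onb d b W ==> i < d ==> b i \<in> W"
 by (auto simp: onb_def intro: span_base)

lemma onb_inj:
 assumes "onb d b W" shows "inj_on b {..<d}"
 by (rule inj_onI) (metis assms lessThan_iff onb_inner zero_neq_one)

lemma onb_dim:
 assumes "onb d b W" shows "dim W = d"
proof -
 have "independent (b ` {..<d})"
 proof (rule pairwise_orthogonal_independent)
  show "pairwise orthogonal (b ` {..<d})"
   using onb_inner[OF assms] by (auto simp: pairwise_def orthogonal_def)
  show "0 \<notin> b ` {..<d}" using onb_inner[OF assms] by force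
 qed
 then have "dim (span (b ` {..<d})) = card (b ` {..<d})" by (simp add: dim_eq_card_independent)
 moreover have "W = span (b ` {..<d})" using assms by (simp add: onb_def)
 ultimately show ?thesis using onb_inj[OF assms] by (simp add: card_image)
qed

lemma onb_exists:
 fixes W :: "'a::euclidean_space set"
 assumes "subspace W"
 obtains b where "onb (dim W) b W"
proof -
 obtain B where B: "B \<subseteq> W" "pairwise orthogonal B" "\<And>x. x \<in> B ==> norm x = 1" "independent B" "card B = dim W" "span B = W"
  using orthonormal_basis_subspace[OF assms] by metis
 have "finite B" using B(4) independent_imp_finite by blast
 then obtain b where b: "bij_betw b {..<card B} B" using ex_bij_betw_nat_finite[of B] by (auto simp: lessThan_atLeast0)
 have "b i \<bullet> b j = (if i = j then 1 else 0)" if "i < dim W" "j < dim W" for i j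
 proof (cases "i = j")
  case True
  then show ?thesis using B(3)[of "b i"] b that B(5) by (auto simp: bij_betw_def norm_eq_1)
 next
  case False
  then have "b i \<noteq> b j" "b i \<in> B" "b j \<in> B" using b that B(5) by (auto simp: bij_betw_def inj_on_def)
  then show ?thesis using B(2) False by (auto simp: pairwise_def orthogonal_def)
 qed
 then have "onb (dim W) b W" using b B(5,6) by (auto simp: onb_def bij_betw_def)
 then show ?thesis by (rule that)
qed

lemma lincomb_in: "onb d b W ==> lincomb d b a \<in> W"
 unfolding lincomb_def by (intro subspace_sum onb_subspace subspace_scale onb_in) auto

lemma lincomb_inner:
 assumes "onb d b W" "j < d" shows "lincomb d b a \<bullet> b j = a j"
proof -
 have "lincomb d b a \<bullet> b j = (\<Sum>i<d. if i = j then a i else 0)"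
  unfolding lincomb_def inner_sum_left using onb_inner[OF assms(1)] assms(2) by (intro sum.cong) auto
 then show ?thesis using assms(2) by simp
qed

lemma norm_lincomb:
 assumes "onb d b W" shows "(norm (lincomb d b a))\<^sup>2 = (\<Sum>i<d. (a i)\<^sup>2)"
proof -
 have "lincomb d b a \<bullet> lincomb d b a = (\<Sum>i<d. a i * (lincomb d b a \<bullet> b i))"
  by (subst (2) lincomb_def) (simp add: inner_sum_right)
 also have "... = (\<Sum>i<d. (a i)\<^sup>2)"
  using lincomb_inner[OF assms] by (intro sum.cong) (auto simp: power2_eq_square)
 finally show ?thesis by (simp add: dot_square_norm)
qed

lemma lincomb_diff: "lincomb d b a - lincomb d b a' = lincomb d b (%i. a i - a' i)"
 by (simp add: lincomb_def sum_subtractf algebra_simps)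

lemma lincomb_scale: "c *\<^sub>R lincomb d b a = lincomb d b (%i. c * a i)"
 by (simp add: lincomb_def scaleR_sum_right)

lemma lincomb_add: "lincomb d b a + lincomb d b a' = lincomb d b (%i. a i + a' i)"
 by (simp add: lincomb_def sum.distrib algebra_simps)

lemma lincomb_cong: "(\<And>i. i < d ==> a i = a' i) ==> lincomb d b a = lincomb d b a'"
 by (simp add: lincomb_def)

lemma lincomb_coords:
 assumes "onb d b W" "x \<in> W" shows "lincomb d b (%i. x \<bullet> b i) = x"
proof -
 let ?y = "x - lincomb d b (%i. x \<bullet> b i)"
 have "?y \<in> W" using assms lincomb_in onb_subspace subspace_diff by blast
 then have "?y \<in> span (b ` {..<d})" using assms by (simp add: onb_def)
 moreover have "orthogonal ?y y" if "y \<in> b ` {..<d}" for y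
  using that lincomb_inner[OF assms(1)] by (auto simp: orthogonal_def inner_diff_left)
 ultimately have "orthogonal ?y ?y" by (meson orthogonal_to_span)
 then show ?thesis by (simp add: orthogonal_self)
qed

lemma sets_frame_lborel [simp, measurable_cong]: "sets (frame_lborel d b) = sets borel"
 by (simp add: frame_lborel_def)

lemma space_frame_lborel [simp]: "space (frame_lborel d b) = UNIV"
 by (simp add: frame_lborel_def)

lemma nn_integral_frame_lborel:
 assumes "G \<in> bmeas borel"
 shows "(INT+ x. G x wrt frame_lborel d b) = (INT+ a. G (lincomb d b a) wrt lPi {..<d})"
 unfolding frame_lborel_def using assms by (intro nn_integral_distr) auto

lemma AE_frame_lborel_in:
 assumes "onb d b W" shows "AE x in frame_lborel d b. x \<in> W"
 unfolding frame_lborel_def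
 using onb_subspace[OF assms] lincomb_in[OF assms]
 by (subst AE_distr_iff) (auto intro!: borel_closed closed_subspace)

lemma emeasure_frame_lborel_cball:
 assumes "onb d b W" "0 < r"
 shows "emeasure (frame_lborel d b) (cball 0 r) = ennreal (unit_ball_vol d * r ^ d)"
proof -
 let ?M = "PiM {..<d} (%_. lborel :: real measure)"
 have n: "norm (lincomb d b a) = sqrt (\<Sum>i<d. (a i)\<^sup>2)" for a
  using norm_lincomb[OF assms(1), of a] by (metis norm_ge_zero real_sqrt_unique)
 have "emeasure (frame_lborel d b) (cball 0 r) = emeasure ?M (lincomb d b -` cball 0 r \<inter> space ?M)"
  unfolding frame_lborel_def by (intro emeasure_distr) auto
 also have "lincomb d b -` cball 0 r \<inter> space ?M = {f. sqrt (\<Sum>i\<in>{..<d}. (f i)\<^sup>2) \<le> r} \<inter> space ?M"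
  by (auto simp: n)
 also have "emeasure ?M ... = ennreal (unit_ball_vol d * r ^ d)"
  using emeasure_cball_aux[of "{..<d}" r] assms(2) by simp
 finally show ?thesis .
qed

lemma sigma_finite_frame_lborel:
 assumes "onb d b W" shows "sigma_finite_measure (frame_lborel d b)"
proof
 let ?A = "range (%n. cball 0 (real (Suc n)) :: 'a set)"
 have "\<Union>?A = UNIV"
 proof (intro equalityI subsetI UNIV_I)
  fix x :: 'a
  obtain n where "norm x \<le> real n" using real_arch_simple by blast
  then have "x \<in> cball 0 (real (Suc n))" by simp
  then show "x \<in> \<Union>?A" by blast
 qed
 moreover have "emeasure (frame_lborel d b) (cball 0 (real (Suc n))) \<noteq> \<infinity>" for n
  by (subst emeasure_frame_lborel_cball[OF assms]) auto
 ultimately show "\<exists>A. countable A \<and> A \<subseteq> sets (frame_lborel d b) \<and> \<Union> A = space (frame_lborel d b) \<and>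
   (\<forall>a\<in>A. emeasure (frame_lborel d b) a \<noteq> \<infinity>)"
  by (intro exI[of _ ?A]) auto
qed

lemma nn_integral_frame_lborel_affine:
 assumes "onb d b W" "c \<noteq> 0" "w \<in> W" and G: "G \<in> bmeas borel"
 shows "(INT+ x. G x wrt frame_lborel d b) = ennreal (\<bar>c\<bar> ^ d) * (INT+ x. G (w + c *\<^sub>R x) wrt frame_lborel d b)"
proof -
 let ?M = "PiM {..<d} (%_. lborel :: real measure)"
 have [measurable]: "G \<in> bmeas borel" by (rule G)
 have "(INT+ x. G x wrt frame_lborel d b) = (INT+ a. G (lincomb d b a) wrt ?M)"
  by (rule nn_integral_frame_lborel[OF G])
 also have "... = (INT+ a. G (lincomb d b (\<lambda>i\<in>{..<d}. w \<bullet> b i + c * a i)) * (\<Prod>i\<in>{..<d}. ennreal \<bar>c\<bar>) wrt ?M)"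
 proof (rule nn_integral_PiM_transfer[where w = "%_ _. ennreal \<bar>c\<bar>" and h = "%i t. w \<bullet> b i + c * t"])
  fix G :: "real => ennreal" and i assume "G \<in> bmeas lborel"
  then have [measurable]: "G \<in> bmeas borel" by simp
  show "(INT+ y. G y wrt lborel) = (INT+ x. G (w \<bullet> b i + c * x) * ennreal \<bar>c\<bar> wrt lborel)"
   using nn_integral_real_affine[of G c "w \<bullet> b i"] assms(2) by (subst nn_integral_multc) (auto simp: mult.commute)
 qed (auto intro: sigma_finite_lborel)
 also have "... = (INT+ a. G (w + c *\<^sub>R lincomb d b a) * ennreal (\<bar>c\<bar> ^ d) wrt ?M)"
 proof (intro nn_integral_cong)
  fix a :: "nat => real"
  have "lincomb d b (\<lambda>i\<in>{..<d}. w \<bullet> b i + c * a i) = lincomb d b (%i. w \<bullet> b i) + lincomb d b (%i. c * a i)"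
   unfolding lincomb_add by (intro lincomb_cong) auto
  then show "G (lincomb d b (\<lambda>i\<in>{..<d}. w \<bullet> b i + c * a i)) * (\<Prod>i\<in>{..<d}. ennreal \<bar>c\<bar>)
   = G (w + c *\<^sub>R lincomb d b a) * ennreal (\<bar>c\<bar> ^ d)"
   using lincomb_coords[OF assms(1,3)] by (simp add: lincomb_scale ennreal_power)
 qed
 also have "... = ennreal (\<bar>c\<bar> ^ d) * (INT+ a. G (w + c *\<^sub>R lincomb d b a) wrt ?M)"
  by (subst nn_integral_multc) (auto simp: mult.commute)
 also have "(INT+ a. G (w + c *\<^sub>R lincomb d b a) wrt ?M) = (INT+ x. G (w + c *\<^sub>R x) wrt frame_lborel d b)"
  by (rule nn_integral_frame_lborel[symmetric]) measurable
 finally show ?thesis .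
qed

text \<open>Substituting \<open>y \<mapsto> y + x\<close>, then \<open>x \<mapsto> x - y\<close>, then \<open>y \<mapsto> x - y\<close> in
 \<open>\<integral>\<integral> 1\<^sub>A(x) 1\<^sub>B(y)\<close> exchanges the roles of the two measures.\<close>

lemma translation_invariant_proportional:
 fixes \<mu> \<nu> :: "'a::euclidean_space measure"
 assumes sf: "sigma_finite_measure \<mu>" "sigma_finite_measure \<nu>"
  and [simp, measurable_cong]: "sets \<mu> = sets borel" "sets \<nu> = sets borel"
  and W: "subspace W" "AE x in \<mu>. x \<in> W" "AE x in \<nu>. x \<in> W"
  and \<mu>: "\<And>w G. w \<in> W ==> G \<in> bmeas borel ==> (INT+ x. G (x + w) wrt \<mu>) = (INT+ x. G x wrt \<mu>)"
  and \<nu>: "\<And>w G. w \<in> W ==> G \<in> bmeas borel ==> (INT+ x. G (x + w) wrt \<nu>) = (INT+ x. G x wrt \<nu>)"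
  and \<nu>r: "\<And>G. G \<in> bmeas borel ==> (INT+ x. G (- x) wrt \<nu>) = (INT+ x. G x wrt \<nu>)"
  and A[measurable]: "A \<in> sets borel" and B[measurable]: "B \<in> sets borel"
 shows "emeasure \<mu> A * emeasure \<nu> B = emeasure \<nu> A * emeasure \<mu> B"
proof -
 interpret \<mu>: sigma_finite_measure \<mu> by fact
 interpret \<nu>: sigma_finite_measure \<nu> by fact
 interpret P: pair_sigma_finite \<mu> \<nu> ..
 have sp[simp]: "space \<mu> = UNIV" "space \<nu> = UNIV"
  using sets_eq_imp_space_eq[of \<mu> borel] sets_eq_imp_space_eq[of \<nu> borel] by auto
 let ?i = "indicator :: 'a set => 'a => ennreal"
 have "emeasure \<mu> A * emeasure \<nu> B = (INT+ x. (INT+ y. ?i A x * ?i B y wrt \<nu>) wrt \<mu>)"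
  by (simp add: nn_integral_cmult nn_integral_multc)
 also have "... = (INT+ x. (INT+ y. ?i A x * ?i B (y + x) wrt \<nu>) wrt \<mu>)"
 proof (rule nn_integral_cong_AE, use W(2) in eventually_elim)
  case (elim x)
  show ?case using \<nu>[OF elim, of "?i B"] by (simp add: nn_integral_cmult)
 qed
 also have "... = (INT+ y. (INT+ x. ?i A x * ?i B (y + x) wrt \<mu>) wrt \<nu>)"
  by (intro P.Fubini'[symmetric]) measurable
 also have "... = (INT+ y. (INT+ x. ?i A (x - y) * ?i B x wrt \<mu>) wrt \<nu>)"
 proof (rule nn_integral_cong_AE, use W(3) in eventually_elim)
  case (elim y)
  then have "- y \<in> W" using W(1) by (simp add: subspace_neg)
  from \<mu>[OF this, of "%x. ?i A x * ?i B (y + x)"] show ?case by simp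
 qed
 also have "... = (INT+ x. (INT+ y. ?i A (x - y) * ?i B x wrt \<nu>) wrt \<mu>)"
  by (intro P.Fubini') measurable
 also have "... = (INT+ x. (INT+ y. ?i A y * ?i B x wrt \<nu>) wrt \<mu>)"
 proof (rule nn_integral_cong_AE, use W(2) in eventually_elim)
  case (elim x)
  show ?case using \<nu>r[of "%y. ?i A (x + y) * ?i B x"] \<nu>[OF elim, of "%y. ?i A y * ?i B x"]
   by (simp add: add.commute)
 qed
 also have "... = emeasure \<nu> A * emeasure \<mu> B"
  by (simp add: nn_integral_cmult nn_integral_multc)
 finally show ?thesis .
qed

lemma frame_lborel_translate:
 assumes "onb d b W" "w \<in> W" "G \<in> bmeas borel"
 shows "(INT+ x. G (x + w) wrt frame_lborel d b) = (INT+ x. G x wrt frame_lborel d b)"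
 using nn_integral_frame_lborel_affine[OF assms(1) _ assms(2,3), of 1] by (simp add: add.commute)

lemma frame_lborel_reflect:
 assumes "onb d b W" "G \<in> bmeas borel"
 shows "(INT+ x. G (- x) wrt frame_lborel d b) = (INT+ x. G x wrt frame_lborel d b)"
 using nn_integral_frame_lborel_affine[OF assms(1) _ subspace_0[OF onb_subspace[OF assms(1)]] assms(2), of "-1"] by simp

text \<open>Both measures are translation invariant along \<open>W\<close>, hence proportional, and
  the closed unit ball has the same positive finite mass for both.\<close>

lemma frame_lborel_unique:
 assumes "onb d b W" "onb d b' W"
 shows "frame_lborel d b = frame_lborel d b'"
proof (rule measure_eqI)
 fix A assume "A \<in> sets (frame_lborel d b)"
 then have A: "A \<in> sets borel" by simp
 have "emeasure (frame_lborel d b) A * emeasure (frame_lborel d b') (cball 0 1)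
   = emeasure (frame_lborel d b') A * emeasure (frame_lborel d b) (cball 0 1)"
  by (rule translation_invariant_proportional[where W = W])
   (use assms A in \<open>auto intro: sigma_finite_frame_lborel AE_frame_lborel_in onb_subspace frame_lborel_translate frame_lborel_reflect\<close>)
 then have "emeasure (frame_lborel d b) A = emeasure (frame_lborel d b') A \<or> unit_ball_vol d * 1 ^ d \<le> 0"
  unfolding emeasure_frame_lborel_cball[OF assms(1) zero_less_one] emeasure_frame_lborel_cball[OF assms(2) zero_less_one]
  by (simp only: mult_right_ennreal_cancel)
 moreover have "0 < unit_ball_vol d" by simp
 ultimately show "emeasure (frame_lborel d b) A = emeasure (frame_lborel d b') A" by simp
qed simp

lemma leb_eq:
 assumes "onb d b W" shows "leb W = frame_lborel d b"
proof -
 have "onb (dim W) (SOME b. onb (dim W) b W) W"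
  using onb_exists[OF onb_subspace[OF assms]] someI_ex[of "%b. onb (dim W) b W"] by blast
 then show ?thesis unfolding leb_def using assms onb_dim[OF assms] by (metis frame_lborel_unique)
qed

lemma sets_leb [simp, measurable_cong]: "sets (leb W) = sets borel"
 by (simp add: leb_def)

lemma space_leb [simp]: "space (leb W) = UNIV"
 by (simp add: leb_def)

context
 fixes W :: "'a::euclidean_space set"
 assumes W: "subspace W"
begin

lemma AE_leb_in: "AE x in leb W. x \<in> W"
 using onb_exists[OF W] by (metis AE_frame_lborel_in leb_eq)

lemma emeasure_leb_cball: "0 < r ==> emeasure (leb W) (cball 0 r) = ennreal (unit_ball_vol (dim W) * r ^ dim W)"
 using onb_exists[OF W] by (metis emeasure_frame_lborel_cball leb_eq)

lemma sigma_finite_leb: "sigma_finite_measure (leb W)"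
 using onb_exists[OF W] by (metis sigma_finite_frame_lborel leb_eq)

lemma nn_integral_leb_affine:
 assumes "c \<noteq> 0" "w \<in> W" "G \<in> bmeas borel"
 shows "(INT+ x. G x wrt leb W) = ennreal (\<bar>c\<bar> ^ dim W) * (INT+ x. G (w + c *\<^sub>R x) wrt leb W)"
proof -
 obtain b where b: "onb (dim W) b W" using onb_exists[OF W] .
 show ?thesis unfolding leb_eq[OF b] by (rule nn_integral_frame_lborel_affine[OF b assms])
qed

lemma leb_translate:
 assumes "w \<in> W" "G \<in> bmeas borel"
 shows "(INT+ x. G (x + w) wrt leb W) = (INT+ x. G x wrt leb W)"
 using nn_integral_leb_affine[OF _ assms, of 1] by (simp add: add.commute)

lemma leb_reflect:
 assumes "G \<in> bmeas borel"
 shows "(INT+ x. G (- x) wrt leb W) = (INT+ x. G x wrt leb W)"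
 using nn_integral_leb_affine[OF _ subspace_0[OF W] assms, of "-1"] by simp

lemma emeasure_leb_isodiametric:
 assumes "closed S" "bounded S"
 shows "emeasure (leb W) S \<le> ennreal (unit_ball_vol (dim W) * (diameter S / 2) ^ dim W)"
proof -
 let ?d = "dim W"
 let ?M = "PiM {..<?d} (%_. lborel :: real measure)"
 obtain b where b: "onb ?d b W" using onb_exists[OF W] .
 let ?T = "lincomb ?d b -` S \<inter> space ?M"
 have S: "S \<in> sets borel" using assms by simp
 have "emeasure (leb W) S = emeasure ?M ?T"
  unfolding leb_eq[OF b] frame_lborel_def using S by (intro emeasure_distr) auto
 also have "... \<le> ennreal (unit_ball_vol (card {..<?d}) * (diameter S / 2) ^ card {..<?d})"
 proof (rule isodiametric_PiM)
  show "?T \<in> sets ?M" using S by measurable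
  show "diam_at_most {..<?d} (diameter S) ?T"
   unfolding diam_at_most_def
  proof (intro ballI)
   fix x y assume "x \<in> ?T" "y \<in> ?T"
   then have "norm (lincomb ?d b (%i. x i - y i)) \<le> diameter S"
    using diameter_bounded_bound[OF assms(2), of "lincomb ?d b x" "lincomb ?d b y"]
    by (simp add: dist_norm lincomb_diff)
   then show "(\<Sum>i<?d. (x i - y i)\<^sup>2) \<le> (diameter S)\<^sup>2"
    unfolding norm_lincomb[OF b, symmetric] by (intro power_mono) auto
  qed
 qed (use diameter_ge_0[OF assms(2)] in auto)
 finally show ?thesis by simp
qed

end

section \<open>Hausdorff measure on a subspace is Lebesgue measure\<close>

definition frame_cube :: "nat => (nat => 'a::euclidean_space) => (nat => real) => real => 'a set" where
 "frame_cube d b t s = {x \<in> span (b ` {..<d}). \<forall>i<d. t i \<le> x \<bullet> b i \<and> x \<bullet> b i \<le> t i + s}"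

context
 fixes W :: "'a::euclidean_space set" and d :: nat and b :: "nat => 'a"
 assumes b: "onb d b W"
begin

lemma frame_cube_eq: "frame_cube d b t s = {x \<in> W. \<forall>i<d. t i \<le> x \<bullet> b i \<and> x \<bullet> b i \<le> t i + s}"
 using b by (simp add: frame_cube_def onb_def)

lemma closed_frame_cube: "closed (frame_cube d b t s)"
proof -
 have "frame_cube d b t s = W \<inter> (\<Inter>i\<in>{..<d}. {x. t i \<le> x \<bullet> b i} \<inter> {x. x \<bullet> b i \<le> t i + s})"
  by (auto simp: frame_cube_eq)
 also have "closed ..."
  by (intro closed_Int closed_INT ballI closed_subspace[OF onb_subspace[OF b]] closed_Collect_le continuous_intros)
 finally show ?thesis .
qed

lemma frame_cube_translate: "frame_cube d b t s = (%x. lincomb d b t + x) ` frame_cube d b (%_. 0) s"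
proof (intro equalityI subsetI)
 fix x assume "x \<in> frame_cube d b t s"
 then have "x - lincomb d b t \<in> frame_cube d b (%_. 0) s"
  using b lincomb_in[OF b] onb_subspace[OF b] by (auto simp: frame_cube_eq inner_diff_left lincomb_inner[OF b] intro: subspace_diff)
 then show "x \<in> (%x. lincomb d b t + x) ` frame_cube d b (%_. 0) s" by (rule rev_image_eqI) simp
next
 fix x assume "x \<in> (%x. lincomb d b t + x) ` frame_cube d b (%_. 0) s"
 then show "x \<in> frame_cube d b t s"
  using b lincomb_in[OF b] onb_subspace[OF b] by (auto simp: frame_cube_eq inner_add_left lincomb_inner[OF b] intro: subspace_add)
qed

lemma emeasure_frame_cube:
 assumes "0 \<le> s" shows "emeasure (leb W) (frame_cube d b t s) = ennreal (s ^ d)"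
proof -
 let ?M = "PiM {..<d} (%_. lborel :: real measure)"
 interpret product_sigma_finite "%_. lborel :: real measure" by standard
 have "emeasure (leb W) (frame_cube d b t s) = emeasure ?M (lincomb d b -` frame_cube d b t s \<inter> space ?M)"
  unfolding leb_eq[OF b] frame_lborel_def using closed_frame_cube by (intro emeasure_distr) auto
 also have "lincomb d b -` frame_cube d b t s \<inter> space ?M = PiE {..<d} (%i. {t i..t i + s})"
  by (simp add: set_eq_iff frame_cube_eq lincomb_in[OF b] lincomb_inner[OF b] space_PiM PiE_iff Ball_def conj_commute)
 also have "emeasure ?M ... = (\<Prod>i<d. ennreal s)"
  using assms by (subst emeasure_PiM) auto
 finally show ?thesis using assms by (simp add: ennreal_power)
qed

lemma norm_frame_cube:
 assumes "x \<in> frame_cube d b t s" "y \<in> frame_cube d b t s" "0 \<le> s"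
 shows "norm (x - y) \<le> sqrt d * s"
proof -
 have xy: "x - y \<in> W" using assms onb_subspace[OF b] by (auto simp: frame_cube_eq intro: subspace_diff)
 have "(norm (x - y))\<^sup>2 = (\<Sum>i<d. ((x - y) \<bullet> b i)\<^sup>2)"
  using norm_lincomb[OF b, of "%i. (x - y) \<bullet> b i"] lincomb_coords[OF b xy] by simp
 also have "... \<le> (\<Sum>i<d. s\<^sup>2)"
  using assms by (intro sum_mono) (auto simp: frame_cube_eq inner_diff_left abs_le_square_iff[symmetric] abs_le_iff, smt+)
 also have "... = (sqrt d * s)\<^sup>2" by (simp add: power_mult_distrib)
 finally show ?thesis by (rule power2_le_imp_le) (use assms(3) in simp)
qed

lemma bounded_frame_cube: "bounded (frame_cube d b t s)"
proof (cases "frame_cube d b t s = {} \<or> s < 0")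
 case True
 have "bounded (frame_cube d b t s)" if "s < 0"
 proof (cases "d = 0")
  case True
  then have "frame_cube d b t s \<subseteq> {0}" by (auto simp: frame_cube_def)
  then show ?thesis by (metis bounded_insert bounded_empty bounded_subset)
 next
  case False
  then have "frame_cube d b t s = {}" using that by (fastforce simp: frame_cube_def)
  then show ?thesis by simp
 qed
 then show ?thesis using True by auto
next
 case False
 then obtain x where x: "x \<in> frame_cube d b t s" by blast
 show ?thesis unfolding bounded_def
  using norm_frame_cube[OF x] False by (metis dist_norm not_less)
qed

lemma diameter_frame_cube: "0 \<le> s ==> diameter (frame_cube d b t s) \<le> sqrt d * s"
 using norm_frame_cube by (intro diameter_le) auto

lemma unit_frame_cube_subdivide:
 assumes "0 < K"
 shows "frame_cube d b (%_. 0) 1 \<subseteq> (\<Union>k\<in>PiE {..<d} (%_. {..<K}). frame_cube d b (%i. real (k i) / K) (1 / K))"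
proof
 fix x assume x: "x \<in> frame_cube d b (%_. 0) 1"
 have "\<exists>j<K. real j / K \<le> x \<bullet> b i \<and> x \<bullet> b i \<le> real j / K + 1 / K" if "i < d" for i
 proof -
  have xi: "0 \<le> x \<bullet> b i" "x \<bullet> b i \<le> 1" using x that by (auto simp: frame_cube_def)
  show ?thesis
  proof (cases "x \<bullet> b i = 1")
   \<comment> \<open>For the coordinate 1 the floor would name the index \<open>K\<close>, which is
     one too large; the last closed cell also contains it.\<close>
   case True
   then show ?thesis using assms by (intro exI[of _ "K - 1"]) (auto simp: field_simps of_nat_diff)
  next
   case False
   define j where "j = nat \<lfloor>x \<bullet> b i * K\<rfloor>"
   have j: "real j \<le> x \<bullet> b i * K" "x \<bullet> b i * K < real j + 1"
    using xi assms by (auto simp: j_def of_nat_nat)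
   moreover have "x \<bullet> b i * real K < 1 * real K" using False xi assms by (intro mult_strict_right_mono) auto
   ultimately have "j < K" by linarith
   then show ?thesis using j assms by (intro exI[of _ j]) (auto simp: field_simps)
  qed
 qed
 then obtain k where k: "\<And>i. i < d ==> k i < K \<and> real (k i) / K \<le> x \<bullet> b i \<and> x \<bullet> b i \<le> real (k i) / K + 1 / K" by metis
 then have "restrict k {..<d} \<in> PiE {..<d} (%_. {..<K})"
  "x \<in> frame_cube d b (%i. real (restrict k {..<d} i) / K) (1 / K)"
  using x by (auto simp: frame_cube_def)
 then show "x \<in> (\<Union>k\<in>PiE {..<d} (%_. {..<K}). frame_cube d b (%i. real (k i) / K) (1 / K))" by blast
qed

lemma hausdorff_content_unit_frame_cube_le:
 assumes "0 < K" "0 \<le> dl"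
 shows "hausdorff_content d dl (frame_cube d b (%_. 0) 1)
  \<le> ennreal (real K ^ d) * hausdorff_content d dl (frame_cube d b (%_. 0) (1 / K))"
proof -
 let ?I = "PiE {..<d} (%_. {..<K})"
 have "hausdorff_content d dl (frame_cube d b (%_. 0) 1)
  \<le> hausdorff_content d dl (\<Union>k\<in>?I. frame_cube d b (%i. real (k i) / K) (1 / K))"
  by (intro hausdorff_content_mono unit_frame_cube_subdivide assms)
 also have "... \<le> (\<Sum>k\<in>?I. hausdorff_content d dl (frame_cube d b (%i. real (k i) / K) (1 / K)))"
  by (intro hausdorff_content_UN_finite assms finite_PiE) auto
 also have "... \<le> (\<Sum>k\<in>?I. hausdorff_content d dl (frame_cube d b (%_. 0) (1 / K)))"
  by (intro sum_mono) (subst frame_cube_translate, intro hausdorff_content_isometry_le, simp)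
 also have "... = ennreal (real K ^ d) * hausdorff_content d dl (frame_cube d b (%_. 0) (1 / K))"
  by (simp add: card_PiE ennreal_power[symmetric] ennreal_of_nat_eq_real_of_nat)
 finally show ?thesis .
qed

text \<open>The unit cube is covered by \<open>K ^ d\<close> cubes of diameter at most
  \<open>sqrt d / K\<close>; the powers of \<open>K\<close> cancel, so the bound does not depend on
  the mesh.\<close>

lemma hausdorff_outer_unit_frame_cube_finite: "hausdorff_outer d (frame_cube d b (%_. 0) 1) < \<infinity>"
proof -
 have "hausdorff_content d dl (frame_cube d b (%_. 0) 1) \<le> ennreal (unit_ball_vol d * (sqrt d / 2) ^ d)" if "0 < dl" for dl
 proof -
  obtain K where K: "sqrt d / dl < real K" using reals_Archimedean2 by blast
  have "0 \<le> sqrt d / dl" using that by simp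
  then have K0: "0 < K" using K by (metis of_nat_0 of_nat_less_iff le_less_trans)
  let ?c = "frame_cube d b (%_. 0) (1 / K)"
  have small: "sqrt d * (1 / K) \<le> dl" using K K0 that by (simp add: field_simps)
  have "hausdorff_content d dl ?c \<le> hausdorff_gauge d ?c"
   using that small diameter_frame_cube[of "1 / K" "%_. 0"] by (intro hausdorff_content_le_gauge bounded_frame_cube) auto
  also have "... \<le> ennreal (unit_ball_vol d * (sqrt d * (1 / K) / 2) ^ d)"
   using diameter_frame_cube[of "1 / K" "%_. 0"] diameter_ge_0[OF bounded_frame_cube]
   by (auto simp: hausdorff_gauge_def intro!: ennreal_leI mult_left_mono power_mono)
  finally have "ennreal (real K ^ d) * hausdorff_content d dl ?c \<le> ennreal (real K ^ d) * ennreal (unit_ball_vol d * (sqrt d * (1 / K) / 2) ^ d)"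
   by (intro mult_left_mono) auto
  also have "... = ennreal (unit_ball_vol d * (sqrt d / 2) ^ d)"
   using K0 by (simp add: ennreal_mult'[symmetric] power_mult_distrib power_divide field_simps)
  finally show ?thesis using hausdorff_content_unit_frame_cube_le[OF K0, of dl] that by auto
 qed
 then have "hausdorff_outer d (frame_cube d b (%_. 0) 1) \<le> ennreal (unit_ball_vol d * (sqrt d / 2) ^ d)"
  unfolding hausdorff_outer_def by (intro SUP_least) auto
 then show ?thesis by (rule order.strict_trans1) simp
qed

text \<open>Translations are isometries, so Hausdorff measure restricted to \<open>W\<close> is
  translation invariant, and finiteness on one cube makes it sigma-finite. Proportionality follows;
  only the constant remains to be found.\<close>

lemma hausdorff_proportional_leb:
 assumes A: "A \<in> sets borel"
 shows "hausdorff_outer d (A \<inter> W) = emeasure (leb W) A * hausdorff_outer d (frame_cube d b (%_. 0) 1)"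
proof -
 let ?C = "frame_cube d b (%_. 0) 1"
 have W[measurable]: "W \<in> sets borel" using onb_subspace[OF b] by (simp add: closed_subspace borel_closed)
 define \<mu> where "\<mu> = density (hausdorff_measure d) (indicator W :: 'a => ennreal)"
 have sets_\<mu>[simp, measurable_cong]: "sets \<mu> = sets borel" by (simp add: \<mu>_def)
 have [simp]: "space \<mu> = UNIV" by (simp add: \<mu>_def)
 have em: "emeasure \<mu> B = hausdorff_outer d (B \<inter> W)" if B: "B \<in> sets borel" for B
 proof -
  have "emeasure \<mu> B = (INT+ x. indicator W x * indicator B x wrt hausdorff_measure d)"
   unfolding \<mu>_def using B by (subst emeasure_density) auto
  also have "... = (INT+ x. indicator (B \<inter> W) x wrt hausdorff_measure d)"
   by (intro nn_integral_cong) (auto simp: indicator_def)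
  also have "... = hausdorff_outer d (B \<inter> W)" using B by (simp add: emeasure_hausdorff_measure)
  finally show ?thesis .
 qed
 have inv: "distr \<mu> borel (%x. x + w) = \<mu>" if w: "w \<in> W" for w
 proof (rule measure_eqI)
  fix B assume "B \<in> sets (distr \<mu> borel (%x. x + w))"
  then have B[measurable]: "B \<in> sets borel" by simp
  have 1: "hausdorff_outer d ((%x. x + v) ` S) \<le> hausdorff_outer d S" for v and S :: "'a set"
   by (rule hausdorff_outer_isometry_le) simp
  have i: "(%x. x + w) -` B \<inter> W = (%x. x + (- w)) ` (B \<inter> W)"
  proof (intro equalityI subsetI)
   fix x assume "x \<in> (%x. x + w) -` B \<inter> W"
   then have "x + w \<in> B \<inter> W" using w onb_subspace[OF b] by (auto intro: subspace_add)
   then show "x \<in> (%x. x + (- w)) ` (B \<inter> W)" by (rule rev_image_eqI) simp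
  next
   fix x assume "x \<in> (%x. x + (- w)) ` (B \<inter> W)"
   then show "x \<in> (%x. x + w) -` B \<inter> W" using w onb_subspace[OF b] by (auto intro: subspace_diff)
  qed
  have i': "B \<inter> W = (%x. x + w) ` ((%x. x + (- w)) ` (B \<inter> W))" by (simp add: image_image)
  have "(%x. x + w) -` B \<in> sets borel" using measurable_sets[of "%x. x + w" borel borel B] by simp
  then have "emeasure (distr \<mu> borel (%x. x + w)) B = hausdorff_outer d ((%x. x + (- w)) ` (B \<inter> W))"
   by (subst emeasure_distr) (auto simp: em i)
  also have "... = hausdorff_outer d (B \<inter> W)"
   using 1[of "- w" "B \<inter> W"] 1[of w "(%x. x + (- w)) ` (B \<inter> W)"] unfolding i'[symmetric] by (rule antisym)
  finally show "emeasure (distr \<mu> borel (%x. x + w)) B = emeasure \<mu> B" using em[OF B] by simp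
 qed simp
 have sf: "sigma_finite_measure \<mu>"
 proof
  define D where "D n = frame_cube d b (%_. - real (Suc n)) (2 * real (Suc n))" for n
  \<comment> \<open>The complement of \<open>W\<close> has measure 0 for \<open>\<mu>\<close> and is
    added so that the pieces exhaust the whole space.\<close>
  let ?A = "range (%n. D n \<union> - W)"
  have "hausdorff_outer d (D n) < \<infinity>" for n
  proof -
   let ?N = "real (Suc n)"
   have "D n \<subseteq> (%x. lincomb d b (%_. - ?N) + (2 * ?N) *\<^sub>R x) ` ?C"
   proof
    fix x assume x: "x \<in> D n"
    let ?y = "(1 / (2 * ?N)) *\<^sub>R (x - lincomb d b (%_. - ?N))"
    have "?y \<in> W" using x lincomb_in[OF b] onb_subspace[OF b]
     by (auto simp: D_def frame_cube_eq intro!: subspace_scale subspace_diff)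
    moreover have "0 \<le> ?y \<bullet> b i \<and> ?y \<bullet> b i \<le> 0 + 1" if "i < d" for i
    proof -
     have "- ?N \<le> x \<bullet> b i" "x \<bullet> b i \<le> - ?N + 2 * ?N" using x that by (auto simp: D_def frame_cube_def)
     moreover have "?y \<bullet> b i = (x \<bullet> b i + ?N) / (2 * ?N)"
      using that by (simp add: inner_diff_left lincomb_inner[OF b])
     ultimately show ?thesis by (simp only:) (auto simp: divide_simps)
    qed
    ultimately have "?y \<in> ?C" by (simp add: frame_cube_eq)
    moreover have "x = lincomb d b (%_. - ?N) + (2 * ?N) *\<^sub>R ?y" by simp
    ultimately show "x \<in> (%x. lincomb d b (%_. - ?N) + (2 * ?N) *\<^sub>R x) ` ?C" by blast
   qed
   then have "hausdorff_outer d (D n) \<le> hausdorff_outer d ((%x. lincomb d b (%_. - ?N) + (2 * ?N) *\<^sub>R x) ` ?C)"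
    by (rule hausdorff_outer_mono)
   also have "... \<le> ennreal ((2 * ?N) ^ d) * hausdorff_outer d ?C"
    by (rule hausdorff_outer_lipschitz_image) (auto simp: dist_norm scaleR_diff_right[symmetric])
   also have "... < \<infinity>" using hausdorff_outer_unit_frame_cube_finite by (simp add: ennreal_mult_less_top)
   finally show ?thesis .
  qed
  moreover have D: "D n \<in> sets borel" "D n \<subseteq> W" for n using closed_frame_cube by (auto simp: D_def frame_cube_eq)
  moreover have "(D n \<union> - W) \<inter> W = D n" for n using D(2) by auto
  ultimately have fin: "emeasure \<mu> (D n \<union> - W) \<noteq> \<infinity>" for n
   using em[of "D n \<union> - W"] W by (auto simp: less_top[symmetric])
  have "\<Union>?A = UNIV"
  proof (intro equalityI subsetI UNIV_I)
   fix x :: 'a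
   obtain n where n: "norm x \<le> real n" using real_arch_simple by blast
   have "- real (Suc n) \<le> x \<bullet> b i \<and> x \<bullet> b i \<le> - real (Suc n) + 2 * real (Suc n)" if "i < d" for i
   proof -
    have "norm (b i) = 1" using onb_inner[OF b that that] by (simp add: norm_eq_1)
    then have "\<bar>x \<bullet> b i\<bar> \<le> norm x" using Cauchy_Schwarz_ineq2[of x "b i"] by simp
    then show ?thesis using n by auto
   qed
   then have "x \<in> D n \<union> - W" by (auto simp: D_def frame_cube_eq)
   then show "x \<in> \<Union>?A" by blast
  qed
  then show "\<exists>A. countable A \<and> A \<subseteq> sets \<mu> \<and> \<Union> A = space \<mu> \<and> (\<forall>a\<in>A. emeasure \<mu> a \<noteq> \<infinity>)"
   using D fin W by (intro exI[of _ ?A]) auto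
 qed
 have AE: "AE x in \<mu>. x \<in> W"
  unfolding \<mu>_def by (subst AE_density) (auto simp: indicator_def)
 have "emeasure \<mu> A * emeasure (leb W) ?C = emeasure (leb W) A * emeasure \<mu> ?C"
 proof (rule translation_invariant_proportional[where W = W])
  fix w and G :: "'a => ennreal" assume w: "w \<in> W" and G: "G \<in> bmeas borel"
  have "(INT+ x. G (x + w) wrt \<mu>) = (INT+ x. G x wrt distr \<mu> borel (%x. x + w))"
   using G by (intro nn_integral_distr[symmetric]) auto
  then show "(INT+ x. G (x + w) wrt \<mu>) = (INT+ x. G x wrt \<mu>)" using inv[OF w] by simp
 next
  have s: "subspace W" by (rule onb_subspace[OF b])
  show "subspace W" "AE x in leb W. x \<in> W" "sigma_finite_measure (leb W)"
   by (auto intro: s AE_leb_in sigma_finite_leb)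
  fix w and G :: "'a => ennreal" assume "w \<in> W" "G \<in> bmeas borel"
  then show "(INT+ x. G (x + w) wrt leb W) = (INT+ x. G x wrt leb W)" by (rule leb_translate[OF s])
 next
  fix G :: "'a => ennreal" assume "G \<in> bmeas borel"
  then show "(INT+ x. G (- x) wrt leb W) = (INT+ x. G x wrt leb W)" by (rule leb_reflect[OF onb_subspace[OF b]])
 qed (use sf AE A closed_frame_cube in auto)
 moreover have "?C \<inter> W = ?C" by (auto simp: frame_cube_eq)
 ultimately show ?thesis
  using em[OF A] em[of ?C] closed_frame_cube[of "%_. 0" 1] emeasure_frame_cube[of 1 "%_. 0"] by simp
qed

text \<open>Upper bound: each small cube is covered by its inscribed ball, whose gauge is exactly its volume, and
 a remainder. Writing \<open>\<theta>\<close> for the volume fraction of the inscribed ball this gives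
 \<open>c \<le> \<theta> + c (1 - \<theta>)\<close>. Lower bound: the isodiametric inequality.\<close>

lemma hausdorff_outer_unit_frame_cube: "hausdorff_outer d (frame_cube d b (%_. 0) 1) = 1"
proof (rule antisym)
 let ?C = "frame_cube d b (%_. 0) 1"
 have sW: "subspace W" by (rule onb_subspace[OF b])
 have dimW: "dim W = d" by (rule onb_dim[OF b])
 have W[measurable]: "W \<in> sets borel" using sW by (simp add: closed_subspace borel_closed)
 define c where "c = enn2real (hausdorff_outer d ?C)"
 have c: "hausdorff_outer d ?C = ennreal c" "0 \<le> c"
  using hausdorff_outer_unit_frame_cube_finite by (auto simp: c_def)
 define \<theta> where "\<theta> = unit_ball_vol d / 2 ^ d"
 have \<theta>0: "0 < \<theta>" by (simp add: \<theta>_def)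
 have "hausdorff_content d dl ?C \<le> ennreal (\<theta> + c * (1 - \<theta>))" if dl: "0 < dl" for dl
 proof -
  obtain K where K: "1 / dl < real K" using reals_Archimedean2 by blast
  then have K0: "0 < K" using dl by (metis of_nat_0 of_nat_less_iff less_trans zero_less_divide_1_iff)
  have Kdl: "1 / K \<le> dl" using K K0 dl by (simp add: field_simps)
  let ?c = "frame_cube d b (%_. 0) (1 / K)"
  let ?r = "1 / (2 * real K)"
  let ?p = "lincomb d b (%_. ?r)"
  let ?B = "cball ?p ?r"
  have sub: "?B \<inter> W \<subseteq> ?c"
  proof
   fix x assume x: "x \<in> ?B \<inter> W"
   have "\<bar>(x - ?p) \<bullet> b i\<bar> \<le> ?r" if "i < d" for i
    using Cauchy_Schwarz_ineq2[of "x - ?p" "b i"] x onb_inner[OF b that that]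
    by (simp add: norm_eq_1[symmetric] dist_norm norm_minus_commute)
   then have "\<bar>x \<bullet> b i - ?r\<bar> \<le> ?r" if "i < d" for i
    using that by (simp add: inner_diff_left lincomb_inner[OF b])
   then have "0 \<le> x \<bullet> b i \<and> x \<bullet> b i \<le> 0 + 1 / K" if "i < d" for i
    using that[THEN \<open>\<And>i. i < d ==> \<bar>x \<bullet> b i - ?r\<bar> \<le> ?r\<close>] by (simp add: abs_le_iff field_simps)
   then show "x \<in> ?c" using x by (simp add: frame_cube_eq)
  qed
  have volB: "emeasure (leb W) ?B = ennreal (unit_ball_vol d * ?r ^ d)"
  proof -
   have "emeasure (leb W) ?B = (INT+ x. indicator ?B x wrt leb W)" by simp
   also have "... = (INT+ x. indicator ?B (x + ?p) wrt leb W)"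
    by (rule leb_translate[OF sW lincomb_in[OF b], symmetric]) (auto intro: borel_measurable_indicator)
   also have "... = (INT+ x. indicator (cball 0 ?r) x wrt leb W)"
    by (intro nn_integral_cong) (auto simp: indicator_def dist_norm norm_minus_commute)
   also have "... = ennreal (unit_ball_vol d * ?r ^ d)"
    using emeasure_leb_cball[OF sW, of ?r] K0 dimW by simp
   finally show ?thesis .
  qed
  have "hausdorff_content d dl ?c \<le> hausdorff_content d dl (?B \<inter> W) + hausdorff_content d dl (?c - ?B)"
   by (rule order_trans[OF hausdorff_content_mono hausdorff_content_Un]) (use dl in \<open>auto simp: frame_cube_eq\<close>)
  also have "hausdorff_content d dl (?B \<inter> W) \<le> ennreal (unit_ball_vol d * ?r ^ d)"
  proof -
   have dB: "diameter (?B \<inter> W) \<le> 1 / K"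
   proof -
    have "diameter (?B \<inter> W) \<le> diameter ?B" by (intro diameter_subset) auto
    also have "... \<le> 2 * ?r" using K0 by (simp add: diameter_cball)
    finally show ?thesis by simp
   qed
   have bB: "bounded (?B \<inter> W)" by (meson bounded_cball bounded_subset inf_le1)
   have "hausdorff_content d dl (?B \<inter> W) \<le> hausdorff_gauge d (?B \<inter> W)"
    using dB Kdl dl bB by (intro hausdorff_content_le_gauge) auto
   also have "... \<le> ennreal (unit_ball_vol d * (1 / K / 2) ^ d)"
    using dB diameter_ge_0[OF bB]
    by (auto simp: hausdorff_gauge_def intro!: ennreal_leI mult_left_mono power_mono)
   finally show ?thesis by (simp add: mult.commute)
  qed
  also have "hausdorff_content d dl (?c - ?B) \<le> ennreal (c * ((1 / K) ^ d - unit_ball_vol d * ?r ^ d))"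
  proof -
   have "hausdorff_content d dl (?c - ?B) \<le> hausdorff_outer d ((?c - ?B) \<inter> W)"
    using dl by (intro order_trans[OF hausdorff_content_le_outer hausdorff_outer_mono]) (auto simp: frame_cube_eq)
   \<comment> \<open>The remainder outside the ball has no convenient cover, so it is measured by
     proportionality; this is how the unknown constant \<open>c\<close> enters its own upper
     bound.\<close>
   also have "... = emeasure (leb W) (?c - ?B) * ennreal c"
    using closed_frame_cube[of "%_. 0" "1 / K"] unfolding c(1)[symmetric] by (intro hausdorff_proportional_leb) auto
   also have "emeasure (leb W) (?c - ?B) = emeasure (leb W) (?c - (?B \<inter> W))"
    by (rule arg_cong[where f = "emeasure (leb W)"]) (auto simp: frame_cube_eq)
   also have "... = emeasure (leb W) ?c - emeasure (leb W) (?B \<inter> W)"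
   proof (rule emeasure_Diff)
    show "emeasure (leb W) (?B \<inter> W) \<noteq> \<infinity>"
     using emeasure_mono[of "?B \<inter> W" ?B "leb W"] volB by (auto simp: top_unique)
   qed (use sub closed_frame_cube in auto)
   also have "emeasure (leb W) (?B \<inter> W) = emeasure (leb W) ?B"
    using AE_leb_in[OF sW] by (intro emeasure_eq_AE) auto
   also have "emeasure (leb W) ?c = ennreal ((1 / K) ^ d)" by (intro emeasure_frame_cube) simp
   also have "ennreal ((1 / K) ^ d) - emeasure (leb W) ?B = ennreal ((1 / K) ^ d - unit_ball_vol d * ?r ^ d)"
    unfolding volB by (intro ennreal_minus) simp
   also have "... * ennreal c = ennreal (c * ((1 / K) ^ d - unit_ball_vol d * ?r ^ d))"
    using c(2) by (subst ennreal_mult''[symmetric]) (auto simp: mult.commute)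
   finally show ?thesis .
  qed
  finally have le: "hausdorff_content d dl ?c \<le> ennreal (unit_ball_vol d * ?r ^ d) + ennreal (c * ((1 / K) ^ d - unit_ball_vol d * ?r ^ d))"
   by (simp add: add_mono)
  have e1: "unit_ball_vol d * ?r ^ d = \<theta> * (1 / K) ^ d"
   by (simp add: \<theta>_def power_divide power_mult_distrib field_simps)
  have "ennreal (unit_ball_vol d * ?r ^ d) \<le> ennreal ((1 / K) ^ d)"
  proof -
   have "emeasure (leb W) ?B = emeasure (leb W) (?B \<inter> W)"
    using AE_leb_in[OF sW] by (intro emeasure_eq_AE) auto
   also have "... \<le> emeasure (leb W) ?c" using sub closed_frame_cube by (intro emeasure_mono) auto
   finally show ?thesis unfolding volB by (simp add: emeasure_frame_cube)
  qed
  then have "\<theta> * (1 / K) ^ d \<le> 1 * (1 / K) ^ d" unfolding e1 by (subst (asm) ennreal_le_iff) auto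
  then have \<theta>1: "\<theta> \<le> 1" using K0 by (subst (asm) mult_le_cancel_right) auto
  have "hausdorff_content d dl ?C \<le> ennreal (real K ^ d) * hausdorff_content d dl ?c"
   using dl by (intro hausdorff_content_unit_frame_cube_le K0) auto
  also have "... \<le> ennreal (real K ^ d) * (ennreal (\<theta> * (1 / K) ^ d) + ennreal (c * ((1 / K) ^ d - \<theta> * (1 / K) ^ d)))"
   using le unfolding e1 by (intro mult_left_mono) auto
  also have "... = ennreal (real K ^ d) * ennreal ((\<theta> + c * (1 - \<theta>)) * (1 / K) ^ d)"
   using \<theta>0 \<theta>1 c(2) K0 by (subst ennreal_plus[symmetric]) (auto simp: algebra_simps mult_left_le_one_le)
  also have "... = ennreal (\<theta> + c * (1 - \<theta>))"
   using K0 \<theta>0 \<theta>1 c(2) by (subst ennreal_mult'[symmetric]) (auto simp: power_divide)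
  finally show ?thesis .
 qed
 then have "ennreal c \<le> ennreal (\<theta> + c * (1 - \<theta>))"
  unfolding c(1)[symmetric] hausdorff_outer_def by (intro SUP_least) auto
 \<comment> \<open>\<open>ennreal\<close> truncates negative reals to 0; in that case the preceding
   inequality forces \<open>c \<le> 0\<close>.\<close>
 moreover have "0 \<le> \<theta> + c * (1 - \<theta>) \<or> c \<le> 0"
  using calculation c(2) by (metis ennreal_neg ennreal_le_iff2 linear not_le)
 ultimately have "c \<le> \<theta> + c * (1 - \<theta>) \<or> c \<le> 0" by (auto simp: ennreal_le_iff)
 then have "c * \<theta> \<le> 1 * \<theta> \<or> c \<le> 0" by (auto simp: algebra_simps)
 then have "c \<le> 1" using \<theta>0 by (auto simp: mult_le_cancel_right)
 then show "hausdorff_outer d ?C \<le> 1" unfolding c(1) by simp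
 have "1 \<le> hausdorff_content d 1 ?C"
  unfolding hausdorff_content_def
 proof (rule INF_greatest, safe)
  fix U :: "nat => 'a set" assume U: "?C \<subseteq> (\<Union>i. U i)" "\<forall>i. bounded (U i) \<and> diameter (U i) \<le> 1"
  have "1 = emeasure (leb W) ?C" using emeasure_frame_cube[of 1 "%_. 0"] by simp
  \<comment> \<open>The covering sets are arbitrary; closures are measurable and have the same
    diameter.\<close>
  also have "... \<le> emeasure (leb W) (\<Union>i. closure (U i))"
  proof (rule emeasure_mono)
   show "?C \<subseteq> (\<Union>i. closure (U i))"
    by (rule order_trans[OF U(1)]) (intro UN_mono closure_subset order_refl)
  qed auto
  also have "... \<le> (\<Sum>i. emeasure (leb W) (closure (U i)))"
   by (intro emeasure_subadditive_countably) auto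
  also have "... \<le> (\<Sum>i. hausdorff_gauge d (U i))"
  proof (intro suminf_le)
   fix i
   show "emeasure (leb W) (closure (U i)) \<le> hausdorff_gauge d (U i)"
   proof (cases "U i = {}")
    case False
    have "emeasure (leb W) (closure (U i)) \<le> ennreal (unit_ball_vol (dim W) * (diameter (closure (U i)) / 2) ^ dim W)"
     using U(2) by (intro emeasure_leb_isodiametric[OF sW]) (auto intro: bounded_closure)
    then show ?thesis using U(2) False dimW by (simp add: hausdorff_gauge_def diameter_closure)
   qed simp
  qed auto
  finally show "1 \<le> (\<Sum>i. hausdorff_gauge d (U i))" .
 qed
 then show "1 \<le> hausdorff_outer d ?C"
  using hausdorff_content_le_outer[of 1 d ?C] by auto
qed

end

theorem hausdorff_measure_subspace:
 fixes W :: "'a::euclidean_space set"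
 assumes W: "subspace W" and A: "A \<in> sets borel" "A \<subseteq> W"
 shows "emeasure (hausdorff_measure (dim W)) A = emeasure (leb W) A"
proof -
 obtain b where b: "onb (dim W) b W" using onb_exists[OF W] .
 have "A \<inter> W = A" using A(2) by auto
 then show ?thesis
  using hausdorff_proportional_leb[OF b A(1)] hausdorff_outer_unit_frame_cube[OF b]
  by (simp add: emeasure_hausdorff_measure[OF A(1)])
qed

section \<open>Orthogonal decompositions\<close>

lemma frame_lborel_measurable_lincomb_add [measurable]:
 "(%p. lincomb d b (fst p) + snd p *\<^sub>R e) \<in> bmeas (lPi {..<d} \<Otimes>\<^sub>M lborel)"
 by measurable

lemma nn_integral_frame_lborel_0: "G \<in> bmeas borel ==> (INT+ x. G x wrt frame_lborel 0 b) = G 0"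
 by (simp add: nn_integral_frame_lborel PiM_empty nn_integral_count_space_finite lincomb_def)

lemma nn_integral_frame_lborel_Suc:
 assumes [measurable]: "G \<in> bmeas borel"
 shows "(INT+ x. G x wrt frame_lborel (Suc d) b) = (INT+ x. (INT+ t. G (x + t *\<^sub>R b d) wrt lborel) wrt frame_lborel d b)"
proof -
 interpret product_sigma_finite "%_. lborel :: real measure" by standard
 have "(INT+ x. G x wrt frame_lborel (Suc d) b) = (INT+ a. G (lincomb (Suc d) b a) wrt PiM (insert d {..<d}) (%_. lborel))"
  by (simp add: nn_integral_frame_lborel lessThan_Suc)
 also have "... = (INT+ a. (INT+ t. G (lincomb (Suc d) b (a(d := t))) wrt lborel) wrt lPi {..<d})"
  by (rule product_nn_integral_insert) (auto simp: lessThan_Suc[symmetric])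
 also have "... = (INT+ a. (INT+ t. G (lincomb d b a + t *\<^sub>R b d) wrt lborel) wrt lPi {..<d})"
  by (intro nn_integral_cong arg_cong[where f = G]) (simp add: lincomb_def)
 also have "... = (INT+ x. (INT+ t. G (x + t *\<^sub>R b d) wrt lborel) wrt frame_lborel d b)"
  by (rule nn_integral_frame_lborel[symmetric]) measurable
 finally show ?thesis .
qed

lemma frame_lborel_cong: "(\<And>i. i < d ==> b i = b' i) ==> frame_lborel d b = frame_lborel d b'"
 unfolding frame_lborel_def by (intro arg_cong[where f = "distr _ _"]) (auto simp: lincomb_def fun_eq_iff)

lemma nn_integral_frame_lborel_append:
 assumes "G \<in> bmeas borel" and b: "\<forall>i<k. \<forall>j<k. b i \<bullet> b j = (if i = j then 1 else 0)"
 shows "(INT+ x. G x wrt frame_lborel (d + k) (%i. if i < d then a i else b (i - d)))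
  = (INT+ x. (INT+ y. G (x + y) wrt frame_lborel k b) wrt frame_lborel d a)"
 using assms
proof (induction k arbitrary: G)
 case 0
 have "frame_lborel d (%i. if i < d then a i else b (i - d)) = frame_lborel d a"
  by (rule frame_lborel_cong) simp
 then show ?case using 0 by (simp add: nn_integral_frame_lborel_0)
next
 case (Suc k)
 note [measurable] = Suc.prems(1)
 let ?c = "%i. if i < d then a i else b (i - d)"
 have "(INT+ x. G x wrt frame_lborel (d + Suc k) ?c) = (INT+ x. (INT+ t. G (x + t *\<^sub>R b k) wrt lborel) wrt frame_lborel (d + k) ?c)"
  by (simp add: nn_integral_frame_lborel_Suc)
 also have "... = (INT+ x. (INT+ y. (INT+ t. G (x + y + t *\<^sub>R b k) wrt lborel) wrt frame_lborel k b) wrt frame_lborel d a)"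
  using Suc.prems(2) by (intro Suc.IH) auto
 also have "... = (INT+ x. (INT+ y. G (x + y) wrt frame_lborel (Suc k) b) wrt frame_lborel d a)"
  by (simp add: nn_integral_frame_lborel_Suc add.assoc)
 finally show ?case .
qed

lemma onb_append:
 assumes A: "onb d a A" and B: "onb k b B" and orth: "\<forall>x\<in>A. \<forall>y\<in>B. x \<bullet> y = 0"
 shows "onb (d + k) (%i. if i < d then a i else b (i - d)) (subspace_sum A B)"
 unfolding onb_def
proof (intro conjI allI impI)
 fix i j assume "i < d + k" "j < d + k"
 then show "(if i < d then a i else b (i - d)) \<bullet> (if j < d then a j else b (j - d)) = (if i = j then 1 else 0)"
  using onb_inner[OF A] onb_inner[OF B] orth onb_in[OF A] onb_in[OF B] by (auto simp: inner_commute)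
next
 let ?c = "%i. if i < d then a i else b (i - d)"
 have "?c ` {..<d+k} = a ` {..<d} \<union> b ` {..<k}"
 proof -
  have "b i \<in> ?c ` {..<d+k}" if "i < k" for i using that by (intro rev_image_eqI[of "d + i"]) auto
  then show ?thesis by force
 qed
 then have "span (?c ` {..<d+k}) = {x + y |x y. x \<in> A \<and> y \<in> B}"
  using A B span_Un[of "a ` {..<d}" "b ` {..<k}"] by (auto simp: onb_def)
 then show "span (?c ` {..<d+k}) = subspace_sum A B" by (simp add: subspace_sum_def)
qed

lemma
 assumes A: "subspace A" and B: "subspace B" and orth: "\<forall>x\<in>A. \<forall>y\<in>B. x \<bullet> y = 0"
 shows nn_integral_leb_sum: "G \<in> bmeas borel ==>
   (INT+ x. G x wrt leb (subspace_sum A B)) = (INT+ x. (INT+ y. G (x + y) wrt leb B) wrt leb A)"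
  and dim_subspace_sum: "dim (subspace_sum A B) = dim A + dim B"
  and subspace_subspace_sum: "subspace (subspace_sum A B)"
proof -
 obtain a b where a: "onb (dim A) a A" and b: "onb (dim B) b B" using onb_exists A B by metis
 note ab = onb_append[OF a b orth]
 show "dim (subspace_sum A B) = dim A + dim B" "subspace (subspace_sum A B)"
  using onb_dim[OF ab] onb_subspace[OF ab] by auto
 assume "G \<in> bmeas borel"
 then show "(INT+ x. G x wrt leb (subspace_sum A B)) = (INT+ x. (INT+ y. G (x + y) wrt leb B) wrt leb A)"
  unfolding leb_eq[OF ab] leb_eq[OF a] leb_eq[OF b]
  using b by (intro nn_integral_frame_lborel_append) (auto simp: onb_def)
qed

lemma leb_UNIV: "leb UNIV = (lborel :: 'a::euclidean_space measure)"
proof (rule measure_eqI)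
 fix A :: "'a set" assume "A \<in> sets (leb UNIV)"
 then have A: "A \<in> sets borel" by simp
 have "emeasure (lborel :: 'a measure) A * emeasure (leb UNIV) (cball 0 1 :: 'a set)
   = emeasure (leb UNIV) A * emeasure lborel (cball 0 1 :: 'a set)"
 proof (rule translation_invariant_proportional[where W = UNIV])
  fix w and G :: "'a => ennreal" assume G: "G \<in> bmeas borel"
  have "(INT+ x. G (x + w) wrt lborel) = (INT+ x. G x wrt distr lborel borel (%x. w + x))"
   using G by (simp add: nn_integral_distr add.commute)
  then show "(INT+ x. G (x + w) wrt lborel) = (INT+ x. G x wrt lborel)"
   using lborel_affine[of 1 w] by (simp add: density_1)
  show "(INT+ x. G (x + w) wrt leb UNIV) = (INT+ x. G x wrt leb UNIV)"
   using G by (intro leb_translate) auto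
  show "(INT+ x. G (- x) wrt leb UNIV) = (INT+ x. G x wrt leb UNIV)"
   using G by (intro leb_reflect) auto
 qed (use A in \<open>auto intro: sigma_finite_lborel sigma_finite_leb\<close>)
 moreover have "emeasure (leb UNIV) (cball 0 1 :: 'a set) = ennreal (unit_ball_vol DIM('a))"
  "emeasure lborel (cball 0 1 :: 'a set) = ennreal (unit_ball_vol DIM('a))"
  using emeasure_leb_cball[of "UNIV :: 'a set" 1] emeasure_cball[of 1 "0::'a"] by auto
 ultimately have "emeasure (lborel :: 'a measure) A = emeasure (leb UNIV) A \<or> unit_ball_vol DIM('a) \<le> 0"
  by (simp only: mult_right_ennreal_cancel)
 moreover have "0 < unit_ball_vol DIM('a)" by simp
 ultimately show "emeasure (leb UNIV) A = emeasure lborel A" by simp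
qed simp

lemma leb_isometry:
 assumes T: "orthogonal_transformation T" and W: "subspace W"
 shows "leb (T ` W) = distr (leb W) borel T"
proof -
 obtain b where b: "onb (dim W) b W" using onb_exists[OF W] .
 have lin: "linear T" using T by (rule orthogonal_transformation_linear)
 have m[measurable]: "T \<in> bmeas borel" using lin by (simp add: borel_measurable_continuous_onI linear_continuous_on linear_conv_bounded_linear)
 have Tb: "onb (dim W) (%i. T (b i)) (T ` W)"
  using b T lin by (auto simp: onb_def orthogonal_transformation_def linear_span_image image_image[symmetric, of T b])
 have "lincomb (dim W) (%i. T (b i)) = (%a. T (lincomb (dim W) b a))"
  using lin by (auto simp: lincomb_def linear_sum linear_scale)
 then show ?thesis
  unfolding leb_eq[OF b] leb_eq[OF Tb] frame_lborel_def by (subst distr_distr) (auto simp: comp_def)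
qed

text \<open>A point has diameter 0, so the isodiametric inequality makes it a null set in positive
  dimension.\<close>

lemma AE_leb_nonzero:
 assumes W: "subspace (W :: 'a::euclidean_space set)" and "0 < dim W"
 shows "AE x in leb W. x \<noteq> 0"
proof -
 have "emeasure (leb W) {0} \<le> ennreal (unit_ball_vol (dim W) * (diameter {0::'a} / 2) ^ dim W)"
  by (rule emeasure_leb_isodiametric[OF W]) auto
 also have "... = 0" using assms(2) by (simp add: zero_power)
 finally show ?thesis by (intro AE_I[of _ _ "{0}"]) auto
qed

text \<open>The orthogonal complement of \<open>V\<close> in \<open>W\<close> has positive
  dimension. In the Fubini decomposition along it only the slice over 0 meets \<open>V\<close>, and
  that point is null.\<close>

lemma leb_null_subspace:
 assumes W: "subspace W" and V: "subspace V" and "V \<subseteq> W" "dim V < dim W"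
 shows "emeasure (leb W) V = 0"
proof -
 let ?U = "{x \<in> W. \<forall>y\<in>V. x \<bullet> y = 0}"
 have U: "subspace ?U" using W by (auto simp: subspace_def inner_add_left)
 have Vm: "V \<in> sets borel" using V by (simp add: closed_subspace borel_closed)
 have sum: "subspace_sum ?U V = W"
 proof (intro equalityI subsetI)
  fix x assume "x \<in> subspace_sum ?U V"
  then show "x \<in> W" using assms(3) W by (auto simp: subspace_sum_def intro: subspace_add)
 next
  fix x assume x: "x \<in> W"
  obtain y z where yz: "y \<in> span V" "\<And>w. w \<in> span V ==> orthogonal z w" "x = y + z"
   using orthogonal_subspace_decomp_exists[of V x] by metis
  have y: "y \<in> V" using yz(1) V by (simp add: span_eq_iff[THEN iffD2])
  then have "z \<in> W" using yz(3) x assms(3) W subspace_diff[of W x y] by auto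
  then have "z \<in> ?U" using yz(2) by (auto simp: orthogonal_def span_base)
  then show "x \<in> subspace_sum ?U V" using y yz(3) unfolding subspace_sum_def mem_Collect_eq by - (rule exI[of _ z], rule exI[of _ y], auto)
 qed
 have orth: "\<forall>x\<in>?U. \<forall>y\<in>V. x \<bullet> y = 0" by auto
 have dU: "0 < dim ?U" using dim_subspace_sum[OF U V orth] sum assms(4) by simp
 have "emeasure (leb W) V = (INT+ x. (INT+ y. indicator V (x + y) wrt leb V) wrt leb ?U)"
  using nn_integral_leb_sum[OF U V orth, of "indicator V"] Vm sum by simp
 also have "... = 0"
 proof -
  have nz: "AE x in leb ?U. x \<noteq> 0" by (rule AE_leb_nonzero[OF U dU])
  have "AE x in leb ?U. (INT+ y. indicator V (x + y) wrt leb V) = 0"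
   using nz AE_leb_in[OF U]
  proof eventually_elim
   case (elim x)
   have "x \<notin> V"
   proof
    assume "x \<in> V"
    then have "x \<bullet> x = 0" using elim(2) by blast
    then show False using elim(1) by simp
   qed
   then have "x + y \<notin> V" if "y \<in> V" for y using subspace_diff[OF V, of "x + y" y] that by auto
   then have "(INT+ y. indicator V (x + y) wrt leb V) = (INT+ y. 0 wrt leb V :: ennreal)"
    by (intro nn_integral_cong_AE) (use AE_leb_in[OF V] in eventually_elim, auto)
   then show ?case by simp
  qed
  then show ?thesis by (subst nn_integral_cong_AE[where v = "%_. 0"]) auto
 qed
 finally show ?thesis .
qed

section \<open>The surface measure of the unit sphere\<close>

text \<open>The cone measure: \<open>dim W\<close> times the volume of the part of the unit ball
  that lies in the cone over a set of directions. The factor is the ratio of surface to volume; the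
  origin, which has no direction, is removed.\<close>

definition cone_measure :: "'a::euclidean_space set => 'a measure" where
 "cone_measure W = distr (density (leb W) (%x. ennreal (dim W) * indicator (cball 0 1 - {0}) x)) borel (%x. x /\<^sub>R norm x)"

lemma sets_cone_measure [simp, measurable_cong]: "sets (cone_measure W) = sets borel"
 by (simp add: cone_measure_def)

lemma space_cone_measure [simp]: "space (cone_measure W) = UNIV"
 by (simp add: cone_measure_def)

lemma punctured_ball_sets [measurable]: "cball (0::'a::euclidean_space) 1 - {0} \<in> sets borel"
 by auto

lemma nn_integral_cone_measure:
 assumes [measurable]: "G \<in> bmeas borel"
 shows "(INT+ u. G u wrt cone_measure W) = ennreal (dim W) * (INT+ x. G (x /\<^sub>R norm x) * indicator (cball 0 1 - {0}) x wrt leb W)"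
proof -
 have "(INT+ u. G u wrt cone_measure W) = (INT+ x. ennreal (dim W) * (G (x /\<^sub>R norm x) * indicator (cball 0 1 - {0}) x) wrt leb W)"
  unfolding cone_measure_def
  by (subst nn_integral_distr, measurable, subst nn_integral_density) (measurable, simp add: mult_ac)
 also have "... = ennreal (dim W) * (INT+ x. G (x /\<^sub>R norm x) * indicator (cball 0 1 - {0}) x wrt leb W)"
  by (rule nn_integral_cmult) measurable
 finally show ?thesis .
qed

lemma emeasure_cone_measure:
 assumes [measurable]: "A \<in> sets borel"
 shows "emeasure (cone_measure W) A = ennreal (dim W) * emeasure (leb W) {x. x \<noteq> 0 \<and> norm x \<le> 1 \<and> x /\<^sub>R norm x \<in> A}"
proof -
 let ?C = "{x. x \<noteq> 0 \<and> norm x \<le> 1 \<and> x /\<^sub>R norm x \<in> A}"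
 have m: "?C \<in> sets borel" by measurable
 have "emeasure (cone_measure W) A = (INT+ u. indicator A u wrt cone_measure W)" by simp
 also have "... = ennreal (dim W) * (INT+ x. indicator ?C x wrt leb W)"
 proof -
  have "(INT+ x. indicator A (x /\<^sub>R norm x) * indicator (cball 0 1 - {0}) x wrt leb W) = (INT+ x. indicator ?C x wrt leb W)"
   by (intro nn_integral_cong) (auto simp: indicator_def)
  then show ?thesis using nn_integral_cone_measure[of "indicator A" W] by simp
 qed
 also have "(INT+ x. indicator ?C x wrt leb W) = emeasure (leb W) ?C"
  using m by (intro nn_integral_indicator) simp
 finally show ?thesis .
qed

lemma emeasure_cone_measure_UNIV:
 assumes W: "subspace W"
 shows "emeasure (cone_measure W) UNIV \<le> ennreal (dim W * unit_ball_vol (dim W))"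
proof -
 have "emeasure (cone_measure W) UNIV \<le> ennreal (dim W) * emeasure (leb W) (cball 0 1)"
  by (subst emeasure_cone_measure) (auto intro!: mult_left_mono emeasure_mono)
 also have "... = ennreal (dim W * unit_ball_vol (dim W))"
  by (subst emeasure_leb_cball[OF W]) (auto simp: ennreal_mult')
 finally show ?thesis .
qed

lemma unit_sphere_sets [measurable]: "subspace W ==> unit_sphere W \<in> sets borel"
proof -
 assume "subspace W"
 then have "closed (W \<inter> sphere 0 1)" by (intro closed_Int closed_subspace closed_sphere)
 moreover have "unit_sphere W = W \<inter> sphere 0 1" by (auto simp: unit_sphere_def)
 ultimately show ?thesis by (simp add: borel_closed)
qed

lemma AE_cone_measure_in:
 assumes W: "subspace W"
 shows "AE x in cone_measure W. x \<in> unit_sphere W"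
 unfolding cone_measure_def
proof (subst AE_distr_iff)
 show "{x \<in> space borel. x \<in> unit_sphere W} \<in> sets borel" using unit_sphere_sets[OF W] by simp
 show "AE x in density (leb W) (%x. ennreal (real (dim W)) * indicator (cball 0 1 - {0}) x). x /\<^sub>R norm x \<in> unit_sphere W"
  using AE_leb_in[OF W] W by (subst AE_density) (auto simp: unit_sphere_def indicator_def subspace_scale)
qed simp

text \<open>With \<open>c\<close> the cosine of the angle, the squared distance before normalising
  exceeds the one after it by
  \<open>(al - \<beta>)\<^sup>2 + 2 * (1 - c) * (al * \<beta> - 1)\<close>, and both norms are at
  least 1.\<close>

lemma normalize_nonexpansive:
 fixes a b :: "'a::real_inner"
 assumes "1 \<le> norm a" "1 \<le> norm b"
 shows "dist (a /\<^sub>R norm a) (b /\<^sub>R norm b) \<le> dist a b"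
proof -
 define al \<beta> c where "al = norm a" and "\<beta> = norm b" and "c = a \<bullet> b / (al * \<beta>)"
 have pos: "1 \<le> al" "1 \<le> \<beta>" using assms by (auto simp: al_def \<beta>_def)
 have ab: "a \<bullet> b = al * \<beta> * c" using pos by (simp add: c_def)
 have "a \<bullet> b \<le> al * \<beta>" unfolding al_def \<beta>_def by (rule norm_cauchy_schwarz)
 then have c: "c \<le> 1" using pos by (simp add: c_def divide_le_eq)
 have n: "(norm (x - y))\<^sup>2 = (norm x)\<^sup>2 + (norm y)\<^sup>2 - 2 * (x \<bullet> y)" for x y :: 'a
  by (simp add: power2_norm_eq_inner inner_diff inner_commute)
 have "(norm (a /\<^sub>R al - b /\<^sub>R \<beta>))\<^sup>2 = 2 - 2 * c"
  unfolding n using pos by (simp add: c_def al_def[symmetric] \<beta>_def[symmetric] divide_simps)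
 moreover have "(norm (a - b))\<^sup>2 = (2 - 2 * c) + ((al - \<beta>)\<^sup>2 + 2 * (1 - c) * (al * \<beta> - 1))"
  unfolding n ab al_def[symmetric] \<beta>_def[symmetric] by (simp add: power2_eq_square algebra_simps)
 moreover have "0 \<le> (al - \<beta>)\<^sup>2 + 2 * (1 - c) * (al * \<beta> - 1)"
  using pos c mult_mono[of 1 al 1 \<beta>] by simp
 ultimately have "(norm (a /\<^sub>R al - b /\<^sub>R \<beta>))\<^sup>2 \<le> (norm (a - b))\<^sup>2" by simp
 then show ?thesis unfolding dist_norm al_def \<beta>_def by (rule power2_le_imp_le) simp
qed

text \<open>Central projection of a small cap onto the tangent hyperplane at its centre. What
  matters is that the constant tends to 1 as the cap shrinks.\<close>

lemma gnomonic_lipschitz: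
 fixes x y p :: "'a::real_inner"
 assumes u: "norm x = 1" "norm y = 1" "norm p = 1" and \<eta>: "\<eta> < 1" "0 \<le> \<eta>"
  and cap: "1 - \<eta> \<le> x \<bullet> p" "1 - \<eta> \<le> y \<bullet> p"
 shows "dist (x /\<^sub>R (x \<bullet> p) - p) (y /\<^sub>R (y \<bullet> p) - p) \<le> (1 / (1 - \<eta>) + sqrt (2 * \<eta>) / (1 - \<eta>)\<^sup>2) * dist x y"
proof -
 define al \<beta> where "al = x \<bullet> p" and "\<beta> = y \<bullet> p"
 have pos: "0 < 1 - \<eta>" "0 < al" "0 < \<beta>" "1 - \<eta> \<le> al" "1 - \<eta> \<le> \<beta>" using cap \<eta> by (auto simp: al_def \<beta>_def)
 have near: "norm (p - v) \<le> sqrt (2 * \<eta>)" if "norm v = 1" "1 - \<eta> \<le> v \<bullet> p" for v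
 proof (rule real_le_rsqrt)
  show "(norm (p - v))\<^sup>2 \<le> 2 * \<eta>"
   using that u(3) by (simp add: power2_norm_eq_inner inner_diff inner_commute norm_eq_1)
 qed
 \<comment> \<open>Since unit vectors have \<open>x - y\<close> orthogonal to \<open>x + y\<close>,
   the vector \<open>p\<close> in \<open>(x - y) \<bullet> p\<close> may be replaced by
   \<open>p\<close> minus the midpoint of \<open>x\<close> and \<open>y\<close>, which is short
   inside the cap. This gives the small factor \<open>sqrt (2 * \<eta>)\<close>.\<close>
 have "(x - y) \<bullet> (x + y) = 0" using u by (simp add: inner_add_right inner_diff_left inner_commute[of y x] norm_eq_1)
 then have "\<beta> - al = - ((x - y) \<bullet> ((1/2) *\<^sub>R ((p - x) + (p - y))))"
  by (simp add: al_def \<beta>_def inner_add_right inner_diff_left inner_diff_right algebra_simps)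
 then have "\<bar>\<beta> - al\<bar> \<le> norm (x - y) * norm ((1/2) *\<^sub>R ((p - x) + (p - y)))"
  using Cauchy_Schwarz_ineq2[of "x - y" "(1/2) *\<^sub>R ((p - x) + (p - y))"] by simp
 also have "... \<le> norm (x - y) * sqrt (2 * \<eta>)"
 proof (intro mult_left_mono)
  have "norm ((p - x) + (p - y)) \<le> sqrt (2 * \<eta>) + sqrt (2 * \<eta>)"
   by (rule norm_triangle_le[OF add_mono]) (use near cap u in auto)
  then show "norm ((1/2) *\<^sub>R ((p - x) + (p - y))) \<le> sqrt (2 * \<eta>)" by simp
 qed simp
 finally have ba: "\<bar>\<beta> - al\<bar> \<le> norm (x - y) * sqrt (2 * \<eta>)" .
 have "x /\<^sub>R al - y /\<^sub>R \<beta> = (x - y) /\<^sub>R al + ((\<beta> - al) / (al * \<beta>)) *\<^sub>R y"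
 proof -
  have "(\<beta> - al) / (al * \<beta>) = inverse al - inverse \<beta>" using pos by (simp add: field_simps)
  then show ?thesis by (simp add: scaleR_diff_left scaleR_diff_right)
 qed
 then have "norm (x /\<^sub>R al - y /\<^sub>R \<beta>) \<le> norm ((x - y) /\<^sub>R al) + norm (((\<beta> - al) / (al * \<beta>)) *\<^sub>R y)"
  by (simp only: norm_triangle_ineq)
 also have "... = norm (x - y) / al + \<bar>\<beta> - al\<bar> / (al * \<beta>)" 
 proof -
  have "\<bar>(\<beta> - al) / (al * \<beta>)\<bar> = \<bar>\<beta> - al\<bar> / (al * \<beta>)" using pos by (simp add: abs_divide abs_mult)
  moreover have "norm ((x - y) /\<^sub>R al) = norm (x - y) / al" using pos by (simp add: divide_inverse mult.commute)
  ultimately show ?thesis using u by simp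
 qed
 also have "... \<le> norm (x - y) / (1 - \<eta>) + (norm (x - y) * sqrt (2 * \<eta>)) / (1 - \<eta>)\<^sup>2"
  unfolding power2_eq_square using pos ba \<eta> by (intro add_mono frac_le mult_mono) auto
 also have "... = (1 / (1 - \<eta>) + sqrt (2 * \<eta>) / (1 - \<eta>)\<^sup>2) * norm (x - y)" by (simp add: algebra_simps)
 finally show ?thesis by (simp add: dist_norm al_def \<beta>_def)
qed

text \<open>The cap \<open>U\<close> is flattened to a set \<open>V\<close> in the tangent space at
  \<open>p\<close>. The flattening and its inverse have Lipschitz constants \<open>K\<close> and 1,
  and in the tangent space Hausdorff measure is Lebesgue measure. The latter is \<open>dim W\<close>
  times the volume of the cone with flat base \<open>p + V\<close>, which lies between the round
  cone over \<open>U\<close> and its dilate by \<open>1 / (1 - \<eta>)\<close>.\<close>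

lemma hausdorff_vs_cone_measure_cap:
 fixes W :: "'a::euclidean_space set"
 assumes W: "subspace W" and p: "p \<in> unit_sphere W" and \<eta>: "0 \<le> \<eta>" "\<eta> < 1"
  and U: "U \<in> sets borel" "U \<subseteq> unit_sphere W" "\<And>x. x \<in> U ==> 1 - \<eta> \<le> x \<bullet> p"
 defines "K \<equiv> 1 / (1 - \<eta>) + sqrt (2 * \<eta>) / (1 - \<eta>)\<^sup>2"
 shows "emeasure (hausdorff_measure (dim W - 1)) U \<le> ennreal ((1 / (1 - \<eta>)) ^ dim W) * emeasure (cone_measure W) U"
  and "emeasure (cone_measure W) U \<le> ennreal (K ^ (dim W - 1)) * emeasure (hausdorff_measure (dim W - 1)) U"
proof -
 define D where "D = dim W"
 let ?T = "{x \<in> W. x \<bullet> p = 0}"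
 have pn: "norm p = 1" "p \<bullet> p = 1" "p \<in> W" using p by (auto simp: unit_sphere_def norm_eq_1)
 have T: "subspace ?T" using W by (auto simp: subspace_def inner_add_left)
 have p1: "onb 1 (%_. p) (span {p})" using pn by (simp add: onb_def lessThan_Suc)
 obtain bT where bT: "onb (dim ?T) bT ?T" using onb_exists[OF T] .
 have orth: "\<forall>x\<in>?T. \<forall>y\<in>span {p}. x \<bullet> y = 0" by (auto simp: span_singleton)
 have sum: "subspace_sum ?T (span {p}) = W"
 proof (intro equalityI subsetI)
  fix x assume "x \<in> subspace_sum ?T (span {p})"
  then show "x \<in> W" using W pn by (auto simp: subspace_sum_def span_singleton intro: subspace_add subspace_scale)
 next
  fix x assume x: "x \<in> W"
  have "x - (x \<bullet> p) *\<^sub>R p \<in> ?T" using x W pn by (auto simp: inner_diff_left intro!: subspace_diff subspace_scale)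
  moreover have "(x \<bullet> p) *\<^sub>R p \<in> span {p}" by (auto simp: span_singleton)
  moreover have "x = (x - (x \<bullet> p) *\<^sub>R p) + (x \<bullet> p) *\<^sub>R p" by simp
  ultimately show "x \<in> subspace_sum ?T (span {p})" unfolding subspace_sum_def by blast
 qed
 have dT: "D = Suc (dim ?T)"
  using dim_subspace_sum[OF T _ orth] sum onb_dim[OF p1] by (simp add: D_def)
 have D1: "dim W - 1 = dim ?T" "dim W = D" using dT by (auto simp: D_def)
 have slice: "(INT+ x. G x wrt leb W) = (INT+ y. (INT+ t. G (y + t *\<^sub>R p) wrt lborel) wrt leb ?T)"
  if [measurable]: "G \<in> bmeas borel" for G
 proof -
  have "(INT+ y. H y wrt leb (span {p})) = (INT+ t. H (t *\<^sub>R p) wrt lborel)" if [measurable]: "H \<in> bmeas borel" for H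
  proof -
   have "(INT+ y. H y wrt leb (span {p})) = (INT+ y. H y wrt frame_lborel (Suc 0) (%_. p))"
    using leb_eq[OF p1] by simp
   also have "... = (INT+ t. H (0 + t *\<^sub>R p) wrt lborel)"
    by (subst nn_integral_frame_lborel_Suc, measurable, subst nn_integral_frame_lborel_0) measurable
   finally show ?thesis by simp
  qed
  then show ?thesis using nn_integral_leb_sum[OF T _ orth that] unfolding sum by simp
 qed
 have [measurable]: "?T \<in> sets borel" "U \<in> sets borel" using T U by (auto simp: closed_subspace borel_closed)
 define P where "P = (%x. x /\<^sub>R (x \<bullet> p) - p)"
 define \<rho> where "\<rho> = (%y. (p + y) /\<^sub>R norm (p + y))"
 have [measurable]: "\<rho> \<in> bmeas borel" unfolding \<rho>_def by measurable
 define V where "V = ?T \<inter> {y. \<rho> y \<in> U}"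
 have Vm[measurable]: "V \<in> sets borel" unfolding V_def by measurable
 have pT: "norm (p + y) \<ge> 1" "(p + y) \<bullet> p = 1" if "y \<in> ?T" for y
 proof -
  show "(p + y) \<bullet> p = 1" using that pn by (simp add: inner_add_left)
  then show "norm (p + y) \<ge> 1" using Cauchy_Schwarz_ineq2[of "p + y" p] pn by simp
 qed
 have cap: "norm x = 1" "x \<in> W" "0 < x \<bullet> p" "x \<bullet> p \<le> 1" "1 - \<eta> \<le> x \<bullet> p" if "x \<in> U" for x
 proof -
  show x: "norm x = 1" "x \<in> W" using that U(2) by (auto simp: unit_sphere_def)
  show "1 - \<eta> \<le> x \<bullet> p" using U(3) that by auto
  then show "0 < x \<bullet> p" using \<eta> by linarith
  show "x \<bullet> p \<le> 1" using norm_cauchy_schwarz[of x p] x pn by simp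
 qed
 have PV: "P x \<in> V" "\<rho> (P x) = x" if "x \<in> U" for x
 proof -
  note c = cap[OF that]
  have "P x \<in> ?T" using c pn W by (auto simp: P_def inner_diff_left intro!: subspace_diff subspace_scale)
  moreover have "p + P x = x /\<^sub>R (x \<bullet> p)" by (simp add: P_def)
  then show "\<rho> (P x) = x" using c by (simp add: \<rho>_def)
  ultimately show "P x \<in> V" using that by (simp add: V_def)
 qed
 have VP: "\<rho> y \<in> U" "P (\<rho> y) = y" if "y \<in> V" for y
 proof -
  show "\<rho> y \<in> U" using that by (simp add: V_def)
  have y: "y \<in> ?T" using that by (simp add: V_def)
  have "\<rho> y \<bullet> p = 1 / norm (p + y)" using pT(2)[OF y] by (simp add: \<rho>_def divide_inverse)
  moreover have "norm (p + y) \<noteq> 0" using pT(1)[OF y] by linarith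
  ultimately have "\<rho> y /\<^sub>R (\<rho> y \<bullet> p) = norm (p + y) *\<^sub>R ((p + y) /\<^sub>R norm (p + y))"
   by (simp add: \<rho>_def)
  also have "... = p + y"
   using right_inverse[OF \<open>norm (p + y) \<noteq> 0\<close>] by (simp only: scaleR_scaleR scaleR_one)
  finally have "\<rho> y /\<^sub>R (\<rho> y \<bullet> p) = p + y" .
  then show "P (\<rho> y) = y" by (simp add: P_def)
 qed
 have UV: "U = \<rho> ` V" and VU: "V = P ` U" using PV VP by (auto simp: image_iff) metis+
 have HV: "hausdorff_outer (dim ?T) V = emeasure (leb ?T) V"
  using hausdorff_measure_subspace[OF T Vm] by (simp add: emeasure_hausdorff_measure V_def)
 have HU: "emeasure (hausdorff_measure (dim ?T)) U = hausdorff_outer (dim ?T) U"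
  using U by (simp add: emeasure_hausdorff_measure)
 have H1: "hausdorff_outer (dim ?T) U \<le> hausdorff_outer (dim ?T) V"
  unfolding UV
 proof (rule hausdorff_outer_isometry_le)
  fix x y assume "x \<in> V" "y \<in> V"
  then have "1 \<le> norm (p + x)" "1 \<le> norm (p + y)" using pT(1) by (auto simp: V_def)
  from normalize_nonexpansive[OF this] show "dist (\<rho> x) (\<rho> y) \<le> dist x y"
   by (simp add: \<rho>_def dist_norm)
 qed
 have K: "0 < K" using \<eta> unfolding K_def by (intro add_pos_nonneg) auto
 have H2: "hausdorff_outer (dim ?T) V \<le> ennreal (K ^ dim ?T) * hausdorff_outer (dim ?T) U"
  unfolding VU
 proof (rule hausdorff_outer_lipschitz_image[OF K])
  fix x y assume "x \<in> U" "y \<in> U"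
  then show "dist (P x) (P y) \<le> K * dist x y"
   unfolding P_def K_def using cap pn \<eta> by (intro gnomonic_lipschitz) auto
 qed
 \<comment> \<open>The cone with apex 0, apex removed, over the flat base \<open>p + V\<close> at
   height 1, where the height is \<open>x \<bullet> p\<close>.\<close>
 define R where "R = {x. 0 < x \<bullet> p \<and> x \<bullet> p \<le> 1 \<and> x /\<^sub>R (x \<bullet> p) - p \<in> V}"
 have Rm[measurable]: "R \<in> sets borel" unfolding R_def by measurable
 \<comment> \<open>The slice at height \<open>t\<close> is \<open>V\<close> scaled by
   \<open>t\<close>; integrating \<open>t ^ (D - 1)\<close> over the unit interval gives the factor
   \<open>1 / D\<close>.\<close>
 have volR: "ennreal D * emeasure (leb W) R = emeasure (leb ?T) V"
 proof -
  interpret T: sigma_finite_measure "leb ?T" by (rule sigma_finite_leb[OF T])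
  interpret TT: pair_sigma_finite "lborel :: real measure" "leb ?T" ..
  have "emeasure (leb W) R = (INT+ y. (INT+ t. indicator R (y + t *\<^sub>R p) wrt lborel) wrt leb ?T)"
   using slice[of "indicator R"] by simp
  also have "... = (INT+ t. (INT+ y. indicator R (y + t *\<^sub>R p) wrt leb ?T) wrt lborel)"
   by (rule TT.Fubini') measurable
  also have "... = (INT+ t. ennreal (t ^ dim ?T) * indicator {0<..1} t * emeasure (leb ?T) V wrt lborel)"
  proof (rule nn_integral_cong)
   fix t :: real
   have "(INT+ y. indicator R (y + t *\<^sub>R p) wrt leb ?T) = (INT+ y. indicator {0<..1} t * indicator V (y /\<^sub>R t) wrt leb ?T)"
   proof (rule nn_integral_cong_AE, use AE_leb_in[OF T] in eventually_elim)
    case (elim y)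
    then have "(y + t *\<^sub>R p) \<bullet> p = t" using pn by (simp add: inner_add_left)
    then show ?case by (auto simp: R_def indicator_def scaleR_add_right)
   qed
   also have "... = indicator {0<..1} t * (INT+ y. indicator V (y /\<^sub>R t) wrt leb ?T)"
    by (rule nn_integral_cmult) measurable
   also have "... = ennreal (t ^ dim ?T) * indicator {0<..1} t * emeasure (leb ?T) V"
   proof (cases "t \<in> {0<..1}")
    case True
    then have t: "0 < t" by simp
    have "(INT+ y. indicator V (y /\<^sub>R t) wrt leb ?T) = ennreal (\<bar>t\<bar> ^ dim ?T) * (INT+ y. indicator V ((0 + t *\<^sub>R y) /\<^sub>R t) wrt leb ?T)"
     using t subspace_0[OF T] by (intro nn_integral_leb_affine[OF T]) auto
    then show ?thesis using t True by simp
   qed simp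
   finally show "(INT+ y. indicator R (y + t *\<^sub>R p) wrt leb ?T) = ennreal (t ^ dim ?T) * indicator {0<..1} t * emeasure (leb ?T) V" .
  qed
  also have "... = (INT+ t. ennreal (t ^ dim ?T) * indicator {0..1} t * emeasure (leb ?T) V wrt lborel)"
   by (intro nn_integral_cong_AE AE_I[of _ _ "{0::real}"]) (auto simp: indicator_def)
  also have "... = (INT+ t. ennreal (t ^ dim ?T) * indicator {0..1} t wrt lborel) * emeasure (leb ?T) V"
   by (rule nn_integral_multc) measurable
  also have "(INT+ t. ennreal (t ^ dim ?T) * indicator {0..1} t wrt lborel) = ennreal (1 ^ D / D - 0 ^ D / D)"
  proof (rule nn_integral_FTC_Icc[where F = "%t. t ^ D / D"])
   fix t :: real
   show "((%t. t ^ D / D) has_real_derivative t ^ dim ?T) (at t)"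
    using DERIV_cdivide[OF DERIV_pow[of D t], of "real D"] dT by simp
  qed auto
  finally have "emeasure (leb W) R = ennreal (1 / D) * emeasure (leb ?T) V"
   by (simp add: dT)
  moreover have "ennreal D * ennreal (1 / D) = 1"
   using dT by (subst ennreal_mult'[symmetric]) auto
  ultimately show ?thesis by (simp only: mult.assoc[symmetric] mult_1)
 qed
 let ?C = "{x. x \<noteq> 0 \<and> norm x \<le> 1 \<and> x /\<^sub>R norm x \<in> U}"
 have Cm[measurable]: "?C \<in> sets borel" by measurable
 have CR: "?C \<subseteq> R"
 proof
  fix x assume x: "x \<in> ?C"
  define u where "u = x /\<^sub>R norm x"
  have u: "u \<in> U" "x = norm x *\<^sub>R u" using x by (auto simp: u_def)
  have xp: "x \<bullet> p = norm x * (u \<bullet> p)" by (subst u(2)) simp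
  have "x /\<^sub>R (x \<bullet> p) - p = P u"
   using x cap(3)[OF u(1)] unfolding xp P_def by (subst u(2)) simp
  moreover have "norm x * (u \<bullet> p) \<le> 1 * 1" using x cap[OF u(1)] by (intro mult_mono) auto
  ultimately show "x \<in> R" using PV(1)[OF u(1)] x cap(3)[OF u(1)] by (simp add: R_def xp)
 qed
 \<comment> \<open>Over the cap the height \<open>x \<bullet> p\<close> is at least
   \<open>(1 - \<eta>) * norm x\<close>, so shrinking by \<open>1 - \<eta>\<close> brings the flat
   cone into the unit ball.\<close>
 have RC: "(1 - \<eta>) *\<^sub>R x \<in> ?C" if "x \<in> R" for x
 proof -
  have x: "0 < x \<bullet> p" "x \<bullet> p \<le> 1" "x /\<^sub>R (x \<bullet> p) - p \<in> V" using that by (auto simp: R_def)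
  then have "x \<noteq> 0" by auto
  have "\<rho> (x /\<^sub>R (x \<bullet> p) - p) = x /\<^sub>R norm x" using x by (simp add: \<rho>_def)
  then have u: "x /\<^sub>R norm x \<in> U" using VP(1)[OF x(3)] by simp
  have "1 - \<eta> \<le> (x /\<^sub>R norm x) \<bullet> p" by (rule cap(5)[OF u])
  then have "(1 - \<eta>) * norm x \<le> x \<bullet> p" using \<open>x \<noteq> 0\<close> by (simp add: field_simps)
  then have "norm ((1 - \<eta>) *\<^sub>R x) \<le> 1" using x(2) \<eta> by simp
  moreover have "((1 - \<eta>) *\<^sub>R x) /\<^sub>R norm ((1 - \<eta>) *\<^sub>R x) = x /\<^sub>R norm x"
  proof -
   have "norm ((1 - \<eta>) *\<^sub>R x) = (1 - \<eta>) * norm x" using \<eta> by simp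
   moreover have "inverse ((1 - \<eta>) * norm x) * (1 - \<eta>) = inverse (norm x)"
    using \<eta> by (simp add: inverse_mult_distrib)
   ultimately show ?thesis by (simp only: scaleR_scaleR)
  qed
  moreover have "(1 - \<eta>) *\<^sub>R x \<noteq> 0" using \<eta> \<open>x \<noteq> 0\<close> by simp
  ultimately show ?thesis using u by (simp only: mem_Collect_eq) simp
 qed
 have "emeasure (leb W) R \<le> ennreal ((1 / (1 - \<eta>)) ^ D) * emeasure (leb W) ?C"
 proof -
  have "emeasure (leb W) R = (INT+ x. indicator R x wrt leb W)" by simp
  also have "... \<le> (INT+ x. indicator ?C ((1 - \<eta>) *\<^sub>R x) wrt leb W)"
   using RC by (intro nn_integral_mono) (auto simp: indicator_def)
  also have "... = ennreal (\<bar>1 / (1 - \<eta>)\<bar> ^ dim W) * (INT+ x. indicator ?C ((1 - \<eta>) *\<^sub>R (0 + (1 / (1 - \<eta>)) *\<^sub>R x)) wrt leb W)"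
   using \<eta> subspace_0[OF W] by (intro nn_integral_leb_affine[OF W]) auto
  finally show ?thesis using \<eta> by (simp add: D_def)
 qed
 then have "emeasure (leb ?T) V \<le> ennreal D * (ennreal ((1 / (1 - \<eta>)) ^ D) * emeasure (leb W) ?C)"
  unfolding volR[symmetric] by (intro mult_left_mono) auto
 also have "... = ennreal ((1 / (1 - \<eta>)) ^ D) * emeasure (cone_measure W) U"
  by (simp add: emeasure_cone_measure D_def mult.left_commute)
 finally have "emeasure (leb ?T) V \<le> ennreal ((1 / (1 - \<eta>)) ^ D) * emeasure (cone_measure W) U" .
 then show "emeasure (hausdorff_measure (dim W - 1)) U \<le> ennreal ((1 / (1 - \<eta>)) ^ dim W) * emeasure (cone_measure W) U"
  using H1 unfolding D1(1) HU HV D_def by (rule order_trans[rotated])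
 have "emeasure (cone_measure W) U = ennreal D * emeasure (leb W) ?C" by (simp add: emeasure_cone_measure D_def)
 also have "... \<le> ennreal D * emeasure (leb W) R" by (intro mult_left_mono emeasure_mono CR) auto
 also have "... \<le> ennreal (K ^ dim ?T) * hausdorff_outer (dim ?T) U" using H2 unfolding volR HV .
 finally show "emeasure (cone_measure W) U \<le> ennreal (K ^ (dim W - 1)) * emeasure (hausdorff_measure (dim W - 1)) U"
  unfolding D1(1) HU .
qed

text \<open>By compactness finitely many caps cover \<open>S\<close>; the set is cut into disjoint
  pieces, each inside one cap, and the local inequalities are added.\<close>

lemma emeasure_le_cmult_by_caps:
 fixes S :: "'a::euclidean_space set" and \<mu> \<nu> :: "'a measure"
 assumes sets: "sets \<mu> = sets borel" "sets \<nu> = sets borel" and "compact S" and \<eta>: "0 < \<eta>" and S1: "\<And>x. x \<in> S ==> norm x = 1"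
  and local: "\<And>p U. p \<in> S ==> U \<in> sets borel ==> U \<subseteq> S ==> (\<And>x. x \<in> U ==> 1 - \<eta> \<le> x \<bullet> p) ==> emeasure \<mu> U \<le> c * emeasure \<nu> U"
  and A: "A \<in> sets borel" "A \<subseteq> S"
 shows "emeasure \<mu> A \<le> c * emeasure \<nu> A"
proof (cases "S = {}")
 case True
 then show ?thesis using A by simp
next
 case False
 have [simp]: "compact S" by fact
 have cov: "S \<subseteq> (\<Union>p\<in>S. {x. 1 - \<eta> < x \<bullet> p})"
 proof
  fix x assume "x \<in> S"
  moreover from this have "x \<bullet> x = 1" using S1 by (simp add: norm_eq_1)
  ultimately show "x \<in> (\<Union>p\<in>S. {x. 1 - \<eta> < x \<bullet> p})" using \<eta> by (intro UN_I[of x]) auto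
 qed
 have op: "open {x. 1 - \<eta> < x \<bullet> p}" for p :: 'a by (intro open_Collect_less continuous_intros)
 obtain F where F: "F \<subseteq> S" "finite F" "S \<subseteq> (\<Union>p\<in>F. {x. 1 - \<eta> < x \<bullet> p})"
 proof (rule compactE_image[OF \<open>compact S\<close> _ cov])
  show "open {x. 1 - \<eta> < x \<bullet> p}" for p :: 'a by (rule op)
 qed (rule that)
 then have F0: "F \<noteq> {}" using False by auto
 \<comment> \<open>The finitely many centres are enumerated by all naturals, with repetitions;
   \<open>disjointed\<close> makes the repeated caps empty.\<close>
 define p where "p = from_nat_into F"
 have p: "range p = F" unfolding p_def using F0 F(2) by (intro range_from_nat_into) (auto intro: countable_finite)
 define B where "B k = A \<inter> {x. 1 - \<eta> < x \<bullet> p k}" for k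
 have B: "B k \<in> sets borel" for k
  unfolding B_def using A(1) by (intro sets.Int) (auto intro!: borel_open open_Collect_less continuous_intros)
 have UB: "(\<Union>k. disjointed B k) = A"
 proof -
  have "x \<in> (\<Union>k. B k)" if "x \<in> A" for x
  proof -
   have "x \<in> (\<Union>p\<in>range p. {x. 1 - \<eta> < x \<bullet> p})" using that A(2) F(3) unfolding p by blast
   then show ?thesis using that by (auto simp: B_def)
  qed
  then have "(\<Union>k. B k) = A" by (auto simp: B_def)
  then show ?thesis by (simp add: UN_disjointed_eq)
 qed
 have dB: "disjointed B k \<in> sets borel" for k
  using sets.range_disjointed_sets[of B borel] B by (auto simp: image_subset_iff)
 have "emeasure \<mu> A = (\<Sum>k. emeasure \<mu> (disjointed B k))"
  using dB sets unfolding UB[symmetric] by (intro suminf_emeasure[symmetric]) (auto simp: disjoint_family_disjointed)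
 also have "... \<le> (\<Sum>k. c * emeasure \<nu> (disjointed B k))"
 proof (intro suminf_le local)
  fix k
  have s: "disjointed B k \<subseteq> B k" by (rule disjointed_subset)
  show "p k \<in> S" using F(1) p by blast
  show "disjointed B k \<subseteq> S" using s A(2) by (auto simp: B_def)
  show "1 - \<eta> \<le> x \<bullet> p k" if "x \<in> disjointed B k" for x using s that by (force simp: B_def)
 qed (use dB in auto)
 also have "... = c * (\<Sum>k. emeasure \<nu> (disjointed B k))" by (rule ennreal_suminf_cmult)
 also have "(\<Sum>k. emeasure \<nu> (disjointed B k)) = emeasure \<nu> A"
  using dB sets unfolding UB[symmetric] by (intro suminf_emeasure) (auto simp: disjoint_family_disjointed)
 finally show ?thesis .
qed

lemma ennreal_le_of_factors_tendsto_1: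
 assumes "f \<longlonglongrightarrow> (1::real)" "\<And>n. (a::ennreal) \<le> ennreal (f n) * b" "b < \<infinity>"
 shows "a \<le> b"
proof -
 obtain r where r: "b = ennreal r" "0 \<le> r" using assms(3) by (cases b) auto
 have "(%n. ennreal (f n * r)) \<longlonglongrightarrow> ennreal (1 * r)"
  by (intro tendsto_ennrealI tendsto_mult assms tendsto_const)
 moreover have "a \<le> ennreal (f n * r)" for n
  using assms(2)[of n] r by (simp add: ennreal_mult'')
 ultimately show ?thesis using r by (intro LIMSEQ_le_const[of _ b]) auto
qed

text \<open>The comparison on caps extends to the sphere with unchanged constants for every cap
  size, and these constants tend to 1. Finite total mass allows the passage to the limit.\<close>

lemma hausdorff_measure_sphere:
 fixes W :: "'a::euclidean_space set"
 assumes W: "subspace W" and A: "A \<in> sets borel" "A \<subseteq> unit_sphere W"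
 shows "emeasure (hausdorff_measure (dim W - 1)) A = emeasure (cone_measure W) A"
proof (rule antisym)
 let ?H = "hausdorff_measure (dim W - 1) :: 'a measure"
 \<comment> \<open>The shift by two keeps the cap size strictly below 1 already for
   \<open>n = 0\<close>.\<close>
 let ?e = "%n. 1 / real (Suc (Suc n))"
 have S: "compact (unit_sphere W)"
 proof -
  have "unit_sphere W = W \<inter> sphere 0 1" by (auto simp: unit_sphere_def)
  then show ?thesis using W by (simp add: closed_Int_compact closed_subspace)
 qed
 have S1: "x \<in> unit_sphere W ==> norm x = 1" for x by (simp add: unit_sphere_def)
 have e0: "?e \<longlonglongrightarrow> 0" by (rule LIMSEQ_Suc[OF LIMSEQ_Suc[OF lim_1_over_n]])
 have fin: "emeasure (cone_measure W) A < \<infinity>"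
 proof -
  have "emeasure (cone_measure W) A \<le> emeasure (cone_measure W) UNIV" by (intro emeasure_mono) auto
  also have "... \<le> ennreal (dim W * unit_ball_vol (dim W))" by (rule emeasure_cone_measure_UNIV[OF W])
  also have "... < \<infinity>" by simp
  finally show ?thesis .
 qed
 have 1: "emeasure ?H A \<le> ennreal ((1 / (1 - ?e n)) ^ dim W) * emeasure (cone_measure W) A" for n
  by (rule emeasure_le_cmult_by_caps[where \<eta> = "?e n", OF _ _ S _ S1 hausdorff_vs_cone_measure_cap(1)[OF W] A]) auto
 show le: "emeasure ?H A \<le> emeasure (cone_measure W) A"
 proof (rule ennreal_le_of_factors_tendsto_1[OF _ 1 fin])
  have "(%n. (1 / (1 - ?e n)) ^ dim W) \<longlonglongrightarrow> (1 / (1 - 0)) ^ dim W"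
   by (intro tendsto_intros e0) auto
  then show "(%n. (1 / (1 - ?e n)) ^ dim W) \<longlonglongrightarrow> 1" by simp
 qed
 let ?K = "\<lambda>\<eta>::real. 1 / (1 - \<eta>) + sqrt (2 * \<eta>) / (1 - \<eta>)\<^sup>2"
 have 2: "emeasure (cone_measure W) A \<le> ennreal (?K (?e n) ^ (dim W - 1)) * emeasure ?H A" for n
  by (rule emeasure_le_cmult_by_caps[where \<eta> = "?e n", OF _ _ S _ S1 hausdorff_vs_cone_measure_cap(2)[OF W] A]) auto
 show "emeasure (cone_measure W) A \<le> emeasure ?H A"
 proof (rule ennreal_le_of_factors_tendsto_1[OF _ 2])
  have "(%n. ?K (?e n) ^ (dim W - 1)) \<longlonglongrightarrow> (1 / (1 - 0) + sqrt (2 * 0) / (1 - 0)\<^sup>2) ^ (dim W - 1)"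
   by (intro tendsto_intros e0) auto
  then show "(%n. ?K (?e n) ^ (dim W - 1)) \<longlonglongrightarrow> 1" by simp
  show "emeasure ?H A < \<infinity>" using le fin by (rule order.strict_trans1)
 qed
qed

section \<open>Integration over unit spheres and polar coordinates\<close>

lemma space_unit_sphere_measure [simp]: "space (unit_sphere_measure W) = unit_sphere W"
 by (simp add: unit_sphere_measure_def space_restrict_space)

lemma measurable_unit_sphere_measure:
 assumes "f \<in> M \<rightarrow>\<^sub>M unit_sphere_measure W" shows "f \<in> bmeas M"
 using assms unfolding unit_sphere_measure_def
 by (auto dest: measurable_restrict_space2_iff[THEN iffD1] simp: measurable_cong_sets[OF refl sets_hausdorff_measure])

lemma measurable_ident_unit_sphere: "(%x. x) \<in> unit_sphere_measure W \<rightarrow>\<^sub>M borel"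
 unfolding unit_sphere_measure_def by (intro measurable_restrict_space1) (simp add: measurable_cong_sets[OF sets_hausdorff_measure refl])

lemma nn_integral_unit_sphere_measure:
 fixes W :: "'a::euclidean_space set"
 assumes W: "subspace W" and G[measurable]: "G \<in> bmeas borel"
 shows "(INT+ u. G u wrt unit_sphere_measure W) = (INT+ u. G u wrt cone_measure W)"
proof -
 let ?H = "hausdorff_measure (dim W - 1) :: 'a measure"
 have ind: "indicator (unit_sphere W) \<in> bmeas ?H"
  by (rule borel_measurable_indicator) (simp add: unit_sphere_sets[OF W])
 have "density ?H (indicator (unit_sphere W)) = cone_measure W"
 proof (rule measure_eqI)
  fix A assume "A \<in> sets (density ?H (indicator (unit_sphere W)))"
  then have A[measurable]: "A \<in> sets borel" by simp
  have "emeasure (density ?H (indicator (unit_sphere W))) A = (INT+ x. indicator (unit_sphere W) x * indicator A x wrt ?H)"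
   using A by (intro emeasure_density ind) simp
  also have "... = (INT+ x. indicator (A \<inter> unit_sphere W) x wrt ?H)"
   by (intro nn_integral_cong) (simp add: indicator_inter_arith mult.commute)
  also have "... = emeasure ?H (A \<inter> unit_sphere W)"
   using A unit_sphere_sets[OF W] by (intro nn_integral_indicator) simp
  also have "... = emeasure (cone_measure W) (A \<inter> unit_sphere W)"
   using A unit_sphere_sets[OF W] by (intro hausdorff_measure_sphere[OF W]) auto
  also have "... = emeasure (cone_measure W) A"
   using AE_cone_measure_in[OF W] A unit_sphere_sets[OF W] by (intro emeasure_eq_AE) auto
  finally show "emeasure (density ?H (indicator (unit_sphere W))) A = emeasure (cone_measure W) A" .
 qed simp
 moreover have "(INT+ u. G u wrt unit_sphere_measure W) = (INT+ u. indicator (unit_sphere W) u * G u wrt ?H)"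
  unfolding unit_sphere_measure_def
  using unit_sphere_sets[OF W] by (subst nn_integral_restrict_space) (auto simp: mult.commute)
 moreover have "... = (INT+ u. G u wrt density ?H (indicator (unit_sphere W)))"
  using ind G by (intro nn_integral_density[symmetric]) (auto cong: measurable_cong_sets)
 ultimately show ?thesis by simp
qed

lemma emeasure_unit_sphere_measure:
 fixes W :: "'a::euclidean_space set"
 assumes W: "subspace W"
 shows "emeasure (unit_sphere_measure W) (unit_sphere W) = ennreal (dim W * unit_ball_vol (dim W))"
proof -
 have "emeasure (unit_sphere_measure W) (unit_sphere W) = (INT+ u. 1 wrt unit_sphere_measure W)" by simp
 also have "... = emeasure (cone_measure W) UNIV" by (subst nn_integral_unit_sphere_measure[OF W]) auto
 also have "... = ennreal (dim W) * emeasure (leb W) (cball 0 1)"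
 proof (cases "dim W = 0")
  case False
  then have "AE x in leb W. x \<noteq> 0" by (intro AE_leb_nonzero[OF W]) (rule neq0_conv[THEN iffD1])
  then show ?thesis by (subst emeasure_cone_measure, simp) (intro arg_cong2[where f = "(*)"] emeasure_eq_AE, auto)
 next
  case True
  show ?thesis by (subst emeasure_cone_measure, simp, unfold True, simp)
 qed
 also have "... = ennreal (dim W * unit_ball_vol (dim W))"
  by (subst emeasure_leb_cball[OF W]) (auto simp: ennreal_mult')
 finally show ?thesis .
qed

text \<open>Links the Gamma form in the normalisation of the Grassmannian with the volume form that
  polar coordinates produce.\<close>

lemma sphere_area_eq:
 assumes "0 < j" shows "sphere_area j = j * unit_ball_vol j"
proof -
 have "Gamma (real j / 2 + 1) = (real j / 2) * Gamma (real j / 2)"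
  using assms by (intro Gamma_plus1) (auto simp: nonpos_Ints_def)
 then have "unit_ball_vol (real j) = pi powr (real j / 2) / ((real j / 2) * Gamma (real j / 2))"
  unfolding unit_ball_vol_def by (simp only:)
 then show ?thesis using assms by (simp add: sphere_area_def)
qed

lemma finite_unit_sphere_measure: "subspace W ==> finite_measure (unit_sphere_measure W)"
 by (rule finite_measureI) (simp add: emeasure_unit_sphere_measure)

lemma sigma_finite_unit_sphere_measure: "subspace W ==> sigma_finite_measure (unit_sphere_measure W)"
 by (rule finite_measure.axioms(1)[OF finite_unit_sphere_measure])

text \<open>For \<open>x \<noteq> 0\<close> and \<open>D = dim W\<close> the integral of
  \<open>D * norm x ^ D / t ^ (D + 1)\<close> over \<open>t \<ge> norm x\<close> is 1. Inserting it,
  exchanging the integrals and scaling \<open>x\<close> by \<open>t\<close> turns the condition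
  \<open>norm x \<le> t\<close> into membership in the unit ball, so the cone measure appears;
  rescaling \<open>t\<close> by \<open>norm y\<close> then leaves only the direction of
  \<open>y\<close>.\<close>

theorem nn_integral_polar:
 fixes W :: "'a::euclidean_space set"
 assumes W: "subspace W" and D: "0 < dim W" and G[measurable]: "G \<in> bmeas borel"
 shows "(INT+ x. G x wrt leb W)
  = (INT+ u. (INT+ t. G (t *\<^sub>R u) * (ennreal (t ^ (dim W - 1)) * indicator {0<..} t) wrt lborel) wrt unit_sphere_measure W)"
proof -
 let ?D = "dim W"
 interpret W: sigma_finite_measure "leb W" by (rule sigma_finite_leb[OF W])
 interpret P: pair_sigma_finite "leb W" "lborel :: real measure" ..
 have nz: "AE x in leb W. x \<noteq> 0" by (rule AE_leb_nonzero[OF W D])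
 have one: "(INT+ t. ennreal (?D * r ^ ?D / t ^ (?D + 1)) * indicator {r..} t wrt lborel) = 1" if r: "0 < r" for r :: real
 proof -
  have "(INT+ t. ennreal (?D * r ^ ?D / t ^ (?D + 1)) * indicator {r..} t wrt lborel) = ennreal (0 - (- (r ^ ?D / r ^ ?D)))"
  proof (rule nn_integral_FTC_atLeast[where F = "%t. - (r ^ ?D / t ^ ?D)"])
   fix t assume t: "r \<le> t"
   have "((%t. - (r ^ ?D / t ^ ?D)) has_real_derivative (r ^ ?D * (?D * t ^ (?D - 1)) / (t ^ ?D * t ^ ?D))) (at t)"
    using r t D by (auto intro!: derivative_eq_intros)
   moreover have "r ^ ?D * (?D * t ^ (?D - 1)) / (t ^ ?D * t ^ ?D) = ?D * r ^ ?D / t ^ (?D + 1)"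
   proof -
    define s where "s = t ^ (?D - 1)"
    have "t ^ ?D = t * s" unfolding s_def using D by (metis Suc_diff_1 power_Suc)
    moreover from this have "t ^ (?D + 1) = t * (t * s)" by simp
    moreover have "s \<noteq> 0" "t \<noteq> 0" using r t by (auto simp: s_def)
    ultimately show ?thesis unfolding s_def[symmetric] by (simp add: divide_simps)
   qed
   ultimately show "((%t. - (r ^ ?D / t ^ ?D)) has_real_derivative (?D * r ^ ?D / t ^ (?D + 1))) (at t)" by simp
   show "0 \<le> ?D * r ^ ?D / t ^ (?D + 1)" using r t by simp
  next
   have "((%t. r ^ ?D / t ^ ?D) \<longlongrightarrow> 0) at_top"
    using D by (intro tendsto_divide_0[OF tendsto_const] filterlim_at_top_imp_at_infinity filterlim_pow_at_top filterlim_ident) auto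
   then show "((%t. - (r ^ ?D / t ^ ?D)) \<longlongrightarrow> 0) at_top" using tendsto_minus[of _ 0] by fastforce
  qed auto
  then show ?thesis using r by simp
 qed
 have "(INT+ x. G x wrt leb W) = (INT+ x. (INT+ t. G x * (ennreal (?D * norm x ^ ?D / t ^ (?D + 1)) * indicator {0..} (t - norm x) * indicator {0<..} t) wrt lborel) wrt leb W)"
 proof (rule nn_integral_cong_AE, use nz in eventually_elim)
  case (elim x)
  have "(INT+ t. G x * (ennreal (?D * norm x ^ ?D / t ^ (?D + 1)) * indicator {0..} (t - norm x) * indicator {0<..} t) wrt lborel)
   = (INT+ t. G x * (ennreal (?D * norm x ^ ?D / t ^ (?D + 1)) * indicator {norm x..} t) wrt lborel)"
  proof -
   have "0 < norm x" using elim by simp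
   from order.strict_trans2[OF this] show ?thesis by (intro nn_integral_cong) (auto simp: indicator_def)
  qed
  also have "... = G x"
   using one[of "norm x"] elim by (subst nn_integral_cmult) auto
  finally show ?case by simp
 qed
 also have "... = (INT+ t. (INT+ x. G x * (ennreal (?D * norm x ^ ?D / t ^ (?D + 1)) * indicator {0..} (t - norm x) * indicator {0<..} t) wrt leb W) wrt lborel)"
  by (rule P.Fubini'[symmetric]) measurable
 also have "... = (INT+ t. (INT+ y. G (t *\<^sub>R y) * (ennreal (?D * norm y ^ ?D * t ^ (?D - 1)) * indicator {..1} (norm y) * indicator {0<..} t) wrt leb W) wrt lborel)"
 proof (rule nn_integral_cong)
  fix t :: real
  show "(INT+ x. G x * (ennreal (?D * norm x ^ ?D / t ^ (?D + 1)) * indicator {0..} (t - norm x) * indicator {0<..} t) wrt leb W)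
   = (INT+ y. G (t *\<^sub>R y) * (ennreal (?D * norm y ^ ?D * t ^ (?D - 1)) * indicator {..1} (norm y) * indicator {0<..} t) wrt leb W)"
  proof (cases "0 < t")
   case t: True
   have "(INT+ x. G x * (ennreal (?D * norm x ^ ?D / t ^ (?D + 1)) * indicator {0..} (t - norm x) * indicator {0<..} t) wrt leb W)
    = ennreal (\<bar>t\<bar> ^ ?D) * (INT+ x. G (0 + t *\<^sub>R x) * (ennreal (?D * norm (0 + t *\<^sub>R x) ^ ?D / t ^ (?D + 1)) * indicator {0..} (t - norm (0 + t *\<^sub>R x)) * indicator {0<..} t) wrt leb W)"
    using t subspace_0[OF W] by (intro nn_integral_leb_affine[OF W]) auto
   also have "... = (INT+ x. ennreal (\<bar>t\<bar> ^ ?D) * (G (0 + t *\<^sub>R x) * (ennreal (?D * norm (0 + t *\<^sub>R x) ^ ?D / t ^ (?D + 1)) * indicator {0..} (t - norm (0 + t *\<^sub>R x)) * indicator {0<..} t)) wrt leb W)"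
    by (rule nn_integral_cmult[symmetric]) measurable
   also have "... = (INT+ y. G (t *\<^sub>R y) * (ennreal (?D * norm y ^ ?D * t ^ (?D - 1)) * indicator {..1} (norm y) * indicator {0<..} t) wrt leb W)"
   proof (rule nn_integral_cong)
    fix x :: 'a
    have i: "indicator {0..} (t - norm (0 + t *\<^sub>R x)) = (indicator {..1} (norm x) :: ennreal)"
     using t by (auto simp: indicator_def)
    have "t ^ ?D * (?D * (t * norm x) ^ ?D / t ^ (?D + 1)) = ?D * norm x ^ ?D * t ^ (?D - 1)"
    proof -
     define s where "s = t ^ (?D - 1)"
     have "t ^ ?D = t * s" unfolding s_def using D by (metis Suc_diff_1 power_Suc)
     moreover from this have "t ^ (?D + 1) = t * (t * s)" by simp
     moreover have "s \<noteq> 0" "t \<noteq> 0" using t by (auto simp: s_def)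
     ultimately show ?thesis unfolding s_def[symmetric] power_mult_distrib by (simp add: divide_simps)
    qed
    then have "ennreal (\<bar>t\<bar> ^ ?D) * ennreal (?D * norm (0 + t *\<^sub>R x) ^ ?D / t ^ (?D + 1)) = ennreal (?D * norm x ^ ?D * t ^ (?D - 1))"
     using t by (subst ennreal_mult[symmetric]) auto
    then show "ennreal (\<bar>t\<bar> ^ ?D) * (G (0 + t *\<^sub>R x) * (ennreal (?D * norm (0 + t *\<^sub>R x) ^ ?D / t ^ (?D + 1)) * indicator {0..} (t - norm (0 + t *\<^sub>R x)) * indicator {0<..} t))
     = G (t *\<^sub>R x) * (ennreal (?D * norm x ^ ?D * t ^ (?D - 1)) * indicator {..1} (norm x) * indicator {0<..} t)"
     unfolding i by (simp add: mult.left_commute mult.assoc[symmetric])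
   qed
   finally show ?thesis .
  qed simp
 qed
 also have "... = (INT+ y. (INT+ t. G (t *\<^sub>R y) * (ennreal (?D * norm y ^ ?D * t ^ (?D - 1)) * indicator {..1} (norm y) * indicator {0<..} t) wrt lborel) wrt leb W)"
  by (rule P.Fubini') measurable
 also have "... = (INT+ y. ennreal ?D * ((INT+ t. G (t *\<^sub>R (y /\<^sub>R norm y)) * (ennreal (t ^ (?D - 1)) * indicator {0<..} t) wrt lborel) * indicator (cball 0 1 - {0}) y) wrt leb W)"
 proof (rule nn_integral_cong_AE, use nz in eventually_elim)
  case (elim y)
  define r where "r = norm y"
  have r: "0 < r" using elim by (simp add: r_def)
  let ?f = "%t. G (t *\<^sub>R (y /\<^sub>R r)) * (ennreal (t ^ (?D - 1)) * indicator {0<..} t)"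
  have "(INT+ t. ?f t wrt lborel) = ennreal \<bar>r\<bar> * (INT+ t. ?f (0 + r * t) wrt lborel)"
   using r by (intro nn_integral_real_affine) auto
  also have "... = (INT+ t. ennreal \<bar>r\<bar> * ?f (0 + r * t) wrt lborel)" by (rule nn_integral_cmult[symmetric]) measurable
  also have "... = (INT+ t. G (t *\<^sub>R y) * (ennreal (r ^ ?D * t ^ (?D - 1)) * indicator {0<..} t) wrt lborel)"
  proof (rule nn_integral_cong)
   fix t :: real
   have s: "(0 + r * t) *\<^sub>R (y /\<^sub>R r) = t *\<^sub>R y" using r by simp
   have i: "indicator {0<..} (0 + r * t) = (indicator {0<..} t :: ennreal)" using r by (auto simp: indicator_def zero_less_mult_iff)
   have e: "r * (r * t) ^ (?D - 1) = r ^ ?D * t ^ (?D - 1)" 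
    using D unfolding power_mult_distrib by (metis Suc_diff_1 mult.assoc power_Suc)
   show "ennreal \<bar>r\<bar> * ?f (0 + r * t) = G (t *\<^sub>R y) * (ennreal (r ^ ?D * t ^ (?D - 1)) * indicator {0<..} t)"
   proof (cases "0 < t")
    case True
    then have "ennreal (r ^ ?D * t ^ (?D - 1)) = ennreal r * ennreal ((r * t) ^ (?D - 1))"
     using r e by (subst ennreal_mult[symmetric]) auto
    then show ?thesis unfolding s i using r by (simp add: mult_ac)
   next
    case False
    then have "indicator {0<..} t = (0::ennreal)" by simp
    then show ?thesis by (simp only: i mult_zero_right)
   qed
  qed
  finally have sub: "(INT+ t. ?f t wrt lborel) = (INT+ t. G (t *\<^sub>R y) * (ennreal (r ^ ?D * t ^ (?D - 1)) * indicator {0<..} t) wrt lborel)" .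
  have "(INT+ t. G (t *\<^sub>R y) * (ennreal (?D * norm y ^ ?D * t ^ (?D - 1)) * indicator {..1} (norm y) * indicator {0<..} t) wrt lborel)
   = (INT+ t. ennreal ?D * indicator {..1} r * (G (t *\<^sub>R y) * (ennreal (r ^ ?D * t ^ (?D - 1)) * indicator {0<..} t)) wrt lborel)"
  proof (rule nn_integral_cong)
   fix t :: real
   have "ennreal (?D * norm y ^ ?D * t ^ (?D - 1)) = ennreal ?D * ennreal (r ^ ?D * t ^ (?D - 1))"
    by (simp add: r_def ennreal_mult'[symmetric] mult.assoc)
   then show "G (t *\<^sub>R y) * (ennreal (?D * norm y ^ ?D * t ^ (?D - 1)) * indicator {..1} (norm y) * indicator {0<..} t)
    = ennreal ?D * indicator {..1} r * (G (t *\<^sub>R y) * (ennreal (r ^ ?D * t ^ (?D - 1)) * indicator {0<..} t))"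
    by (simp add: r_def mult_ac)
  qed
  also have "... = ennreal ?D * indicator {..1} r * (INT+ t. ?f t wrt lborel)"
   unfolding sub by (rule nn_integral_cmult) measurable
  also have "indicator {..1} r = (indicator (cball 0 1 - {0}) y :: ennreal)" using elim by (auto simp: indicator_def r_def)
  finally show ?case by (simp add: r_def mult_ac)
 qed
 also have "... = ennreal ?D * (INT+ y. (INT+ t. G (t *\<^sub>R (y /\<^sub>R norm y)) * (ennreal (t ^ (?D - 1)) * indicator {0<..} t) wrt lborel) * indicator (cball 0 1 - {0}) y wrt leb W)"
  by (rule nn_integral_cmult) measurable
 also have "... = (INT+ u. (INT+ t. G (t *\<^sub>R u) * (ennreal (t ^ (?D - 1)) * indicator {0<..} t) wrt lborel) wrt cone_measure W)"
  by (rule nn_integral_cone_measure[symmetric]) measurable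
 also have "... = (INT+ u. (INT+ t. G (t *\<^sub>R u) * (ennreal (t ^ (?D - 1)) * indicator {0<..} t) wrt lborel) wrt unit_sphere_measure W)"
  by (rule nn_integral_unit_sphere_measure[OF W, symmetric]) measurable
 finally show ?thesis .
qed

section \<open>Orthogonal projections and Gram-Schmidt orthogonalisation\<close>

lemma orth_proj_eqI:
 assumes L: "subspace L" and y: "y \<in> L" "\<And>z. z \<in> L ==> (x - y) \<bullet> z = 0"
 shows "orth_proj L x = y"
 unfolding orth_proj_def
proof (rule the_equality)
 show "y \<in> L \<and> x - y \<in> orthogonal_comp L"
  using y by (auto simp: orthogonal_comp_def orthogonal_def inner_commute)
 fix y' assume y': "y' \<in> L \<and> x - y' \<in> orthogonal_comp L"
 have d: "y' - y \<in> L" using y' y L by (auto intro: subspace_diff)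
 have "(x - y') \<bullet> (y' - y) = 0" using y' d by (auto simp: orthogonal_comp_def orthogonal_def inner_commute)
 moreover have "(x - y) \<bullet> (y' - y) = 0" using y(2) d by blast
 ultimately have "(y' - y) \<bullet> (y' - y) = 0" by (simp add: inner_diff_left)
 then show "y' = y" by simp
qed

lemma orth_proj_exists:
 assumes L: "subspace L"
 shows orth_proj_in: "orth_proj L x \<in> L" and orth_proj_orthogonal: "z \<in> L ==> (x - orth_proj L x) \<bullet> z = 0"
proof -
 obtain y w where yw: "y \<in> span L" "\<And>v. v \<in> span L ==> orthogonal w v" "x = y + w"
  using orthogonal_subspace_decomp_exists[of L x] by metis
 have sp: "span L = L" using L by (simp add: span_eq_iff)
 have *: "y \<in> L" "\<And>z. z \<in> L ==> (x - y) \<bullet> z = 0"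
  using yw(1) yw(2)[unfolded sp] yw(3) unfolding sp by (auto simp: orthogonal_def)
 with orth_proj_eqI[OF L this] show "orth_proj L x \<in> L" "z \<in> L ==> (x - orth_proj L x) \<bullet> z = 0" by auto
qed

lemma orth_proj_inner: "subspace L ==> z \<in> L ==> orth_proj L x \<bullet> z = x \<bullet> z"
 using orth_proj_orthogonal[of L z x] by (simp add: inner_diff_left)

lemma orth_proj_ident: "subspace L ==> x \<in> L ==> orth_proj L x = x"
 by (rule orth_proj_eqI) auto

lemma linear_orth_proj: assumes L: "subspace L" shows "linear (orth_proj L)"
proof (rule linearI)
 show "orth_proj L (x + y) = orth_proj L x + orth_proj L y" for x y
  by (rule orth_proj_eqI[OF L]) (use L in \<open>auto intro: subspace_add orth_proj_in simp: inner_add_left inner_diff_left orth_proj_inner\<close>)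
 show "orth_proj L (c *\<^sub>R x) = c *\<^sub>R orth_proj L x" for c x
  by (rule orth_proj_eqI[OF L]) (use L in \<open>auto intro: subspace_scale orth_proj_in simp: inner_diff_left orth_proj_inner\<close>)
qed

lemma orth_proj_measurable [measurable]: "subspace L ==> orth_proj L \<in> bmeas borel"
 using linear_orth_proj[of L] by (simp add: borel_measurable_continuous_onI linear_continuous_on linear_conv_bounded_linear)

text \<open>As an explicit recursion the projection is visibly measurable in the tuple. A vanishing
  residual contributes a zero vector, so the recursion gives the projection onto the span also for
  dependent tuples.\<close>

primrec gs_proj :: "(nat => 'a::euclidean_space) => nat => 'a => 'a" where
 "gs_proj x 0 v = 0"
| "gs_proj x (Suc j) v = gs_proj x j v + ((v \<bullet> (x j - gs_proj x j (x j))) /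
   ((x j - gs_proj x j (x j)) \<bullet> (x j - gs_proj x j (x j)))) *\<^sub>R (x j - gs_proj x j (x j))"

definition gs_res :: "(nat => 'a::euclidean_space) => nat => 'a" where
 "gs_res x j = x j - gs_proj x j (x j)"

text \<open>The volume of the parallelepiped as a product of heights. Dependent tuples get the value
  0, and the single heights are what polar coordinates act on.\<close>

definition gs_vol :: "nat => (nat => 'a::euclidean_space) => real" where
 "gs_vol m x = (\<Prod>j<m. norm (gs_res x j))"

definition gs_frame :: "(nat => 'a::euclidean_space) => nat => 'a" where
 "gs_frame x j = gs_res x j /\<^sub>R norm (gs_res x j)"

lemma gs_proj_Suc: "gs_proj x (Suc j) v = gs_proj x j v + ((v \<bullet> gs_res x j) / (gs_res x j \<bullet> gs_res x j)) *\<^sub>R gs_res x j"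
 by (simp add: gs_res_def)

lemma gs_proj_cong: "(\<And>i. i < j ==> x i = x' i) ==> gs_proj x j v = gs_proj x' j v"
 by (induction j arbitrary: v) auto

lemma gs_res_cong: "(\<And>i. i \<le> j ==> x i = x' i) ==> gs_res x j = gs_res x' j"
 unfolding gs_res_def by (metis gs_proj_cong less_imp_le order_refl)

lemma gs_vol_cong: "(\<And>i. i < m ==> x i = x' i) ==> gs_vol m x = gs_vol m x'"
 unfolding gs_vol_def by (intro prod.cong refl arg_cong[where f = norm] gs_res_cong) auto

lemma gs_vol_nonneg: "0 \<le> gs_vol m x"
 by (simp add: gs_vol_def prod_nonneg)

lemma gs_vol_Suc: "gs_vol (Suc m) x = gs_vol m x * norm (gs_res x m)"
 by (simp add: gs_vol_def)

lemma image_lessThan_Suc: "x ` {..<Suc j} = insert (x j) (x ` {..<j})"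
 by (auto simp: lessThan_Suc)

lemma gs_proj_spec:
 "gs_proj x j v \<in> span (x ` {..<j}) \<and> (\<forall>z\<in>span (x ` {..<j}). (v - gs_proj x j v) \<bullet> z = 0)"
proof (induction j arbitrary: v)
 case (Suc j)
 let ?S = "span (x ` {..<j})" and ?S' = "span (x ` {..<Suc j})"
 let ?y = "gs_res x j"
 have sub: "?S \<subseteq> ?S'" by (intro span_mono) auto
 have xj: "x j \<in> ?S'" by (intro span_base) auto
 have y: "?y \<in> ?S'" unfolding gs_res_def using Suc sub xj by (intro span_diff) auto
 have yorth: "?y \<bullet> z = 0" if "z \<in> ?S" for z unfolding gs_res_def using Suc that by auto
 have 1: "gs_proj x (Suc j) v \<in> ?S'"
  unfolding gs_proj_Suc using Suc sub y by (intro span_add span_scale) auto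
 have "(v - gs_proj x (Suc j) v) \<bullet> b = 0" if "b \<in> x ` {..<Suc j}" for b
 proof -
  have 2: "(v - gs_proj x (Suc j) v) \<bullet> z = 0" if "z \<in> ?S" for z
  proof -
   have "(v - gs_proj x (Suc j) v) \<bullet> z = (v - gs_proj x j v) \<bullet> z - ((v \<bullet> ?y) / (?y \<bullet> ?y)) * (?y \<bullet> z)"
    unfolding gs_proj_Suc by (simp add: inner_diff_left inner_add_left)
   then show ?thesis using Suc that yorth by auto
  qed
  have 3: "(v - gs_proj x (Suc j) v) \<bullet> ?y = 0"
  proof (cases "?y = 0")
   case False
   have "gs_proj x j v \<bullet> ?y = 0" using yorth[of "gs_proj x j v"] Suc by (auto simp: inner_commute)
   then show ?thesis unfolding gs_proj_Suc using False by (simp add: inner_diff_left inner_add_left)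
  qed simp
  show ?thesis
  proof (cases "b = x j")
   case True
   have "b = ?y + gs_proj x j (x j)" by (simp add: gs_res_def True)
   then show ?thesis using 2[of "gs_proj x j (x j)"] 3 Suc by (simp add: inner_add_right)
  next
   case False
   then have "b \<in> x ` {..<j}" using that by (auto simp: image_lessThan_Suc)
   then show ?thesis using 2[OF span_base] by blast
  qed
 qed
 then have "(v - gs_proj x (Suc j) v) \<bullet> z = 0" if "z \<in> ?S'" for z
  using that orthogonal_to_span[of z "x ` {..<Suc j}" "v - gs_proj x (Suc j) v"] by (auto simp: orthogonal_def)
 then show ?case using 1 by blast
qed simp

lemma gs_proj_eq: "gs_proj x j = orth_proj (span (x ` {..<j}))"
proof
 fix v show "gs_proj x j v = orth_proj (span (x ` {..<j})) v"
  using gs_proj_spec[of x j v] by (intro orth_proj_eqI[symmetric]) auto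
qed

lemma gs_res_orthogonal: "z \<in> span (x ` {..<j}) ==> gs_res x j \<bullet> z = 0"
 unfolding gs_res_def using gs_proj_spec[of x j "x j"] by blast

lemma gs_res_in: "gs_res x j \<in> span (x ` {..<Suc j})"
proof -
 have "span (x ` {..<j}) \<subseteq> span (x ` {..<Suc j})" by (intro span_mono) auto
 then show ?thesis unfolding gs_res_def using gs_proj_spec[of x j "x j"] by (intro span_diff) (auto intro: span_base)
qed

lemma gs_res_in_le: "j < m ==> gs_res x j \<in> span (x ` {..<m})"
 using gs_res_in[of x j] span_mono[of "x ` {..<Suc j}" "x ` {..<m}"] by (force simp: less_eq_Suc_le)

lemma gs_res_eq_0_iff: "gs_res x j = 0 \<longleftrightarrow> x j \<in> span (x ` {..<j})"
proof
 assume "gs_res x j = 0"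
 then have "x j = gs_proj x j (x j)" by (simp add: gs_res_def)
 then show "x j \<in> span (x ` {..<j})" using gs_proj_spec[of x j "x j"] by metis
next
 assume "x j \<in> span (x ` {..<j})"
 then show "gs_res x j = 0" by (simp add: gs_res_def gs_proj_eq orth_proj_ident)
qed

lemma norm_gs_res_le: "norm (gs_res x j) \<le> norm (x j)"
proof -
 have "x j \<bullet> gs_res x j = gs_res x j \<bullet> gs_res x j"
  using gs_res_orthogonal[of "gs_proj x j (x j)" x j] gs_proj_spec[of x j "x j"]
  by (simp add: gs_res_def inner_diff_left inner_diff_right inner_commute)
 then have "norm (gs_res x j) * norm (gs_res x j) \<le> norm (x j) * norm (gs_res x j)"
  using norm_cauchy_schwarz[of "x j" "gs_res x j"] by (simp add: norm_eq_sqrt_inner)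
 then show ?thesis by (cases "norm (gs_res x j) = 0") (auto simp: mult_le_cancel_right)
qed

lemma inner_gs_frame: "x j \<bullet> gs_frame x j = norm (gs_res x j)"
proof -
 have "x j \<bullet> gs_res x j = gs_res x j \<bullet> gs_res x j"
  using gs_res_orthogonal[of "gs_proj x j (x j)" x j] gs_proj_spec[of x j "x j"]
  by (simp add: gs_res_def inner_diff_left inner_diff_right inner_commute)
 then show ?thesis
  by (cases "gs_res x j = 0") (auto simp: gs_frame_def dot_square_norm power2_eq_square)
qed

lemma gs_vol_neq_0: "gs_vol m x \<noteq> 0 \<longleftrightarrow> (\<forall>j<m. gs_res x j \<noteq> 0)"
 by (auto simp: gs_vol_def)

lemma onb_gs_frame:
 assumes "gs_vol m x \<noteq> 0" shows "onb m (gs_frame x) (span (x ` {..<m}))"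
 unfolding onb_def
proof (intro conjI allI impI)
 have nz: "gs_res x j \<noteq> 0" if "j < m" for j using assms that by (simp add: gs_vol_neq_0)
 have o: "gs_res x j \<bullet> gs_res x i = 0" if "i < j" for i j
  by (rule gs_res_orthogonal[OF gs_res_in_le[OF that]])
 fix i j assume ij: "i < m" "j < m"
 show "gs_frame x i \<bullet> gs_frame x j = (if i = j then 1 else 0)"
  using o[of i j] o[of j i] nz[OF ij(1)] ij
  by (cases i j rule: linorder_cases) (auto simp: gs_frame_def inner_commute dot_square_norm power2_eq_square)
next
 have nz: "gs_res x j \<noteq> 0" if "j < m" for j using assms that by (simp add: gs_vol_neq_0)
 have "x j \<in> span (gs_frame x ` {..<m})" if "j < m" for j
  using that
 proof (induction j rule: less_induct)
  case (less j)
  have "x ` {..<j} \<subseteq> span (gs_frame x ` {..<m})" using less by auto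
  then have "span (x ` {..<j}) \<subseteq> span (gs_frame x ` {..<m})" by (simp add: span_minimal)
  moreover have "gs_res x j = norm (gs_res x j) *\<^sub>R gs_frame x j" using nz less.prems by (simp add: gs_frame_def)
  moreover have "gs_frame x j \<in> span (gs_frame x ` {..<m})" using less.prems by (intro span_base) auto
  moreover have "x j = gs_proj x j (x j) + gs_res x j" by (simp add: gs_res_def)
  ultimately show ?case using gs_proj_spec[of x j "x j"] by (metis span_add span_scale subsetD)
 qed
 then have 1: "span (x ` {..<m}) \<subseteq> span (gs_frame x ` {..<m})" by (intro span_minimal) auto
 have "gs_frame x j \<in> span (x ` {..<m})" if "j < m" for j
  unfolding gs_frame_def by (intro span_scale gs_res_in_le that)
 then have "span (gs_frame x ` {..<m}) \<subseteq> span (x ` {..<m})" by (intro span_minimal) auto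
 with 1 show "span (gs_frame x ` {..<m}) = span (x ` {..<m})" by simp
qed

lemma gs_vol_0_dim:
 assumes "gs_vol m x = 0" shows "dim (span (x ` {..<m})) < m"
proof -
 obtain j where j: "j < m" "x j \<in> span (x ` {..<j})" using assms gs_vol_neq_0 gs_res_eq_0_iff by blast
 have "span (x ` {..<j}) \<subseteq> span (x ` ({..<m} - {j}))" using j by (intro span_mono) auto
 then have "x j \<in> span (x ` ({..<m} - {j}))" using j by blast
 moreover have "x ` {..<m} = insert (x j) (x ` ({..<m} - {j}))" using j by auto
 ultimately have "span (x ` {..<m}) = span (x ` ({..<m} - {j}))" by (simp add: span_redundant)
 then have "dim (span (x ` {..<m})) \<le> card (x ` ({..<m} - {j}))" by (simp add: dim_le_card')
 also have "... \<le> card ({..<m} - {j})" by (rule card_image_le) simp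
 also have "... < m" using j by simp
 finally show ?thesis .
qed

lemma gs_vol_neq_0_span:
 assumes "gs_vol m x \<noteq> 0" "subspace L" "dim L = m" "\<And>i. i < m ==> x i \<in> L"
 shows "span (x ` {..<m}) = L"
proof -
 have "span (x ` {..<m}) \<subseteq> L" using assms by (intro span_minimal) auto
 moreover have "dim (span (x ` {..<m})) = m" by (rule onb_dim[OF onb_gs_frame[OF assms(1)]])
 ultimately show ?thesis using assms(2,3) by (metis subspace_dim_equal subspace_span order_refl)
qed

lemma gs_scale:
 assumes "\<And>i. i < m ==> a i \<noteq> 0"
 shows "gs_vol m (%i. a i *\<^sub>R x i) = (\<Prod>i<m. \<bar>a i\<bar>) * gs_vol m x"
proof -
 have "gs_res (%i. a i *\<^sub>R x i) j = a j *\<^sub>R gs_res x j" if "j < m" for j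
 proof -
  have "(%i. a i *\<^sub>R x i) ` {..<j} \<subseteq> span (x ` {..<j})" by (auto intro: span_scale span_base)
  moreover have "x i \<in> span ((%i. a i *\<^sub>R x i) ` {..<j})" if i: "i < j" for i
  proof -
   have "x i = (1 / a i) *\<^sub>R (a i *\<^sub>R x i)" using assms[of i] i \<open>j < m\<close> by simp
   moreover have "(1 / a i) *\<^sub>R (a i *\<^sub>R x i) \<in> span ((%i. a i *\<^sub>R x i) ` {..<j})"
    using i by (intro span_scale span_base) auto
   ultimately show ?thesis by metis
  qed
  ultimately have "span ((%i. a i *\<^sub>R x i) ` {..<j}) = span (x ` {..<j})"
   by (intro equalityI span_minimal) auto
  then show ?thesis unfolding gs_res_def gs_proj_eq
   by (simp add: linear_scale[OF linear_orth_proj] scaleR_diff_right)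
 qed
 then show ?thesis by (simp add: gs_vol_def prod.distrib)
qed

lemma gs_proj_isometry:
 assumes T: "orthogonal_transformation T"
 shows "gs_proj (%i. T (x i)) j (T v) = T (gs_proj x j v)"
proof -
 have lin: "linear T" and inn: "\<And>v w. T v \<bullet> T w = v \<bullet> w" using T by (auto simp: orthogonal_transformation_def)
 show ?thesis
  by (induction j arbitrary: v) (auto simp: linear_0[OF lin] linear_add[OF lin] linear_scale[OF lin] linear_diff[OF lin, symmetric] inn)
qed

lemma gs_res_isometry:
 assumes T: "orthogonal_transformation T"
 shows "gs_res (%i. T (x i)) j = T (gs_res x j)"
 using T unfolding gs_res_def gs_proj_isometry[OF T] by (simp add: orthogonal_transformation_def linear_diff)

lemma gs_frame_isometry:
 assumes T: "orthogonal_transformation T"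
 shows "gs_frame (%i. T (x i)) j = T (gs_frame x j)"
 using T unfolding gs_frame_def gs_res_isometry[OF T]
 by (simp add: orthogonal_transformation_norm linear_scale[OF orthogonal_transformation_linear])

lemma gs_proj_measurable:
 assumes x: "\<And>i. i < j ==> (%w. x w i) \<in> bmeas M" and v: "v \<in> bmeas M"
 shows "(%w. gs_proj (x w) j (v w)) \<in> bmeas M"
 using assms
proof (induction j arbitrary: v)
 case (Suc j)
 have [measurable]: "(%w. x w j) \<in> bmeas M" "v \<in> bmeas M" using Suc.prems by auto
 have [measurable]: "(%w. gs_proj (x w) j (v w)) \<in> bmeas M"
  "(%w. gs_proj (x w) j (x w j)) \<in> bmeas M"
  using Suc by auto
 show ?case unfolding gs_proj.simps by measurable
qed simp

lemma gs_res_measurable: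
 assumes "\<And>i. i \<le> j ==> (%w. x w i) \<in> bmeas M"
 shows "(%w. gs_res (x w) j) \<in> bmeas M"
 unfolding gs_res_def using assms by (intro borel_measurable_diff gs_proj_measurable) auto

lemma gs_frame_measurable:
 assumes "\<And>i. i \<le> j ==> (%w. x w i) \<in> bmeas M"
 shows "(%w. gs_frame (x w) j) \<in> bmeas M"
 unfolding gs_frame_def using gs_res_measurable[OF assms] by measurable

lemma gs_vol_measurable:
 assumes "\<And>i. i < m ==> (%w. x w i) \<in> bmeas M"
 shows "(%w. gs_vol m (x w)) \<in> bmeas M"
 unfolding gs_vol_def using assms by (intro borel_measurable_prod measurable_compose[OF gs_res_measurable borel_measurable_norm]) auto

lemma gs_proj_tendsto:
 assumes "\<And>i. i < j ==> (%k. X k i) \<longlonglongrightarrow> x i" "\<And>i. i < j ==> gs_res x i \<noteq> 0" "V \<longlonglongrightarrow> v"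
 shows "(%k. gs_proj (X k) j (V k)) \<longlonglongrightarrow> gs_proj x j v"
 using assms
proof (induction j arbitrary: V v)
 case (Suc j)
 have X: "(%k. X k j) \<longlonglongrightarrow> x j" and nz: "gs_res x j \<noteq> 0" using Suc.prems by auto
 have 1: "(%k. gs_proj (X k) j (V k)) \<longlonglongrightarrow> gs_proj x j v"
  and 2: "(%k. gs_proj (X k) j (X k j)) \<longlonglongrightarrow> gs_proj x j (x j)"
  using Suc X by auto
 show ?case unfolding gs_proj.simps
  using nz by (intro tendsto_intros 1 2 X Suc.prems(3)) (simp add: gs_res_def)
qed simp

text \<open>Gram-Schmidt is discontinuous at dependent tuples. There the first vanishing residual
  still depends continuously on the tuple, since the earlier ones are nonzero; it forces the product
  to 0 because all other heights are bounded by norms.\<close>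

lemma gs_vol_tendsto:
 assumes X: "\<And>i. i < m ==> (%k. X k i) \<longlonglongrightarrow> x i"
 shows "(%k. gs_vol m (X k)) \<longlonglongrightarrow> gs_vol m x"
proof (cases "gs_vol m x = 0")
 case False
 then have "gs_res x j \<noteq> 0" if "j < m" for j using that by (simp add: gs_vol_neq_0)
 then show ?thesis 
  unfolding gs_vol_def by (subst (1 2) gs_res_def) (intro tendsto_prod tendsto_norm tendsto_diff gs_proj_tendsto X, auto)
next
 case True
 then obtain j0 where "j0 < m \<and> gs_res x j0 = 0" using gs_vol_neq_0 by blast
 then obtain j where j: "j < m" "gs_res x j = 0" and least: "\<And>i. i < j ==> gs_res x i \<noteq> 0"
  using exists_least_iff[of "%j. j < m \<and> gs_res x j = 0"] by (metis less_trans)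
 have "(%k. gs_res (X k) j) \<longlonglongrightarrow> gs_res x j"
  unfolding gs_res_def using X j(1) least by (intro tendsto_diff gs_proj_tendsto) auto
 then have r: "(%k. norm (gs_res (X k) j)) \<longlonglongrightarrow> 0" using j(2) tendsto_norm by fastforce
 have "(%k. norm (gs_res (X k) j) * (\<Prod>i\<in>{..<m} - {j}. norm (X k i))) \<longlonglongrightarrow> 0 * (\<Prod>i\<in>{..<m} - {j}. norm (x i))"
  using X by (intro tendsto_mult r tendsto_prod tendsto_norm) auto
 then have lim: "(%k. norm (gs_res (X k) j) * (\<Prod>i\<in>{..<m} - {j}. norm (X k i))) \<longlonglongrightarrow> 0" by simp
 have "gs_vol m (X k) \<le> norm (gs_res (X k) j) * (\<Prod>i\<in>{..<m} - {j}. norm (X k i))" for k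
 proof -
  have "gs_vol m (X k) = norm (gs_res (X k) j) * (\<Prod>i\<in>{..<m} - {j}. norm (gs_res (X k) i))"
   unfolding gs_vol_def using j(1) by (intro prod.remove) auto
  also have "... \<le> norm (gs_res (X k) j) * (\<Prod>i\<in>{..<m} - {j}. norm (X k i))"
   by (intro mult_left_mono prod_mono) (auto simp: norm_gs_res_le)
  finally show ?thesis .
 qed
 then show ?thesis unfolding True 
  by (intro tendsto_sandwich[OF _ _ tendsto_const lim]) (auto simp: gs_vol_nonneg)
qed

lemma gs_vol_le: "gs_vol m x \<le> (\<Prod>i<m. norm (x i))"
 unfolding gs_vol_def by (intro prod_mono) (auto simp: norm_gs_res_le)

section \<open>Volumes of parallelepipeds and simplices\<close>

lemma nn_integral_lborel_scale:
 assumes "0 < (r::real)" and [measurable]: "G \<in> bmeas borel"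
 shows "ennreal r * (INT+ t. G (c + t * r) wrt lborel) = (INT+ t. G t wrt lborel)"
 using nn_integral_real_affine[of G r c] assms by (simp add: mult.commute)

text \<open>In the induction the last vector is replaced by its residual, a shear that translation
  invariance along the earlier span absorbs, and the residual is then normalised by a
  scaling.\<close>

lemma nn_integral_lincomb:
 assumes "gs_vol m v \<noteq> 0" "G \<in> bmeas borel"
 shows "ennreal (gs_vol m v) * (INT+ a. G (lincomb m v a) wrt lPi {..<m})
  = (INT+ x. G x wrt leb (span (v ` {..<m})))"
 using assms
proof (induction m arbitrary: G)
 case 0
 have "onb 0 (gs_frame v) (span (v ` {..<0}))" by (simp add: onb_def)
 from leb_eq[OF this] show ?case using 0
  by (simp add: nn_integral_frame_lborel_0 gs_vol_def PiM_empty nn_integral_count_space_finite lincomb_def)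
next
 case (Suc m)
 note [measurable] = Suc.prems(2)
 interpret product_sigma_finite "%_. lborel :: real measure" by standard
 let ?L = "span (v ` {..<m})" and ?e = "gs_frame v m" and ?y = "gs_res v m"
 have vm: "gs_vol m v \<noteq> 0" "?y \<noteq> 0" using Suc.prems(1) by (auto simp: gs_vol_Suc)
 have r: "0 < norm ?y" using vm by simp
 have sf: "sigma_finite_measure (leb ?L)" by (rule sigma_finite_leb) simp
 interpret L: sigma_finite_measure "leb ?L" by (rule sf)
 interpret P: pair_sigma_finite "PiM {..<m} (%_. lborel :: real measure)" "lborel :: real measure"
  by (intro pair_sigma_finite.intro sigma_finite lborel.sigma_finite_measure_axioms) simp
 interpret PL: pair_sigma_finite "leb ?L" "lborel :: real measure" ..
 have me[measurable]: "lincomb m v \<in> bmeas (lPi {..<m})" by simp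
 have "ennreal (gs_vol m v) * (INT+ a. G (lincomb (Suc m) v a) wrt lPi {..<Suc m})
  = ennreal (gs_vol m v) * (INT+ a. (INT+ t. G (lincomb m v a + t *\<^sub>R v m) wrt lborel) wrt lPi {..<m})"
  using nn_integral_frame_lborel_Suc[of G m v] nn_integral_frame_lborel[of G "Suc m" v]
   nn_integral_frame_lborel[of "%x. INT+ t. G (x + t *\<^sub>R v m) wrt lborel" m v] by simp
 also have "... = (INT+ x. (INT+ t. G (x + t *\<^sub>R v m) wrt lborel) wrt leb ?L)"
  by (rule Suc.IH[OF vm(1)]) measurable
 also have "... = (INT+ t. (INT+ x. G (x + t *\<^sub>R v m) wrt leb ?L) wrt lborel)"
  by (rule PL.Fubini'[symmetric]) measurable
 also have "... = (INT+ t. (INT+ x. G (x + t *\<^sub>R ?y) wrt leb ?L) wrt lborel)"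
 proof (rule nn_integral_cong)
  fix t :: real
  have p: "t *\<^sub>R gs_proj v m (v m) \<in> ?L" using gs_proj_spec[of v m "v m"] by (intro span_scale) auto
  have "(INT+ x. G (x + t *\<^sub>R ?y) wrt leb ?L) = (INT+ x. G (x + t *\<^sub>R gs_proj v m (v m) + t *\<^sub>R ?y) wrt leb ?L)"
   by (rule leb_translate[OF _ p, symmetric]) auto
  then show "(INT+ x. G (x + t *\<^sub>R v m) wrt leb ?L) = (INT+ x. G (x + t *\<^sub>R ?y) wrt leb ?L)"
   by (simp add: gs_res_def scaleR_diff_right)
 qed
 also have "... = (INT+ x. (INT+ t. G (x + t *\<^sub>R ?y) wrt lborel) wrt leb ?L)"
  by (rule PL.Fubini') measurable
 finally have IH: "ennreal (gs_vol m v) * (INT+ a. G (lincomb (Suc m) v a) wrt lPi {..<Suc m})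
  = (INT+ x. (INT+ t. G (x + t *\<^sub>R ?y) wrt lborel) wrt leb ?L)" .
 have "ennreal (gs_vol (Suc m) v) * (INT+ a. G (lincomb (Suc m) v a) wrt lPi {..<Suc m})
  = ennreal (norm ?y) * (INT+ x. (INT+ t. G (x + t *\<^sub>R ?y) wrt lborel) wrt leb ?L)"
  unfolding IH[symmetric] by (simp add: gs_vol_Suc ennreal_mult gs_vol_nonneg mult_ac)
 also have "... = (INT+ x. ennreal (norm ?y) * (INT+ t. G (x + t *\<^sub>R ?y) wrt lborel) wrt leb ?L)"
  by (rule nn_integral_cmult[symmetric]) measurable
 also have "... = (INT+ x. (INT+ t. G (x + t *\<^sub>R ?e) wrt lborel) wrt leb ?L)"
 proof (rule nn_integral_cong)
  fix x
  have "ennreal (norm ?y) * (INT+ t. G (x + (0 + t * norm ?y) *\<^sub>R ?e) wrt lborel) = (INT+ t. G (x + t *\<^sub>R ?e) wrt lborel)"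
   using r by (rule nn_integral_lborel_scale) measurable
  moreover have "(0 + t * norm ?y) *\<^sub>R ?e = t *\<^sub>R ?y" for t
  proof -
   have "norm ?y *\<^sub>R ?e = ?y" using vm(2) by (simp add: gs_frame_def)
   then show ?thesis by (metis add_0 scaleR_scaleR)
  qed
  ultimately show "ennreal (norm ?y) * (INT+ t. G (x + t *\<^sub>R ?y) wrt lborel) = (INT+ t. G (x + t *\<^sub>R ?e) wrt lborel)"
   by (simp only:)
 qed
 also have "... = (INT+ x. G x wrt leb (span (v ` {..<Suc m})))"
  unfolding leb_eq[OF onb_gs_frame[OF vm(1)]] leb_eq[OF onb_gs_frame[OF Suc.prems(1)]]
  by (rule nn_integral_frame_lborel_Suc[symmetric]) measurable
 finally show ?case .
qed

text \<open>In the Gram-Schmidt basis the coordinates \<open>x i \<bullet> c\<close> form a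
  triangular linear system whose diagonal entries are the norms of the residuals, so the Jacobian is
  \<open>gs_vol m x\<close>.\<close>

lemma nn_integral_inner_coordinates:
 assumes "gs_vol m x \<noteq> 0" "G \<in> bmeas (lPi {..<m})"
 shows "ennreal (gs_vol m x) * (INT+ c. G (\<lambda>i\<in>{..<m}. x i \<bullet> c) wrt leb (span (x ` {..<m})))
  = (INT+ a. G a wrt lPi {..<m})"
 using assms
proof (induction m arbitrary: G)
 case 0
 have "onb 0 (gs_frame x) (span (x ` {..<0}))" by (simp add: onb_def)
 from leb_eq[OF this] have "emeasure (leb (span (x ` {..<0}))) UNIV = 1"
  using nn_integral_frame_lborel_0[of "%_. 1"] by simp
 then show ?case
  by (simp add: gs_vol_def PiM_empty nn_integral_count_space_finite restrict_def)
next
 case (Suc m)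
 interpret product_sigma_finite "%_. lborel :: real measure" by standard
 let ?L = "span (x ` {..<m})" and ?e = "gs_frame x m" and ?y = "gs_res x m"
 have vm: "gs_vol m x \<noteq> 0" "?y \<noteq> 0" using Suc.prems(1) by (auto simp: gs_vol_Suc)
 have r: "0 < norm ?y" using vm by simp
 interpret L: sigma_finite_measure "leb ?L" by (rule sigma_finite_leb) simp
 have G[measurable]: "G \<in> bmeas (PiM (insert m {..<m}) (%_. lborel))"
  using Suc.prems(2) by (simp add: lessThan_Suc)
 define K where "K a = (INT+ s. G (a(m := s)) wrt lborel)" for a
 have G2: "(%(a, s). G (a(m := s))) \<in> bmeas (lPi {..<m} \<Otimes>\<^sub>M lborel)"
  using measurable_compose[OF measurable_add_dim G] by (simp add: case_prod_beta')
 then have K[measurable]: "K \<in> bmeas (lPi {..<m})"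
  unfolding K_def by (rule lborel.borel_measurable_nn_integral)
 have mm: "(%c. \<lambda>i\<in>{..<k}. x i \<bullet> c) \<in> borel \<rightarrow>\<^sub>M lPi {..<k}" for k
  by (rule measurable_restrict) simp
 have Gc[measurable]: "(%c. G (\<lambda>i\<in>{..<Suc m}. x i \<bullet> c)) \<in> bmeas borel"
  by (rule measurable_compose[OF mm Suc.prems(2)])
 have Kc[measurable]: "(%c. K (\<lambda>i\<in>{..<m}. x i \<bullet> c)) \<in> bmeas borel"
  by (rule measurable_compose[OF mm K])
 have "(INT+ c. G (\<lambda>i\<in>{..<Suc m}. x i \<bullet> c) wrt leb (span (x ` {..<Suc m})))
  = (INT+ c. (INT+ t. G (\<lambda>i\<in>{..<Suc m}. x i \<bullet> (c + t *\<^sub>R ?e)) wrt lborel) wrt leb ?L)"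
  unfolding leb_eq[OF onb_gs_frame[OF vm(1)]] leb_eq[OF onb_gs_frame[OF Suc.prems(1)]]
  by (rule nn_integral_frame_lborel_Suc) measurable
 also have "... = (INT+ c. (INT+ t. G ((\<lambda>i\<in>{..<m}. x i \<bullet> c)(m := x m \<bullet> c + t * norm ?y)) wrt lborel) wrt leb ?L)"
 proof (intro nn_integral_cong arg_cong[where f = G] ext)
  fix c t i
  have "x i \<bullet> ?e = 0" if "i < m"
   using gs_res_orthogonal[of "x i" x m] that by (simp add: gs_frame_def inner_commute span_base)
  then show "(\<lambda>i\<in>{..<Suc m}. x i \<bullet> (c + t *\<^sub>R ?e)) i = ((\<lambda>i\<in>{..<m}. x i \<bullet> c)(m := x m \<bullet> c + t * norm ?y)) i"
   using inner_gs_frame[of x m] by (auto simp: inner_add_right restrict_def less_Suc_eq)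
 qed
 finally have "ennreal (gs_vol (Suc m) x) * (INT+ c. G (\<lambda>i\<in>{..<Suc m}. x i \<bullet> c) wrt leb (span (x ` {..<Suc m})))
  = ennreal (gs_vol m x) * (ennreal (norm ?y) * (INT+ c. (INT+ t. G ((\<lambda>i\<in>{..<m}. x i \<bullet> c)(m := x m \<bullet> c + t * norm ?y)) wrt lborel) wrt leb ?L))"
  by (simp add: gs_vol_Suc ennreal_mult gs_vol_nonneg mult_ac)
 also have "ennreal (norm ?y) * (INT+ c. (INT+ t. G ((\<lambda>i\<in>{..<m}. x i \<bullet> c)(m := x m \<bullet> c + t * norm ?y)) wrt lborel) wrt leb ?L)
  = (INT+ c. ennreal (norm ?y) * (INT+ t. G ((\<lambda>i\<in>{..<m}. x i \<bullet> c)(m := x m \<bullet> c + t * norm ?y)) wrt lborel) wrt leb ?L)"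
 proof (rule nn_integral_cmult[symmetric])
  have "(%p. G ((\<lambda>i\<in>{..<m}. x i \<bullet> fst p)(m := x m \<bullet> fst p + snd p * norm ?y))) \<in> bmeas (borel \<Otimes>\<^sub>M lborel)"
   using measurable_compose[OF measurable_Pair[OF measurable_compose[OF measurable_fst mm[of m]], of "%p. x m \<bullet> fst p + snd p * norm ?y" lborel lborel] G2]
   by (simp add: case_prod_beta')
  then show "(%c. INT+ t. G ((\<lambda>i\<in>{..<m}. x i \<bullet> c)(m := x m \<bullet> c + t * norm ?y)) wrt lborel) \<in> bmeas (leb ?L)"
   by (subst measurable_cong_sets[OF sets_leb refl]) (intro lborel.borel_measurable_nn_integral, simp add: case_prod_beta')
 qed
 also have "... = (INT+ c. K (\<lambda>i\<in>{..<m}. x i \<bullet> c) wrt leb ?L)"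
 proof (rule nn_integral_cong)
  fix c
  have sp: "(\<lambda>i\<in>{..<m}. x i \<bullet> c) \<in> space (PiM {..<m} (%_. lborel :: real measure))" by (simp add: space_PiM)
  have "(%s. G ((\<lambda>i\<in>{..<m}. x i \<bullet> c)(m := s))) \<in> bmeas borel"
   using measurable_compose[OF measurable_component_update[OF sp] G] by simp
  from nn_integral_lborel_scale[OF r this]
  show "ennreal (norm ?y) * (INT+ t. G ((\<lambda>i\<in>{..<m}. x i \<bullet> c)(m := x m \<bullet> c + t * norm ?y)) wrt lborel) = K (\<lambda>i\<in>{..<m}. x i \<bullet> c)"
   unfolding K_def .
 qed
 also have "ennreal (gs_vol m x) * ... = (INT+ a. K a wrt lPi {..<m})"
  by (rule Suc.IH[OF vm(1) K])
 also have "... = (INT+ a. G a wrt lPi {..<Suc m})"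
  unfolding K_def lessThan_Suc by (rule product_nn_integral_insert[symmetric]) (use G in auto)
 finally show ?case .
qed

text \<open>After moving \<open>y0\<close> to the origin the simplex is the image of the standard
  simplex, of volume \<open>1 / fact m\<close>, under a linear map with determinant
  \<open>gs_vol\<close>. In the degenerate case it lies in a proper subspace, which is null.\<close>

lemma simplex_volume_eq_gs_vol:
 fixes L :: "'a::euclidean_space set"
 assumes L: "subspace L" "dim L = m" and y: "y0 \<in> L" "\<And>i. i < m ==> y i \<in> L"
 shows "fact m * simplex_volume m y0 y = gs_vol m (%i. y i - y0)"
proof -
 let ?v = "%i. y i - y0"
 let ?C = "convex hull (insert y0 (y ` {..<m}))"
 let ?Z = "convex hull (insert 0 (?v ` {..<m}))"
 have cl: "closed ?C" "closed ?Z" by (auto intro!: compact_imp_closed finite_imp_compact_convex_hull)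
 have "insert y0 (y ` {..<m}) \<subseteq> L" using y by auto
 then have sub: "?C \<subseteq> L" using L(1) by (intro hull_minimal) (auto intro: subspace_imp_convex)
 have "insert y0 (y ` {..<m}) = (%x. y0 + x) ` insert 0 (?v ` {..<m})" by (auto simp: image_image)
 then have tr: "?C = (%x. y0 + x) ` ?Z" by (simp only: convex_hull_translation)
 have v: "?v i \<in> L" if "i < m" for i using y that L(1) by (auto intro: subspace_diff)
 have "emeasure (hausdorff_measure m) ?C = emeasure (leb L) ?C"
  using hausdorff_measure_subspace[OF L(1), of ?C] sub cl L(2) by simp
 also have "... = (INT+ x. indicator ?C x wrt leb L)" using cl by simp
 also have "... = (INT+ x. indicator ?C (x + y0) wrt leb L)"
  using cl by (intro leb_translate[OF L(1) y(1), symmetric]) auto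
 also have "... = (INT+ x. indicator ?Z x wrt leb L)"
  unfolding tr by (intro nn_integral_cong) (auto simp: indicator_def add.commute)
 finally have H: "emeasure (hausdorff_measure m) ?C = (INT+ x. indicator ?Z x wrt leb L)" .
 show ?thesis
 proof (cases "gs_vol m ?v = 0")
  case True
  have "?Z \<subseteq> span (?v ` {..<m})" by (intro hull_minimal) (auto intro: span_base span_0 subspace_imp_convex)
  moreover have "emeasure (leb L) (span (?v ` {..<m})) = 0"
  proof (rule leb_null_subspace[OF L(1) subspace_span])
   show "span (?v ` {..<m}) \<subseteq> L" using v by (intro span_minimal L(1)) auto
   show "dim (span (?v ` {..<m})) < dim L" using gs_vol_0_dim[OF True] L(2) by simp
  qed
  moreover have "span (?v ` {..<m}) \<in> sets borel" by (simp add: closed_subspace borel_closed)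
  ultimately have "emeasure (leb L) ?Z = 0" using emeasure_mono[of ?Z "span (?v ` {..<m})" "leb L"] by simp
  then show ?thesis using H True cl unfolding simplex_volume_def by (simp add: measure_def)
 next
  case False
  have sp: "span (?v ` {..<m}) = L" using gs_vol_neq_0_span[OF False L v] by simp
  have nz: "?v i \<notin> span (?v ` {..<i})" if "i < m" for i
   using False that gs_vol_neq_0[of m ?v] gs_res_eq_0_iff[of ?v i] by blast
  have inj: "inj_on ?v {..<m}"
  proof (rule linorder_inj_onI)
   show "?v i \<noteq> ?v j" if "i < j" "i \<in> {..<m}" "j \<in> {..<m}" for i j
    using nz[of j] that span_base[of "?v i" "?v ` {..<j}"] by (metis imageI lessThan_iff)
  qed (use nat_le_linear in blast)
  have n0: "0 \<notin> ?v ` {..<m}"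
  proof
   assume "0 \<in> ?v ` {..<m}"
   then obtain i where i: "i < m" "?v i = 0" by auto
   have "0 \<in> span (?v ` {..<i})" by (rule span_0)
   then show False using nz[OF i(1)] unfolding i(2) by blast
  qed
  have b: "onb m (gs_frame ?v) L" using onb_gs_frame[OF False] sp by simp
  \<comment> \<open>At the largest index where two coefficient vectors of the same point differ, the
    corresponding edge would lie in the span of the earlier ones.\<close>
  have ind: "a i = a' i" if eq: "lincomb m ?v a = lincomb m ?v a'" and "i < m" for a a' i
  proof (rule ccontr)
   assume ne: "a i \<noteq> a' i"
   define j where "j = Max {i. i < m \<and> a i \<noteq> a' i}"
   have "j \<in> {i. i < m \<and> a i \<noteq> a' i}" unfolding j_def using ne \<open>i < m\<close> by (intro Max_in) auto
   then have j: "j < m" "a j \<noteq> a' j" by auto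
   have mx: "a k = a' k" if "j < k" "k < m" for k
   proof (rule ccontr)
    assume "a k \<noteq> a' k"
    then have "k \<le> j" unfolding j_def using that by (intro Max_ge) auto
    then show False using that by simp
   qed
   have "0 = lincomb m ?v (%i. a i - a' i)" using eq lincomb_diff[of m ?v a a'] by simp
   also have "... = (\<Sum>i<Suc j. (a i - a' i) *\<^sub>R ?v i)"
    unfolding lincomb_def using j mx by (intro sum.mono_neutral_right) (auto simp: not_less less_Suc_eq_le)
   also have "... = (\<Sum>i<j. (a i - a' i) *\<^sub>R ?v i) + (a j - a' j) *\<^sub>R ?v j" by simp
   finally have z: "(a j - a' j) *\<^sub>R ?v j = - (\<Sum>i<j. (a i - a' i) *\<^sub>R ?v i)"
    by (metis add.commute add.inverse_unique add.inverse_inverse)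
   have "?v j = (1 / (a j - a' j)) *\<^sub>R ((a j - a' j) *\<^sub>R ?v j)" using j(2) by simp
   also have "... = (1 / (a j - a' j)) *\<^sub>R (- (\<Sum>i<j. (a i - a' i) *\<^sub>R ?v i))" by (simp only: z)
   also have "... \<in> span (?v ` {..<j})" by (intro span_scale span_neg span_sum span_base) auto
   finally show False using nz[OF j(1)] by blast
  qed
  have C0: "?Z = {lincomb m ?v a |a. (\<forall>i<m. 0 \<le> a i) \<and> sum a {..<m} \<le> 1}"
  proof -
   have "?Z = {y. \<exists>u. (\<forall>x\<in>?v ` {..<m}. 0 \<le> u x) \<and> sum u (?v ` {..<m}) \<le> 1 \<and> (\<Sum>x\<in>?v ` {..<m}. u x *\<^sub>R x) = y}"
    by (rule Starlike.simplex) (use n0 in auto)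
   also have "... = {lincomb m ?v a |a. (\<forall>i<m. 0 \<le> a i) \<and> sum a {..<m} \<le> 1}"
   proof (intro equalityI subsetI)
    fix z assume "z \<in> {y. \<exists>u. (\<forall>x\<in>?v ` {..<m}. 0 \<le> u x) \<and> sum u (?v ` {..<m}) \<le> 1 \<and> (\<Sum>x\<in>?v ` {..<m}. u x *\<^sub>R x) = y}"
    then obtain u where u: "\<forall>x\<in>?v ` {..<m}. 0 \<le> u x" "sum u (?v ` {..<m}) \<le> 1" "(\<Sum>x\<in>?v ` {..<m}. u x *\<^sub>R x) = z" by blast
    then have "z = lincomb m ?v (%i. u (?v i))" "(\<forall>i<m. 0 \<le> u (?v i))" "sum (%i. u (?v i)) {..<m} \<le> 1"
     using inj by (auto simp: sum.reindex lincomb_def)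
    then show "z \<in> {lincomb m ?v a |a. (\<forall>i<m. 0 \<le> a i) \<and> sum a {..<m} \<le> 1}" by blast
   next
    fix z assume "z \<in> {lincomb m ?v a |a. (\<forall>i<m. 0 \<le> a i) \<and> sum a {..<m} \<le> 1}"
    then obtain a where a: "z = lincomb m ?v a" "\<forall>i<m. 0 \<le> a i" "sum a {..<m} \<le> 1" by blast
    define u where "u x = a (the_inv_into {..<m} ?v x)" for x
    have ui: "u (?v i) = a i" if "i < m" for i unfolding u_def using the_inv_into_f_f[OF inj, of i] that by simp
    have "(\<forall>x\<in>?v ` {..<m}. 0 \<le> u x) \<and> sum u (?v ` {..<m}) \<le> 1 \<and> (\<Sum>x\<in>?v ` {..<m}. u x *\<^sub>R x) = z"
     using a ui inj by (simp add: sum.reindex lincomb_def)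
    then show "z \<in> {y. \<exists>u. (\<forall>x\<in>?v ` {..<m}. 0 \<le> u x) \<and> sum u (?v ` {..<m}) \<le> 1 \<and> (\<Sum>x\<in>?v ` {..<m}. u x *\<^sub>R x) = y}" by blast
   qed
   finally show ?thesis .
  qed
  let ?M = "PiM {..<m} (%_. lborel :: real measure)"
  let ?S = "{x. (\<forall>i\<in>{..<m}. 0 \<le> x i) \<and> sum x {..<m} \<le> 1} \<inter> space ?M"
  have Sm: "?S \<in> sets ?M"
  proof -
   have "{x \<in> space ?M. (\<forall>i\<in>{..<m}. 0 \<le> x i) \<and> sum x {..<m} \<le> 1} \<in> sets ?M" by measurable
   moreover have "?S = {x \<in> space ?M. (\<forall>i\<in>{..<m}. 0 \<le> x i) \<and> sum x {..<m} \<le> 1}" by blast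
   ultimately show ?thesis by metis
  qed
  have "(INT+ x. indicator ?Z x wrt leb L) = ennreal (gs_vol m ?v) * (INT+ a. indicator ?Z (lincomb m ?v a) wrt ?M)"
   using nn_integral_lincomb[OF False, of "indicator ?Z"] cl sp by simp
  also have "(INT+ a. indicator ?Z (lincomb m ?v a) wrt ?M) = (INT+ a. indicator ?S a wrt ?M)"
  proof (rule nn_integral_cong)
   fix a assume a: "a \<in> space ?M"
   have "lincomb m ?v a \<in> ?Z \<longleftrightarrow> (\<forall>i<m. 0 \<le> a i) \<and> sum a {..<m} \<le> 1"
   proof
    assume "lincomb m ?v a \<in> ?Z"
    then obtain a' where a': "lincomb m ?v a = lincomb m ?v a'" "\<forall>i<m. 0 \<le> a' i" "sum a' {..<m} \<le> 1"
     unfolding C0 by blast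
    have "a i = a' i" if "i < m" for i by (rule ind[OF a'(1) that])
    moreover from this have "sum a {..<m} = sum a' {..<m}" by (intro sum.cong) auto
    ultimately show "(\<forall>i<m. 0 \<le> a i) \<and> sum a {..<m} \<le> 1" using a' by simp
   qed (unfold C0, blast)
   then show "indicator ?Z (lincomb m ?v a) = (indicator ?S a :: ennreal)" using a by (simp add: indicator_def Ball_def)
  qed
  also have "... = emeasure ?M ?S" using Sm by simp
  also have "... = ennreal (1 ^ card {..<m} / fact (card {..<m}))"
   by (rule emeasure_std_simplex_aux) auto
  finally have "emeasure (hausdorff_measure m) ?C = ennreal (gs_vol m ?v) * ennreal (1 / fact m)"
   unfolding H by simp
  also have "... = ennreal (gs_vol m ?v * (1 / fact m))"
   by (rule ennreal_mult[symmetric]) (auto simp: gs_vol_nonneg)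
  finally have "emeasure (hausdorff_measure m) ?C = ennreal (gs_vol m ?v / fact m)" by simp
  then have "simplex_volume m y0 y = gs_vol m ?v / fact m"
   unfolding simplex_volume_def measure_def using gs_vol_nonneg[of m ?v] by simp
  then show ?thesis by simp
 qed
qed

section \<open>Measures on tuples\<close>

lemma sets_PiM_borel_open:
 assumes "finite I"
 shows "sets (PiM I (%_. borel :: 'a::topological_space measure)) =
  sigma_sets (PiE I (%_. UNIV)) {PiE I U |U. \<forall>i. open (U i)}"
proof -
 let ?E = "{S :: 'a set. open S}"
 let ?P = "{{f\<in>(\<Pi>\<^sub>E i\<in>I. (UNIV :: 'a set)). \<forall>i\<in>j. f i \<in> A i} | A j. j \<in> {I} \<and> A \<in> Pi j (%_. ?E)}"
 have "?P = {PiE I U |U. \<forall>i. open (U i)}" (is "_ = ?R")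
 proof (intro equalityI subsetI)
  fix S assume "S \<in> ?P"
  then obtain A where A: "A \<in> Pi I (%_. ?E)" "S = {f\<in>(\<Pi>\<^sub>E i\<in>I. UNIV). \<forall>i\<in>I. f i \<in> A i}" by blast
  then have "S = PiE I (%i. if i \<in> I then A i else UNIV)" "\<forall>i. open (if i \<in> I then A i else UNIV)"
   by (auto simp: PiE_iff Pi_iff intro: extensional_arb)
  then show "S \<in> ?R" by blast
 next
  fix S assume "S \<in> ?R"
  then obtain U where U: "S = PiE I U" "\<forall>i. open (U i)" by blast
  then have "S = {f\<in>(\<Pi>\<^sub>E i\<in>I. UNIV). \<forall>i\<in>I. f i \<in> U i}" "U \<in> Pi I (%_. ?E)" by (auto simp: PiE_iff intro: extensional_arb)
  then show "S \<in> ?P" by blast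
 qed
 moreover have "sets (\<Pi>\<^sub>M i\<in>I. sigma UNIV ?E) = sets (sigma (\<Pi>\<^sub>E i\<in>I. UNIV) ?P)"
 proof (rule sets_PiM_sigma)
  show "\<exists>S\<subseteq>?E. countable S \<and> UNIV = \<Union>S" if "i \<in> I" for i
   by (rule exI[of _ "{UNIV}"]) simp
  show "?E \<subseteq> Pow UNIV" if "i \<in> I" for i by simp
  show "finite j" if "j \<in> {I}" for j using that assms by simp
 qed simp
 moreover have "?R \<subseteq> Pow (\<Pi>\<^sub>E i\<in>I. UNIV)" by (auto simp: PiE_iff)
 ultimately have "sets (\<Pi>\<^sub>M i\<in>I. sigma UNIV ?E) = sigma_sets (\<Pi>\<^sub>E i\<in>I. UNIV) ?R"
  by (simp only: sets_measure_of)
 moreover have "(borel :: 'a measure) = sigma UNIV ?E" by (simp add: borel_def)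
 ultimately show ?thesis by simp
qed

lemma PiM_borel_eqI_open:
 fixes M N :: "('i => 'a::euclidean_space) measure"
 assumes I: "finite I" and sets: "sets M = sets (bPi I)" "sets N = sets (bPi I)"
  and eq: "\<And>U. (\<And>i. open (U i)) ==> emeasure M (PiE I U) = emeasure N (PiE I U)"
  and fin: "\<And>k::nat. emeasure M (PiE I (%_. ball 0 (real k))) \<noteq> \<infinity>"
 shows "M = N"
proof (rule measure_eqI_generator_eq)
 let ?E = "{PiE I U |U :: 'i => 'a set. \<forall>i. open (U i)}"
 show "Int_stable ?E"
 proof (rule Int_stableI)
  fix a b assume "a \<in> ?E" "b \<in> ?E"
  then obtain U V where "a = PiE I U" "\<forall>i. open (U i)" "b = PiE I V" "\<forall>i. open (V i)" by blast
  then have "a \<inter> b = PiE I (%i. U i \<inter> V i)" "\<forall>i. open (U i \<inter> V i)" by auto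
  then show "a \<inter> b \<in> ?E" by blast
 qed
 show "?E \<subseteq> Pow (PiE I (%_. UNIV))" by (auto simp: PiE_iff)
 show "sets M = sigma_sets (PiE I (%_. UNIV)) ?E" "sets N = sigma_sets (PiE I (%_. UNIV)) ?E"
  using sets sets_PiM_borel_open[OF I, where 'a = 'a] by auto
 show "emeasure M X = emeasure N X" if "X \<in> ?E" for X using that eq by blast
 show "range (%k. PiE I (%_. ball 0 (real k))) \<subseteq> ?E" by auto
 show "(\<Union>k. PiE I (%_. ball 0 (real k))) = PiE I (%_. UNIV :: 'a set)"
 proof (intro equalityI subsetI)
  fix x :: "'i => 'a" assume x: "x \<in> PiE I (%_. UNIV)"
  obtain k where k: "(\<Sum>i\<in>I. norm (x i)) < real k" using reals_Archimedean2 by blast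
  have "norm (x i) < real k" if "i \<in> I" for i
   using member_le_sum[of i I "%i. norm (x i)"] I that k by auto
  then have "x \<in> PiE I (%_. ball 0 (real k))" using x by (auto simp: PiE_iff)
  then show "x \<in> (\<Union>k. PiE I (%_. ball 0 (real k)))" by blast
 qed (auto simp: PiE_iff)
qed (use fin in auto)

text \<open>Christensen's argument: two finite measures of equal mass for which all balls of a given radius around points
 of \<open>X\<close> have the same measure agree. Fubini shows that balls have the same measure for both, and
 then Fatou's lemma compares the measures of open sets.\<close>

lemma uniformly_distributed_measures_eq:
 fixes al \<beta> :: "('i => 'a::euclidean_space) measure"
 defines "B \<equiv> %I x r. PiE I (%i. ball (x i) r)"
 assumes I: "finite I" and sets[measurable_cong]: "sets al = sets (bPi I)" "sets \<beta> = sets (bPi I)"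
  and fin: "finite_measure al" "finite_measure \<beta>"
  and mass: "emeasure al (space al) = emeasure \<beta> (space \<beta>)"
  and X: "AE x in al. x \<in> X" "AE x in \<beta>. x \<in> X"
  and unif: "\<And>x y r. x \<in> X ==> y \<in> X ==> emeasure al (B I x r) = emeasure al (B I y r)"
   "\<And>x y r. x \<in> X ==> y \<in> X ==> emeasure \<beta> (B I x r) = emeasure \<beta> (B I y r)"
 shows "al = \<beta>"
proof (cases "emeasure al (space al) = 0")
 case True
 then have "emeasure al A = 0" "emeasure \<beta> A = 0" for A
  using mass emeasure_space[of al A] emeasure_space[of \<beta> A] by auto
 then show ?thesis using sets by (intro measure_eqI) auto
next
 case False
 interpret al: finite_measure al by fact
 interpret \<beta>: finite_measure \<beta> by fact
 interpret P: pair_sigma_finite al \<beta> ..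
 have space: "space al = PiE I (%_. UNIV)" "space \<beta> = PiE I (%_. UNIV)"
  using sets[THEN sets_eq_imp_space_eq] by (auto simp: space_PiM)
 have Bm[measurable]: "B I x r \<in> sets (bPi I)" for x r
  unfolding B_def using I by (intro sets_PiM_I_finite) auto
 let ?near = "%r x y. indicator (B I x r) y :: ennreal"
 have near_sym: "?near r x y = ?near r y x" if "x \<in> PiE I (%_. UNIV)" "y \<in> PiE I (%_. UNIV)" for r x y
  using that by (auto simp: B_def indicator_def PiE_iff dist_commute)
 have near_meas[measurable]: "(%p. ?near r (fst p) (snd p)) \<in> bmeas (bPi I \<Otimes>\<^sub>M bPi I)" for r
 proof -
  have "(%p. ?near r (fst p) (snd p)) \<in> bmeas (bPi I \<Otimes>\<^sub>M bPi I) \<longleftrightarrow>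
   (%p. if \<forall>i\<in>I. dist (fst p i) (snd p i) < r then 1 else 0 :: ennreal) \<in> bmeas (PiM I (%_. borel :: 'a measure) \<Otimes>\<^sub>M bPi I)"
   by (rule measurable_cong) (auto simp: B_def indicator_def space_pair_measure space_PiM PiE_iff)
  also have "..." using I by measurable
  finally show ?thesis .
 qed
 obtain x0 where x0: "x0 \<in> X"
 proof (rule ccontr)
  assume "\<not> thesis"
  then have "X = {}" using that by auto
  then have "AE x in al. False" using X(1) by simp
  then have "emeasure al (space al) = 0" by (subst (asm) AE_iff_measurable[where N = "space al"]) auto
  then show False using False by simp
 qed
 define h where "h r = emeasure al (B I x0 r)" for r
 define g where "g r = emeasure \<beta> (B I x0 r)" for r
 have h: "emeasure al (B I x r) = h r" and g: "emeasure \<beta> (B I x r) = g r" if "x \<in> X" for x r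
  unfolding h_def g_def by (rule unif(1)[OF that x0], rule unif(2)[OF that x0])
 have hg: "h r = g r" for r
 proof -
  have "g r * emeasure al (space al) = (INT+ x. emeasure \<beta> (B I x r) wrt al)"
   by (subst nn_integral_cong_AE[where v = "%_. g r"]) (use X(1) in eventually_elim, auto simp: g)
  also have "... = (INT+ x. (INT+ y. ?near r x y wrt \<beta>) wrt al)" by simp
  also have "... = (INT+ y. (INT+ x. ?near r x y wrt al) wrt \<beta>)"
   by (rule P.Fubini'[symmetric]) (use near_meas in \<open>simp add: case_prod_beta'\<close>)
  also have "... = (INT+ y. (INT+ x. ?near r y x wrt al) wrt \<beta>)"
   by (intro nn_integral_cong near_sym) (auto simp: space)
  also have "... = (INT+ y. emeasure al (B I y r) wrt \<beta>)" by simp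
  also have "... = h r * emeasure \<beta> (space \<beta>)"
   by (subst nn_integral_cong_AE[where v = "%_. h r"]) (use X(2) in eventually_elim, auto simp: h)
  finally have "emeasure al (space al) * g r = emeasure al (space al) * h r" using mass by (simp add: mult.commute)
  then show ?thesis using False al.emeasure_finite by (auto simp: ennreal_mult_cancel_left)
 qed
 \<comment> \<open>If balls of radius \<open>r\<close> around points of \<open>X\<close> were null,
   so would be every ball of radius \<open>r / 2\<close>: it either misses \<open>X\<close> or lies
   in such a ball. Countably many of these, with centres in a dense set, cover the space.\<close>
 have pos: "0 < h r" if r: "0 < r" for r
 proof (rule ccontr)
  assume "\<not> 0 < h r"
  then have h0: "h r = 0" by simp
  obtain D :: "'a set" where D: "countable D" "\<And>U. open U ==> U \<noteq> {} ==> \<exists>d\<in>D. d \<in> U"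
   using countable_dense_exists by blast
  let ?C = "PiE I (%_. D)"
  have C: "countable ?C" using I D(1) by (intro countable_PiE) auto
  have "emeasure al (B I d (r/2)) = 0" if "d \<in> ?C" for d
  proof (cases "\<exists>x\<in>X. x \<in> B I d (r/2)")
   case True
   then obtain x where x: "x \<in> X" "x \<in> B I d (r/2)" by blast
   have "B I d (r/2) \<subseteq> B I x r"
   proof
    fix y assume y: "y \<in> B I d (r/2)"
    have "dist (x i) (y i) < r" if "i \<in> I" for i
     using x(2) y that dist_triangle_half_r[of "d i" "x i" r "y i"] by (auto simp: B_def PiE_iff)
    then show "y \<in> B I x r" using y by (auto simp: B_def PiE_iff)
   qed
   then have "emeasure al (B I d (r/2)) \<le> h r" unfolding h[OF x(1), symmetric] by (intro emeasure_mono) auto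
   then show ?thesis using h0 by simp
  next
   case False
   have "AE x in al. x \<notin> B I d (r/2)" using X(1) by eventually_elim (use False in auto)
   moreover have "B I d (r/2) \<in> sets al" using Bm sets(1) by simp
   ultimately have "B I d (r/2) \<in> null_sets al" by (simp only: AE_iff_null_sets)
   then show ?thesis by (rule null_setsD1)
  qed
  then have "B I d (r/2) \<in> null_sets al" if "d \<in> ?C" for d
   using that Bm sets(1) by (intro null_setsI) auto
  then have "(\<Union>d\<in>?C. B I d (r/2)) \<in> null_sets al" by (intro null_sets_UN' C)
  then have "emeasure al (\<Union>d\<in>?C. B I d (r/2)) = 0" by (rule null_setsD1)
  moreover have "(\<Union>d\<in>?C. B I d (r/2)) = space al"
  proof (intro equalityI subsetI)
   fix x assume x: "x \<in> space al"
   have "\<exists>d\<in>D. d \<in> ball (x i) (r/2)" for i using r by (intro D(2)) auto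
   then obtain d where d: "\<And>i. d i \<in> D" "\<And>i. d i \<in> ball (x i) (r/2)" by metis
   then have "restrict d I \<in> ?C" "x \<in> B I (restrict d I) (r/2)"
    using x by (auto simp: B_def PiE_iff space dist_commute)
   then show "x \<in> (\<Union>d\<in>?C. B I d (r/2))" by blast
  qed (auto simp: B_def PiE_iff space)
  ultimately show False using False by simp
 qed
 have hfin: "h r < \<infinity>" for r unfolding h_def using al.emeasure_finite[of "B I x0 r"] by (simp add: less_top[symmetric])
 have le: "emeasure \<mu> (PiE I U) \<le> emeasure \<mu>' (PiE I U)"
  if U: "\<And>i. open (U i)" and \<mu>: "finite_measure \<mu>" "finite_measure \<mu>'" "AE x in \<mu>. x \<in> X" "AE x in \<mu>'. x \<in> X"
   and hm: "\<And>x r. x \<in> X ==> emeasure \<mu> (B I x r) = h r" "\<And>x r. x \<in> X ==> emeasure \<mu>' (B I x r) = h r"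
   and s[measurable_cong]: "sets \<mu> = sets (bPi I)" "sets \<mu>' = sets (bPi I)"
  for U and \<mu> \<mu>' :: "('i => 'a) measure"
 proof -
  interpret \<mu>: finite_measure \<mu> by fact
  interpret \<mu>': finite_measure \<mu>' by fact
  interpret Q: pair_sigma_finite \<mu> \<mu>' ..
  have sp: "space \<mu> = PiE I (%_. UNIV)" "space \<mu>' = PiE I (%_. UNIV)"
   using s[THEN sets_eq_imp_space_eq] by (auto simp: space_PiM)
  let ?U = "PiE I U"
  have Um[measurable]: "?U \<in> sets (bPi I)"
   using I U by (intro sets_PiM_I_finite) auto
  let ?r = "%k::nat. 1 / real (Suc k)"
  \<comment> \<open>The proportion of a small ball around \<open>x\<close> that lies in
    \<open>?U\<close>. It is eventually 1 for \<open>x\<close> in \<open>?U\<close>, while by Fubini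
    its integral with respect to \<open>\<mu>\<close> equals the \<open>\<mu>'\<close>-measure of
    \<open>?U\<close> for every \<open>k\<close>.\<close>
  define f where "f k x = emeasure \<mu>' (?U \<inter> B I x (?r k)) / h (?r k)" for k x
  have fint: "f k x = (INT+ y. indicator ?U y * ?near (?r k) x y wrt \<mu>') / h (?r k)" for k x
  proof -
   have "emeasure \<mu>' (?U \<inter> B I x (?r k)) = (INT+ y. indicator (?U \<inter> B I x (?r k)) y wrt \<mu>')" by simp
   then show ?thesis by (simp add: f_def indicator_inter_arith)
  qed
  have jm: "(%p. indicator ?U (snd p) * ?near r (fst p) (snd p)) \<in> bmeas (\<mu> \<Otimes>\<^sub>M \<mu>')" for r
   using borel_measurable_times_ennreal[OF measurable_compose[OF measurable_snd borel_measurable_indicator[OF Um]] near_meas[of r]]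
   by (simp add: measurable_cong_sets[OF sets_pair_measure_cong[OF s] refl])
  have im: "(%x. INT+ y. indicator ?U y * ?near r x y wrt \<mu>') \<in> bmeas \<mu>" for r
   using jm[of r] by (intro \<mu>'.borel_measurable_nn_integral) (simp add: case_prod_beta')
  have fm[measurable]: "f k \<in> bmeas \<mu>" for k
   unfolding fint[abs_def] by (intro borel_measurable_divide_ennreal im) simp
  have "emeasure \<mu> ?U = (INT+ x. indicator ?U x wrt \<mu>)" by simp
  also have "... \<le> (INT+ x. liminf (%k. f k x) wrt \<mu>)"
  proof (rule nn_integral_mono_AE, use \<mu>(3) in eventually_elim)
   case (elim x)
   show ?case
   proof (cases "x \<in> ?U")
    case True
    have "\<exists>e>0. ball (x i) e \<subseteq> U i" if "i \<in> I" for i using U True that by (auto simp: open_contains_ball PiE_iff)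
    then obtain e where e: "\<And>i. i \<in> I ==> 0 < e i \<and> ball (x i) (e i) \<subseteq> U i" by metis
    define d where "d = Min (insert 1 (e ` I))"
    have d: "0 < d" "\<And>i. i \<in> I ==> d \<le> e i" using I e by (auto simp: d_def)
    obtain k0 where k0: "?r k0 < d" using reals_Archimedean[OF d(1)] by (auto simp: inverse_eq_divide)
    have "f k x = 1" if "k0 \<le> k" for k
    proof -
     have "?r k \<le> ?r k0" using that by (simp add: field_simps)
     then have "B I x (?r k) \<subseteq> ?U" unfolding B_def
     proof (intro PiE_mono)
      fix i assume "i \<in> I" "?r k \<le> ?r k0"
      then have "ball (x i) (?r k) \<subseteq> ball (x i) (e i)" using k0 d(2)[of i] by (intro subset_ball) linarith
      then show "ball (x i) (?r k) \<subseteq> U i" using e[OF \<open>i \<in> I\<close>] by blast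
     qed
     then have "?U \<inter> B I x (?r k) = B I x (?r k)" by blast
     then show ?thesis unfolding f_def using hm(2)[OF elim] pos[of "?r k"] hfin[of "?r k"]
      by (simp add: ennreal_divide_self less_top[symmetric])
    qed
    then have "\<forall>\<^sub>F k in sequentially. f k x = 1" by (auto simp: eventually_sequentially)
    then have "1 \<le> liminf (%k. f k x)" by (intro Liminf_bounded) (auto elim: eventually_mono)
    then show ?thesis using True by simp
   qed simp
  qed
  also have "... \<le> liminf (%k. INT+ x. f k x wrt \<mu>)" by (rule nn_integral_liminf) measurable
  also have "(%k. INT+ x. f k x wrt \<mu>) = (%k. emeasure \<mu>' ?U)"
  proof
   fix k
   have "(INT+ x. f k x wrt \<mu>) = (INT+ x. (INT+ y. indicator ?U y * ?near (?r k) x y wrt \<mu>') wrt \<mu>) / h (?r k)"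
    unfolding fint by (intro nn_integral_divide im)
   also have "(INT+ x. (INT+ y. indicator ?U y * ?near (?r k) x y wrt \<mu>') wrt \<mu>) = (INT+ y. (INT+ x. indicator ?U y * ?near (?r k) x y wrt \<mu>) wrt \<mu>')"
    using jm[of "?r k"] by (intro Q.Fubini'[symmetric]) (simp add: case_prod_beta')
   also have "... = (INT+ y. indicator ?U y * h (?r k) wrt \<mu>')"
   proof (rule nn_integral_cong_AE, use \<mu>(4) AE_space in eventually_elim)
    case (elim y)
    have "(INT+ x. indicator ?U y * ?near (?r k) x y wrt \<mu>) = (INT+ x. indicator ?U y * ?near (?r k) y x wrt \<mu>)"
     using elim(2) by (intro nn_integral_cong arg_cong2[where f = "(*)"] near_sym refl) (auto simp: sp)
    also have "... = indicator ?U y * h (?r k)"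
     using hm(1)[OF elim(1)] by (subst nn_integral_cmult) auto
    finally show ?case .
   qed
   also have "... = emeasure \<mu>' ?U * h (?r k)" by (simp add: nn_integral_multc)
   finally show "(INT+ x. f k x wrt \<mu>) = emeasure \<mu>' ?U"
    using pos[of "?r k"] hfin[of "?r k"] by (simp add: ennreal_divide_times mult_divide_eq_ennreal less_top[symmetric])
  qed
  finally show ?thesis by (simp add: Liminf_const)
 qed
 show ?thesis
 proof (rule PiM_borel_eqI_open[OF I sets])
  fix U :: "'i => 'a set" assume U: "\<And>i. open (U i)"
  show "emeasure al (PiE I U) = emeasure \<beta> (PiE I U)"
   using le[OF U fin X, OF h _ sets] le[OF U fin(2,1) X(2,1), OF _ h sets(2,1)] g hg by (intro antisym) auto
 qed simp
qed

section \<open>Projections as measurable kernels\<close>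

lemma dim_orthogonal_comp: "subspace W ==> dim (orthogonal_comp W) = DIM('a) - dim (W :: 'a::euclidean_space set)"
 and subspace_sum_orthogonal_comp: "subspace W ==> subspace_sum W (orthogonal_comp W) = UNIV"
proof -
 assume W: "subspace W"
 have sub: "subspace (orthogonal_comp W)" by (rule subspace_orthogonal_comp)
 have orth: "\<forall>x\<in>W. \<forall>y\<in>orthogonal_comp W. x \<bullet> y = 0" by (auto simp: orthogonal_comp_def orthogonal_def)
 show sum: "subspace_sum W (orthogonal_comp W) = UNIV"
 proof (intro equalityI subsetI UNIV_I)
  fix x
  have "x - orth_proj W x \<in> orthogonal_comp W"
   using orth_proj_orthogonal[OF W] by (auto simp: orthogonal_comp_def orthogonal_def inner_commute)
  moreover have "x = orth_proj W x + (x - orth_proj W x)" by simp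
  ultimately show "x \<in> subspace_sum W (orthogonal_comp W)"
   unfolding subspace_sum_def using orth_proj_in[OF W] by blast
 qed
 show "dim (orthogonal_comp W) = DIM('a) - dim W"
  using dim_subspace_sum[OF W sub orth] unfolding sum by simp
qed

lemma indicator_orth_proj_measurable:
 assumes W: "subspace (W :: 'a::euclidean_space set)"
 shows "(%x. indicator (cball 0 1) (x - orth_proj W x) :: ennreal) \<in> bmeas borel"
proof -
 note [measurable] = orth_proj_measurable[OF W]
 have "(%x. x - orth_proj W x) \<in> bmeas borel" by measurable
 then show ?thesis by (rule measurable_compose) (intro borel_measurable_indicator, simp)
qed

text \<open>The right side integrates against the fixed measure \<open>lborel\<close>, and
  \<open>W\<close> enters only through the integrand: the directions orthogonal to \<open>W\<close>
  are averaged over their unit ball. This is what later makes integrals over a varying subspace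
  measurable in that subspace.\<close>

lemma nn_integral_leb_kernel:
 fixes W :: "'a::euclidean_space set"
 assumes W: "subspace W" and [measurable]: "F \<in> bmeas borel"
 shows "(INT+ x. F x wrt leb W) = (INT+ x. F (orth_proj W x) *
  (ennreal (1 / unit_ball_vol (DIM('a) - dim W)) * indicator (cball 0 1) (x - orth_proj W x)) wrt lborel)"
proof -
 let ?P = "orth_proj W" and ?U = "orthogonal_comp W" and ?\<omega> = "unit_ball_vol (DIM('a) - dim W)"
 have U: "subspace ?U" by (rule subspace_orthogonal_comp)
 note [measurable] = orth_proj_measurable[OF W] indicator_orth_proj_measurable[OF W]
 have orth: "\<forall>x\<in>W. \<forall>y\<in>?U. x \<bullet> y = 0" by (auto simp: orthogonal_comp_def orthogonal_def)
 have "?\<omega> \<noteq> 0" using unit_ball_vol_pos[of "DIM('a) - dim W"] by linarith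
 then have \<omega>: "ennreal (1 / ?\<omega>) * ennreal ?\<omega> = 1" by (subst ennreal_mult[symmetric]) simp_all
 have ball: "(INT+ y. indicator (cball 0 1) y wrt leb ?U) = ennreal ?\<omega>"
  using emeasure_leb_cball[OF U, of 1] by (simp add: dim_orthogonal_comp[OF W])
 have "(INT+ x. F (?P x) * (ennreal (1 / ?\<omega>) * indicator (cball 0 1) (x - ?P x)) wrt lborel)
  = (INT+ x. (INT+ y. F (?P (x + y)) * (ennreal (1 / ?\<omega>) * indicator (cball 0 1) ((x + y) - ?P (x + y))) wrt leb ?U) wrt leb W)"
  using nn_integral_leb_sum[OF W U orth, of "%x. F (?P x) * (ennreal (1 / ?\<omega>) * indicator (cball 0 1) (x - ?P x))"]
  unfolding subspace_sum_orthogonal_comp[OF W] leb_UNIV by measurable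
 also have "... = (INT+ x. F x wrt leb W)"
 proof (rule nn_integral_cong_AE, use AE_leb_in[OF W] in eventually_elim)
  case (elim x)
  have "(INT+ y. F (?P (x + y)) * (ennreal (1 / ?\<omega>) * indicator (cball 0 1) ((x + y) - ?P (x + y))) wrt leb ?U)
   = (INT+ y. (F x * ennreal (1 / ?\<omega>)) * indicator (cball 0 1) y wrt leb ?U)"
  proof (rule nn_integral_cong_AE, use AE_leb_in[OF U] in eventually_elim)
   case (elim y)
   have "?P (x + y) = x"
    by (rule orth_proj_eqI[OF W \<open>x \<in> W\<close>]) (use elim orth in \<open>auto simp: inner_commute\<close>)
   then show ?case by (simp add: mult.assoc)
  qed
  also have "... = (F x * ennreal (1 / ?\<omega>)) * (INT+ y. indicator (cball 0 1) y wrt leb ?U)"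
   by (rule nn_integral_cmult) (intro borel_measurable_indicator, simp)
  also have "... = F x" unfolding ball by (simp only: mult.assoc \<omega> mult_1_right)
  finally show ?case .
 qed
 finally show ?thesis by simp
qed

lemma nn_integral_leb_tuple_kernel:
 fixes W :: "'a::euclidean_space set"
 assumes W: "subspace W" and I: "finite I" and F: "F \<in> bmeas (bPi I)"
 shows "(INT+ x. F x wrt PiM I (%_. leb W)) = (INT+ x. F (\<lambda>i\<in>I. orth_proj W (x i)) *
  (\<Prod>i\<in>I. ennreal (1 / unit_ball_vol (DIM('a) - dim W)) * indicator (cball 0 1) (x i - orth_proj W (x i))) wrt lPi I)"
proof (rule nn_integral_PiM_transfer[OF I, where h = "%_. orth_proj W"])
 note [measurable] = orth_proj_measurable[OF W]
 show "orth_proj W \<in> lborel \<rightarrow>\<^sub>M leb W" by (simp add: measurable_cong_sets[OF refl sets_leb])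
 show "(%x. ennreal (1 / unit_ball_vol (real (DIM('a) - dim W))) * indicator (cball 0 1) (x - orth_proj W x)) \<in> bmeas lborel"
  using indicator_orth_proj_measurable[OF W] by simp
 show "F \<in> bmeas (PiM I (%_. leb W))"
  using F by (simp cong: measurable_cong_sets sets_PiM_cong)
qed (auto intro: sigma_finite_lborel sigma_finite_leb[OF W] nn_integral_leb_kernel[OF W])

section \<open>The shape of a tuple relative to its Gram-Schmidt frame\<close>

lemma subspace_subspace_sum': "subspace A ==> subspace B ==> subspace (subspace_sum A B)"
 unfolding subspace_sum_def by (rule subspace_sums)

lemma relative_complement:
 fixes E W :: "'a::euclidean_space set"
 assumes W: "subspace W" and E: "subspace E" "E \<subseteq> W"
 defines "U \<equiv> {x \<in> W. \<forall>y\<in>E. x \<bullet> y = 0}"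
 shows "subspace U" "subspace_sum E U = W" "\<forall>x\<in>E. \<forall>y\<in>U. x \<bullet> y = 0" "dim U = dim W - dim E"
proof -
 show U: "subspace U" using W unfolding U_def by (auto simp: subspace_def inner_add_left)
 show orth: "\<forall>x\<in>E. \<forall>y\<in>U. x \<bullet> y = 0" by (auto simp: U_def inner_commute)
 show sum: "subspace_sum E U = W"
 proof (intro equalityI subsetI)
  fix x assume "x \<in> subspace_sum E U"
  then show "x \<in> W" using E W by (auto simp: subspace_sum_def U_def intro: subspace_add)
 next
  fix x assume x: "x \<in> W"
  have p: "orth_proj E x \<in> E" by (rule orth_proj_in[OF E(1)])
  have "x - orth_proj E x \<in> U"
   using x p E W orth_proj_orthogonal[OF E(1)] by (auto simp: U_def intro: subspace_diff)
  moreover have "x = orth_proj E x + (x - orth_proj E x)" by simp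
  ultimately show "x \<in> subspace_sum E U" unfolding subspace_sum_def using p by blast
 qed
 show "dim U = dim W - dim E" using dim_subspace_sum[OF E(1) U orth] sum by simp
qed

lemma nn_integral_radial:
 fixes U :: "'a::euclidean_space set"
 assumes U: "subspace U" "0 < dim U" and [measurable]: "k \<in> bmeas borel"
 shows "(INT+ u. k (norm u) wrt leb U) = (INT+ s. k s * (ennreal (sphere_area (dim U) * s ^ (dim U - 1)) * indicator {0<..} s) wrt lborel)"
proof -
 have "(INT+ u. k (norm u) wrt leb U)
  = (INT+ z. (INT+ t. k (norm (t *\<^sub>R z)) * (ennreal (t ^ (dim U - 1)) * indicator {0<..} t) wrt lborel) wrt unit_sphere_measure U)"
  by (rule nn_integral_polar[OF U]) measurable
 also have "... = (INT+ z. (INT+ t. k t * (ennreal (t ^ (dim U - 1)) * indicator {0<..} t) wrt lborel) wrt unit_sphere_measure U)"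
  by (intro nn_integral_cong) (auto simp: unit_sphere_def indicator_def)
 also have "... = (INT+ t. k t * (ennreal (t ^ (dim U - 1)) * indicator {0<..} t) wrt lborel) * ennreal (sphere_area (dim U))"
  using emeasure_unit_sphere_measure[OF U(1)] sphere_area_eq[OF U(2)] by simp
 also have "... = (INT+ t. k t * (ennreal (t ^ (dim U - 1)) * indicator {0<..} t) * ennreal (sphere_area (dim U)) wrt lborel)"
  by (rule nn_integral_multc[symmetric]) measurable
 also have "... = (INT+ s. k s * (ennreal (sphere_area (dim U) * s ^ (dim U - 1)) * indicator {0<..} s) wrt lborel)"
 proof (rule nn_integral_cong)
  fix s :: real
  have "0 \<le> sphere_area (dim U)" using sphere_area_eq[OF U(2)] by simp
  then show "k s * (ennreal (s ^ (dim U - 1)) * indicator {0<..} s) * ennreal (sphere_area (dim U))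
   = k s * (ennreal (sphere_area (dim U) * s ^ (dim U - 1)) * indicator {0<..} s)"
   by (simp add: ennreal_mult' mult_ac)
 qed
 finally show ?thesis .
qed

text \<open>Inserting the product of the indicators of \<open>W\<close> as a weight changes no
  integral; for the indicator of the exceptional set the weighted integrand is 0.\<close>

lemma AE_PiM_leb_in:
 fixes W :: "'a::euclidean_space set"
 assumes "subspace W" "finite I"
 shows "AE x in PiM I (%_. leb W). \<forall>i\<in>I. x i \<in> W"
proof -
 have sf: "sigma_finite_measure (leb W)" by (rule sigma_finite_leb[OF assms(1)])
 have Wm: "W \<in> sets borel" using assms(1) by (simp add: closed_subspace borel_closed)
 have "(INT+ x. (\<Prod>i\<in>I. indicator W (x i)) * F x wrt PiM I (%_. leb W)) = (INT+ x. F x wrt PiM I (%_. leb W))"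
  if F: "F \<in> bmeas (PiM I (%_. leb W))" for F
 proof -
  have "(INT+ x. F x wrt PiM I (%_. leb W)) = (INT+ x. F (\<lambda>i\<in>I. x i) * (\<Prod>i\<in>I. indicator W (x i)) wrt PiM I (%_. leb W))"
  proof (rule nn_integral_PiM_transfer[OF assms(2) sf sf _ _ _ F, where h = "%_ x. x" and w = "%_. indicator W"])
   fix G :: "'a => ennreal" 
   show "(INT+ y. G y wrt leb W) = (INT+ x. G x * indicator W x wrt leb W)"
    using AE_leb_in[OF assms(1)] by (intro nn_integral_cong_AE) auto
  qed (use Wm in auto)
  also have "... = (INT+ x. (\<Prod>i\<in>I. indicator W (x i)) * F x wrt PiM I (%_. leb W))"
   by (intro nn_integral_cong) (auto simp: space_PiM PiE_def extensional_restrict mult.commute)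
  finally show ?thesis by simp
 qed
 note * = this
 let ?N = "{x \<in> space (PiM I (%_. leb W)). \<not> (\<forall>i\<in>I. x i \<in> W)}"
 have Nm: "?N \<in> sets (PiM I (%_. leb W))"
 proof -
  have A: "{x \<in> space (PiM I (%_. leb W)). \<forall>i\<in>I. x i \<in> W} \<in> sets (PiM I (%_. leb W))"
   using assms(2) Wm by (intro sets.sets_Collect_finite_All measurable_sets_Collect[OF measurable_component_singleton, where P = "%x. x \<in> W"]) auto
  have N: "?N = space (PiM I (%_. leb W)) - {x \<in> space (PiM I (%_. leb W)). \<forall>i\<in>I. x i \<in> W}"
   by blast
  show ?thesis unfolding N by (rule sets.compl_sets[OF A])
 qed
 have "emeasure (PiM I (%_. leb W)) ?N = (INT+ x. indicator ?N x wrt PiM I (%_. leb W))" using Nm by simp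
 also have "... = (INT+ x. (\<Prod>i\<in>I. indicator W (x i)) * indicator ?N x wrt PiM I (%_. leb W))"
  using Nm by (intro *[symmetric]) auto
 also have "... = (INT+ x. 0 wrt PiM I (%_. leb W))"
  using assms(2) by (intro nn_integral_cong) (auto simp: indicator_def)
 finally show ?thesis using Nm by (intro AE_I[of _ _ ?N]) auto
qed

locale shape_frame =
 fixes Q :: "'a::euclidean_space set" and b :: "nat => 'a"
 assumes Q: "subspace Q"
  and b: "onb (dim (orthogonal_comp Q)) b (orthogonal_comp Q)"
begin

abbreviation V :: "'a set" where "V \<equiv> orthogonal_comp Q"

lemma subspace_V: "subspace V"
 by (rule subspace_orthogonal_comp)

lemma orth_VQ: "x \<in> V ==> y \<in> Q ==> x \<bullet> y = 0"
 by (auto simp: orthogonal_comp_def orthogonal_def inner_commute)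

lemma V_iff: "x \<in> V \<longleftrightarrow> (\<forall>y\<in>Q. x \<bullet> y = 0)"
 by (auto simp: orthogonal_comp_def orthogonal_def inner_commute)

lemma orth_proj_V: "orth_proj V x = x - orth_proj Q x"
proof (rule orth_proj_eqI[OF subspace_V])
 show "x - orth_proj Q x \<in> V" using orth_proj_orthogonal[OF Q] by (auto simp: V_iff)
 show "(x - (x - orth_proj Q x)) \<bullet> z = 0" if "z \<in> V" for z
  using orth_VQ[OF that orth_proj_in[OF Q, of x]] by (simp add: inner_commute)
qed

text \<open>The coordinates of \<open>x j\<close> in its own Gram-Schmidt frame are written out in
  the fixed basis \<open>b\<close>, and the component in \<open>Q\<close> is kept. A shape is thus a
  vector of the ambient space, and its law can be given by a density with respect to some
  \<open>leb\<close>.\<close>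

definition shape :: "(nat => 'a) => nat => 'a" where
 "shape x j = (\<Sum>i<j. (x j \<bullet> gs_frame (%i. orth_proj V (x i)) i) *\<^sub>R b i)
   + norm (gs_res (%i. orth_proj V (x i)) j) *\<^sub>R b j + orth_proj Q (x j)"

definition shape_space :: "nat => 'a set" where
 "shape_space j = subspace_sum (span (b ` {..<Suc j})) Q"

text \<open>In a \<open>d\<close>-dimensional subspace the residual of point \<open>j\<close> ranges
  over the \<open>d - j\<close> dimensions orthogonal to the earlier points; this is the polar
  density of its norm, the coordinate of the shape along \<open>b j\<close>.\<close>

definition shape_weight :: "nat => nat => 'a => ennreal" where
 "shape_weight d j v = ennreal (sphere_area (d - j) * (v \<bullet> b j) ^ (d - j - 1)) * indicator {0<..} (v \<bullet> b j)"

lemma shape_weight_measurable [measurable]: "shape_weight d j \<in> bmeas borel"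
 unfolding shape_weight_def[abs_def] by measurable

lemma subspace_shape_space: "subspace (shape_space j)"
 unfolding shape_space_def by (intro subspace_subspace_sum' subspace_span Q)

lemma onb_b: "j \<le> dim V ==> onb j b (span (b ` {..<j}))"
 using onb_inner[OF b] by (simp add: onb_def)

text \<open>\<open>L\<close> splits into the span of the frame \<open>e\<close> and its complement
  \<open>U\<close>. The part along \<open>e\<close> is carried isometrically to \<open>b\<close>,
  the part in \<open>U\<close> enters only through its norm and is treated by polar coordinates, the
  part in \<open>Q\<close> is unchanged. The result depends neither on \<open>e\<close> nor on the
  position of \<open>L\<close>.\<close>

lemma nn_integral_shape_step:
 assumes L: "subspace L" "L \<subseteq> V" "dim L = d" and j: "j < d"
  and e: "\<forall>i<j. \<forall>k<j. e i \<bullet> e k = (if i = k then 1 else 0)" "\<And>i. i < j ==> e i \<in> L"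
  and H[measurable]: "H \<in> bmeas borel"
 shows "(INT+ x. H ((\<Sum>i<j. (x \<bullet> e i) *\<^sub>R b i) + norm (orth_proj V x - (\<Sum>i<j. (x \<bullet> e i) *\<^sub>R e i)) *\<^sub>R b j + orth_proj Q x) wrt leb (subspace_sum L Q))
  = (INT+ v. H v * shape_weight d j v wrt leb (shape_space j))"
proof -
 note [measurable] = orth_proj_measurable[OF Q] orth_proj_measurable[OF subspace_V]
 let ?E = "span (e ` {..<j})"
 have eE: "onb j e ?E" using e by (simp add: onb_def)
 have EL: "?E \<subseteq> L" using e L by (intro span_minimal) auto
 define U where "U = {x \<in> L. \<forall>y\<in>?E. x \<bullet> y = 0}"
 note Uc = relative_complement[OF L(1) subspace_span EL, folded U_def]
 have dU: "dim U = d - j" using Uc(4) onb_dim[OF eE] L(3) by simp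
 have dimV: "d \<le> dim V" using dim_subset[OF L(2)] L(3) by simp
 have orthLQ: "\<forall>x\<in>L. \<forall>y\<in>Q. x \<bullet> y = 0" using L(2) orth_VQ by blast
 interpret Qm: sigma_finite_measure "leb Q" by (rule sigma_finite_leb[OF Q])
 define k where "k c s = (INT+ y. H (c + s *\<^sub>R b j + y) wrt leb Q)" for c s
 have km[measurable]: "(%p. k (fst p) (snd p)) \<in> bmeas (borel \<Otimes>\<^sub>M borel)"
  unfolding k_def by measurable
 have km1[measurable]: "(%s. k c s) \<in> bmeas borel" for c
  using measurable_compose[OF measurable_Pair1' km, of c] by simp
 let ?\<Phi> = "%x. H ((\<Sum>i<j. (x \<bullet> e i) *\<^sub>R b i) + norm (orth_proj V x - (\<Sum>i<j. (x \<bullet> e i) *\<^sub>R e i)) *\<^sub>R b j + orth_proj Q x)"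
 have "(INT+ x. ?\<Phi> x wrt leb (subspace_sum L Q)) = (INT+ l. (INT+ y. ?\<Phi> (l + y) wrt leb Q) wrt leb L)"
  by (rule nn_integral_leb_sum[OF L(1) Q orthLQ]) measurable
 also have "... = (INT+ a. (INT+ u. (INT+ y. ?\<Phi> (a + u + y) wrt leb Q) wrt leb U) wrt leb ?E)"
  using nn_integral_leb_sum[OF subspace_span Uc(1) Uc(3), of "%l. INT+ y. ?\<Phi> (l + y) wrt leb Q"]
  unfolding Uc(2) by simp
 also have "... = (INT+ a. (INT+ u. k (lincomb j b (%i. a \<bullet> e i)) (norm u) wrt leb U) wrt leb ?E)"
 proof (rule nn_integral_cong_AE, use AE_leb_in[OF subspace_span] in eventually_elim)
  case (elim a)
  show ?case
  proof (rule nn_integral_cong_AE, use AE_leb_in[OF Uc(1)] in eventually_elim)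
   case (elim u)
   show ?case unfolding k_def
   proof (rule nn_integral_cong_AE, use AE_leb_in[OF Q] in eventually_elim)
    case (elim y)
    have aV: "a \<in> V" "u \<in> V" using \<open>a \<in> ?E\<close> \<open>u \<in> U\<close> EL L(2) by (auto simp: U_def)
    have "(a + u + y) \<bullet> e i = a \<bullet> e i" if "i < j" for i
    proof -
     have "e i \<in> ?E" using that by (auto intro: span_base)
     then have "u \<bullet> e i = 0" "e i \<in> V" using \<open>u \<in> U\<close> EL L(2) by (auto simp: U_def)
     moreover have "y \<bullet> e i = 0" using orth_VQ[OF calculation(2) elim] by (simp add: inner_commute)
     ultimately show ?thesis by (simp add: inner_add_left)
    qed
    then have s: "(\<Sum>i<j. ((a + u + y) \<bullet> e i) *\<^sub>R f i) = lincomb j f (%i. a \<bullet> e i)" for f :: "nat => 'a"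
     by (simp add: lincomb_def)
    have pQ: "orth_proj Q (a + u + y) = y"
     by (rule orth_proj_eqI[OF Q elim]) (use aV orth_VQ in \<open>auto simp: inner_add_left\<close>)
    have "lincomb j e (%i. a \<bullet> e i) = a" by (rule lincomb_coords[OF eE \<open>a \<in> ?E\<close>])
    then show ?case unfolding s pQ orth_proj_V by simp
   qed
  qed
 qed
 also have "... = (INT+ a. (INT+ u. k (lincomb j b a) (norm u) wrt leb U) wrt lPi {..<j})"
 proof -
  interpret Um: sigma_finite_measure "leb U" by (rule sigma_finite_leb[OF Uc(1)])
  have lm: "(%a. lincomb j b (%i. a \<bullet> e i)) \<in> bmeas borel" unfolding lincomb_def by measurable
  have "(%p. k (lincomb j b (%i. fst p \<bullet> e i)) (norm (snd p))) \<in> bmeas (borel \<Otimes>\<^sub>M borel)"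
   using measurable_compose[OF measurable_Pair[OF measurable_compose[OF measurable_fst lm] measurable_compose[OF measurable_snd borel_measurable_norm]] km] by simp
  then have "(%a. INT+ u. k (lincomb j b (%i. a \<bullet> e i)) (norm u) wrt leb U) \<in> bmeas borel"
   by (intro Um.borel_measurable_nn_integral) (simp add: case_prod_beta' cong: measurable_cong_sets sets_pair_measure_cong)
  then show ?thesis
   unfolding leb_eq[OF eE]
   by (subst nn_integral_frame_lborel) (auto intro!: nn_integral_cong arg_cong2[where f = k] lincomb_cong simp: lincomb_inner[OF eE])
 qed
 also have "... = (INT+ c. (INT+ u. k c (norm u) wrt leb U) wrt frame_lborel j b)"
 proof -
  interpret Um: sigma_finite_measure "leb U" by (rule sigma_finite_leb[OF Uc(1)])
  have "(%p. k (fst p) (norm (snd p))) \<in> bmeas (borel \<Otimes>\<^sub>M borel)"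
   using measurable_compose[OF measurable_Pair[OF measurable_fst measurable_compose[OF measurable_snd borel_measurable_norm]] km] by simp
  then have "(%c. INT+ u. k c (norm u) wrt leb U) \<in> bmeas borel"
   by (intro Um.borel_measurable_nn_integral) (simp add: case_prod_beta' cong: measurable_cong_sets sets_pair_measure_cong)
  then show ?thesis by (simp add: nn_integral_frame_lborel)
 qed
 also have "... = (INT+ c. (INT+ s. k c s * (ennreal (sphere_area (d - j) * s ^ (d - j - 1)) * indicator {0<..} s) wrt lborel) wrt frame_lborel j b)"
  using nn_integral_radial[OF Uc(1)] dU j by (intro nn_integral_cong) simp
 also have "... = (INT+ c. (INT+ s. (INT+ y. H (c + s *\<^sub>R b j + y) * shape_weight d j (c + s *\<^sub>R b j + y) wrt leb Q) wrt lborel) wrt frame_lborel j b)"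
 proof -
  have bj: "onb j b (span (b ` {..<j}))" using j dimV by (intro onb_b) simp
  have bV: "b i \<in> V" if "i \<le> j" for i using onb_in[OF b] that j dimV by simp
  show ?thesis
  proof (rule nn_integral_cong_AE, use AE_frame_lborel_in[OF bj] in eventually_elim)
   case (elim c)
   have cb: "c \<bullet> b j = 0"
   proof -
    have "orthogonal (b j) c"
    proof (rule orthogonal_to_span[OF elim])
     fix y assume "y \<in> b ` {..<j}"
     then show "orthogonal (b j) y" using onb_inner[OF b] j dimV by (auto simp: orthogonal_def)
    qed
    then show ?thesis by (simp add: orthogonal_def inner_commute)
   qed
   have bb: "b j \<bullet> b j = 1" using onb_inner[OF b, of j j] j dimV by simp
   show ?case
   proof (rule nn_integral_cong)
    fix s :: real
    have "(INT+ y. H (c + s *\<^sub>R b j + y) * shape_weight d j (c + s *\<^sub>R b j + y) wrt leb Q)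
     = (INT+ y. H (c + s *\<^sub>R b j + y) * (ennreal (sphere_area (d - j) * s ^ (d - j - 1)) * indicator {0<..} s) wrt leb Q)"
    proof (rule nn_integral_cong_AE, use AE_leb_in[OF Q] in eventually_elim)
     case (elim y)
     have "y \<bullet> b j = 0" using orth_VQ[OF bV[OF order_refl] elim] by (simp add: inner_commute)
     then have "(c + s *\<^sub>R b j + y) \<bullet> b j = s" using cb bb by (simp add: inner_add_left)
     then show ?case by (simp add: shape_weight_def)
    qed
    also have "... = k c s * (ennreal (sphere_area (d - j) * s ^ (d - j - 1)) * indicator {0<..} s)"
     unfolding k_def by (rule nn_integral_multc) measurable
    finally show "k c s * (ennreal (sphere_area (d - j) * s ^ (d - j - 1)) * indicator {0<..} s)
     = (INT+ y. H (c + s *\<^sub>R b j + y) * shape_weight d j (c + s *\<^sub>R b j + y) wrt leb Q)" by simp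
   qed
  qed
 qed
 also have "... = (INT+ c. (INT+ y. H (c + y) * shape_weight d j (c + y) wrt leb Q) wrt frame_lborel (Suc j) b)"
  by (rule nn_integral_frame_lborel_Suc[symmetric]) measurable
 also have "... = (INT+ v. H v * shape_weight d j v wrt leb (shape_space j))"
 proof -
  have bS: "onb (Suc j) b (span (b ` {..<Suc j}))" using j dimV by (intro onb_b) simp
  have "span (b ` {..<Suc j}) \<subseteq> V"
   using onb_in[OF b] j dimV by (intro span_minimal subspace_V) auto
  then have o: "\<forall>x\<in>span (b ` {..<Suc j}). \<forall>y\<in>Q. x \<bullet> y = 0" using orth_VQ by blast
  show ?thesis unfolding shape_space_def leb_eq[OF bS, symmetric]
   by (rule nn_integral_leb_sum[OF subspace_span Q o, symmetric]) measurable
 qed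
 finally show ?thesis .
qed

lemma shape_cong: "(\<And>i. i \<le> j ==> x i = x' i) ==> shape x j = shape x' j"
 unfolding shape_def gs_frame_def
 by (intro arg_cong2[where f = "(+)"] sum.cong arg_cong2[where f = scaleR] arg_cong2[where f = inner] arg_cong[where f = norm]
   arg_cong[where f = inverse] arg_cong[where f = "orth_proj Q"] gs_res_cong arg_cong[where f = "orth_proj V"] refl) auto

lemma shape_measurable:
 assumes "\<And>i. i \<le> j ==> (%w. x w i) \<in> bmeas M"
 shows "(%w. shape (x w) j) \<in> bmeas M"
proof -
 have p: "(%w. orth_proj V (x w i)) \<in> bmeas M" "(%w. orth_proj Q (x w i)) \<in> bmeas M" if "i \<le> j" for i
  using measurable_compose[OF assms[OF that] orth_proj_measurable[OF subspace_V]]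
   measurable_compose[OF assms[OF that] orth_proj_measurable[OF Q]] by auto
 have f: "(%w. gs_frame (%i. orth_proj V (x w i)) i) \<in> bmeas M" if "i \<le> j" for i
  using p that by (intro gs_frame_measurable) auto
 have r: "(%w. gs_res (%i. orth_proj V (x w i)) j) \<in> bmeas M"
  using p by (intro gs_res_measurable) auto
 show ?thesis unfolding shape_def
  using assms[of j] p(2)[of j] f r by (intro borel_measurable_add borel_measurable_sum borel_measurable_scaleR borel_measurable_inner
    measurable_compose[OF r borel_measurable_norm]) auto
qed

lemma shape_tuple_measurable: "(%x. \<lambda>j\<in>{..<k}. shape x j) \<in> bPi {..<k} \<rightarrow>\<^sub>M bPi {..<k}"
 by (intro measurable_restrict shape_measurable measurable_component_singleton) auto

abbreviation vol :: "nat => (nat => 'a) => real" where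
 "vol k x \<equiv> gs_vol k (%i. orth_proj V (x i))"

lemma vol_measurable: "vol k \<in> bmeas (bPi {..<k})"
proof (rule gs_vol_measurable)
 fix i assume "i < k"
 then have "(%x. x i) \<in> bPi {..<k} \<rightarrow>\<^sub>M (borel :: 'a measure)"
  by (intro measurable_component_singleton) simp
 then show "(%x. orth_proj V (x i)) \<in> bmeas (bPi {..<k})"
  by (rule measurable_compose) (rule orth_proj_measurable[OF subspace_V])
qed

lemma shape_inner_b: "j < dim V ==> shape x j \<bullet> b j = norm (gs_res (%i. orth_proj V (x i)) j)"
proof -
 assume j: "j < dim V"
 have "(\<Sum>i<j. (x j \<bullet> gs_frame (%i. orth_proj V (x i)) i) *\<^sub>R b i) \<bullet> b j = 0"
  unfolding inner_sum_left using onb_inner[OF b _ j] j by (intro sum.neutral) auto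
 moreover have "orth_proj Q (x j) \<bullet> b j = 0"
  using orth_VQ[OF onb_in[OF b j] orth_proj_in[OF Q, of "x j"]] by (simp add: inner_commute)
 ultimately show ?thesis using onb_inner[OF b j j] by (simp add: shape_def inner_add_left)
qed

lemma vol_Suc_upd:
 "vol (Suc k) (x(k := z)) = vol k x * norm (gs_res (%i. orth_proj V ((x(k := z)) i)) k)"
proof -
 have "vol k (x(k := z)) = vol k x" by (rule gs_vol_cong) auto
 then show ?thesis by (simp only: gs_vol_Suc)
qed

lemma orth_proj_V_in_L:
 assumes "subspace L" "L \<subseteq> V" "x \<in> subspace_sum L Q"
 shows "orth_proj V x \<in> L" "orth_proj V x = orth_proj L x"
proof -
 obtain l y where x: "x = l + y" "l \<in> L" "y \<in> Q" using assms(3) by (auto simp: subspace_sum_def)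
 have "orth_proj V x = l"
  by (rule orth_proj_eqI[OF subspace_V]) (use x assms(2) orth_VQ in \<open>auto simp: inner_commute\<close>)
 moreover have "orth_proj L x = l"
  by (rule orth_proj_eqI[OF assms(1) x(2)]) (use x assms(2) orth_VQ in \<open>auto simp: inner_commute\<close>)
 ultimately show "orth_proj V x \<in> L" "orth_proj V x = orth_proj L x" using x by auto
qed

text \<open>As the law of each new entry of the shape does not depend on the earlier points, the
  entries have a product law, in which \<open>L\<close> appears only through its dimension. The
  indicator discards dependent tuples, for which there is no orthonormal frame.\<close>

lemma nn_integral_shape:
 assumes L: "subspace L" "L \<subseteq> V" "dim L = d" and "k \<le> d"
  and "G \<in> bmeas (bPi {..<k})"
 shows "(INT+ x. G (\<lambda>j\<in>{..<k}. shape x j) * indicator {0<..} (vol k x) wrt PiM {..<k} (%_. leb (subspace_sum L Q)))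
  = (INT+ v. G v * (\<Prod>j<k. shape_weight d j (v j)) wrt PiM {..<k} (%j. leb (shape_space j)))"
 using assms(4,5)
proof (induction k arbitrary: G)
 case 0
 show ?case by (simp add: PiM_empty nn_integral_count_space_finite gs_vol_def restrict_def)
next
 case (Suc k)
 let ?W = "subspace_sum L Q"
 have W: "subspace ?W" by (rule subspace_subspace_sum'[OF L(1) Q])
 have sfW: "sigma_finite_measure (leb ?W)" by (rule sigma_finite_leb[OF W])
 have sfB: "sigma_finite_measure (leb (shape_space j))" for j by (rule sigma_finite_leb[OF subspace_shape_space])
 interpret PW: product_sigma_finite "%_. leb ?W" using sfW by (simp add: product_sigma_finite_def)
 interpret PB: product_sigma_finite "%j. leb (shape_space j)" using sfB by (simp add: product_sigma_finite_def)
 have setsW: "sets (PiM J (%_. leb ?W)) = sets (bPi J)" for J :: "nat set" by (intro sets_PiM_cong) auto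
 have setsB: "sets (PiM J (%j. leb (shape_space j))) = sets (bPi J)" for J :: "nat set" by (intro sets_PiM_cong) auto
 note G = Suc.prems(2)
 define G' where "G' v = (INT+ z. G (v(k := z)) * shape_weight d k z wrt leb (shape_space k))" for v
 have G2: "(%p. G ((fst p)(k := snd p))) \<in> bmeas (bPi {..<k} \<Otimes>\<^sub>M borel)"
  using measurable_compose[OF measurable_add_dim[where I = "{..<k}" and M = "%_. borel" and i = k], of G] G
  by (simp add: lessThan_Suc case_prod_beta')
 have wk: "(%p. shape_weight d k (snd p)) \<in> bmeas (bPi {..<k} \<Otimes>\<^sub>M borel)" by measurable
 have G'm: "G' \<in> bmeas (bPi {..<k})"
  unfolding G'_def using borel_measurable_times_ennreal[OF G2 wk]
  by (intro sigma_finite_measure.borel_measurable_nn_integral[OF sfB]) (simp add: case_prod_beta' cong: measurable_cong_sets sets_pair_measure_cong)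
 let ?F = "%k G x. G (\<lambda>j\<in>{..<k}. shape x j) * indicator {0<..} (vol k x) :: ennreal"
 have Fm: "?F l G \<in> bmeas (bPi {..<l})" if "G \<in> bmeas (bPi {..<l})" for l G
  using measurable_compose[OF shape_tuple_measurable that] measurable_compose[OF vol_measurable, of "indicator {0<..}" borel l]
  by (intro borel_measurable_times_ennreal) auto
 have "(INT+ x. ?F (Suc k) G x wrt PiM {..<Suc k} (%_. leb ?W))
  = (INT+ x. (INT+ z. ?F (Suc k) G (x(k := z)) wrt leb ?W) wrt PiM {..<k} (%_. leb ?W))"
  using Fm[OF G]
  by (intro PW.product_nn_integral_insert[of "{..<k}" k, folded lessThan_Suc]) (auto simp only: measurable_cong_sets[OF setsW refl] finite_lessThan lessThan_iff less_irrefl)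
 also have "... = (INT+ x. ?F k G' x wrt PiM {..<k} (%_. leb ?W))"
 proof (rule nn_integral_cong_AE, use AE_PiM_leb_in[OF W finite_lessThan] in eventually_elim)
  case (elim x)
  let ?xh = "%i. orth_proj V (x i)"
  show ?case
  proof (cases "vol k x = 0")
   case True
   then show ?thesis by (simp only: vol_Suc_upd) simp
  next
   case False
   have xL: "?xh i \<in> L" if "i < k" for i using orth_proj_V_in_L[OF L(1,2)] elim that by auto
   have f: "onb k (gs_frame ?xh) (span (?xh ` {..<k}))" by (rule onb_gs_frame[OF False])
   have fL: "gs_frame ?xh i \<in> L" if "i < k" for i
    using onb_in[OF f that] span_minimal[of "?xh ` {..<k}" L] xL L(1) by auto
   define H where "H v = G ((\<lambda>j\<in>{..<k}. shape x j)(k := v)) * indicator {0<..} (v \<bullet> b k)" for v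
   have sp: "(\<lambda>j\<in>{..<k}. shape x j) \<in> space (bPi {..<k})" by (simp add: space_PiM)
   have Hm[measurable]: "H \<in> bmeas borel"
    using measurable_compose[OF measurable_Pair1'[OF sp] G2] unfolding H_def by simp
   have kd: "k < d" "k < dim V" using Suc.prems(1) dim_subset[OF L(2)] L(3) by auto
   have "(INT+ z. ?F (Suc k) G (x(k := z)) wrt leb ?W)
    = (INT+ z. H ((\<Sum>i<k. (z \<bullet> gs_frame ?xh i) *\<^sub>R b i) + norm (orth_proj V z - (\<Sum>i<k. (z \<bullet> gs_frame ?xh i) *\<^sub>R gs_frame ?xh i)) *\<^sub>R b k + orth_proj Q z) wrt leb ?W)"
   proof (rule nn_integral_cong)
    fix z
    let ?y = "x(k := z)" and ?yh = "%i. orth_proj V ((x(k := z)) i)"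
    have fr: "gs_frame ?yh i = gs_frame ?xh i" if "i < k" for i
     using that unfolding gs_frame_def by (intro arg_cong2[where f = scaleR] arg_cong[where f = inverse] arg_cong[where f = norm] gs_res_cong) auto
    have "gs_proj ?yh k (orth_proj V z) = lincomb k (gs_frame ?xh) (%i. orth_proj V z \<bullet> gs_frame ?xh i)"
    proof -
     have "gs_proj ?yh k (orth_proj V z) = gs_proj ?xh k (orth_proj V z)" by (rule gs_proj_cong) auto
     also have "... = lincomb k (gs_frame ?xh) (%i. gs_proj ?xh k (orth_proj V z) \<bullet> gs_frame ?xh i)"
      by (rule lincomb_coords[OF f, symmetric]) (use gs_proj_spec in blast)
     also have "... = lincomb k (gs_frame ?xh) (%i. orth_proj V z \<bullet> gs_frame ?xh i)"
      unfolding gs_proj_eq using onb_in[OF f] by (intro lincomb_cong orth_proj_inner) auto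
     finally show ?thesis .
    qed
    also have "... = (\<Sum>i<k. (z \<bullet> gs_frame ?xh i) *\<^sub>R gs_frame ?xh i)"
     unfolding lincomb_def using fL L(2) orth_proj_inner[OF subspace_V] by (intro sum.cong) auto
    finally have res: "gs_res ?yh k = orth_proj V z - (\<Sum>i<k. (z \<bullet> gs_frame ?xh i) *\<^sub>R gs_frame ?xh i)"
     by (simp add: gs_res_def)
    define v where "v = shape ?y k"
    have v: "v = (\<Sum>i<k. (z \<bullet> gs_frame ?xh i) *\<^sub>R b i) + norm (orth_proj V z - (\<Sum>i<k. (z \<bullet> gs_frame ?xh i) *\<^sub>R gs_frame ?xh i)) *\<^sub>R b k + orth_proj Q z"
     unfolding v_def shape_def res using fr by simp
    have vb: "v \<bullet> b k = norm (gs_res ?yh k)" unfolding v_def by (rule shape_inner_b[OF kd(2)])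
    have "(\<lambda>j\<in>{..<Suc k}. shape ?y j) = (\<lambda>j\<in>{..<k}. shape x j)(k := v)"
     unfolding v_def using shape_cong[of _ ?y x] by (auto simp: fun_eq_iff restrict_def less_Suc_eq)
    moreover have "indicator {0<..} (vol (Suc k) ?y) = (indicator {0<..} (v \<bullet> b k) :: ennreal)"
     unfolding vol_Suc_upd vb using False gs_vol_nonneg[of k ?xh] by (auto simp: indicator_def zero_less_mult_iff)
    ultimately show "?F (Suc k) G ?y = H ((\<Sum>i<k. (z \<bullet> gs_frame ?xh i) *\<^sub>R b i) + norm (orth_proj V z - (\<Sum>i<k. (z \<bullet> gs_frame ?xh i) *\<^sub>R gs_frame ?xh i)) *\<^sub>R b k + orth_proj Q z)"
     unfolding v[symmetric] H_def by simp
   qed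
   also have "... = (INT+ v. H v * shape_weight d k v wrt leb (shape_space k))"
    using f fL by (intro nn_integral_shape_step[OF L kd(1)]) (auto simp: onb_def)
   \<comment> \<open>The weight already contains the indicator of a positive height and absorbs the
     one in \<open>H\<close>.\<close>
   also have "... = G' (\<lambda>j\<in>{..<k}. shape x j)"
    unfolding G'_def H_def by (intro nn_integral_cong) (auto simp: shape_weight_def indicator_def)
   finally show ?thesis using False gs_vol_nonneg[of k ?xh] by (simp add: less_le)
  qed
 qed
 also have "... = (INT+ v. G' v * (\<Prod>j<k. shape_weight d j (v j)) wrt PiM {..<k} (%j. leb (shape_space j)))"
  using Suc.prems(1) G'm by (intro Suc.IH) auto
 also have "... = (INT+ v. (INT+ z. G (v(k := z)) * (\<Prod>j<Suc k. shape_weight d j ((v(k := z)) j)) wrt leb (shape_space k)) wrt PiM {..<k} (%j. leb (shape_space j)))"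
 proof (rule nn_integral_cong)
  fix v assume v: "v \<in> space (PiM {..<k} (%j. leb (shape_space j)))"
  have sp: "v \<in> space (bPi {..<k})" using v by (simp add: space_PiM)
  have m: "(%z. G (v(k := z))) \<in> bmeas (leb (shape_space k))"
   using measurable_compose[OF measurable_Pair1'[OF sp] G2] by (simp cong: measurable_cong_sets)
  have "G' v * (\<Prod>j<k. shape_weight d j (v j))
   = (INT+ z. G (v(k := z)) * shape_weight d k z * (\<Prod>j<k. shape_weight d j (v j)) wrt leb (shape_space k))"
   unfolding G'_def using m by (intro nn_integral_multc[symmetric] borel_measurable_times_ennreal) (auto cong: measurable_cong_sets)
  also have "... = (INT+ z. G (v(k := z)) * (\<Prod>j<Suc k. shape_weight d j ((v(k := z)) j)) wrt leb (shape_space k))"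
   by (intro nn_integral_cong) (simp add: mult_ac)
  finally show "G' v * (\<Prod>j<k. shape_weight d j (v j)) = (INT+ z. G (v(k := z)) * (\<Prod>j<Suc k. shape_weight d j ((v(k := z)) j)) wrt leb (shape_space k))" .
 qed
 also have "... = (INT+ v. G v * (\<Prod>j<Suc k. shape_weight d j (v j)) wrt PiM {..<Suc k} (%j. leb (shape_space j)))"
 proof -
  have "(%v. G v * (\<Prod>j<Suc k. shape_weight d j (v j))) \<in> bmeas (bPi {..<Suc k})"
  proof (intro borel_measurable_times_ennreal borel_measurable_prod_ennreal G)
   fix j assume "j \<in> {..<Suc k}"
   then have "(%v. v j) \<in> bPi {..<Suc k} \<rightarrow>\<^sub>M (borel :: 'a measure)"
    by (rule measurable_component_singleton)
   then show "(%v. shape_weight d j (v j)) \<in> bmeas (bPi {..<Suc k})"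
    by (rule measurable_compose) (rule shape_weight_measurable)
  qed
  then show ?thesis
   by (intro PB.product_nn_integral_insert[of "{..<k}" k, folded lessThan_Suc, symmetric]) (auto simp only: measurable_cong_sets[OF setsB refl] finite_lessThan lessThan_iff less_irrefl)
 qed
 finally show ?case .
qed

end

section \<open>Comparison of shape laws and recovery of a tuple from frame and shape\<close>

context shape_frame
begin

lemma sum_V_Q: "subspace_sum V Q = UNIV"
proof -
 have "subspace_sum V Q = subspace_sum Q V" by (auto simp: subspace_sum_def add.commute) (metis add.commute)+
 then show ?thesis using subspace_sum_orthogonal_comp[OF Q] by simp
qed

lemma vol_eq_prod_shape:
 assumes "m \<le> dim V" shows "vol m x = (\<Prod>j<m. shape x j \<bullet> b j)"
 unfolding gs_vol_def using assms shape_inner_b by (intro prod.cong) auto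

text \<open>The product laws for \<open>L\<close> and for \<open>V\<close> differ in entry
  \<open>j\<close> by the power \<open>dim V - m\<close> of the height and by the sphere areas. The
  heights multiply to \<open>vol\<close>. The identity is cross-multiplied, so that it can be stated
  for extended nonnegative reals without division.\<close>

lemma shape_ratio:
 assumes L: "subspace L" "L \<subseteq> V" "dim L = m" and G: "G \<in> bmeas (bPi {..<m})"
 shows "ennreal (\<Prod>i<m. sphere_area (dim V - i)) * (INT+ x. G (\<lambda>j\<in>{..<m}. shape x j) *
   (ennreal (vol m x ^ (dim V - m)) * indicator {0<..} (vol m x)) wrt PiM {..<m} (%_. leb (subspace_sum L Q)))
  = ennreal (\<Prod>i<m. sphere_area (m - i)) * (INT+ x. G (\<lambda>j\<in>{..<m}. shape x j) * indicator {0<..} (vol m x) wrt lPi {..<m})"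
proof -
 let ?N = "dim V"
 let ?B = "PiM {..<m} (%j. leb (shape_space j))"
 have mN: "m \<le> ?N" using dim_subset[OF L(2)] L(3) by simp
 have setsB: "sets ?B = sets (bPi {..<m})" by (intro sets_PiM_cong) auto
 define G' where "G' v = G v * (\<Prod>j<m. ennreal ((v j \<bullet> b j) ^ (?N - m)))" for v
 have comp: "(%v. v j) \<in> bPi {..<m} \<rightarrow>\<^sub>M (borel :: 'a measure)" if "j < m" for j
  using that by (intro measurable_component_singleton) simp
 have G'm: "G' \<in> bmeas (bPi {..<m})"
  unfolding G'_def
  by (intro borel_measurable_times_ennreal G borel_measurable_prod_ennreal measurable_compose[OF _ measurable_ennreal]
    borel_measurable_power borel_measurable_inner comp) auto
 have wm: "(%v. \<Prod>j<m. shape_weight d j (v j)) \<in> bmeas (bPi {..<m})" for d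
 proof (rule borel_measurable_prod_ennreal)
  fix j assume "j \<in> {..<m}"
  then show "(%v. shape_weight d j (v j)) \<in> bmeas (bPi {..<m})"
   using measurable_compose[OF comp shape_weight_measurable] by simp
 qed
 have "(INT+ x. G (\<lambda>j\<in>{..<m}. shape x j) * (ennreal (vol m x ^ (?N - m)) * indicator {0<..} (vol m x)) wrt PiM {..<m} (%_. leb (subspace_sum L Q)))
  = (INT+ x. G' (\<lambda>j\<in>{..<m}. shape x j) * indicator {0<..} (vol m x) wrt PiM {..<m} (%_. leb (subspace_sum L Q)))"
 proof (rule nn_integral_cong)
  fix x
  have nn: "0 \<le> shape x j \<bullet> b j" if "j < m" for j using that mN by (simp add: shape_inner_b)
  have "ennreal (vol m x ^ (?N - m)) = (\<Prod>j<m. ennreal ((shape x j \<bullet> b j) ^ (?N - m)))"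
   unfolding vol_eq_prod_shape[OF mN] prod_power_distrib using nn by (subst prod_ennreal) auto
  also have "... = (\<Prod>j<m. ennreal (((\<lambda>j\<in>{..<m}. shape x j) j \<bullet> b j) ^ (?N - m)))" by (intro prod.cong) auto
  finally show "G (\<lambda>j\<in>{..<m}. shape x j) * (ennreal (vol m x ^ (?N - m)) * indicator {0<..} (vol m x)) = G' (\<lambda>j\<in>{..<m}. shape x j) * indicator {0<..} (vol m x)"
   unfolding G'_def by (simp only: mult.assoc)
 qed
 also have "... = (INT+ v. G' v * (\<Prod>j<m. shape_weight m j (v j)) wrt ?B)"
  by (rule nn_integral_shape[OF L order_refl G'm])
 finally have "ennreal (\<Prod>i<m. sphere_area (?N - i)) * (INT+ x. G (\<lambda>j\<in>{..<m}. shape x j) *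
   (ennreal (vol m x ^ (?N - m)) * indicator {0<..} (vol m x)) wrt PiM {..<m} (%_. leb (subspace_sum L Q)))
  = (INT+ v. ennreal (\<Prod>i<m. sphere_area (?N - i)) * (G' v * (\<Prod>j<m. shape_weight m j (v j))) wrt ?B)"
  using borel_measurable_times_ennreal[OF G'm wm[of m]]
  by (subst nn_integral_cmult) (simp_all add: measurable_cong_sets[OF setsB refl])
 also have "... = (INT+ v. ennreal (\<Prod>i<m. sphere_area (m - i)) * (G v * (\<Prod>j<m. shape_weight ?N j (v j))) wrt ?B)"
 proof (rule nn_integral_cong)
  fix v
  have sa: "0 \<le> sphere_area k" if "0 < k" for k using that by (simp add: sphere_area_eq)
  \<comment> \<open>The exponents \<open>?N - m\<close> and \<open>m - j - 1\<close> add up to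
    \<open>?N - j - 1\<close>, the exponent that belongs to the dimension of
    \<open>V\<close>.\<close>
  have each: "ennreal (sphere_area (?N - j)) * (ennreal ((v j \<bullet> b j) ^ (?N - m)) * shape_weight m j (v j))
    = ennreal (sphere_area (m - j)) * shape_weight ?N j (v j)" if j: "j < m" for j
  proof (cases "0 < v j \<bullet> b j")
   case True
   let ?s = "v j \<bullet> b j"
   have "?N - m + (m - j - 1) = ?N - j - 1" using j mN by simp
   then have p: "?s ^ (?N - m) * ?s ^ (m - j - 1) = ?s ^ (?N - j - 1)" by (simp only: power_add[symmetric])
   have "sphere_area (?N - j) * (?s ^ (?N - m) * (sphere_area (m - j) * ?s ^ (m - j - 1)))
    = sphere_area (m - j) * (sphere_area (?N - j) * (?s ^ (?N - m) * ?s ^ (m - j - 1)))" by simp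
   then have "sphere_area (?N - j) * (?s ^ (?N - m) * (sphere_area (m - j) * ?s ^ (m - j - 1)))
    = sphere_area (m - j) * (sphere_area (?N - j) * ?s ^ (?N - j - 1))" unfolding p .
   moreover have "0 \<le> sphere_area (?N - j)" "0 \<le> sphere_area (m - j)" using j mN by (auto intro: sa)
   ultimately show ?thesis
    using True by (simp add: shape_weight_def ennreal_mult'[symmetric])
  qed (simp add: shape_weight_def)
  have "ennreal (\<Prod>i<m. sphere_area (?N - i)) * (G' v * (\<Prod>j<m. shape_weight m j (v j)))
   = G v * (\<Prod>j<m. ennreal (sphere_area (?N - j)) * (ennreal ((v j \<bullet> b j) ^ (?N - m)) * shape_weight m j (v j)))"
   using mN by (subst prod_ennreal[symmetric]) (auto simp: G'_def prod.distrib mult_ac intro!: sa)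
  also have "... = G v * (\<Prod>j<m. ennreal (sphere_area (m - j)) * shape_weight ?N j (v j))"
   by (intro arg_cong[where f = "%z. G v * z"] prod.cong refl each) (simp only: lessThan_iff)
  also have "... = ennreal (\<Prod>i<m. sphere_area (m - i)) * (G v * (\<Prod>j<m. shape_weight ?N j (v j)))"
   by (subst prod_ennreal[symmetric]) (auto simp: prod.distrib mult_ac intro!: sa)
  finally show "ennreal (\<Prod>i<m. sphere_area (?N - i)) * (G' v * (\<Prod>j<m. shape_weight m j (v j)))
   = ennreal (\<Prod>i<m. sphere_area (m - i)) * (G v * (\<Prod>j<m. shape_weight ?N j (v j)))" .
 qed
 also have "... = ennreal (\<Prod>i<m. sphere_area (m - i)) * (INT+ v. G v * (\<Prod>j<m. shape_weight ?N j (v j)) wrt ?B)"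
  using borel_measurable_times_ennreal[OF G wm[of ?N]]
  by (intro nn_integral_cmult) (simp_all add: measurable_cong_sets[OF setsB refl])
 also have "(INT+ v. G v * (\<Prod>j<m. shape_weight ?N j (v j)) wrt ?B)
  = (INT+ x. G (\<lambda>j\<in>{..<m}. shape x j) * indicator {0<..} (vol m x) wrt lPi {..<m})"
  using nn_integral_shape[OF subspace_V order_refl refl mN G] by (simp add: sum_V_Q leb_UNIV)
 finally show ?thesis .
qed

text \<open>Given \<open>k\<close> independent projections, a bad next point lies in the sum of
  their span and \<open>Q\<close>, of dimension \<open>k + dim Q\<close>, which is less than that of
  the whole space.\<close>

lemma AE_vol_neq_0:
 assumes "k \<le> dim V" shows "AE x in lPi {..<k}. vol k x \<noteq> 0"
 using assms
proof (induction k)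
 case (Suc k)
 interpret P: product_sigma_finite "%_. lborel :: 'a measure" by standard
 have setsW: "sets (PiM J (%_. lborel :: 'a measure)) = sets (bPi J)" for J :: "nat set" by (intro sets_PiM_cong) auto
 let ?f = "%k x. indicator {0} (vol k x) :: ennreal"
 have fm: "?f k \<in> bmeas (lPi {..<k})" for k
  using measurable_compose[OF vol_measurable, of "indicator {0}" borel k] by (simp add: measurable_cong_sets[OF setsW refl])
 have "(INT+ x. ?f (Suc k) x wrt lPi {..<Suc k}) = (INT+ x. (INT+ z. ?f (Suc k) (x(k := z)) wrt lborel) wrt lPi {..<k})"
  using fm[of "Suc k"] by (intro P.product_nn_integral_insert[of "{..<k}" k, folded lessThan_Suc]) (auto simp only: finite_lessThan lessThan_iff less_irrefl)
 also have "... = (INT+ x. 0 wrt PiM {..<k} (%_. lborel :: 'a measure))"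
 proof (rule nn_integral_cong_AE)
  have "AE x in lPi {..<k}. vol k x \<noteq> 0" using Suc by simp
  then show "AE x in lPi {..<k}. (INT+ z. ?f (Suc k) (x(k := z)) wrt lborel) = 0"
  proof eventually_elim
   case (elim x)
   let ?xh = "%i. orth_proj V (x i)"
   let ?S = "span (?xh ` {..<k})"
   have SV: "?S \<subseteq> V" by (intro span_minimal subspace_V) (auto intro: orth_proj_in[OF subspace_V])
   have orth: "\<forall>x\<in>?S. \<forall>y\<in>Q. x \<bullet> y = 0" using SV orth_VQ by blast
   have ds: "dim ?S = k" by (rule onb_dim[OF onb_gs_frame[OF elim]])
   have dn: "dim V + dim Q = DIM('a)"
    using dim_subspace_sum[OF subspace_V Q] orth_VQ by (simp add: sum_V_Q)
   have null: "emeasure lborel (subspace_sum ?S Q) = 0"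
    using leb_null_subspace[of UNIV "subspace_sum ?S Q"] subspace_subspace_sum[OF subspace_span Q orth]
     dim_subspace_sum[OF subspace_span Q orth] Suc.prems dn ds by (simp add: leb_UNIV)
   have "(INT+ z. ?f (Suc k) (x(k := z)) wrt lborel) \<le> (INT+ z. indicator (subspace_sum ?S Q) z wrt lborel)"
   proof (intro nn_integral_mono)
    fix z
    let ?yh = "%i. orth_proj V ((x(k := z)) i)"
    show "?f (Suc k) (x(k := z)) \<le> indicator (subspace_sum ?S Q) z"
    proof (cases "vol (Suc k) (x(k := z)) = 0")
     case True
     then have "gs_res ?yh k = 0" using elim unfolding vol_Suc_upd by simp
     then have "?yh k \<in> span (?yh ` {..<k})" by (simp only: gs_res_eq_0_iff)
     moreover have "?yh ` {..<k} = ?xh ` {..<k}" by auto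
     ultimately have "orth_proj V z \<in> ?S" by simp
     moreover have "z = orth_proj V z + orth_proj Q z" by (simp add: orth_proj_V)
     ultimately have "z \<in> subspace_sum ?S Q" unfolding subspace_sum_def using orth_proj_in[OF Q] by blast
     then show ?thesis by (simp add: indicator_def)
    qed simp
   qed
   also have "... = 0"
    using null subspace_subspace_sum[OF subspace_span Q orth] by (subst nn_integral_indicator) (auto simp: closed_subspace borel_closed)
   finally show ?case by simp
  qed
 qed
 finally have "(INT+ x. ?f (Suc k) x wrt lPi {..<Suc k}) = 0" by simp
 then have "AE x in lPi {..<Suc k}. ?f (Suc k) x = 0"
  by (rule nn_integral_0_iff_AE[OF fm, THEN iffD1])
 then show ?case by eventually_elim (auto simp: indicator_def split: if_splits)
qed (simp add: gs_vol_def)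

text \<open>Left inverse of the encoding by frame and shape. The sum runs up to \<open>j\<close>
  itself because entry \<open>j\<close> has a component along frame vector \<open>j\<close>, its
  height.\<close>

definition unshape :: "(nat => 'a) => (nat => 'a) => nat => 'a" where
 "unshape e v j = (\<Sum>i<Suc j. (v j \<bullet> b i) *\<^sub>R e i) + orth_proj Q (v j)"

lemma unshape_measurable:
 "(%p. \<lambda>j\<in>{..<m}. unshape (fst p) (snd p) j) \<in> bPi {..<m} \<Otimes>\<^sub>M bPi {..<m} \<rightarrow>\<^sub>M bPi {..<m}"
proof (rule measurable_restrict)
 fix j assume j: "j \<in> {..<m}"
 let ?P = "PiM {..<m} (%_. borel :: 'a measure)"
 have 1: "(%p. fst p i) \<in> bmeas (?P \<Otimes>\<^sub>M ?P)" "(%p. snd p i) \<in> bmeas (?P \<Otimes>\<^sub>M ?P)" if "i < m" for i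
  using that measurable_compose[OF measurable_fst measurable_component_singleton[of i "{..<m}" "%_. borel"]]
   measurable_compose[OF measurable_snd measurable_component_singleton[of i "{..<m}" "%_. borel"]] by auto
 have 2: "(%p. orth_proj Q (snd p j)) \<in> bmeas (?P \<Otimes>\<^sub>M ?P)"
  using measurable_compose[OF 1(2) orth_proj_measurable[OF Q]] j by simp
 show "(%p. unshape (fst p) (snd p) j) \<in> bmeas (?P \<Otimes>\<^sub>M ?P)"
  unfolding unshape_def using 1 2 j
  by (intro borel_measurable_add borel_measurable_sum borel_measurable_scaleR borel_measurable_inner) auto
qed

text \<open>\<open>norm_shape\<close> makes a cutoff by the norms of the points a condition on the
  shape alone.\<close>

lemma
 assumes vol: "vol m x \<noteq> 0" and m: "m \<le> dim V" and j: "j < m"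
 shows unshape_shape: "unshape (gs_frame (%i. orth_proj V (x i))) (shape x) j = x j"
  and norm_shape: "norm (shape x j) = norm (x j)"
proof -
 let ?xh = "%i. orth_proj V (x i)" and ?e = "gs_frame (%i. orth_proj V (x i))"
 have volj: "gs_vol (Suc j) ?xh \<noteq> 0" using vol j unfolding gs_vol_neq_0 by auto
 have e: "onb (Suc j) ?e (span (?xh ` {..<Suc j}))" by (rule onb_gs_frame[OF volj])
 have bj: "onb (Suc j) b (span (b ` {..<Suc j}))" using j m by (intro onb_b) simp
 have SV: "span (?xh ` {..<Suc j}) \<subseteq> V" by (intro span_minimal subspace_V) (auto intro: orth_proj_in[OF subspace_V])
 have bV: "b i \<in> V" if "i < Suc j" for i using onb_in[OF b] that j m by simp
 define c where "c i = ?xh j \<bullet> ?e i" for i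
 have ci: "c i = x j \<bullet> ?e i" if "i < j" for i
  unfolding c_def using onb_in[OF e, of i] SV that by (intro orth_proj_inner[OF subspace_V]) auto
 have cj: "c j = norm (gs_res ?xh j)" unfolding c_def by (rule inner_gs_frame)
 have xh: "?xh j = lincomb (Suc j) ?e c"
  unfolding c_def by (rule lincomb_coords[OF e, symmetric]) (auto intro: span_base)
 have x: "x j = lincomb (Suc j) ?e c + orth_proj Q (x j)"
  unfolding xh[symmetric] by (simp add: orth_proj_V)
 have sh: "shape x j = lincomb (Suc j) b c + orth_proj Q (x j)"
  unfolding shape_def lincomb_def by (simp add: cj ci)
 have lbV: "lincomb (Suc j) b c \<in> V" using lincomb_in[OF bj] span_minimal[of "b ` {..<Suc j}" V] bV subspace_V by blast
 have leV: "lincomb (Suc j) ?e c \<in> V" using lincomb_in[OF e] SV by blast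
 have pQ: "orth_proj Q (x j) \<in> Q" by (rule orth_proj_in[OF Q])
 have "shape x j \<bullet> b i = c i" if "i < Suc j" for i
  unfolding sh using orth_VQ[OF bV[OF that] pQ] lincomb_inner[OF bj that]
  by (simp add: inner_add_left inner_commute[of "orth_proj Q (x j)"])
 moreover have "orth_proj Q (shape x j) = orth_proj Q (x j)"
  by (rule orth_proj_eqI[OF Q pQ]) (use sh lbV orth_VQ in auto)
 ultimately show "unshape ?e (shape x) j = x j"
  using x unfolding unshape_def lincomb_def by simp
 have "(norm (shape x j))\<^sup>2 = (norm (lincomb (Suc j) b c))\<^sup>2 + (norm (orth_proj Q (x j)))\<^sup>2"
  unfolding sh by (rule norm_add_Pythagorean) (simp add: orthogonal_def orth_VQ[OF lbV pQ])
 moreover have "(norm (x j))\<^sup>2 = (norm (lincomb (Suc j) ?e c))\<^sup>2 + (norm (orth_proj Q (x j)))\<^sup>2"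
  by (subst x, rule norm_add_Pythagorean) (simp add: orthogonal_def orth_VQ[OF leV pQ])
 ultimately have "(norm (shape x j))\<^sup>2 = (norm (x j))\<^sup>2"
  unfolding norm_lincomb[OF bj] norm_lincomb[OF e] by simp
 then show "norm (shape x j) = norm (x j)" by simp
qed

lemma
 assumes T: "orthogonal_transformation T" and TQ: "\<forall>y\<in>Q. T y = y"
 shows orth_proj_Q_rot: "orth_proj Q (T x) = orth_proj Q x"
  and orth_proj_V_rot: "orth_proj V (T x) = T (orth_proj V x)"
  and rot_V: "x \<in> V ==> T x \<in> V"
proof -
 have lin: "linear T" and inn: "T v \<bullet> T w = v \<bullet> w" for v w using T by (auto simp: orthogonal_transformation_def)
 show TV: "T x \<in> V" if "x \<in> V" for x
  using that inn[of x] TQ by (auto simp: V_iff) (metis)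
 let ?p = "orth_proj Q x" and ?v = "orth_proj V x"
 have p: "?p \<in> Q" by (rule orth_proj_in[OF Q])
 have v: "?v \<in> V" by (rule orth_proj_in[OF subspace_V])
 have "x = ?v + ?p" by (simp add: orth_proj_V)
 then have Tx: "T x = T ?v + ?p" using bspec[OF TQ p] linear_add[OF lin, of ?v ?p] by simp
 show "orth_proj Q (T x) = orth_proj Q x"
  by (rule orth_proj_eqI[OF Q p]) (use Tx TV[OF v] orth_VQ in auto)
 show "orth_proj V (T x) = T (orth_proj V x)"
  by (rule orth_proj_eqI[OF subspace_V TV[OF v]]) (use Tx orth_VQ[OF _ p] in \<open>auto simp: inner_commute\<close>)
qed

text \<open>The point of the encoding: an orthogonal map fixing \<open>Q\<close> acts on the frame
  and leaves the shape alone.\<close>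

lemma
 assumes T: "orthogonal_transformation T" and TQ: "\<forall>y\<in>Q. T y = y"
 shows shape_rot: "shape (%i. T (x i)) j = shape x j"
  and vol_rot: "vol m (%i. T (x i)) = vol m x"
  and frame_rot: "gs_frame (%i. orth_proj V (T (x i))) j = T (gs_frame (%i. orth_proj V (x i)) j)"
proof -
 have inn: "T v \<bullet> T w = v \<bullet> w" for v w using T by (auto simp: orthogonal_transformation_def)
 have n: "norm (T v) = norm v" for v using T by (simp add: orthogonal_transformation_norm)
 note P = orth_proj_V_rot[OF T TQ] orth_proj_Q_rot[OF T TQ]
 show "gs_frame (%i. orth_proj V (T (x i))) j = T (gs_frame (%i. orth_proj V (x i)) j)"
  unfolding P by (rule gs_frame_isometry[OF T])
 show "shape (%i. T (x i)) j = shape x j"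
  unfolding shape_def P gs_frame_isometry[OF T] gs_res_isometry[OF T] inn n ..
 show "vol m (%i. T (x i)) = vol m x"
  unfolding P gs_vol_def gs_res_isometry[OF T] n ..
qed

end

section \<open>The Blaschke-Petkantschin formula\<close>

lemma finite_measure_distr_density:
 assumes "finite_measure D" and h: "h \<in> D \<rightarrow>\<^sub>M N" and A: "A \<in> sets D"
 shows "finite_measure (distr (density D (indicator A)) N h)"
proof -
 interpret finite_measure D by fact
 have "finite_measure (density D (indicator A))"
  using A emeasure_finite[of A] by (intro finite_measureI) (simp add: emeasure_density)
 then show ?thesis by (rule finite_measure.finite_measure_distr) (use h in simp)
qed

section \<open>Invariant measures are determined by their shape law\<close>

context shape_frame
begin

definition frame :: "nat => (nat => 'a) => nat => 'a" where
 "frame m x = (\<lambda>j\<in>{..<m}. gs_frame (%i. orth_proj V (x i)) j)"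

abbreviation shapes :: "nat => (nat => 'a) => nat => 'a" where
 "shapes m x \<equiv> \<lambda>j\<in>{..<m}. shape x j"

text \<open>The Stiefel manifold of orthonormal \<open>m\<close>-frames in \<open>V\<close>.\<close>

definition frames :: "nat => (nat => 'a) set" where
 "frames m = {x. \<forall>i\<in>{..<m}. x i \<in> V \<and> (\<forall>j\<in>{..<m}. x i \<bullet> x j = (if i = j then 1 else 0))}"

lemma frame_measurable: "frame m \<in> bPi {..<m} \<rightarrow>\<^sub>M bPi {..<m}"
 unfolding frame_def
proof (intro measurable_restrict gs_frame_measurable)
 fix j i assume "j \<in> {..<m}" "i \<le> j"
 then have "(%x. x i) \<in> bPi {..<m} \<rightarrow>\<^sub>M (borel :: 'a measure)"
  by (intro measurable_component_singleton) simp
 then show "(%x. orth_proj V (x i)) \<in> bmeas (bPi {..<m})"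
  by (rule measurable_compose) (rule orth_proj_measurable[OF subspace_V])
qed

lemma frame_in_frames:
 assumes "vol m x \<noteq> 0" shows "frame m x \<in> frames m"
proof -
 have e: "onb m (gs_frame (%i. orth_proj V (x i))) (span ((%i. orth_proj V (x i)) ` {..<m}))"
  by (rule onb_gs_frame[OF assms])
 have "span ((%i. orth_proj V (x i)) ` {..<m}) \<subseteq> V"
  by (intro span_minimal subspace_V) (auto intro: orth_proj_in[OF subspace_V])
 then show ?thesis using onb_in[OF e] onb_inner[OF e] by (auto simp: frames_def frame_def)
qed

lemma
 assumes T: "orthogonal_transformation T" and TQ: "\<forall>y\<in>Q. T y = y"
 shows frame_tuple_rot: "frame m (\<lambda>i\<in>{..<m}. T (x i)) = (\<lambda>i\<in>{..<m}. T (frame m x i))"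
  and shape_tuple_rot: "shapes m (\<lambda>i\<in>{..<m}. T (x i)) = shapes m x"
  and vol_tuple_rot: "vol m (\<lambda>i\<in>{..<m}. T (x i)) = vol m x"
proof -
 have "gs_frame (%i. orth_proj V ((\<lambda>i\<in>{..<m}. T (x i)) i)) j = gs_frame (%i. orth_proj V (T (x i))) j" if "j < m" for j
  using that unfolding gs_frame_def
  by (intro arg_cong2[where f = scaleR] arg_cong[where f = inverse] arg_cong[where f = norm] gs_res_cong) auto
 then show "frame m (\<lambda>i\<in>{..<m}. T (x i)) = (\<lambda>i\<in>{..<m}. T (frame m x i))"
  using frame_rot[OF T TQ] by (auto simp: frame_def restrict_def)
 have "shape (\<lambda>i\<in>{..<m}. T (x i)) j = shape (%i. T (x i)) j" if "j < m" for j
  using that by (intro shape_cong) auto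
 then show "shapes m (\<lambda>i\<in>{..<m}. T (x i)) = shapes m x"
  using shape_rot[OF T TQ] by (auto simp: restrict_def)
 have "vol m (\<lambda>i\<in>{..<m}. T (x i)) = vol m (%i. T (x i))" by (rule gs_vol_cong) auto
 then show "vol m (\<lambda>i\<in>{..<m}. T (x i)) = vol m x" using vol_rot[OF T TQ] by simp
qed

text \<open>Conditioning is done without disintegration: \<open>al D B\<close> is the law of the
  frame on the event that the shape lies in \<open>B\<close>. A transitive group of isometries
  preserves it, so balls of equal radius around frames have equal measure, and its mass is fixed by
  the shape law. Hence it agrees for \<open>D1\<close> and \<open>D2\<close> for each
  \<open>B\<close>; this gives the joint laws on rectangles, and \<open>unshape\<close> recovers the
  tuples.\<close>

lemma finite_measure_eq_by_shape_law:
 fixes D1 D2 :: "(nat => 'a) measure"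
 assumes m: "m \<le> dim V"
  and R: "\<forall>T\<in>R. orthogonal_transformation T \<and> (\<forall>y\<in>Q. T y = y)"
  and trans: "\<forall>x\<in>frames m. \<forall>y\<in>frames m. \<exists>T\<in>R. \<forall>i<m. T (x i) = y i"
  and fin: "finite_measure D1" "finite_measure D2"
  and sets: "sets D1 = sets (bPi {..<m})" "sets D2 = sets (bPi {..<m})"
  and AE: "AE x in D1. vol m x \<noteq> 0" "AE x in D2. vol m x \<noteq> 0"
  and inv: "\<forall>T\<in>R. \<forall>G\<in>bmeas (bPi {..<m}). (INT+ x. G (\<lambda>i\<in>{..<m}. T (x i)) wrt D1) = (INT+ x. G x wrt D1)"
   "\<forall>T\<in>R. \<forall>G\<in>bmeas (bPi {..<m}). (INT+ x. G (\<lambda>i\<in>{..<m}. T (x i)) wrt D2) = (INT+ x. G x wrt D2)"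
  and law: "\<And>B. B \<in> sets (bPi {..<m}) ==>
   (INT+ x. indicator B (shapes m x) wrt D1) = (INT+ x. indicator B (shapes m x) wrt D2)"
 shows "D1 = D2"
proof -
 let ?P = "PiM {..<m} (%_. borel :: 'a measure)"
 note fm = frame_measurable[of m] and sm = shape_tuple_measurable[of m]
 have spP: "space ?P = PiE {..<m} (%_. UNIV)" by (simp add: space_PiM)
 have spD: "space D1 = space ?P" "space D2 = space ?P" using sets[THEN sets_eq_imp_space_eq] by auto
 have meas: "f \<in> D \<rightarrow>\<^sub>M N" if "f \<in> ?P \<rightarrow>\<^sub>M N" "D \<in> {D1, D2}" for f :: "(nat => 'a) => 'b" and N D
  using that measurable_cong_sets[OF sets(1) refl] measurable_cong_sets[OF sets(2) refl] by auto
 define al where "al D B = distr (density D (indicator (shapes m -` B \<inter> space ?P))) ?P (frame m)" for D B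
 have Bm: "shapes m -` B \<inter> space ?P \<in> sets D" if "B \<in> sets ?P" "D \<in> {D1, D2}" for B D
  using measurable_sets[OF sm that(1)] that(2) sets by auto
 have al: "emeasure (al D B) A = (INT+ x. indicator A (frame m x) * indicator B (shapes m x) wrt D)"
  if B: "B \<in> sets ?P" and A: "A \<in> sets ?P" and D: "D \<in> {D1, D2}" for A B D
 proof -
  have f: "frame m \<in> D \<rightarrow>\<^sub>M ?P" by (rule meas[OF fm D])
  have "emeasure (al D B) A = emeasure (density D (indicator (shapes m -` B \<inter> space ?P))) (frame m -` A \<inter> space D)"
   unfolding al_def using f A by (subst emeasure_distr) auto
  also have "... = (INT+ x. indicator (shapes m -` B \<inter> space ?P) x * indicator (frame m -` A \<inter> space D) x wrt D)"
   using Bm[OF B D] measurable_sets[OF f A] by (subst emeasure_density) auto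
  also have "... = (INT+ x. indicator A (frame m x) * indicator B (shapes m x) wrt D)"
   using D spD by (intro nn_integral_cong) (auto simp: indicator_def)
  finally show ?thesis .
 qed
 have al_AE: "AE e in al D B. e \<in> frames m" if B: "B \<in> sets ?P" and D: "D \<in> {D1, D2}" and AED: "AE x in D. vol m x \<noteq> 0" for B D
 proof -
  have S: "Measurable.pred ?P (%x. x \<in> frames m)"
  proof -
   have c: "(%x. x i) \<in> ?P \<rightarrow>\<^sub>M (borel :: 'a measure)" if "i < m" for i using that by (intro measurable_component_singleton) simp
   have 1: "Measurable.pred ?P (%x. x i \<in> V)" if "i < m" for i
    using borel_closed[OF closed_subspace[OF subspace_V]]
    by (intro pred_sets2[OF _ c[OF that]]) auto
   have 2: "Measurable.pred ?P (%x. x i \<bullet> x j = r)" if "i < m" "j < m" for i j r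
    by (rule measurable_compose[OF borel_measurable_inner[OF c[OF that(1)] c[OF that(2)]]]) measurable
   have "Measurable.pred ?P (%x. \<forall>i\<in>{..<m}. x i \<in> V \<and> (\<forall>j\<in>{..<m}. x i \<bullet> x j = (if i = j then 1 else 0)))"
    by (intro pred_intros_finite pred_intros_logic 1 2) auto
   then show ?thesis unfolding frames_def mem_Collect_eq .
  qed
  have f: "frame m \<in> density D (indicator (shapes m -` B \<inter> space ?P)) \<rightarrow>\<^sub>M ?P" using meas[OF fm D] by simp
  have "AE x in density D (indicator (shapes m -` B \<inter> space ?P)). frame m x \<in> frames m"
   using AED Bm[OF B D] by (subst AE_density) (auto elim!: eventually_mono intro: frame_in_frames)
  then show ?thesis unfolding al_def by (rule AE_distr_iff[OF f S[unfolded pred_def], THEN iffD2])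
 qed
 have balls: "emeasure (al D B) (PiE {..<m} (%i. ball (x i) r)) = emeasure (al D B) (PiE {..<m} (%i. ball (y i) r))"
  if B: "B \<in> sets ?P" and D: "D \<in> {D1, D2}" and x: "x \<in> frames m" and y: "y \<in> frames m" for B D x y r
 proof -
  obtain T where TR: "T \<in> R" and T: "\<And>i. i < m ==> T (x i) = y i" using trans x y by blast
  have TO: "orthogonal_transformation T" and TQ: "\<forall>y\<in>Q. T y = y" using R TR by auto
  have Am: "PiE {..<m} (%i. ball (z i) r) \<in> sets ?P" for z by (intro sets_PiM_I_finite) auto
  let ?G = "%x. indicator (PiE {..<m} (%i. ball (y i) r)) (frame m x) * indicator B (shapes m x) :: ennreal"
  have Gm: "?G \<in> bmeas ?P"
   by (intro borel_measurable_times_ennreal measurable_compose[OF fm borel_measurable_indicator[OF Am]] measurable_compose[OF sm borel_measurable_indicator[OF B]])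
  have dT: "dist (T v) (T w) = dist v w" for v w
   using TO by (simp add: dist_norm orthogonal_transformation_norm linear_diff[OF orthogonal_transformation_linear[OF TO], symmetric])
  have "emeasure (al D B) (PiE {..<m} (%i. ball (y i) r)) = (INT+ x. ?G x wrt D)" by (rule al[OF B Am D])
  also have "... = (INT+ x. ?G (\<lambda>i\<in>{..<m}. T (x i)) wrt D)" 
   using bspec[OF bspec[OF inv(1) TR] Gm] bspec[OF bspec[OF inv(2) TR] Gm] D by (elim insertE emptyE) simp_all
  also have "... = (INT+ z. indicator (PiE {..<m} (%i. ball (x i) r)) (frame m z) * indicator B (shapes m z) wrt D)"
  proof (rule nn_integral_cong)
   fix z
   have "(\<lambda>i\<in>{..<m}. T (frame m z i)) \<in> PiE {..<m} (%i. ball (y i) r) \<longleftrightarrow> frame m z \<in> PiE {..<m} (%i. ball (x i) r)"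
    using dT T[symmetric] by (auto simp: PiE_iff frame_def)
   then show "?G (\<lambda>i\<in>{..<m}. T (z i)) = indicator (PiE {..<m} (%i. ball (x i) r)) (frame m z) * indicator B (shapes m z)"
    unfolding frame_tuple_rot[OF TO TQ] shape_tuple_rot[OF TO TQ] by (simp add: indicator_def)
  qed
  also have "... = emeasure (al D B) (PiE {..<m} (%i. ball (x i) r))" by (rule al[OF B Am D, symmetric])
  finally show ?thesis by simp
 qed
 have al_eq: "al D1 B = al D2 B" if B: "B \<in> sets ?P" for B
 proof (rule uniformly_distributed_measures_eq[where I = "{..<m}" and X = "frames m"])
  show "sets (al D1 B) = sets ?P" "sets (al D2 B) = sets ?P" by (simp_all add: al_def)
  show "finite_measure (al D1 B)" "finite_measure (al D2 B)"
   unfolding al_def using fin Bm[OF B] meas[OF fm] by (auto intro!: finite_measure_distr_density)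
  have "emeasure (al D B) (space ?P) = (INT+ x. indicator B (shapes m x) wrt D)" if "D \<in> {D1, D2}" for D
   unfolding al[OF B sets.top that] by (intro nn_integral_cong) (simp add: spP frame_def)
  then show "emeasure (al D1 B) (space (al D1 B)) = emeasure (al D2 B) (space (al D2 B))"
   using law[OF B] by (simp add: al_def)
  show "AE e in al D1 B. e \<in> frames m" "AE e in al D2 B. e \<in> frames m"
   using al_AE[OF B _ AE(1)] al_AE[OF B _ AE(2)] by simp_all
  fix x y r assume xy: "x \<in> frames m" "y \<in> frames m"
  show "emeasure (al D1 B) (PiE {..<m} (%i. ball (x i) r)) = emeasure (al D1 B) (PiE {..<m} (%i. ball (y i) r))"
   "emeasure (al D2 B) (PiE {..<m} (%i. ball (x i) r)) = emeasure (al D2 B) (PiE {..<m} (%i. ball (y i) r))"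
   using balls[OF B _ xy, of _ r] by simp_all
 qed simp
 have pm: "(%x. (frame m x, shapes m x)) \<in> ?P \<rightarrow>\<^sub>M ?P \<Otimes>\<^sub>M ?P" by (intro measurable_Pair fm sm)
 define J where "J D = distr D (?P \<Otimes>\<^sub>M ?P) (%x. (frame m x, shapes m x))" for D
 have J_rect: "emeasure (J D) (A \<times> B) = emeasure (al D B) A" if A: "A \<in> sets ?P" and B: "B \<in> sets ?P" and D: "D \<in> {D1, D2}" for A B D
 proof -
  have "emeasure (J D) (A \<times> B) = (INT+ p. indicator (A \<times> B) p wrt J D)" using A B by (simp add: J_def)
  also have "... = (INT+ x. indicator (A \<times> B) (frame m x, shapes m x) wrt D)"
   unfolding J_def using A B by (intro nn_integral_distr meas[OF pm D]) auto
  finally show ?thesis unfolding al[OF B A D] indicator_times by simp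
 qed
 have J_eq: "J D1 = J D2"
 proof (rule measure_eqI_generator_eq[where E = "{a \<times> b | a b. a \<in> sets ?P \<and> b \<in> sets ?P}" and \<Omega> = "space ?P \<times> space ?P" and A = "%_. space ?P \<times> space ?P"])
  show "emeasure (J D1) X = emeasure (J D2) X" if "X \<in> {a \<times> b | a b. a \<in> sets ?P \<and> b \<in> sets ?P}" for X
   using that J_rect al_eq by auto
  have "emeasure (J D1) (space ?P \<times> space ?P) = emeasure (al D1 (space ?P)) (space ?P)" by (rule J_rect) auto
  also have "... < \<infinity>"
   using finite_measure.emeasure_finite[OF finite_measure_distr_density[OF fin(1) meas[OF fm] Bm[OF sets.top]], of "space ?P"]
   by (simp add: al_def less_top)
  finally show "emeasure (J D1) (space ?P \<times> space ?P) \<noteq> \<infinity>" by simp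
 qed (auto simp: J_def sets_pair_measure Int_stable_pair_measure_generator dest: sets.sets_into_space)
 let ?u = "%p. \<lambda>j\<in>{..<m}. unshape (fst p) (snd p) j"
 have D: "emeasure D A = (INT+ p. indicator A (?u p) wrt J D)"
  if "D \<in> {D1, D2}" and A: "A \<in> sets ?P" and AED: "AE x in D. vol m x \<noteq> 0" for D A
 proof -
  have "(INT+ p. indicator A (?u p) wrt J D) = (INT+ x. indicator A (?u (frame m x, shapes m x)) wrt D)"
   unfolding J_def using A measurable_compose[OF unshape_measurable borel_measurable_indicator[OF A]]
   by (intro nn_integral_distr meas[OF pm that(1)]) auto
  also have "... = (INT+ x. indicator A x wrt D)"
  proof (rule nn_integral_cong_AE, use AED AE_space in eventually_elim)
   case (elim x)
   have x: "x \<in> PiE {..<m} (%_. UNIV)" using elim(2) that(1) spD spP by auto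
   have "?u (frame m x, shapes m x) = x"
   proof
    fix j
    show "?u (frame m x, shapes m x) j = x j"
    proof (cases "j < m")
     case True
     have "unshape (frame m x) (shapes m x) j = unshape (gs_frame (%i. orth_proj V (x i))) (shape x) j"
      using True by (auto simp: unshape_def frame_def intro!: arg_cong2[where f = "(+)"] sum.cong)
     then show ?thesis using True unshape_shape[OF elim(1) m True] by simp
    qed (use x in \<open>auto simp: PiE_iff extensional_def\<close>)
   qed
   then show ?case by simp
  qed
  also have "... = emeasure D A" using A that(1) sets by auto
  finally show ?thesis by simp
 qed
 show ?thesis
 proof (rule measure_eqI)
  show "sets D1 = sets D2" using sets by simp
  show "emeasure D1 A = emeasure D2 A" if "A \<in> sets D1" for A
   using that D[of D1 A] D[of D2 A] AE sets J_eq by simp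
 qed
qed

text \<open>Reduction of infinite measures to finite ones by restriction to bounded boxes. The box
  is determined by the norms of the points, hence by the shape, and orthogonal maps preserve it, so
  shape law and invariance pass to the restrictions.\<close>

lemma measure_eq_by_shape_law:
 fixes M1 M2 :: "(nat => 'a) measure"
 assumes m: "m \<le> dim V"
  and R: "\<forall>T\<in>R. orthogonal_transformation T \<and> (\<forall>y\<in>Q. T y = y)"
  and trans: "\<forall>x\<in>frames m. \<forall>y\<in>frames m. \<exists>T\<in>R. \<forall>i<m. T (x i) = y i"
  and sets: "sets M1 = sets (bPi {..<m})" "sets M2 = sets (bPi {..<m})"
  and fin: "\<And>k::nat. emeasure M1 (PiE {..<m} (%_. cball 0 (real k))) < \<infinity>"
  and AE: "AE x in M1. vol m x \<noteq> 0" "AE x in M2. vol m x \<noteq> 0"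
  and inv: "\<forall>T\<in>R. \<forall>G\<in>bmeas (bPi {..<m}). (INT+ x. G (\<lambda>i\<in>{..<m}. T (x i)) wrt M1) = (INT+ x. G x wrt M1)"
   "\<forall>T\<in>R. \<forall>G\<in>bmeas (bPi {..<m}). (INT+ x. G (\<lambda>i\<in>{..<m}. T (x i)) wrt M2) = (INT+ x. G x wrt M2)"
  and law: "\<And>G. G \<in> bmeas (bPi {..<m}) ==>
   (INT+ x. G (shapes m x) wrt M1) = (INT+ x. G (shapes m x) wrt M2)"
 shows "M1 = M2"
proof -
 let ?P = "PiM {..<m} (%_. borel :: 'a measure)"
 define K where "K k = PiE {..<m} (%_. cball 0 (real k) :: 'a set)" for k
 have Km: "K k \<in> sets ?P" for k unfolding K_def by (intro sets_PiM_I_finite) auto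
 have KI: "(indicator (K k) :: _ => ennreal) \<in> bmeas ?P" for k using Km by (intro borel_measurable_indicator)
 have meas: "f \<in> M \<rightarrow>\<^sub>M N" if "f \<in> ?P \<rightarrow>\<^sub>M N" "M \<in> {M1, M2}" for f :: "(nat => 'a) => 'b" and N M
  using that measurable_cong_sets[OF sets(1) refl] measurable_cong_sets[OF sets(2) refl] by auto
 have dens: "(INT+ x. G x wrt density M (indicator (K k))) = (INT+ x. indicator (K k) x * G x wrt M)"
  if "G \<in> bmeas ?P" "M \<in> {M1, M2}" for G M k
  using meas[OF that] meas[OF KI that(2)] by (intro nn_integral_density) auto
 have shK: "AE x in M. indicator (K k) x = (indicator (K k) (shapes m x) :: ennreal)"
  if "M \<in> {M1, M2}" and AEM: "AE x in M. vol m x \<noteq> 0" for M k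
  using AEM AE_space
 proof eventually_elim
  case (elim x)
  have "x \<in> space ?P" using elim(2) that(1) sets[THEN sets_eq_imp_space_eq] by auto
  then have "x \<in> PiE {..<m} (%_. UNIV)" by (simp add: space_PiM)
  then show ?case using norm_shape[OF elim(1) m] by (auto simp: K_def PiE_iff indicator_def)
 qed
 have shK2: "(INT+ x. indicator (K k) x * G (shapes m x) wrt M) = (INT+ x. indicator (K k) (shapes m x) * G (shapes m x) wrt M)"
  if "M \<in> {M1, M2}" and AEM: "AE x in M. vol m x \<noteq> 0" for M k G
  by (rule nn_integral_cong_AE, use shK[OF that, of k] in eventually_elim) simp
 have law': "(INT+ x. indicator (K k) x * G (shapes m x) wrt M1) = (INT+ x. indicator (K k) x * G (shapes m x) wrt M2)"
  if G: "G \<in> bmeas ?P" for G k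
  using law[OF borel_measurable_times_ennreal[OF KI G], of k] shK2[of M1 k G] shK2[of M2 k G] AE by simp
 have D_eq: "density M1 (indicator (K k)) = density M2 (indicator (K k))" for k
 proof (rule finite_measure_eq_by_shape_law[OF m R trans])
  have e: "emeasure (density M (indicator (K k))) (space M) = (INT+ x. indicator (K k) x wrt M)" if "M \<in> {M1, M2}" for M
   using meas[OF KI that] by (subst emeasure_density) (auto intro!: nn_integral_cong)
  have f1: "emeasure (density M1 (indicator (K k))) (space M1) < \<infinity>"
   using fin[of k] Km[of k] sets unfolding e[of M1, simplified] by (simp add: K_def)
  show "finite_measure (density M1 (indicator (K k)))" using f1 by (intro finite_measureI) simp
  \<comment> \<open>Boundedness on boxes is assumed for \<open>M1\<close> only; for
    \<open>M2\<close> it follows from the shape laws with the constant test function 1.\<close>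
  have "(INT+ x. indicator (K k) x wrt M1) = (INT+ x. indicator (K k) x wrt M2)"
   using law'[of "%_. 1" k] by simp
  then show "finite_measure (density M2 (indicator (K k)))"
   using f1 e by (intro finite_measureI) simp
  show "AE x in density M1 (indicator (K k)). vol m x \<noteq> 0" "AE x in density M2 (indicator (K k)). vol m x \<noteq> 0"
   using AE meas[OF KI] by (auto simp: AE_density elim!: eventually_mono)
  have I: "(INT+ x. G (\<lambda>i\<in>{..<m}. T (x i)) wrt density M (indicator (K k))) = (INT+ x. G x wrt density M (indicator (K k)))"
   if T: "T \<in> R" and G: "G \<in> bmeas ?P" and M: "M \<in> {M1, M2}" for T G M
  proof -
   have TO: "orthogonal_transformation T" using R T by auto
   have "T \<in> bmeas borel"
    using orthogonal_transformation_linear[OF TO] by (intro borel_measurable_continuous_onI linear_continuous_on) (simp add: linear_conv_bounded_linear)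
   then have Tm: "(%x. \<lambda>i\<in>{..<m}. T (x i)) \<in> ?P \<rightarrow>\<^sub>M ?P"
    by (intro measurable_restrict measurable_compose[OF measurable_component_singleton]) auto
   have "indicator (K k) (\<lambda>i\<in>{..<m}. T (x i)) = (indicator (K k) x :: ennreal)" if "x \<in> space M" for x
   proof -
    have "x \<in> space ?P" using that M sets[THEN sets_eq_imp_space_eq] by auto
    then have "x \<in> PiE {..<m} (%_. UNIV)" by (simp add: space_PiM)
    then show ?thesis using TO by (auto simp: K_def PiE_iff indicator_def orthogonal_transformation_norm)
   qed
   then have "(INT+ x. indicator (K k) x * G (\<lambda>i\<in>{..<m}. T (x i)) wrt M)
    = (INT+ x. indicator (K k) (\<lambda>i\<in>{..<m}. T (x i)) * G (\<lambda>i\<in>{..<m}. T (x i)) wrt M)"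
    by (intro nn_integral_cong) simp
   also have "... = (INT+ x. indicator (K k) x * G x wrt M)"
    using bspec[OF bspec[OF inv(1) T] borel_measurable_times_ennreal[OF KI G], of k]
     bspec[OF bspec[OF inv(2) T] borel_measurable_times_ennreal[OF KI G], of k] M by auto
   finally show ?thesis unfolding dens[OF G M] dens[OF measurable_compose[OF Tm G] M] .
  qed
  show "\<forall>T\<in>R. \<forall>G\<in>bmeas ?P. (INT+ x. G (\<lambda>i\<in>{..<m}. T (x i)) wrt density M1 (indicator (K k))) = (INT+ x. G x wrt density M1 (indicator (K k)))"
   "\<forall>T\<in>R. \<forall>G\<in>bmeas ?P. (INT+ x. G (\<lambda>i\<in>{..<m}. T (x i)) wrt density M2 (indicator (K k))) = (INT+ x. G x wrt density M2 (indicator (K k)))"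
   using I by blast+
  fix B assume B: "B \<in> sets ?P"
  have "(%x. indicator B (shapes m x) :: ennreal) \<in> bmeas ?P"
   by (rule measurable_compose[OF shape_tuple_measurable borel_measurable_indicator[OF B]])
  then show "(INT+ x. indicator B (shapes m x) wrt density M1 (indicator (K k))) = (INT+ x. indicator B (shapes m x) wrt density M2 (indicator (K k)))"
   using law'[OF borel_measurable_indicator[OF B], of k] by (simp add: dens)
 qed (use sets in auto)
 show ?thesis
 proof (rule measure_eqI)
  show "sets M1 = sets M2" using sets by simp
  fix A assume "A \<in> sets M1"
  then have A: "A \<in> sets ?P" using sets by simp
  have "emeasure M A = (SUP k. emeasure M (A \<inter> K k))" if M: "M \<in> {M1, M2}" for M
  proof -
   have "K k \<subseteq> K l" if "k \<le> l" for k l using that unfolding K_def by (intro PiE_mono) auto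
   then have "incseq (%k. A \<inter> K k)" by (auto simp: incseq_def)
   moreover have "range (%k. A \<inter> K k) \<subseteq> sets M" using A Km M sets by auto
   ultimately have "(SUP k. emeasure M (A \<inter> K k)) = emeasure M (\<Union>k. A \<inter> K k)" by (intro SUP_emeasure_incseq)
   moreover have "(\<Union>k. A \<inter> K k) = A"
   proof (intro equalityI subsetI)
    fix x assume x: "x \<in> A"
    then have xe: "x \<in> PiE {..<m} (%_. UNIV)" using sets.sets_into_space[OF A] by (auto simp: space_PiM)
    obtain k where k: "(\<Sum>i<m. norm (x i)) \<le> real k" using real_arch_simple by blast
    have "norm (x i) \<le> real k" if "i < m" for i
     using member_le_sum[of i "{..<m}" "%i. norm (x i)"] that k by auto
    then have "x \<in> K k" using xe by (auto simp: K_def PiE_iff)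
    then show "x \<in> (\<Union>k. A \<inter> K k)" using x by blast
   qed auto
   ultimately show ?thesis by simp
  qed
  moreover have "emeasure M (A \<inter> K k) = emeasure (density M (indicator (K k))) A" if M: "M \<in> {M1, M2}" for M k
  proof -
   have "A \<inter> K k \<in> sets M" using A Km M sets by auto
   then have "emeasure M (A \<inter> K k) = (INT+ x. indicator (A \<inter> K k) x wrt M)" by simp
   also have "... = (INT+ x. indicator (K k) x * indicator A x wrt M)" by (simp add: indicator_inter_arith mult.commute)
   also have "... = emeasure (density M (indicator (K k))) A"
    using meas[OF KI M] A M sets by (subst emeasure_density) auto
   finally show ?thesis .
  qed
  ultimately show "emeasure M1 A = emeasure M2 A" using D_eq by simp
 qed
qed

end

section \<open>Reflections and transitivity on frames\<close>

lemma reflection_orthogonal: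
 assumes "norm w = 1" shows "orthogonal_transformation (%v. v - (2 * (v \<bullet> w)) *\<^sub>R w)"
proof -
 have w: "w \<bullet> w = 1" using assms by (simp add: norm_eq_1)
 have "linear (%v. v - (2 * (v \<bullet> w)) *\<^sub>R w)"
  by (rule linearI) (simp_all add: inner_add_left algebra_simps)
 moreover have "(v - (2 * (v \<bullet> w)) *\<^sub>R w) \<bullet> (u - (2 * (u \<bullet> w)) *\<^sub>R w) = v \<bullet> u" for v u
  by (simp add: inner_diff_left inner_diff_right w inner_commute[of w u] algebra_simps)
 ultimately show ?thesis by (simp add: orthogonal_transformation_def)
qed

text \<open>The reflection is conjugate, by an orthogonal map carrying an axis vector to
  \<open>w\<close>, to a diagonal matrix with one entry \<open>- 1\<close>.\<close>

lemma det_reflection: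
 fixes w :: "real ^ 'n" assumes "norm w = 1"
 shows "det (matrix (%v. v - (2 * (v \<bullet> w)) *\<^sub>R w)) = - 1"
proof -
 let ?r = "%v. v - (2 * (v \<bullet> w)) *\<^sub>R w"
 define k where "k = (SOME k :: 'n. True)"
 obtain f :: "real ^ 'n => real ^ 'n" where f: "orthogonal_transformation f" "f (axis k 1) = w"
  by (rule orthogonal_transformation_exists_1[of "axis k 1" w]) (use assms in simp_all)
 have inn: "f v \<bullet> f u = v \<bullet> u" for v u using f(1) by (simp add: orthogonal_transformation_def)
 have lf: "linear f" by (rule orthogonal_transformation_linear[OF f(1)])
 define D where "D v = (v :: real ^ 'n) - (2 * (v \<bullet> axis k 1)) *\<^sub>R axis k 1" for v
 have lD: "linear D" unfolding D_def by (rule linearI) (simp_all add: inner_add_left algebra_simps)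
 have "?r \<circ> f = f \<circ> D"
 proof
  fix v
  have "f (D v) = f v - (2 * (v \<bullet> axis k 1)) *\<^sub>R w"
   unfolding D_def linear_diff[OF lf] linear_cmul[OF lf] f(2) ..
  moreover have "f v \<bullet> w = v \<bullet> axis k 1" using inn[of v "axis k 1"] f(2) by simp
  ultimately show "(?r \<circ> f) v = (f \<circ> D) v" by simp
 qed
 then have "matrix ?r ** matrix f = matrix f ** matrix D"
  using matrix_compose[OF lf orthogonal_transformation_linear[OF reflection_orthogonal[OF assms]]] matrix_compose[OF lD lf] by simp
 then have "det (matrix ?r ** matrix f) = det (matrix f ** matrix D)" by simp
 then have "det (matrix ?r) * det (matrix f) = det (matrix D) * det (matrix f)"
  unfolding det_mul by (simp add: mult.commute)
 moreover have "det (matrix f) \<noteq> 0" using orthogonal_transformation_det[OF f(1)] by auto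
 moreover have "det (matrix D) = - 1"
 proof -
  have e: "matrix D $ i $ j = (if i = j then (if i = k then - 1 else 1) else 0)" for i j
   unfolding matrix_def D_def inner_axis_axis by (auto simp: axis_def)
  have "det (matrix D) = (\<Prod>i\<in>UNIV. if i = k then - 1 else 1)"
   by (subst det_diagonal) (simp_all add: e)
  then show ?thesis by simp
 qed
 ultimately have "det (matrix ?r) * det (matrix f) = - 1 * det (matrix f)" "det (matrix f) \<noteq> 0" by simp_all
 then show ?thesis by (simp only: mult_cancel_right simp_thms)
qed

lemma orthonormal_transport:
 fixes x y :: "nat => 'a::euclidean_space"
 assumes x: "onb n x UNIV" and y: "onb n y UNIV"
 defines "T \<equiv> %v. lincomb n y (%i. v \<bullet> x i)"
 shows "orthogonal_transformation T" "i < n ==> T (x i) = y i"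
proof -
 have "linear T"
  unfolding T_def by (rule linearI) (simp_all add: inner_add_left flip: lincomb_add lincomb_scale)
 moreover have "norm (T v) = norm v" for v
 proof -
  have "(norm (T v))\<^sup>2 = (norm (lincomb n x (%i. v \<bullet> x i)))\<^sup>2" unfolding T_def norm_lincomb[OF y] norm_lincomb[OF x] ..
  also have "lincomb n x (%i. v \<bullet> x i) = v" by (rule lincomb_coords[OF x]) simp
  finally show ?thesis by simp
 qed
 ultimately show "orthogonal_transformation T" by (simp add: orthogonal_transformation)
 show "T (x i) = y i" if i: "i < n"
 proof -
  have "T (x i) = (\<Sum>j<n. (if j = i then y i else 0))"
   unfolding T_def lincomb_def using onb_inner[OF x i] by (intro sum.cong) auto
  then show ?thesis using i by simp
 qed
qed

context shape_frame
begin

text \<open>All extensions end with the same basis \<open>c\<close> of \<open>Q\<close>, so the map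
  carrying one extended frame to another fixes \<open>Q\<close> pointwise.\<close>

lemma frame_extend:
 assumes c: "onb (dim Q) c Q" and m: "m \<le> dim V" and x: "x \<in> frames m"
 obtains X where "onb (dim V + dim Q) X UNIV" "\<And>i. i < m ==> X i = x i" "\<And>i. i < dim V ==> X i \<in> V"
  "\<And>i. dim V \<le> i ==> X i = c (i - dim V)"
proof -
 let ?E = "span (x ` {..<m})"
 have xE: "onb m x ?E" using x by (simp add: onb_def frames_def)
 have EV: "?E \<subseteq> V" using x by (intro span_minimal subspace_V) (auto simp: frames_def)
 define U where "U = {x \<in> V. \<forall>y\<in>?E. x \<bullet> y = 0}"
 note U = relative_complement[OF subspace_V subspace_span EV, folded U_def]
 obtain u where "onb (dim U) u U" using onb_exists[OF U(1)] .
 then have "onb (dim V - m) u U" using U(4) onb_dim[OF xE] by simp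
 from onb_append[OF xE this U(3)] have Y: "onb (dim V) (%i. if i < m then x i else u (i - m)) V"
  using m by (simp add: U(2))
 have "onb (dim V + dim Q) (%i. if i < dim V then if i < m then x i else u (i - m) else c (i - dim V)) UNIV"
  using onb_append[OF Y c] orth_VQ by (simp add: sum_V_Q)
 then show thesis by (rule that) (use m onb_in[OF Y] in auto)
qed

end

lemma (in shape_frame) frames_transitive:
 assumes m: "m \<le> dim V" and x: "x \<in> frames m" and y: "y \<in> frames m"
 obtains T where "orthogonal_transformation T" "\<forall>v\<in>Q. T v = v" "\<And>i. i < m ==> T (x i) = y i"
proof -
 obtain c where c: "onb (dim Q) c Q" using onb_exists[OF Q] .
 obtain X where X: "onb (dim V + dim Q) X UNIV" "\<And>i. i < m ==> X i = x i" "\<And>i. i < dim V ==> X i \<in> V"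
  "\<And>i. dim V \<le> i ==> X i = c (i - dim V)" using frame_extend[OF c m x] by blast
 obtain Y where Y: "onb (dim V + dim Q) Y UNIV" "\<And>i. i < m ==> Y i = y i" "\<And>i. i < dim V ==> Y i \<in> V"
  "\<And>i. dim V \<le> i ==> Y i = c (i - dim V)" using frame_extend[OF c m y] by blast
 note T = orthonormal_transport[OF X(1) Y(1)]
 have "lincomb (dim V + dim Q) Y (%i. v \<bullet> X i) = v" if v: "v \<in> Q" for v
 proof -
  have "v \<bullet> X i = v \<bullet> Y i" for i
  proof (cases "i < dim V")
   case True
   show ?thesis using orth_VQ[OF X(3)[OF True] v] orth_VQ[OF Y(3)[OF True] v] by (simp add: inner_commute)
  qed (simp add: X(4) Y(4))
  then have "lincomb (dim V + dim Q) Y (%i. v \<bullet> X i) = lincomb (dim V + dim Q) Y (%i. v \<bullet> Y i)" by simp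
  also have "... = v" by (rule lincomb_coords[OF Y(1)]) simp
  finally show ?thesis .
 qed
 moreover have "lincomb (dim V + dim Q) Y (%k. x i \<bullet> X k) = y i" if "i < m" for i
  using T(2)[of i] that m by (simp add: X(2)[OF that] Y(2)[OF that])
 ultimately show thesis by (intro that[OF T(1)]) auto
qed

section \<open>Rotations of the Grassmannian and measurable dependence on the subspace\<close>

locale grassmann_frame = shape_frame Q b for Q :: "(real ^ 'n) set" and b +
 fixes m :: nat and \<nu> :: "(real ^ 'n) set measure"
 assumes \<nu>: "is_grassmannian_measure m (orthogonal_comp Q) \<nu>" and m: "m \<le> dim (orthogonal_comp Q)"
begin

lemma rotations_of_V: "T \<in> rotations_of V ==> orthogonal_transformation T \<and> (\<forall>y\<in>Q. T y = y)"
 by (auto simp: rotations_of_def orthogonal_comp_self[OF Q])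

text \<open>The strict inequality leaves a direction in \<open>V\<close> along which an orthogonal map of determinant
 \<open>- 1\<close> can be corrected by a reflection.\<close>

lemma rotations_transitive:
 assumes mV: "m < dim V" and x: "x \<in> frames m" and y: "y \<in> frames m"
 shows "\<exists>T\<in>rotations_of V. \<forall>i<m. T (x i) = y i"
proof -
 obtain T where T: "orthogonal_transformation T" "\<forall>v\<in>Q. T v = v" "\<And>i. i < m ==> T (x i) = y i"
  using frames_transitive[OF m x y] by blast
 show ?thesis
 proof (cases "det (matrix T) = 1")
  case True
  then have "T \<in> rotations_of V" using T by (simp add: rotations_of_def orthogonal_comp_self[OF Q])
  then show ?thesis using T(3) by blast
 next
  case False
  then have dT: "det (matrix T) = - 1" using orthogonal_transformation_det[OF T(1)] by (auto simp: abs_if split: if_splits)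
  obtain c where c: "onb (dim Q) c Q" using onb_exists[OF Q] .
  obtain Y where Y: "onb (dim V + dim Q) Y UNIV" "\<And>i. i < m ==> Y i = y i" "\<And>i. i < dim V ==> Y i \<in> V"
   using frame_extend[OF c m y] by metis
  let ?r = "%v. v - (2 * (v \<bullet> Y m)) *\<^sub>R Y m"
  have w: "norm (Y m) = 1" using onb_inner[OF Y(1), of m m] mV by (simp add: norm_eq_1)
  have rQ: "?r v = v" if "v \<in> Q" for v using orth_VQ[OF Y(3)[OF mV] that] by (simp add: inner_commute)
  have ry: "?r (y i) = y i" if "i < m" for i using onb_inner[OF Y(1), of i m] that mV Y(2)[OF that] by simp
  have "orthogonal_transformation (?r \<circ> T)" by (rule orthogonal_transformation_compose[OF reflection_orthogonal[OF w] T(1)])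
  moreover have "det (matrix (?r \<circ> T)) = 1"
   using matrix_compose[OF orthogonal_transformation_linear[OF T(1)] orthogonal_transformation_linear[OF reflection_orthogonal[OF w]]]
   by (simp add: det_mul det_reflection[OF w] dT)
  ultimately have "?r \<circ> T \<in> rotations_of V" using T(2) rQ by (simp add: rotations_of_def orthogonal_comp_self[OF Q])
  moreover have "\<forall>i<m. (?r \<circ> T) (x i) = y i" using T(3) ry by simp
  ultimately show ?thesis by blast
 qed
qed

lemma sets_\<nu>: "sets \<nu> = sets (grassmannian_borel m V)"
 using \<nu> by (simp add: is_grassmannian_measure_def)

lemma space_\<nu>: "space \<nu> = grassmannian m V"
 using sets_eq_imp_space_eq[OF sets_\<nu>] by (simp add: grassmannian_borel_def)

lemma in_\<nu>: "L \<in> space \<nu> \<longleftrightarrow> subspace L \<and> L \<subseteq> V \<and> dim L = m"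
 by (simp add: space_\<nu> grassmannian_def)

lemma emeasure_\<nu>: "emeasure \<nu> (space \<nu>) = ennreal ((\<Prod>i<m. sphere_area (dim V - i)) / (\<Prod>i=1..m. sphere_area i))"
 using \<nu> by (simp add: is_grassmannian_measure_def space_\<nu>)

lemma sigma_finite_\<nu>: "sigma_finite_measure \<nu>"
proof -
 have "finite_measure \<nu>" by (rule finite_measureI) (simp add: emeasure_\<nu>)
 then show ?thesis by (simp add: finite_measure_def)
qed

lemma matrix_orth_proj_measurable: "(%L. matrix (orth_proj L)) \<in> bmeas \<nu>"
 unfolding measurable_cong_sets[OF sets_\<nu> refl] grassmannian_borel_def
 by (rule measurable_vimage_algebra1) simp

lemma matrix_vector_measurable: "(%p. (fst p :: real ^ 'n ^ 'n) *v snd p) \<in> bmeas (borel \<Otimes>\<^sub>M borel)"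
 unfolding borel_prod
proof (intro borel_measurable_continuous_onI)
 have "continuous_on UNIV (%p. \<chi> i. \<Sum>j\<in>UNIV. (fst p :: real ^ 'n ^ 'n) $ i $ j * snd p $ j)"
  by (intro continuous_intros)
 then show "continuous_on UNIV (%p. (fst p :: real ^ 'n ^ 'n) *v snd p)" by (simp add: matrix_vector_mult_def)
qed

text \<open>The Borel structure of the Grassmannian makes the projection matrix measurable in
  \<open>L\<close>; applying a matrix to a vector is jointly continuous.\<close>

lemma orth_proj_kernel_measurable: "(%p. orth_proj (fst p) (snd p)) \<in> bmeas (\<nu> \<Otimes>\<^sub>M borel)"
proof -
 have "(%p. matrix (orth_proj (fst p)) *v snd p) \<in> bmeas (\<nu> \<Otimes>\<^sub>M borel)"
  using measurable_compose[OF measurable_Pair[OF measurable_compose[OF measurable_fst matrix_orth_proj_measurable] measurable_snd] matrix_vector_measurable]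
  by simp
 moreover have "matrix (orth_proj (fst p)) *v snd p = orth_proj (fst p) (snd p)" if "p \<in> space (\<nu> \<Otimes>\<^sub>M borel)" for p
 proof -
  have "subspace (fst p)" using that by (auto simp: space_pair_measure in_\<nu>)
  from fun_cong[OF matrix_vector_mul(2)[OF linear_orth_proj[OF this]], of "snd p"] show ?thesis .
 qed
 ultimately show ?thesis by (simp cong: measurable_cong)
qed

lemma rot_V_image:
 assumes T: "T \<in> rotations_of V" and L: "L \<in> space \<nu>" shows "T ` L \<in> space \<nu>" "inv T ` L \<in> space \<nu>"
proof -
 have *: "S ` L \<in> space \<nu>" if S: "orthogonal_transformation S" "\<forall>y\<in>Q. S y = y" for S
 proof -
  have "linear S" by (rule orthogonal_transformation_linear[OF S(1)])
  moreover have "dim (S ` L) = dim L"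
   using dim_image_eq[OF \<open>linear S\<close>] orthogonal_transformation_inj[OF S(1)] by (simp add: inj_on_subset[OF _ subset_UNIV])
  ultimately show ?thesis using L rot_V[OF S] by (auto simp: in_\<nu> linear_subspace_image)
 qed
 have TO: "orthogonal_transformation T" "\<forall>y\<in>Q. T y = y" using rotations_of_V[OF T] by auto
 show "T ` L \<in> space \<nu>" by (rule *[OF TO])
 have "\<forall>y\<in>Q. inv T y = y" using TO(2) orthogonal_transformation_inj[OF TO(1)] by (metis inv_f_eq)
 then show "inv T ` L \<in> space \<nu>" by (intro * orthogonal_transformation_inv[OF TO(1)])
qed

lemma orth_proj_image:
 assumes T: "orthogonal_transformation (T :: real ^ 'n => real ^ 'n)" and L: "subspace L"
 shows "orth_proj (T ` L) x = T (orth_proj L (inv T x))"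
proof (rule orth_proj_eqI)
 have lin: "linear T" and inn: "T v \<bullet> T w = v \<bullet> w" for v w using T by (auto simp: orthogonal_transformation_def)
 show "subspace (T ` L)" by (rule linear_subspace_image[OF lin L])
 show "T (orth_proj L (inv T x)) \<in> T ` L" using orth_proj_in[OF L] by blast
 have x: "x = T (inv T x)" using orthogonal_transformation_surj[OF T] by (simp add: surj_f_inv_f)
 fix z assume "z \<in> T ` L"
 then obtain w where w: "z = T w" "w \<in> L" by auto
 have "x - T (orth_proj L (inv T x)) = T (inv T x - orth_proj L (inv T x))"
  by (subst x) (simp only: linear_diff[OF lin])
 then show "(x - T (orth_proj L (inv T x))) \<bullet> z = 0"
  unfolding w(1) inn using orth_proj_orthogonal[OF L w(2)] by (simp only: inn)
qed

text \<open>On projection matrices the map acts by conjugation with \<open>matrix T\<close>, which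
  is continuous.\<close>

lemma image_measurable:
 assumes T: "T \<in> rotations_of V" shows "(%L. T ` L) \<in> \<nu> \<rightarrow>\<^sub>M \<nu>"
proof -
 have TO: "orthogonal_transformation T" using rotations_of_V[OF T] by auto
 have lT: "linear T" "linear (inv T)"
  using TO orthogonal_transformation_inv[OF TO] by (simp_all add: orthogonal_transformation_linear)
 have "continuous_on UNIV (\<lambda>A :: real ^ 'n ^ 'n. \<chi> i j. \<Sum>k\<in>UNIV. (\<Sum>l\<in>UNIV. matrix T $ i $ l * A $ l $ k) * matrix (inv T) $ k $ j)"
  by (intro continuous_intros)
 then have m: "(\<lambda>A :: real ^ 'n ^ 'n. matrix T ** A ** matrix (inv T)) \<in> bmeas borel"
  by (intro borel_measurable_continuous_onI) (simp add: matrix_matrix_mult_def)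
 have eq: "matrix (orth_proj (T ` L)) = matrix T ** matrix (orth_proj L) ** matrix (inv T)" if L: "L \<in> space \<nu>" for L
 proof -
  have sL: "subspace L" using L by (simp add: in_\<nu>)
  have "orth_proj (T ` L) = (T \<circ> orth_proj L) \<circ> inv T" using orth_proj_image[OF TO sL] by (simp add: fun_eq_iff)
  then show ?thesis
   using matrix_compose[OF lT(2) linear_compose[OF linear_orth_proj[OF sL] lT(1)]] matrix_compose[OF linear_orth_proj[OF sL] lT(1)] by simp
 qed
 have "(%L. matrix (orth_proj (T ` L))) \<in> bmeas \<nu>"
  using measurable_compose[OF matrix_orth_proj_measurable m] eq by (simp cong: measurable_cong)
 then have "(%L. T ` L) \<in> \<nu> \<rightarrow>\<^sub>M vimage_algebra (grassmannian m V) (%L. matrix (orth_proj L)) borel"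
  using rot_V_image(1)[OF T] by (intro measurable_vimage_algebra2) (auto simp: space_\<nu>)
 then show ?thesis unfolding measurable_cong_sets[OF refl sets_\<nu>] grassmannian_borel_def .
qed

lemma nn_integral_rotate_\<nu>:
 assumes T: "T \<in> rotations_of V" and G: "G \<in> bmeas \<nu>"
 shows "(INT+ L. G (T ` L) wrt \<nu>) = (INT+ L. G L wrt \<nu>)"
proof -
 note im = image_measurable[OF T]
 have TO: "orthogonal_transformation T" using rotations_of_V[OF T] by auto
 have "distr \<nu> \<nu> (%L. T ` L) = \<nu>"
 proof (rule measure_eqI)
  fix A assume "A \<in> sets (distr \<nu> \<nu> (%L. T ` L))"
  then have A: "A \<in> sets \<nu>" by simp
  let ?B = "(%L. T ` L) -` A \<inter> space \<nu>"
  have B: "?B \<in> sets \<nu>" by (rule measurable_sets[OF im A])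
  \<comment> \<open>Invariance is assumed for images of sets, whereas \<open>distr\<close> speaks of
    preimages; as \<open>inv T\<close> also maps the Grassmannian into itself, \<open>A\<close> is
    the image of its preimage.\<close>
  have "(%L. T ` L) ` ?B = A"
  proof (intro equalityI subsetI)
   fix L assume L: "L \<in> A"
   have "T ` (inv T ` L) = L" using orthogonal_transformation_surj[OF TO] by (simp add: image_f_inv_f)
   moreover have "inv T ` L \<in> ?B" using rot_V_image(2)[OF T] sets.sets_into_space[OF A] L calculation by auto
   ultimately show "L \<in> (%L. T ` L) ` ?B" by (metis image_eqI)
  qed auto
  then have "emeasure \<nu> A = emeasure \<nu> ?B"
   using \<nu> T B unfolding is_grassmannian_measure_def by (metis (no_types, lifting))
  then show "emeasure (distr \<nu> \<nu> (%L. T ` L)) A = emeasure \<nu> A" using im A by (simp add: emeasure_distr)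
 qed simp
 then have "(INT+ L. G L wrt \<nu>) = (INT+ L. G L wrt distr \<nu> \<nu> (%L. T ` L))" by simp
 also have "... = (INT+ L. G (T ` L) wrt \<nu>)" by (rule nn_integral_distr[OF im]) (use G in simp)
 finally show ?thesis by simp
qed

end

lemma orthogonal_transformation_measurable:
 "orthogonal_transformation (T :: 'a::euclidean_space => 'a) ==> T \<in> bmeas borel"
 using orthogonal_transformation_linear[of T]
 by (intro borel_measurable_continuous_onI linear_continuous_on) (simp add: linear_conv_bounded_linear)

lemma nn_integral_PiM_rotate:
 fixes W :: "'a::euclidean_space set" and T :: "'a => 'a"
 assumes T: "orthogonal_transformation T" and W: "subspace W" and I: "finite I" and G: "G \<in> bmeas (bPi I)"
 shows "(INT+ x. G (\<lambda>i\<in>I. T (x i)) wrt PiM I (%_. leb W)) = (INT+ x. G x wrt PiM I (%_. leb (T ` W)))"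
proof -
 note Tm = orthogonal_transformation_measurable[OF T]
 have TW: "subspace (T ` W)" by (rule linear_subspace_image[OF orthogonal_transformation_linear[OF T] W])
 have sets: "sets (PiM I (%_. leb (T ` W))) = sets (bPi I)" by (intro sets_PiM_cong) auto
 have "(INT+ x. G x wrt PiM I (%_. leb (T ` W))) = (INT+ x. G (\<lambda>i\<in>I. T (x i)) * (\<Prod>i\<in>I. 1) wrt PiM I (%_. leb W))"
 proof (rule nn_integral_PiM_transfer[OF I, where h = "%_. T" and w = "%_ _. 1"])
  show "T \<in> leb W \<rightarrow>\<^sub>M leb (T ` W)"
   using Tm by (simp add: measurable_cong_sets[OF sets_leb sets_leb])
  show "(INT+ y. H y wrt leb (T ` W)) = (INT+ x. H (T x) * 1 wrt leb W)" if "H \<in> bmeas (leb (T ` W))" for H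
   unfolding leb_isometry[OF T W] using that Tm
   by (subst nn_integral_distr) (auto simp: measurable_cong_sets[OF sets_leb refl])
  show "G \<in> bmeas (PiM I (%_. leb (T ` W)))" using G by (simp add: measurable_cong_sets[OF sets refl])
 qed (use sigma_finite_leb W TW in auto)
 then show ?thesis by simp
qed

section \<open>The two sides of the Blaschke-Petkantschin formula as measures\<close>

context grassmann_frame
begin

text \<open>For \<open>L\<close> in the Grassmannian this is the tuple of projections onto
  \<open>L + Q\<close>, written as a sum of two projections so that the dependence on
  \<open>L\<close> is only through \<open>orth_proj L\<close>.\<close>

definition fibre :: "(real ^ 'n) set \<times> (nat => real ^ 'n) => nat => real ^ 'n" where
 "fibre p = (\<lambda>i\<in>{..<m}. orth_proj (fst p) (snd p i) + orth_proj Q (snd p i))"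

definition fibre_weight :: "(real ^ 'n) set \<times> (nat => real ^ 'n) => ennreal" where
 "fibre_weight p = (\<Prod>i<m. ennreal (1 / unit_ball_vol (CARD('n) - (m + dim Q))) * indicator (cball 0 1) (snd p i - fibre p i))"

text \<open>The right side of the Blaschke-Petkantschin formula as a measure. The image of a density
  on one fixed product replaces the family of measures on the spaces \<open>L + Q\<close>.\<close>

definition fibre_measure :: "(nat => real ^ 'n) measure" where
 "fibre_measure = distr (density (\<nu> \<Otimes>\<^sub>M lPi {..<m})
   (%p. ennreal (vol m (fibre p) ^ (dim V - m)) * fibre_weight p)) (bPi {..<m}) fibre"

lemma sets_PiM_lborel: "sets (PiM {..<m} (%_. lborel :: (real ^ 'n) measure)) = sets (bPi {..<m})"
 by (intro sets_PiM_cong) auto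

lemma coordinate_measurable: "i < m ==> (%p. snd p i) \<in> bmeas (\<nu> \<Otimes>\<^sub>M PiM {..<m} (%_. lborel :: (real ^ 'n) measure))"
proof -
 assume "i < m"
 then have "(%x. x i) \<in> PiM {..<m} (%_. lborel :: (real ^ 'n) measure) \<rightarrow>\<^sub>M lborel"
  by (intro measurable_component_singleton) simp
 then have "(%x. x i) \<in> bmeas (PiM {..<m} (%_. lborel :: (real ^ 'n) measure))" by simp
 then show ?thesis by (rule measurable_compose[OF measurable_snd])
qed

lemma fibre_coordinate_measurable:
 assumes "i < m"
 shows "(%p. orth_proj (fst p) (snd p i) + orth_proj Q (snd p i)) \<in> bmeas (\<nu> \<Otimes>\<^sub>M lPi {..<m})"
 using measurable_compose[OF measurable_Pair[OF measurable_fst coordinate_measurable[OF assms]] orth_proj_kernel_measurable]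
  measurable_compose[OF coordinate_measurable[OF assms] orth_proj_measurable[OF Q]]
 by (intro borel_measurable_add) auto

lemma fibre_measurable: "fibre \<in> \<nu> \<Otimes>\<^sub>M lPi {..<m} \<rightarrow>\<^sub>M bPi {..<m}"
 unfolding fibre_def by (intro measurable_restrict fibre_coordinate_measurable) simp

lemma fibre_weight_measurable: "fibre_weight \<in> bmeas (\<nu> \<Otimes>\<^sub>M lPi {..<m})"
 unfolding fibre_weight_def
proof (intro borel_measurable_prod_ennreal borel_measurable_times_ennreal borel_measurable_const)
 fix i assume i: "i \<in> {..<m}"
 have "(%p. snd p i - fibre p i) \<in> bmeas (\<nu> \<Otimes>\<^sub>M lPi {..<m})"
  using i borel_measurable_diff[OF coordinate_measurable fibre_coordinate_measurable, of i i] by (simp add: fibre_def)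
 then show "(%p. indicator (cball 0 1) (snd p i - fibre p i) :: ennreal) \<in> bmeas (\<nu> \<Otimes>\<^sub>M lPi {..<m})"
  by (rule measurable_compose) (intro borel_measurable_indicator, simp)
qed

lemma
 assumes L: "L \<in> space \<nu>"
 shows subspace_sum_L: "subspace (subspace_sum L Q)" and dim_sum_L: "dim (subspace_sum L Q) = m + dim Q"
  and orth_proj_sum_L: "orth_proj (subspace_sum L Q) x = orth_proj L x + orth_proj Q x"
proof -
 have sL: "subspace L" "L \<subseteq> V" "dim L = m" using L by (auto simp: in_\<nu>)
 have o: "\<forall>x\<in>L. \<forall>y\<in>Q. x \<bullet> y = 0" using sL(2) orth_VQ by blast
 show W: "subspace (subspace_sum L Q)" by (rule subspace_subspace_sum[OF sL(1) Q o])
 show "dim (subspace_sum L Q) = m + dim Q" using dim_subspace_sum[OF sL(1) Q o] sL(3) by simp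
 show "orth_proj (subspace_sum L Q) x = orth_proj L x + orth_proj Q x"
 proof (rule orth_proj_eqI[OF W])
  show "orth_proj L x + orth_proj Q x \<in> subspace_sum L Q"
   using orth_proj_in[OF sL(1)] orth_proj_in[OF Q] by (auto simp: subspace_sum_def)
  fix z assume "z \<in> subspace_sum L Q"
  then obtain l y where z: "z = l + y" "l \<in> L" "y \<in> Q" by (auto simp: subspace_sum_def)
  have "orth_proj L x \<bullet> y = 0" "l \<bullet> orth_proj Q x = 0"
   using o orth_proj_in[OF sL(1)] orth_proj_in[OF Q] z by auto
  then show "(x - (orth_proj L x + orth_proj Q x)) \<bullet> z = 0"
   using orth_proj_inner[OF sL(1) z(2), of x] orth_proj_inner[OF Q z(3), of x]
   by (simp add: z inner_diff_left inner_add_left inner_add_right inner_commute[of "orth_proj Q x" l])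
 qed
qed

lemma fibre_kernel:
 assumes L: "L \<in> space \<nu>" and F: "F \<in> bmeas (bPi {..<m})"
 shows "(INT+ x. F x wrt PiM {..<m} (%_. leb (subspace_sum L Q)))
  = (INT+ x. F (fibre (L, x)) * fibre_weight (L, x) wrt lPi {..<m})"
proof -
 note eq = nn_integral_leb_tuple_kernel[OF subspace_sum_L[OF L] finite_lessThan F, unfolded dim_sum_L[OF L]]
 have f: "(\<lambda>i\<in>{..<m}. orth_proj (subspace_sum L Q) (x i)) = fibre (L, x)" for x
  by (simp add: fibre_def orth_proj_sum_L[OF L] restrict_def)
 have w: "(\<Prod>i<m. ennreal (1 / unit_ball_vol (DIM(real ^ 'n) - (m + dim Q))) * indicator (cball 0 1) (x i - orth_proj (subspace_sum L Q) (x i)))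
  = fibre_weight (L, x)" for x
  unfolding fibre_weight_def by (intro prod.cong) (auto simp: fibre_def orth_proj_sum_L[OF L])
 show ?thesis unfolding eq f w ..
qed

text \<open>The measure integrated against varies with \<open>L\<close>; the projection kernel moves
  this dependence into a jointly measurable integrand.\<close>

lemma fibre_kernel_measurable:
 assumes F: "F \<in> bmeas (bPi {..<m})"
 shows "(%L. INT+ x. F x wrt PiM {..<m} (%_. leb (subspace_sum L Q))) \<in> bmeas \<nu>"
proof -
 interpret P: sigma_finite_measure "PiM {..<m} (%_. lborel :: (real ^ 'n) measure)"
  by (intro product_sigma_finite.sigma_finite) (auto simp: product_sigma_finite_def intro: sigma_finite_lborel)
 have "(%p. F (fibre p) * fibre_weight p) \<in> bmeas (\<nu> \<Otimes>\<^sub>M lPi {..<m})"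
  by (intro borel_measurable_times_ennreal measurable_compose[OF fibre_measurable F] fibre_weight_measurable)
 then have "(%L. INT+ x. F (fibre (L, x)) * fibre_weight (L, x) wrt lPi {..<m}) \<in> bmeas \<nu>"
  by (intro P.borel_measurable_nn_integral) (simp add: case_prod_beta')
 then show ?thesis using fibre_kernel[OF _ F] by (simp cong: measurable_cong)
qed

lemma vol_power_measurable: "(%x. ennreal (vol m x ^ k)) \<in> bmeas (bPi {..<m})"
 using vol_measurable[of m] by measurable

lemma nn_integral_fibre_measure:
 assumes F: "F \<in> bmeas (bPi {..<m})"
 shows "(INT+ x. F x wrt fibre_measure) = (INT+ L. (INT+ x. F x * ennreal (vol m x ^ (dim V - m)) wrt PiM {..<m} (%_. leb (subspace_sum L Q))) wrt \<nu>)"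
proof -
 interpret P: sigma_finite_measure "PiM {..<m} (%_. lborel :: (real ^ 'n) measure)"
  by (intro product_sigma_finite.sigma_finite) (auto simp: product_sigma_finite_def intro: sigma_finite_lborel)
 interpret N: sigma_finite_measure \<nu> by (rule sigma_finite_\<nu>)
 let ?N = "\<nu> \<Otimes>\<^sub>M PiM {..<m} (%_. lborel :: (real ^ 'n) measure)"
 let ?v = "%x. ennreal (vol m x ^ (dim V - m))"
 have vm: "(%p. ?v (fibre p)) \<in> bmeas ?N" by (rule measurable_compose[OF fibre_measurable vol_power_measurable])
 have wm: "(%p. ?v (fibre p) * fibre_weight p) \<in> bmeas ?N"
  by (intro borel_measurable_times_ennreal vm fibre_weight_measurable)
 note Fm = measurable_compose[OF fibre_measurable F]
 have "(INT+ x. F x wrt fibre_measure) = (INT+ p. F (fibre p) wrt density ?N (%p. ?v (fibre p) * fibre_weight p))"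
  unfolding fibre_measure_def using F fibre_measurable by (intro nn_integral_distr) auto
 also have "... = (INT+ p. (?v (fibre p) * fibre_weight p) * F (fibre p) wrt ?N)"
  by (rule nn_integral_density[OF wm Fm])
 also have "... = (INT+ L. (INT+ x. (?v (fibre (L, x)) * fibre_weight (L, x)) * F (fibre (L, x)) wrt lPi {..<m}) wrt \<nu>)"
  by (rule P.nn_integral_fst[symmetric]) (intro borel_measurable_times_ennreal wm Fm)
 also have "... = (INT+ L. (INT+ x. F x * ?v x wrt PiM {..<m} (%_. leb (subspace_sum L Q))) wrt \<nu>)"
  using fibre_kernel[OF _ borel_measurable_times_ennreal[OF F vol_power_measurable]] by (intro nn_integral_cong) (simp add: mult_ac)
 finally show ?thesis .
qed

lemma fibre_measure_rotate:
 assumes T: "T \<in> rotations_of V" and G: "G \<in> bmeas (bPi {..<m})"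
 shows "(INT+ x. G (\<lambda>i\<in>{..<m}. T (x i)) wrt fibre_measure) = (INT+ x. G x wrt fibre_measure)"
proof -
 have TO: "orthogonal_transformation T" and TQ: "\<forall>y\<in>Q. T y = y" using rotations_of_V[OF T] by auto
 have Tm: "(%x. \<lambda>i\<in>{..<m}. T (x i)) \<in> bPi {..<m} \<rightarrow>\<^sub>M bPi {..<m}"
  using orthogonal_transformation_measurable[OF TO]
  by (intro measurable_restrict measurable_compose[OF measurable_component_singleton]) auto
 let ?G = "%x. G x * ennreal (vol m x ^ (dim V - m))"
 have Gm: "?G \<in> bmeas (bPi {..<m})" by (intro borel_measurable_times_ennreal G vol_power_measurable)
 let ?\<Phi> = "%L. INT+ x. ?G x wrt PiM {..<m} (%_. leb (subspace_sum L Q))"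
 have "(INT+ x. G (\<lambda>i\<in>{..<m}. T (x i)) wrt fibre_measure) = (INT+ L. ?\<Phi> (T ` L) wrt \<nu>)"
  unfolding nn_integral_fibre_measure[OF measurable_compose[OF Tm G]]
 proof (rule nn_integral_cong)
  fix L assume L: "L \<in> space \<nu>"
  have "T ` subspace_sum L Q = subspace_sum (T ` L) Q"
  proof -
   have lin: "linear T" by (rule orthogonal_transformation_linear[OF TO])
   have "T (l + y) = T l + y" if "y \<in> Q" for l y using that TQ by (simp add: linear_add[OF lin])
   then show ?thesis unfolding subspace_sum_def by (auto simp: image_iff Bex_def) metis
  qed
  then show "(INT+ x. G (\<lambda>i\<in>{..<m}. T (x i)) * ennreal (vol m x ^ (dim V - m)) wrt PiM {..<m} (%_. leb (subspace_sum L Q))) = ?\<Phi> (T ` L)"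
   using nn_integral_PiM_rotate[OF TO subspace_sum_L[OF L] finite_lessThan Gm] by (simp only: vol_tuple_rot[OF TO TQ])
 qed
 also have "... = (INT+ L. ?\<Phi> L wrt \<nu>)" by (rule nn_integral_rotate_\<nu>[OF T fibre_kernel_measurable[OF Gm]])
 finally show ?thesis unfolding nn_integral_fibre_measure[OF G] .
qed

lemma PiM_lborel_eq_fibre_measure:
 assumes mV: "m < dim V" shows "lPi {..<m} = fibre_measure"
proof (rule measure_eq_by_shape_law[OF m])
 let ?P = "PiM {..<m} (%_. borel :: (real ^ 'n) measure)" and ?v = "%x. ennreal (vol m x ^ (dim V - m))"
 interpret P: product_sigma_finite "%_. lborel :: (real ^ 'n) measure" by standard
 show "\<forall>T\<in>rotations_of V. orthogonal_transformation T \<and> (\<forall>y\<in>Q. T y = y)" using rotations_of_V by blast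
 show "\<forall>x\<in>frames m. \<forall>y\<in>frames m. \<exists>T\<in>rotations_of V. \<forall>i<m. T (x i) = y i" using rotations_transitive[OF mV] by blast
 show "sets (lPi {..<m}) = sets ?P" by (rule sets_PiM_lborel)
 show "sets fibre_measure = sets ?P" by (simp add: fibre_measure_def)
 show "emeasure (lPi {..<m}) (PiE {..<m} (%_. cball 0 (real k) :: (real ^ 'n) set)) < \<infinity>" for k
 proof -
  have "emeasure lborel (cball 0 (real k) :: (real ^ 'n) set) < \<infinity>" by (intro emeasure_bounded_finite) auto
  then show ?thesis by (subst P.emeasure_PiM) (auto simp: power_less_top_ennreal)
 qed
 show AE1: "AE x in lPi {..<m}. vol m x \<noteq> 0" by (rule AE_vol_neq_0[OF m])
 have sf: "sets fibre_measure = sets ?P" by (simp add: fibre_measure_def)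
 show "AE x in fibre_measure. vol m x \<noteq> 0"
 proof -
  have im: "(%x. indicator {0} (vol m x) :: ennreal) \<in> bmeas ?P"
   by (rule measurable_compose[OF vol_measurable]) simp
  \<comment> \<open>The exponent \<open>dim V - m\<close> is positive, so the density itself kills
    dependent tuples.\<close>
  have z: "indicator {0} (vol m x) * ?v x = 0" for x using mV by (auto simp: indicator_def zero_power)
  then have "(INT+ x. indicator {0} (vol m x) wrt fibre_measure) = 0" unfolding nn_integral_fibre_measure[OF im] z by simp
  then have "AE x in fibre_measure. indicator {0} (vol m x) = (0 :: ennreal)"
   using im by (intro nn_integral_0_iff_AE[THEN iffD1]) (simp_all add: measurable_cong_sets[OF sf refl])
  then show ?thesis by eventually_elim (auto simp: indicator_def split: if_splits)
 qed
 show "\<forall>T\<in>rotations_of V. \<forall>G\<in>bmeas ?P. (INT+ x. G (\<lambda>i\<in>{..<m}. T (x i)) wrt fibre_measure) = (INT+ x. G x wrt fibre_measure)"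
  using fibre_measure_rotate by blast
 show "\<forall>T\<in>rotations_of V. \<forall>G\<in>bmeas ?P. (INT+ x. G (\<lambda>i\<in>{..<m}. T (x i)) wrt lPi {..<m}) = (INT+ x. G x wrt lPi {..<m})"
 proof (intro ballI)
  fix T and G :: "(nat => real ^ 'n) => ennreal" assume T: "T \<in> rotations_of V" and G: "G \<in> bmeas ?P"
  have TO: "orthogonal_transformation T" using rotations_of_V[OF T] by auto
  show "(INT+ x. G (\<lambda>i\<in>{..<m}. T (x i)) wrt lPi {..<m}) = (INT+ x. G x wrt lPi {..<m})"
   using nn_integral_PiM_rotate[OF TO subspace_UNIV finite_lessThan G]
   by (simp add: orthogonal_transformation_surj[OF TO] leb_UNIV)
 qed
 fix G :: "(nat => real ^ 'n) => ennreal" assume G: "G \<in> bmeas ?P"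
 let ?ind = "%x. indicator {0<..} (vol m x) :: ennreal"
 let ?X = "INT+ x. G (shapes m x) wrt lPi {..<m}"
 define a where "a = (\<Prod>i<m. sphere_area (dim V - i))"
 define c where "c = (\<Prod>i<m. sphere_area (m - i))"
 have X: "?X = (INT+ x. G (shapes m x) * ?ind x wrt lPi {..<m})"
 proof (rule nn_integral_cong_AE, use AE1 in eventually_elim)
  case (elim x)
  then have "0 < vol m x" using gs_vol_nonneg[of m "%i. orth_proj V (x i)"] by linarith
  then show ?case by simp
 qed
 have sa: "0 < sphere_area k" if "0 < k" for k
  using that unit_ball_vol_pos[of k] by (simp add: sphere_area_eq)
 have a: "0 < a" and c: "0 < c" unfolding a_def c_def using mV by (auto intro!: prod_pos sa)
 \<comment> \<open>Reversing the order of the factors identifies the denominator of the Grassmannian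
   mass with the constant of the shape law for dimension \<open>m\<close>.\<close>
 have cc: "(\<Prod>i=1..m. sphere_area i) = c" unfolding c_def
  by (rule prod.reindex_bij_witness[where i = "%i. m - i" and j = "%i. m - i"]) auto
 have Gs: "(%x. G (shapes m x)) \<in> bmeas ?P" by (rule measurable_compose[OF shape_tuple_measurable G])
 have "(INT+ x. G (shapes m x) wrt fibre_measure) = (INT+ L. ennreal (c / a) * ?X wrt \<nu>)"
  unfolding nn_integral_fibre_measure[OF Gs]
 proof (rule nn_integral_cong)
  fix L assume L: "L \<in> space \<nu>"
  then have sL: "subspace L" "L \<subseteq> V" "dim L = m" by (auto simp: in_\<nu>)
  let ?Y = "INT+ x. G (shapes m x) * ?v x wrt PiM {..<m} (%_. leb (subspace_sum L Q))"
  \<comment> \<open>Again by the positive exponent, the indicator required by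
    \<open>shape_ratio\<close> is already implied by the density.\<close>
  have v0: "?v x = ?v x * ?ind x" for x
   using mV gs_vol_nonneg[of m "%i. orth_proj V (x i)"] by (auto simp: indicator_def less_le zero_power)
  have "?Y = (INT+ x. G (shapes m x) * (?v x * ?ind x) wrt PiM {..<m} (%_. leb (subspace_sum L Q)))"
   using v0 by (intro nn_integral_cong arg_cong2[where f = "(*)"] refl) blast
  then have "ennreal a * ?Y = ennreal c * ?X" unfolding X using shape_ratio[OF sL G] by (simp add: a_def c_def)
  then have "ennreal (1 / a) * (ennreal a * ?Y) = ennreal (1 / a) * (ennreal c * ?X)" by simp
  then show "?Y = ennreal (c / a) * ?X"
   using a c by (simp add: mult.assoc[symmetric] ennreal_mult[symmetric])
 qed
 \<comment> \<open>Every \<open>L\<close> contributes the same amount \<open>c / a\<close>, and the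
   total mass of \<open>\<nu>\<close> is \<open>a / c\<close>: the normalisation of the Grassmannian
   is exactly what is needed.\<close>
 also have "... = ennreal (c / a) * ennreal (a / c) * ?X"
  unfolding nn_integral_const emeasure_\<nu> cc a_def[symmetric] by (simp only: mult_ac)
 also have "ennreal (c / a) * ennreal (a / c) = 1" using a c by (simp add: ennreal_mult[symmetric])
 finally show "?X = (INT+ x. G (shapes m x) wrt fibre_measure)" unfolding mult_1_left by (rule sym)
qed

theorem blaschke_petkantschin:
 assumes F: "F \<in> bmeas (bPi {..<m})"
 shows "(INT+ x. F x wrt lPi {..<m}) =
  (INT+ L. (INT+ x. F x * ennreal (vol m x ^ (dim V - m)) wrt PiM {..<m} (%_. leb (subspace_sum L Q))) wrt \<nu>)"
proof (cases "m < dim V")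
 case True
 then show ?thesis using PiM_lborel_eq_fibre_measure nn_integral_fibre_measure[OF F] by simp
next
 \<comment> \<open>Rotations are not transitive on full frames, but here \<open>V\<close> is the
   only element of the Grassmannian, the prescribed mass is 1 and the exponent of \<open>vol\<close>
   is 0.\<close>
 case False
 then have mV: "m = dim V" using m by simp
 have V: "L = V" if "L \<in> space \<nu>" for L
  using that subspace_dim_equal[of L V] subspace_V mV by (simp add: in_\<nu>)
 have "0 < sphere_area k" if "0 < k" for k
  using that unit_ball_vol_pos[of k] by (simp add: sphere_area_eq)
 then have "0 < (\<Prod>i<m. sphere_area (m - i))" by (auto intro!: prod_pos)
 moreover have "(\<Prod>i=1..m. sphere_area i) = (\<Prod>i<m. sphere_area (m - i))"
  by (rule prod.reindex_bij_witness[where i = "%i. m - i" and j = "%i. m - i"]) auto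
 ultimately have 1: "emeasure \<nu> (space \<nu>) = 1" unfolding emeasure_\<nu> mV[symmetric] by (simp only: divide_self less_irrefl if_False one_ennreal_def[symmetric] ennreal_1)
 have "(INT+ L. (INT+ x. F x * ennreal (vol m x ^ (dim V - m)) wrt PiM {..<m} (%_. leb (subspace_sum L Q))) wrt \<nu>)
  = (INT+ L. (INT+ x. F x wrt lPi {..<m}) wrt \<nu>)"
  by (rule nn_integral_cong, drule V) (simp add: sum_V_Q leb_UNIV mV)
 also have "... = (INT+ x. F x wrt lPi {..<m})" by (simp add: 1)
 finally show ?thesis by simp
qed

end

section \<open>Tuples on spheres with centre in a subspace\<close>

text \<open>The substitution \<open>s = K * (t\<^sup>2 - \<rho>\<^sup>2)\<close> turns the
  approximate delta function of \<open>t\<^sup>2 - \<rho>\<^sup>2\<close> into the uniform weight on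
  the unit interval; \<open>1 / (2 * \<tau> s)\<close> is what remains of its Jacobian.\<close>

lemma nn_integral_shell_substitution:
 fixes h :: "real => ennreal"
 assumes \<rho>: "0 \<le> \<rho>" and K: "0 < K" and h[measurable]: "h \<in> bmeas borel"
 defines "\<tau> \<equiv> %s. sqrt (\<rho>\<^sup>2 + s / K)"
 shows "(INT+ t. h t * (ennreal (t ^ d) * indicator {0<..} t) * (ennreal K * indicator {0<..<1/K} (t\<^sup>2 - \<rho>\<^sup>2)) wrt lborel)
  = (INT+ s. h (\<tau> s) * (ennreal (\<tau> s ^ d / (2 * \<tau> s)) * indicator {0<..<1} s) wrt lborel)"
proof -
 define f where "f s = h (\<tau> s) * (ennreal (\<tau> s ^ d / (2 * \<tau> s)) * indicator {0<..<1} s)" for s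
 define g where "g t = K * (t\<^sup>2 - \<rho>\<^sup>2)" for t
 define b where "b = sqrt (\<rho>\<^sup>2 + 1 / K)"
 have b2: "b\<^sup>2 = \<rho>\<^sup>2 + 1 / K" using K by (simp add: b_def)
 have b: "\<rho> < b" unfolding b_def by (rule real_less_rsqrt) (use K in simp)
 have g01: "g \<rho> = 0" "g b = 1" using K by (simp_all add: g_def b2)
 have [measurable]: "\<tau> \<in> bmeas borel" unfolding \<tau>_def by measurable
 have fm: "f \<in> bmeas borel" unfolding f_def by measurable
 have "(INT+ s. f s wrt lborel) = (INT+ s. f s * indicator {g \<rho>..g b} s wrt lborel)"
  unfolding g01 by (intro nn_integral_cong) (auto simp: f_def indicator_def)
 also have "... = (INT+ t. f (g t) * ennreal (2 * K * t) * indicator {\<rho>..b} t wrt lborel)"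
 proof (rule nn_integral_substitution_aux[OF fm _ _ _ _ b])
  show "(g has_real_derivative 2 * K * x) (at x)" for x
   unfolding g_def by (auto intro!: derivative_eq_intros)
  show "continuous_on {\<rho>..b} (%x. 2 * K * x)" by (intro continuous_intros)
 qed (use \<rho> K in auto)
 also have "... = (INT+ t. h t * (ennreal (t ^ d) * indicator {0<..} t) * (ennreal K * indicator {0<..<1/K} (t\<^sup>2 - \<rho>\<^sup>2)) wrt lborel)"
 proof (rule nn_integral_cong)
  fix t
  have gi: "0 < g t \<longleftrightarrow> 0 < t\<^sup>2 - \<rho>\<^sup>2" "g t < 1 \<longleftrightarrow> t\<^sup>2 - \<rho>\<^sup>2 < 1 / K"
   using K by (simp_all only: g_def zero_less_mult_iff pos_less_divide_eq mult.commute[of K]) auto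
  show "f (g t) * ennreal (2 * K * t) * indicator {\<rho>..b} t
   = h t * (ennreal (t ^ d) * indicator {0<..} t) * (ennreal K * indicator {0<..<1/K} (t\<^sup>2 - \<rho>\<^sup>2))"
  proof (cases "0 < t \<and> 0 < t\<^sup>2 - \<rho>\<^sup>2 \<and> t\<^sup>2 - \<rho>\<^sup>2 < 1 / K")
   case True
   have \<tau>: "\<tau> (g t) = t" using K True by (simp add: \<tau>_def g_def)
   have "\<rho> \<le> t" by (rule power2_le_imp_le) (use True in auto)
   moreover have "t \<le> b" by (rule power2_le_imp_le) (use True b \<rho> b2 in auto)
   ultimately have "f (g t) * ennreal (2 * K * t) * indicator {\<rho>..b} t = h t * (ennreal (t ^ d / (2 * t)) * ennreal (2 * K * t))"
    using True gi by (simp add: f_def \<tau> mult.assoc)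
   also have "ennreal (t ^ d / (2 * t)) * ennreal (2 * K * t) = ennreal (t ^ d) * ennreal K"
    using True K by (simp add: ennreal_mult[symmetric])
   finally show ?thesis using True by (simp add: mult.assoc)
  next
   case False
   show ?thesis
   proof (cases "0 < t")
    case True
    with False gi have "f (g t) = 0" by (auto simp: f_def indicator_def)
    with False True show ?thesis by (auto simp: indicator_def)
   next
    \<comment> \<open>For \<open>t \<le> 0\<close> the interval is met only if
      \<open>t = \<rho> = 0\<close>, where \<open>g t = 0\<close> falls outside the open unit
      interval.\<close>
    case f: False
    have "f (g t) * indicator {\<rho>..b} t = 0"
     using f \<rho> gi by (cases "t = 0") (auto simp: f_def indicator_def)
    then have "f (g t) * ennreal (2 * K * t) * indicator {\<rho>..b} t = 0" by auto
    then show ?thesis using f by simp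
   qed
  qed
 qed
 finally show ?thesis unfolding f_def by simp
qed

lemma nn_integral_shell:
 fixes W :: "'a::euclidean_space set"
 assumes W: "subspace W" "0 < dim W" and c: "c \<in> W" and \<rho>: "0 \<le> \<rho>" and K: "0 < K" and H[measurable]: "H \<in> bmeas borel"
 defines "\<tau> \<equiv> %s. sqrt (\<rho>\<^sup>2 + s / K)"
 shows "(INT+ x. H x * (ennreal K * indicator {0<..<1/K} ((norm (x - c))\<^sup>2 - \<rho>\<^sup>2)) wrt leb W)
  = (INT+ u. (INT+ s. H (c + \<tau> s *\<^sub>R u) * (ennreal (\<tau> s ^ (dim W - 1) / (2 * \<tau> s)) * indicator {0<..<1} s) wrt lborel) wrt unit_sphere_measure W)"
proof -
 have "(INT+ x. H x * (ennreal K * indicator {0<..<1/K} ((norm (x - c))\<^sup>2 - \<rho>\<^sup>2)) wrt leb W)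
  = (INT+ x. H (x + c) * (ennreal K * indicator {0<..<1/K} ((norm (x + c - c))\<^sup>2 - \<rho>\<^sup>2)) wrt leb W)"
  by (rule leb_translate[OF W(1) c, symmetric]) measurable
 also have "... = (INT+ x. H (c + x) * (ennreal K * indicator {0<..<1/K} ((norm x)\<^sup>2 - \<rho>\<^sup>2)) wrt leb W)"
  by (simp add: add.commute)
 also have "... = (INT+ u. (INT+ t. (H (c + t *\<^sub>R u) * (ennreal K * indicator {0<..<1/K} ((norm (t *\<^sub>R u))\<^sup>2 - \<rho>\<^sup>2))) * (ennreal (t ^ (dim W - 1)) * indicator {0<..} t) wrt lborel) wrt unit_sphere_measure W)"
  by (rule nn_integral_polar[OF W]) measurable
 also have "... = (INT+ u. (INT+ s. H (c + \<tau> s *\<^sub>R u) * (ennreal (\<tau> s ^ (dim W - 1) / (2 * \<tau> s)) * indicator {0<..<1} s) wrt lborel) wrt unit_sphere_measure W)"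
 proof (rule nn_integral_cong)
  fix u assume "u \<in> space (unit_sphere_measure W)"
  then have u: "norm u = 1" by (simp add: unit_sphere_def)
  have hm: "(%t. H (c + t *\<^sub>R u)) \<in> bmeas borel" by measurable
  show "(INT+ t. (H (c + t *\<^sub>R u) * (ennreal K * indicator {0<..<1/K} ((norm (t *\<^sub>R u))\<^sup>2 - \<rho>\<^sup>2))) * (ennreal (t ^ (dim W - 1)) * indicator {0<..} t) wrt lborel)
   = (INT+ s. H (c + \<tau> s *\<^sub>R u) * (ennreal (\<tau> s ^ (dim W - 1) / (2 * \<tau> s)) * indicator {0<..<1} s) wrt lborel)"
   unfolding \<tau>_def nn_integral_shell_substitution[OF \<rho> K hm, symmetric] by (intro nn_integral_cong) (simp add: u mult_ac)
 qed
 finally show ?thesis .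
qed

lemma nn_integral_shell_tuple:
 fixes W :: "'a::euclidean_space set"
 assumes W: "subspace W" "0 < dim W" and c: "c \<in> W" and \<rho>: "0 \<le> \<rho>" and K: "0 < K" and I: "finite I"
  and F: "F \<in> bmeas (bPi I)"
 defines "\<tau> \<equiv> %s. sqrt (\<rho>\<^sup>2 + s / K)"
 shows "(INT+ x. F x * (\<Prod>i\<in>I. ennreal K * indicator {0<..<1/K} ((norm (x i - c))\<^sup>2 - \<rho>\<^sup>2)) wrt PiM I (%_. leb W))
  = (INT+ u. (INT+ s. F (\<lambda>i\<in>I. c + \<tau> (s i) *\<^sub>R u i) * (\<Prod>i\<in>I. ennreal (\<tau> (s i) ^ (dim W - 1) / (2 * \<tau> (s i))) * indicator {0<..<1} (s i))
    wrt lPi I) wrt PiM I (%_. unit_sphere_measure W))"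
proof -
 define w where "w x = ennreal K * indicator {0<..<1/K} ((norm (x - c))\<^sup>2 - \<rho>\<^sup>2)" for x
 have wm: "w \<in> bmeas borel" unfolding w_def by measurable
 have wm': "w \<in> bmeas (leb W)" using wm by (simp add: measurable_cong_sets[OF sets_leb refl])
 \<comment> \<open>The shell weight is absorbed into the measure, because the transfer to pairs
   expresses an unweighted integral over each factor.\<close>
 define N where "N = density (leb W) w"
 have sN: "sets N = sets borel" by (simp add: N_def)
 have [measurable]: "\<tau> \<in> bmeas borel" unfolding \<tau>_def by measurable
 have Nint: "(INT+ x. G x wrt N) = (INT+ x. G x * w x wrt leb W)" if "G \<in> bmeas N" for G
  unfolding N_def using that wm' by (subst nn_integral_density) (auto simp: mult.commute N_def)
 have sfW: "sigma_finite_measure (leb W)" by (rule sigma_finite_leb[OF W(1)])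
 have sfN: "sigma_finite_measure N"
 proof -
  \<comment> \<open>A ball around the origin that contains the outer sphere around \<open>c\<close>,
    hence the support of the weight; this makes \<open>N\<close> finite.\<close>
  define R where "R = norm c + sqrt (\<rho>\<^sup>2 + 1 / K)"
  have "0 < sqrt (\<rho>\<^sup>2 + 1 / K)" using K by (intro real_sqrt_gt_zero add_nonneg_pos) auto
  then have R: "0 < R" unfolding R_def by (intro add_nonneg_pos) auto
  have "w x \<le> ennreal K * indicator (cball 0 R) x" for x
  proof (cases "x \<in> cball 0 R")
   case False
   have "R - norm c \<le> norm (x - c)" using norm_triangle_ineq2[of x c] False by simp
   then have "(sqrt (\<rho>\<^sup>2 + 1 / K))\<^sup>2 \<le> (norm (x - c))\<^sup>2"
    using K by (intro power_mono) (auto simp: R_def)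
   then show ?thesis using K by (auto simp: w_def indicator_def)
  qed (auto simp: w_def indicator_def)
  then have "emeasure N UNIV \<le> (INT+ x. ennreal K * indicator (cball 0 R) x wrt leb W)"
   unfolding N_def using wm' by (subst emeasure_density) (auto intro!: nn_integral_mono)
  also have "... = ennreal K * emeasure (leb W) (cball 0 R)"
   by (rule nn_integral_cmult_indicator) simp
  also have "... < \<infinity>" unfolding emeasure_leb_cball[OF W(1) R] by (simp add: ennreal_mult_less_top)
  finally have "finite_measure N" by (intro finite_measureI) (simp add: N_def)
  then show ?thesis by (simp add: finite_measure_def)
 qed
 have sPN: "sets (PiM I (%_. N)) = sets (bPi I)" by (intro sets_PiM_cong) (auto simp: sN)
 have FN: "F \<in> bmeas (PiM I (%_. N))" using F by (simp add: measurable_cong_sets[OF sPN refl])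
 have "(INT+ x. F x wrt PiM I (%_. N)) = (INT+ x. F (\<lambda>i\<in>I. x i) * (\<Prod>i\<in>I. w (x i)) wrt PiM I (%_. leb W))"
 proof (rule nn_integral_PiM_transfer[OF I sfW sfN _ _ _ FN, where h = "%_ x. x" and w = "%_. w"])
  show "(%x. x) \<in> leb W \<rightarrow>\<^sub>M N" by (rule measurable_ident_sets) (simp add: sN)
 qed (use wm' Nint in auto)
 also have "... = (INT+ x. F x * (\<Prod>i\<in>I. w (x i)) wrt PiM I (%_. leb W))"
  by (intro nn_integral_cong) (simp add: space_PiM PiE_iff extensional_restrict)
 finally have 1: "(INT+ x. F x * (\<Prod>i\<in>I. w (x i)) wrt PiM I (%_. leb W)) = (INT+ x. F x wrt PiM I (%_. N))" by simp
 have um: "(%p. fst p) \<in> bmeas (unit_sphere_measure W \<Otimes>\<^sub>M (lborel :: real measure))"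
  by (rule measurable_unit_sphere_measure[OF measurable_fst])
 have "(INT+ x. F x wrt PiM I (%_. N)) = (INT+ u. (INT+ s. F (\<lambda>i\<in>I. c + \<tau> (s i) *\<^sub>R u i) * (\<Prod>i\<in>I. ennreal (\<tau> (s i) ^ (dim W - 1) / (2 * \<tau> (s i))) * indicator {0<..<1} (s i))
    wrt lPi I) wrt PiM I (%_. unit_sphere_measure W))"
 proof (rule nn_integral_PiM_transfer_pair[OF I sigma_finite_unit_sphere_measure[OF W(1)] sigma_finite_lborel sfN _ _ _ FN,
    where h = "%_ u s. c + \<tau> s *\<^sub>R u" and w = "%_ u s. ennreal (\<tau> s ^ (dim W - 1) / (2 * \<tau> s)) * indicator {0<..<1} s"])
  have "(%p. \<tau> (snd p)) \<in> bmeas (unit_sphere_measure W \<Otimes>\<^sub>M lborel)" by measurable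
  from borel_measurable_add[OF borel_measurable_const borel_measurable_scaleR[OF this um]]
  show "(%p. c + \<tau> (snd p) *\<^sub>R fst p) \<in> unit_sphere_measure W \<Otimes>\<^sub>M lborel \<rightarrow>\<^sub>M N"
   by (simp add: measurable_cong_sets[OF refl sN])
  show "(%p. ennreal (\<tau> (snd p) ^ (dim W - 1) / (2 * \<tau> (snd p))) * indicator {0<..<1} (snd p)) \<in> bmeas (unit_sphere_measure W \<Otimes>\<^sub>M lborel)"
   by measurable
  fix G :: "'a => ennreal" assume G: "G \<in> bmeas N"
  then have "G \<in> bmeas borel" by (simp add: measurable_cong_sets[OF sN refl])
  from nn_integral_shell[OF W c \<rho> K this]
  show "(INT+ y. G y wrt N) = (INT+ u. (INT+ s. G (c + \<tau> s *\<^sub>R u) * (ennreal (\<tau> s ^ (dim W - 1) / (2 * \<tau> s)) * indicator {0<..<1} s) wrt lborel) wrt unit_sphere_measure W)"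
   unfolding Nint[OF G] w_def \<tau>_def .
 qed
 with 1 show ?thesis unfolding w_def by simp
qed

text \<open>The shape setting is used with the orthogonal complement of \<open>L\<close> in the
  place of \<open>Q\<close>, which turns its \<open>V\<close> into \<open>L\<close> and settles the
  case of Lebesgue measure on the whole space. The projection kernel carries this over to
  \<open>W\<close>, since projecting to \<open>W\<close> first does not change the projection to
  \<open>L\<close>.\<close>

lemma AE_gs_vol_neq_0:
 fixes L W :: "'a::euclidean_space set"
 assumes L: "subspace L" "dim L = m" and W: "subspace W" "L \<subseteq> W"
 shows "AE x in PiM {..<m} (%_. leb W). gs_vol m (%i. orth_proj L (x i)) \<noteq> 0"
proof -
 obtain b where b: "onb (dim L) b L" using onb_exists[OF L(1)] .
 interpret shape_frame "orthogonal_comp L" b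
  using b by unfold_locales (auto simp: orthogonal_comp_self[OF L(1)] subspace_orthogonal_comp)
 note VL = orthogonal_comp_self[OF L(1)]
 have sets: "sets (PiM {..<m} (%_. leb W)) = sets (bPi {..<m})" by (intro sets_PiM_cong) auto
 let ?F = "%x. indicator {0} (gs_vol m (%i. orth_proj L (x i))) :: ennreal"
 have Fm: "?F \<in> bmeas (bPi {..<m})"
  using measurable_compose[OF vol_measurable[of m], of "indicator {0}" borel] by (simp add: VL)
 have "orth_proj L (orth_proj W x) = orth_proj L x" for x
  by (rule orth_proj_eqI[OF L(1) orth_proj_in[OF L(1)]])
   (use W orth_proj_inner[OF W(1)] orth_proj_inner[OF L(1)] in \<open>auto simp: inner_diff_left subset_iff\<close>)
 then have g: "gs_vol m (%i. orth_proj L ((\<lambda>i\<in>{..<m}. orth_proj W (x i)) i)) = gs_vol m (%i. orth_proj L (x i))" for x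
  by (intro gs_vol_cong) simp
 have "(INT+ x. ?F x wrt PiM {..<m} (%_. leb W)) = (INT+ x. 0 wrt PiM {..<m} (%_. lborel :: 'a measure))"
  unfolding nn_integral_leb_tuple_kernel[OF W(1) finite_lessThan Fm] g
 proof (rule nn_integral_cong_AE)
  have "AE x in PiM {..<m} (%_. lborel :: 'a measure). gs_vol m (%i. orth_proj L (x i)) \<noteq> 0"
   using AE_vol_neq_0[of m] L(2) unfolding VL by simp
  then show "AE x in PiM {..<m} (%_. lborel :: 'a measure). ?F x * (\<Prod>i<m. ennreal (1 / unit_ball_vol (real (DIM('a) - dim W))) *
    indicator (cball 0 1) (x i - orth_proj W (x i))) = 0"
   by eventually_elim simp
 qed
 then have "(INT+ x. ?F x wrt PiM {..<m} (%_. leb W)) = 0" by simp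
 then have "AE x in PiM {..<m} (%_. leb W). ?F x = 0"
  using Fm by (intro nn_integral_0_iff_AE[THEN iffD1]) (simp_all add: measurable_cong_sets[OF sets refl])
 then show ?thesis by eventually_elim (auto simp: indicator_def split: if_splits)
qed

text \<open>The limit of thin shells can be taken only for continuous test functions. Products of
  truncated multiples of the distance to the complement increase to the indicator of an open box, so
  such functions determine the measure.\<close>

lemma PiM_borel_eqI_continuous:
 fixes M N :: "('i => 'a::euclidean_space) measure"
 assumes I: "finite I" and sets: "sets M = sets (bPi I)" "sets N = sets (bPi I)"
  and fin: "\<And>k::nat. emeasure M (PiE I (%_. ball 0 (real k))) \<noteq> \<infinity>"
  and eq: "\<And>f. (\<And>i. continuous_on UNIV (f i)) ==> (\<And>i x. 0 \<le> f i x \<and> f i x \<le> (1::real)) ==>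
   (INT+ x. ennreal (\<Prod>i\<in>I. f i (x i)) wrt M) = (INT+ x. ennreal (\<Prod>i\<in>I. f i (x i)) wrt N)"
 shows "M = N"
proof (rule PiM_borel_eqI_open[OF I sets _ fin])
 fix U :: "'i => 'a set" assume U: "\<And>i. open (U i)"
 \<comment> \<open>\<open>infdist\<close> to the empty set is 0 by convention, so the full space is
   treated separately.\<close>
 define f where "f j i x = (if U i = UNIV then 1 else min 1 (real j * infdist x (- U i)))" for j i x
 have cont: "continuous_on UNIV (f j i)" for j i
  unfolding f_def by (cases "U i = UNIV") (auto intro!: continuous_intros)
 have f01: "0 \<le> f j i x \<and> f j i x \<le> 1" for j i x by (auto simp: f_def infdist_nonneg)
 have mono: "f j i x \<le> f k i x" if "j \<le> k" for j k i x
 proof -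
  have "real j * infdist x (- U i) \<le> real k * infdist x (- U i)" using that by (intro mult_right_mono infdist_nonneg) simp
  from min.mono[OF order_refl this, of 1] show ?thesis by (simp add: f_def)
 qed
 have lim: "(%j. f j i x) \<longlonglongrightarrow> indicator (U i) x" for i x
 proof (cases "U i = UNIV \<or> x \<notin> U i")
  case True
  then show ?thesis by (cases "U i = UNIV") (simp_all add: f_def infdist_zero)
 next
  case False
  have "closed (- U i)" by (rule closed_Compl[OF U])
  then have d: "0 < infdist x (- U i)" using False by (intro infdist_pos_not_in_closed) auto
  obtain j0 where j0: "1 < real j0 * infdist x (- U i)" using reals_Archimedean3[OF d] by blast
  have "f j i x = 1" if "j0 \<le> j" for j
  proof -
   have "real j0 * infdist x (- U i) \<le> real j * infdist x (- U i)" using that by (intro mult_right_mono infdist_nonneg) simp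
   then show ?thesis using j0 by (simp add: f_def)
  qed
  then have "\<forall>\<^sub>F j in sequentially. f j i x = indicator (U i) x" using False by (auto simp: eventually_sequentially)
  then show ?thesis by (rule tendsto_eventually)
 qed
 have fm: "(%x. ennreal (\<Prod>i\<in>I. f j i (x i))) \<in> bmeas (bPi I)" for j
 proof (intro measurable_compose[OF _ measurable_ennreal] borel_measurable_prod)
  fix i assume "i \<in> I"
  then have "(%x. x i) \<in> bPi I \<rightarrow>\<^sub>M (borel :: 'a measure)" by (rule measurable_component_singleton)
  then show "(%x. f j i (x i)) \<in> bmeas (bPi I)"
   by (rule measurable_compose) (rule borel_measurable_continuous_onI[OF cont])
 qed
 have *: "(%j. INT+ x. ennreal (\<Prod>i\<in>I. f j i (x i)) wrt M) \<longlonglongrightarrow> emeasure M (PiE I U)"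
  if s: "sets M = sets (bPi I)" for M :: "('i => 'a) measure"
 proof -
  have "(%j. INT+ x. ennreal (\<Prod>i\<in>I. f j i (x i)) wrt M) \<longlonglongrightarrow> (INT+ x. ennreal (\<Prod>i\<in>I. indicator (U i) (x i)) wrt M)"
  proof (rule nn_integral_LIMSEQ)
   show "incseq (%j x. ennreal (\<Prod>i\<in>I. f j i (x i)))"
    by (intro incseq_SucI le_funI ennreal_leI prod_mono) (use f01 mono in auto)
   show "(%x. ennreal (\<Prod>i\<in>I. f j i (x i))) \<in> bmeas M" for j
    using fm by (simp add: measurable_cong_sets[OF s refl])
   show "(%j. ennreal (\<Prod>i\<in>I. f j i (x i))) \<longlonglongrightarrow> ennreal (\<Prod>i\<in>I. indicator (U i) (x i))" for x
    by (intro tendsto_ennrealI tendsto_prod lim)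
  qed
  also have "(INT+ x. ennreal (\<Prod>i\<in>I. indicator (U i) (x i)) wrt M) = (INT+ x. indicator (PiE I U) x wrt M)"
  proof (rule nn_integral_cong)
   fix x assume "x \<in> space M"
   then have x: "x \<in> PiE I (%_. UNIV)" using sets_eq_imp_space_eq[OF s] by (simp add: space_PiM)
   show "ennreal (\<Prod>i\<in>I. indicator (U i) (x i)) = indicator (PiE I U) x"
   proof (cases "x \<in> PiE I U")
    case False
    then obtain i where "i \<in> I" "x i \<notin> U i" using x by (auto simp: PiE_iff)
    then have "(\<Prod>i\<in>I. indicator (U i) (x i) :: real) = 0" by (intro prod_zero[OF I] bexI[of _ i]) auto
    then show ?thesis using False by simp
   qed (auto simp: PiE_iff)
  qed
  also have "... = emeasure M (PiE I U)" using I U s by (intro nn_integral_indicator) (auto intro!: sets_PiM_I_finite)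
  finally show ?thesis .
 qed
 show "emeasure M (PiE I U) = emeasure N (PiE I U)"
  using LIMSEQ_unique[OF *[OF sets(1)]] *[OF sets(2)] eq[OF cont f01] by simp
qed

section \<open>Shells around centres in a subspace\<close>

locale shell_pencil =
 fixes L Q :: "'a::euclidean_space set" and r0 :: real and m :: nat
 assumes L: "subspace L" and Q: "subspace Q" and orth: "\<forall>x\<in>L. \<forall>y\<in>Q. x \<bullet> y = 0"
  and dim_L: "dim L = m" and m: "1 \<le> m" and r0: "0 \<le> r0"
begin

abbreviation W :: "'a set" where "W \<equiv> subspace_sum L Q"
abbreviation spheres :: "(nat => 'a) measure" where "spheres \<equiv> PiM {..<m} (%_. unit_sphere_measure W)"
abbreviation reals :: "(nat => real) measure" where "reals \<equiv> lPi {..<m}"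
abbreviation points :: "(nat => 'a) measure" where "points \<equiv> PiM {..<m} (%_. leb W)"

text \<open>With this radius the origin has power \<open>- r0\<^sup>2\<close> with respect to every
  sphere considered, which is the reason why the incidence conditions become linear in the
  centre.\<close>

definition rad :: "'a => real" where "rad c = sqrt ((norm c)\<^sup>2 + r0\<^sup>2)"

definition shell :: "real => 'a => real => real" where "shell K c s = sqrt ((rad c)\<^sup>2 + s / K)"

lemma subspace_W: "subspace W" and dim_W: "dim W = m + dim Q" and L_W: "L \<subseteq> W"
proof -
 show "subspace W" by (rule subspace_subspace_sum[OF L Q orth])
 show "dim W = m + dim Q" using dim_subspace_sum[OF L Q orth] dim_L by simp
 show "L \<subseteq> W" using subspace_0[OF Q] by (force simp: subspace_sum_def)
qed

lemma dim_W_pos: "0 < dim W" using dim_W m by simp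

lemma rad_nonneg: "0 \<le> rad c" and rad_sq: "(rad c)\<^sup>2 = (norm c)\<^sup>2 + r0\<^sup>2" and norm_le_rad: "norm c \<le> rad c"
proof -
 show "0 \<le> rad c" "(rad c)\<^sup>2 = (norm c)\<^sup>2 + r0\<^sup>2" by (simp_all add: rad_def)
 show "norm c \<le> rad c" unfolding rad_def by (rule real_le_rsqrt) simp
qed

lemma sets_points: "sets points = sets (bPi {..<m})" by (intro sets_PiM_cong) auto

definition incidence :: "real => (nat => 'a) => 'a => ennreal" where
 "incidence K x c = (\<Prod>i<m. ennreal K * indicator {0<..<1/K} ((norm (x i - c))\<^sup>2 - (rad c)\<^sup>2))"

text \<open>The shells \<open>0 < norm (x - c)\<^sup>2 - rad c\<^sup>2 < 1 / K\<close> approximate the sphere of radius \<open>rad c\<close>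
 around \<open>c\<close>. As the quadratic terms in \<open>c\<close> cancel, the conditions are linear in \<open>c\<close>, so that the
 integral over \<open>c\<close> is exact for every \<open>K\<close>.\<close>

definition cap :: "real => real => (nat => 'a) => ennreal" where
 "cap K C x = ennreal (2 ^ m * gs_vol m (%i. orth_proj L (x i))) * (INT+ c. indicator (cball 0 C) c * incidence K x c wrt leb L)"

lemma quadric: "c \<in> L ==> (norm (x - c))\<^sup>2 - (rad c)\<^sup>2 = (norm x)\<^sup>2 - r0\<^sup>2 - 2 * (orth_proj L x \<bullet> c)"
 by (simp add: rad_sq orth_proj_inner[OF L] power2_norm_eq_inner inner_diff_left inner_diff_right inner_commute[of c x])

lemma coord_p: "i < m ==> (%p. fst p i) \<in> bmeas (PiM {..<m} (%_. borel :: 'a measure) \<Otimes>\<^sub>M (borel :: 'b::topological_space measure))"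
 by (rule measurable_compose[OF measurable_fst measurable_component_singleton]) simp

lemma rad_measurable: "rad \<in> bmeas borel"
 unfolding rad_def by measurable

lemma incidence_measurable: "(%p. incidence K (fst p) (snd p)) \<in> bmeas (bPi {..<m} \<Otimes>\<^sub>M borel)"
 unfolding incidence_def
proof (intro borel_measurable_prod_ennreal borel_measurable_times_ennreal borel_measurable_const)
 fix i assume "i \<in> {..<m}"
 then have [measurable]: "(%p. fst p i) \<in> bmeas (PiM {..<m} (%_. borel :: 'a measure) \<Otimes>\<^sub>M (borel :: 'a measure))"
  by (intro coord_p) simp
 note [measurable] = rad_measurable
 have "(%p. (norm (fst p i - snd p))\<^sup>2 - (rad (snd p))\<^sup>2) \<in> bmeas (bPi {..<m} \<Otimes>\<^sub>M borel)" by measurable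
 then show "(%p. indicator {0<..<1/K} ((norm (fst p i - snd p))\<^sup>2 - (rad (snd p))\<^sup>2) :: ennreal) \<in> bmeas (bPi {..<m} \<Otimes>\<^sub>M borel)"
  by (rule measurable_compose) simp
qed

lemma incidence_measurable': "incidence K x \<in> bmeas borel"
proof -
 have "incidence K x = (%c. incidence K (\<lambda>i\<in>{..<m}. x i) c)" by (auto simp: incidence_def)
 moreover have "(\<lambda>i\<in>{..<m}. x i) \<in> space (bPi {..<m})" by (simp add: space_PiM)
 ultimately show ?thesis using measurable_compose[OF measurable_Pair1' incidence_measurable] by simp
qed

lemma vol_L_measurable: "(%x. gs_vol m (%i. orth_proj L (x i))) \<in> bmeas (bPi {..<m})"
proof (rule gs_vol_measurable)
 fix i assume "i < m"
 then have "(%x. x i) \<in> bPi {..<m} \<rightarrow>\<^sub>M (borel :: 'a measure)"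
  by (intro measurable_component_singleton) simp
 then show "(%x. orth_proj L (x i)) \<in> bmeas (bPi {..<m})"
  by (rule measurable_compose) (rule orth_proj_measurable[OF L])
qed

lemma cap_measurable: "cap K C \<in> bmeas (bPi {..<m})"
proof -
 interpret S: sigma_finite_measure "leb L" by (rule sigma_finite_leb[OF L])
 have "(%p. indicator (cball 0 C) (snd p) * incidence K (fst p) (snd p)) \<in> bmeas (bPi {..<m} \<Otimes>\<^sub>M borel)"
  by (intro borel_measurable_times_ennreal incidence_measurable measurable_compose[OF measurable_snd borel_measurable_indicator]) simp
 then have "(%x. INT+ c. indicator (cball 0 C) c * incidence K x c wrt leb L) \<in> bmeas (bPi {..<m})"
  by (intro S.borel_measurable_nn_integral) (simp add: case_prod_beta' cong: measurable_cong_sets sets_pair_measure_cong)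
 then show ?thesis unfolding cap_def[abs_def] using vol_L_measurable
  by (intro borel_measurable_times_ennreal measurable_compose[OF _ measurable_ennreal] borel_measurable_times borel_measurable_const) auto
qed

text \<open>By \<open>quadric\<close> each condition confines one product
  \<open>orth_proj L (x i) \<bullet> c\<close> to an interval. In these products as coordinates the
  integral factorises, with \<open>gs_vol\<close> as the Jacobian.\<close>

lemma incidence_integral:
 assumes vol: "gs_vol m (%i. orth_proj L (x i)) \<noteq> 0" and K: "0 < K"
 shows "ennreal (2 ^ m * gs_vol m (%i. orth_proj L (x i))) * (INT+ c. incidence K x c wrt leb L) = 1"
proof -
 let ?xh = "%i. orth_proj L (x i)"
 define q where "q i = (norm (x i))\<^sup>2 - r0\<^sup>2" for i
 define g where "g i a = ennreal K * indicator {0<..<1/K} (q i - 2 * a)" for i and a :: real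
 have gm: "g i \<in> bmeas borel" for i unfolding g_def by measurable
 have span: "span (?xh ` {..<m}) = L"
  by (rule gs_vol_neq_0_span[OF vol L dim_L]) (rule orth_proj_in[OF L])
 interpret P: product_sigma_finite "%_. lborel :: real measure" by standard
 have Gm: "(%a. \<Prod>i<m. g i (a i)) \<in> bmeas reals"
  by (intro borel_measurable_prod_ennreal measurable_compose[OF measurable_component_singleton]) (auto simp: gm)
 have "(INT+ c. incidence K x c wrt leb L) = (INT+ c. (\<Prod>i<m. g i ((\<lambda>i\<in>{..<m}. ?xh i \<bullet> c) i)) wrt leb L)"
  by (rule nn_integral_cong_AE, use AE_leb_in[OF L] in eventually_elim) (simp add: incidence_def g_def q_def quadric)
 then have "ennreal (gs_vol m ?xh) * (INT+ c. incidence K x c wrt leb L) = (INT+ a. (\<Prod>i<m. g i (a i)) wrt reals)"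
  using nn_integral_inner_coordinates[OF vol Gm] unfolding span by simp
 also have "... = (\<Prod>i<m. INT+ a. g i a wrt lborel)" by (rule P.product_nn_integral_prod) (use gm in auto)
 also have "... = (\<Prod>i<m. ennreal (1 / 2))"
 proof (intro prod.cong refl)
  fix i
  \<comment> \<open>The interval has length \<open>1 / (2 * K)\<close> because the product enters
    \<open>quadric\<close> with the factor 2; this is the origin of \<open>2 ^ m\<close> in
    \<open>cap\<close>.\<close>
  have "(INT+ a. g i a wrt lborel) = (INT+ a. ennreal K * indicator {(q i - 1 / K) / 2<..<q i / 2} a wrt lborel)"
   by (intro nn_integral_cong) (auto simp: g_def indicator_def)
  also have "... = ennreal K * ennreal (q i / 2 - (q i - 1 / K) / 2)"
   using K by (subst nn_integral_cmult_indicator) (simp_all add: divide_right_mono)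
  also have "... = ennreal (1 / 2)" using K by (subst ennreal_mult[symmetric]) (simp_all add: field_simps)
  finally show "(INT+ a. g i a wrt lborel) = ennreal (1 / 2)" .
 qed
 also have "... = ennreal ((1 / 2) ^ m)" by (subst prod_ennreal) simp_all
 finally have e: "ennreal (gs_vol m ?xh) * (INT+ c. incidence K x c wrt leb L) = ennreal ((1 / 2) ^ m)" .
 have "ennreal (2 ^ m * gs_vol m ?xh) * (INT+ c. incidence K x c wrt leb L) = ennreal (2 ^ m) * ennreal ((1 / 2) ^ m)"
  unfolding e[symmetric] by (subst ennreal_mult) (simp_all add: gs_vol_nonneg mult.assoc)
 also have "... = 1" by (subst ennreal_mult[symmetric]) (simp_all add: power_mult_distrib[symmetric])
 finally show ?thesis .
qed

lemma cap_mono: "C \<le> C' ==> cap K C x \<le> cap K C' x"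
 unfolding cap_def by (intro mult_left_mono nn_integral_mono mult_right_mono) (auto simp: indicator_def)

lemma cap_le_1:
 assumes "gs_vol m (%i. orth_proj L (x i)) \<noteq> 0" "0 < K" shows "cap K C x \<le> 1"
 unfolding cap_def incidence_integral[OF assms, symmetric]
 by (intro mult_left_mono nn_integral_mono) (auto simp: indicator_def)

text \<open>For \<open>K \<ge> 1\<close> incidence bounds every product
  \<open>orth_proj L (x i) \<bullet> c\<close> independently of \<open>K\<close>. When the
  projections span \<open>L\<close>, the linear map \<open>f\<close> built from these products is
  injective on \<open>L\<close>, so the centre itself is bounded and a large cutoff has no
  effect.\<close>

lemma cap_eventually_1:
 assumes vol: "gs_vol m (%i. orth_proj L (x i)) \<noteq> 0"
 obtains C0 where "\<And>C K. C0 \<le> C ==> 1 \<le> K ==> cap K C x = 1"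
proof -
 let ?xh = "%i. orth_proj L (x i)"
 define f where "f c = (\<Sum>i<m. (?xh i \<bullet> c) *\<^sub>R ?xh i)" for c
 have span: "span (?xh ` {..<m}) = L"
  by (rule gs_vol_neq_0_span[OF vol L dim_L]) (rule orth_proj_in[OF L])
 have bl: "bounded_linear f"
  unfolding f_def by (intro bounded_linear_sum bounded_linear_compose[OF bounded_linear_scaleR_left bounded_linear_inner_right])
 have inj: "\<forall>c\<in>L. f c = 0 \<longrightarrow> c = 0"
 proof (intro ballI impI)
  fix c assume c: "c \<in> L" and f0: "f c = 0"
  have "(\<Sum>i<m. (?xh i \<bullet> c)\<^sup>2) = f c \<bullet> c" by (simp add: f_def inner_sum_left power2_eq_square)
  then have z: "?xh i \<bullet> c = 0" if "i < m" for i using f0 that by (simp add: sum_nonneg_eq_0_iff)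
  have "orthogonal c c"
  proof (rule orthogonal_to_span[of c "?xh ` {..<m}"])
   show "c \<in> span (?xh ` {..<m})" unfolding span by (rule c)
   show "orthogonal c y" if "y \<in> ?xh ` {..<m}" for y using that z by (auto simp: orthogonal_def inner_commute)
  qed
  then show "c = 0" by (simp add: orthogonal_def)
 qed
 obtain e where e: "0 < e" "\<forall>c\<in>L. e * norm c \<le> norm (f c)"
  using injective_imp_isometric[OF closed_subspace[OF L] L bl inj] by blast
 define S where "S = (\<Sum>i<m. ((norm (x i))\<^sup>2 + r0\<^sup>2 + 1) * norm (?xh i))"
 have "cap K C x = 1" if C: "S / e \<le> C" and K: "1 \<le> K" for C K
 proof -
  have "(INT+ c. indicator (cball 0 C) c * incidence K x c wrt leb L) = (INT+ c. incidence K x c wrt leb L)"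
  proof (rule nn_integral_cong_AE, use AE_leb_in[OF L] in eventually_elim)
   case (elim c)
   show ?case
   proof (cases "incidence K x c = 0")
    case False
    have b: "\<bar>?xh i \<bullet> c\<bar> \<le> (norm (x i))\<^sup>2 + r0\<^sup>2 + 1" if "i < m" for i
    proof -
     have "(norm (x i - c))\<^sup>2 - (rad c)\<^sup>2 \<in> {0<..<1/K}"
      using False that by (auto simp: incidence_def indicator_def split: if_splits)
     then have "0 < (norm (x i))\<^sup>2 - r0\<^sup>2 - 2 * (?xh i \<bullet> c)" "(norm (x i))\<^sup>2 - r0\<^sup>2 - 2 * (?xh i \<bullet> c) < 1 / K"
      unfolding quadric[OF elim] by auto
     moreover have "1 / K \<le> 1" using K by simp
     moreover have "0 \<le> (norm (x i))\<^sup>2" "0 \<le> r0\<^sup>2" by simp_all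
     ultimately show ?thesis unfolding abs_le_iff by linarith
    qed
    have "e * norm c \<le> norm (f c)" using e(2) elim by blast
    also have "... \<le> (\<Sum>i<m. norm ((?xh i \<bullet> c) *\<^sub>R ?xh i))" unfolding f_def by (rule norm_sum)
    also have "... \<le> S" unfolding S_def using b by (intro sum_mono) (auto intro: mult_right_mono)
    finally have "norm c \<le> S / e" using e(1) by (simp add: pos_le_divide_eq mult.commute)
    then show ?thesis using C by (simp add: indicator_def)
   qed simp
  qed
  then show ?thesis unfolding cap_def using incidence_integral[OF vol, of K] K by simp
 qed
 then show thesis by (rule that)
qed

text \<open>The integrand in terms of the centre \<open>c\<close>, the directions \<open>u i\<close>
  and the positions \<open>s i\<close> inside the shells. The radii extracted from
  \<open>gs_vol\<close> by homogeneity, together with \<open>2 ^ m\<close>, have cancelled against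
  the Jacobians \<open>1 / (2 * shell K c (s i))\<close>.\<close>

definition thick :: "((nat => 'a) => ennreal) => real => 'a => (nat => 'a) => (nat => real) => ennreal" where
 "thick F K c u s = F (\<lambda>i\<in>{..<m}. c + shell K c (s i) *\<^sub>R u i) *
   ennreal (gs_vol m (%i. (1 / shell K c (s i)) *\<^sub>R c + orth_proj L (u i)) * (\<Prod>i<m. shell K c (s i) ^ (dim W - 1))) *
   (\<Prod>i<m. indicator {0<..<1} (s i))"

text \<open>Tonelli exchanges the tuple and the centre; for a fixed centre the tuple is integrated
  in polar coordinates around it. The cutoff \<open>C\<close> is carried along because the limit of
  thin shells needs a bounded set of centres.\<close>

lemma thick_identity:
 assumes F: "F \<in> bmeas (bPi {..<m})" and K: "0 < K"
 shows "(INT+ x. F x * cap K C x wrt points)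
  = (INT+ c. indicator (cball 0 C) c * (INT+ u. (INT+ s. thick F K c u s wrt reals) wrt spheres) wrt leb L)"
proof -
 interpret S: sigma_finite_measure "leb L" by (rule sigma_finite_leb[OF L])
 interpret X: sigma_finite_measure points
  by (intro product_sigma_finite.sigma_finite) (auto simp: product_sigma_finite_def intro: sigma_finite_leb subspace_W)
 interpret XS: pair_sigma_finite points "leb L" ..
 let ?g = "%x. ennreal (2 ^ m * gs_vol m (%i. orth_proj L (x i)))"
 let ?P = "PiM {..<m} (%_. borel :: 'a measure)"
 have gm: "?g \<in> bmeas ?P"
  using vol_L_measurable by (intro measurable_compose[OF _ measurable_ennreal] borel_measurable_times borel_measurable_const) auto
 have setsp: "sets (points \<Otimes>\<^sub>M leb L) = sets (?P \<Otimes>\<^sub>M borel)" by (intro sets_pair_measure_cong sets_points sets_leb)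
 have Hm: "(%p. (F (fst p) * ?g (fst p)) * (indicator (cball 0 C) (snd p) * incidence K (fst p) (snd p))) \<in> bmeas (points \<Otimes>\<^sub>M leb L)"
  unfolding measurable_cong_sets[OF setsp refl]
  by (intro borel_measurable_times_ennreal incidence_measurable measurable_compose[OF measurable_snd borel_measurable_indicator]
    measurable_compose[OF measurable_fst F] measurable_compose[OF measurable_fst gm]) simp
 have im: "(%c. indicator (cball 0 C) c * incidence K x c) \<in> bmeas (leb L)" for x
  using incidence_measurable'[of K x] by (intro borel_measurable_times_ennreal borel_measurable_indicator) (simp_all add: measurable_cong_sets[OF sets_leb refl])
 have "(INT+ x. F x * cap K C x wrt points)
  = (INT+ x. (INT+ c. (F x * ?g x) * (indicator (cball 0 C) c * incidence K x c) wrt leb L) wrt points)"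
  unfolding cap_def nn_integral_cmult[OF im] by (simp only: mult.assoc)
 also have "... = (INT+ c. (INT+ x. (F x * ?g x) * (indicator (cball 0 C) c * incidence K x c) wrt points) wrt leb L)"
  using Hm by (intro XS.Fubini'[symmetric]) (simp add: case_prod_beta')
 also have "... = (INT+ c. indicator (cball 0 C) c * (INT+ u. (INT+ s. thick F K c u s wrt reals) wrt spheres) wrt leb L)"
 proof (rule nn_integral_cong_AE, use AE_leb_in[OF L] in eventually_elim)
  case (elim c)
  have cW: "c \<in> W" using elim L_W by blast
  have Fg: "(%x. F x * ?g x) \<in> bmeas ?P" by (intro borel_measurable_times_ennreal F gm)
  have im': "(%x. (F x * ?g x) * incidence K x c) \<in> bmeas points"
   unfolding measurable_cong_sets[OF sets_points refl]
   using measurable_compose[OF measurable_Pair2'[of c borel] incidence_measurable[of K]] by (intro borel_measurable_times_ennreal Fg) simp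
  have "(INT+ x. (F x * ?g x) * (indicator (cball 0 C) c * incidence K x c) wrt points) = (INT+ x. indicator (cball 0 C) c * ((F x * ?g x) * incidence K x c) wrt points)"
   by (intro nn_integral_cong) (simp only: mult_ac)
  also have "... = indicator (cball 0 C) c * (INT+ x. (F x * ?g x) * incidence K x c wrt points)"
   by (rule nn_integral_cmult[OF im'])
  also have "(INT+ x. (F x * ?g x) * incidence K x c wrt points) = (INT+ u. (INT+ s. thick F K c u s wrt reals) wrt spheres)"
   unfolding incidence_def nn_integral_shell_tuple[OF subspace_W dim_W_pos cW rad_nonneg K finite_lessThan Fg] shell_def[symmetric]
  proof (intro nn_integral_cong)
   fix u :: "nat => 'a" and s :: "nat => real"
   let ?t = "%i. shell K c (s i)" and ?y = "\<lambda>i\<in>{..<m}. c + shell K c (s i) *\<^sub>R u i"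
   let ?w = "%i. ennreal (?t i ^ (dim W - 1) / (2 * ?t i))"
   show "F ?y * ?g ?y * (\<Prod>i<m. ?w i * indicator {0<..<1} (s i)) = thick F K c u s"
   proof (cases "\<forall>i<m. s i \<in> {0<..<1}")
    case True
    have t: "0 < ?t i" if "i < m" for i
     unfolding shell_def using True that K by (intro real_sqrt_gt_zero add_nonneg_pos) auto
    have "gs_vol m (%i. orth_proj L (?y i)) = gs_vol m (%i. ?t i *\<^sub>R ((1 / ?t i) *\<^sub>R c + orth_proj L (u i)))"
    proof (rule gs_vol_cong)
     fix i assume i: "i < m"
     note lin = linear_orth_proj[OF L]
     have "orth_proj L (?y i) = c + ?t i *\<^sub>R orth_proj L (u i)"
      using i by (simp add: linear_add[OF lin] linear_cmul[OF lin] orth_proj_ident[OF L elim])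
     then show "orth_proj L (?y i) = ?t i *\<^sub>R ((1 / ?t i) *\<^sub>R c + orth_proj L (u i))"
      using t[OF i] by (simp add: scaleR_add_right)
    qed
    \<comment> \<open>Each point may lie at a different radius within its shell, so the volume is
      scaled vector by vector.\<close>
    also have "... = (\<Prod>i<m. \<bar>?t i\<bar>) * gs_vol m (%i. (1 / ?t i) *\<^sub>R c + orth_proj L (u i))"
     by (rule gs_scale) (use t in fastforce)
    also have "(\<Prod>i<m. \<bar>?t i\<bar>) = (\<Prod>i<m. ?t i)" using t by (intro prod.cong) (auto intro!: abs_of_pos)
    finally have v: "gs_vol m (%i. orth_proj L (?y i)) = (\<Prod>i<m. ?t i) * gs_vol m (%i. (1 / ?t i) *\<^sub>R c + orth_proj L (u i))" .
    have "(\<Prod>i<m. 2 * ?t i * (?t i ^ (dim W - 1) / (2 * ?t i))) = (\<Prod>i<m. ?t i ^ (dim W - 1))"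
    proof (intro prod.cong refl)
     fix i assume "i \<in> {..<m}"
     then have "?t i \<noteq> 0" using t[of i] by (metis lessThan_iff less_irrefl)
     then show "2 * ?t i * (?t i ^ (dim W - 1) / (2 * ?t i)) = ?t i ^ (dim W - 1)" by (simp only: nonzero_mult_div_cancel_left mult_eq_0_iff times_divide_eq_right) simp
    qed
    then have p: "2 ^ m * (\<Prod>i<m. ?t i) * (\<Prod>i<m. ?t i ^ (dim W - 1) / (2 * ?t i)) = (\<Prod>i<m. ?t i ^ (dim W - 1))"
     unfolding prod.distrib prod_constant card_lessThan .
    have ind: "(\<Prod>i<m. indicator {0<..<1} (s i)) = (1 :: ennreal)" using True by (intro prod.neutral) auto
    have tw: "0 \<le> ?t i ^ (dim W - 1) / (2 * ?t i)" if "i < m" for i using t[OF that] by simp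
    have "(\<Prod>i<m. ?w i) = ennreal (\<Prod>i<m. ?t i ^ (dim W - 1) / (2 * ?t i))"
     by (rule prod_ennreal) (use tw in auto)
    then have "?g ?y * (\<Prod>i<m. ?w i) = ennreal (2 ^ m * gs_vol m (%i. orth_proj L (?y i)) * (\<Prod>i<m. ?t i ^ (dim W - 1) / (2 * ?t i)))"
     by (simp only:) (intro ennreal_mult[symmetric] mult_nonneg_nonneg gs_vol_nonneg prod_nonneg zero_le_power, use tw in auto)
    also have "2 ^ m * gs_vol m (%i. orth_proj L (?y i)) * (\<Prod>i<m. ?t i ^ (dim W - 1) / (2 * ?t i))
     = gs_vol m (%i. (1 / ?t i) *\<^sub>R c + orth_proj L (u i)) * (2 ^ m * (\<Prod>i<m. ?t i) * (\<Prod>i<m. ?t i ^ (dim W - 1) / (2 * ?t i)))"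
     unfolding v by (simp only: mult_ac)
    finally have "?g ?y * (\<Prod>i<m. ?w i) = ennreal (gs_vol m (%i. (1 / ?t i) *\<^sub>R c + orth_proj L (u i)) * (\<Prod>i<m. ?t i ^ (dim W - 1)))"
     unfolding p .
    then show ?thesis unfolding thick_def prod.distrib ind by (simp only: mult.assoc mult_1_right)
   next
    case False
    then obtain j where j: "j < m" "s j \<notin> {0<..<1}" by blast
    have "(\<Prod>i<m. indicator {0<..<1} (s i)) = (0 :: ennreal)" by (intro prod_zero[OF finite_lessThan] bexI[of _ j]) (use j in simp_all)
    then show ?thesis unfolding thick_def prod.distrib by (simp only: mult_zero_right)
   qed
  qed
  finally show ?case .
 qed
 finally show ?thesis .
qed

end

lemma norm_orth_proj_le: "subspace L ==> norm (orth_proj L x) \<le> norm (x :: 'a::euclidean_space)"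
proof -
 assume L: "subspace L"
 have "norm (orth_proj L x) * norm (orth_proj L x) = orth_proj L x \<bullet> orth_proj L x" by (simp add: dot_square_norm power2_eq_square)
 also have "... = x \<bullet> orth_proj L x" by (rule orth_proj_inner[OF L orth_proj_in[OF L]])
 also have "... \<le> norm x * norm (orth_proj L x)" by (rule norm_cauchy_schwarz)
 finally show ?thesis by (cases "orth_proj L x = 0") auto
qed

section \<open>The limit of vanishing shell thickness\<close>

context shell_pencil
begin

text \<open>The limit of \<open>thick\<close> for \<open>K\<close> tending to infinity: all radii
  become \<open>rad c\<close>, and the positions \<open>s\<close> drop out because the unit cube has
  volume 1.\<close>

definition thin :: "((nat => 'a) => ennreal) => 'a => (nat => 'a) => ennreal" where
 "thin F c u = F (\<lambda>i\<in>{..<m}. c + rad c *\<^sub>R u i) *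
   ennreal (gs_vol m (%i. (1 / rad c) *\<^sub>R c + orth_proj L (u i)) * rad c ^ (m * (dim W - 1)))"

abbreviation flags :: "('a \<times> (nat => 'a) \<times> (nat => real)) measure" where
 "flags \<equiv> leb L \<Otimes>\<^sub>M (spheres \<Otimes>\<^sub>M reals)"

lemma sigma_finite_spheres: "sigma_finite_measure spheres"
 by (intro product_sigma_finite.sigma_finite) (auto simp: product_sigma_finite_def intro: sigma_finite_unit_sphere_measure subspace_W)

lemma sigma_finite_reals: "sigma_finite_measure reals"
 by (intro product_sigma_finite.sigma_finite) (auto simp: product_sigma_finite_def intro: sigma_finite_lborel)

lemma emeasure_spheres: "emeasure spheres (space spheres) < \<infinity>"
proof -
 interpret P: product_sigma_finite "%_. unit_sphere_measure W"
  using sigma_finite_unit_sphere_measure[OF subspace_W] by (simp add: product_sigma_finite_def)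
 have "emeasure spheres (space spheres) = (\<Prod>i<m. emeasure (unit_sphere_measure W) (space (unit_sphere_measure W)))"
  unfolding space_PiM by (rule P.emeasure_PiM) (use sets.top[of "unit_sphere_measure W"] in auto)
 then show ?thesis by (simp add: emeasure_unit_sphere_measure[OF subspace_W] power_less_top_ennreal)
qed

lemma nn_integral_flags:
 assumes G: "G \<in> bmeas flags"
 shows "(INT+ p. G p wrt flags) = (INT+ c. (INT+ u. (INT+ s. G (c, u, s) wrt reals) wrt spheres) wrt leb L)"
proof -
 interpret R: sigma_finite_measure reals by (rule sigma_finite_reals)
 interpret S: sigma_finite_measure spheres by (rule sigma_finite_spheres)
 interpret SR: pair_sigma_finite spheres reals ..
 have "(INT+ p. G p wrt flags) = (INT+ c. (INT+ q. G (c, q) wrt (spheres \<Otimes>\<^sub>M reals)) wrt leb L)"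
  by (rule sigma_finite_measure.nn_integral_fst[OF SR.sigma_finite_measure_axioms G, symmetric])
 also have "... = (INT+ c. (INT+ u. (INT+ s. G (c, u, s) wrt reals) wrt spheres) wrt leb L)"
 proof (rule nn_integral_cong)
  fix c assume "c \<in> space (leb L)"
  from measurable_compose[OF measurable_Pair1'[OF this] G] show "(INT+ q. G (c, q) wrt (spheres \<Otimes>\<^sub>M reals)) = (INT+ u. (INT+ s. G (c, u, s) wrt reals) wrt spheres)"
   by (rule R.nn_integral_fst[symmetric])
 qed
 finally show ?thesis .
qed

lemma flag_measurable:
 shows flag_c: "(%p. fst p) \<in> bmeas flags"
  and flag_u: "i < m ==> (%p. fst (snd p) i) \<in> bmeas flags"
  and flag_s: "i < m ==> (%p. snd (snd p) i) \<in> bmeas flags"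
  and flag_c': "(%q. fst q) \<in> bmeas (leb L \<Otimes>\<^sub>M spheres)"
  and flag_u': "i < m ==> (%q. snd q i) \<in> bmeas (leb L \<Otimes>\<^sub>M spheres)"
proof -
 have f: "fst \<in> leb L \<Otimes>\<^sub>M M \<rightarrow>\<^sub>M borel" for M :: "'b measure"
  using measurable_fst[of "leb L" M] by (simp add: measurable_cong_sets[OF refl sets_leb])
 show "(%p. fst p) \<in> bmeas flags" "(%q. fst q) \<in> bmeas (leb L \<Otimes>\<^sub>M spheres)" by (rule f)+
 assume i: "i < m"
 have u: "(%u. u i) \<in> bmeas spheres"
  by (rule measurable_unit_sphere_measure[where W = W], rule measurable_component_singleton) (use i in simp)
 show "(%p. fst (snd p) i) \<in> bmeas flags"
  by (rule measurable_compose[OF measurable_compose[OF measurable_snd measurable_fst] u])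
 show "(%q. snd q i) \<in> bmeas (leb L \<Otimes>\<^sub>M spheres)" by (rule measurable_compose[OF measurable_snd u])
 have "(%s. s i) \<in> reals \<rightarrow>\<^sub>M lborel" using i by (intro measurable_component_singleton) simp
 then have "(%s. s i) \<in> bmeas reals" by simp
 then show "(%p. snd (snd p) i) \<in> bmeas flags"
  by (rule measurable_compose[OF measurable_compose[OF measurable_snd measurable_snd]])
qed

lemma thick_measurable:
 assumes F: "F \<in> bmeas (bPi {..<m})"
 shows "(%p. thick F K (fst p) (fst (snd p)) (snd (snd p))) \<in> bmeas flags"
proof -
 note u = flag_u and s = flag_s and [measurable] = flag_c
 have r: "(%p. rad (fst p)) \<in> bmeas flags" by (rule measurable_compose[OF flag_c rad_measurable])
 have sh: "(%p. shell K (fst p) (snd (snd p) i)) \<in> bmeas flags" if "i < m" for i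
 proof -
  note [measurable] = r s[OF that]
  show ?thesis unfolding shell_def by measurable
 qed
 have pu: "(%p. orth_proj L (fst (snd p) i)) \<in> bmeas flags" if "i < m" for i
  by (rule measurable_compose[OF u[OF that] orth_proj_measurable[OF L]])
 have x: "(%p. \<lambda>i\<in>{..<m}. fst p + shell K (fst p) (snd (snd p) i) *\<^sub>R fst (snd p) i) \<in> flags \<rightarrow>\<^sub>M bPi {..<m}"
  by (intro measurable_restrict borel_measurable_add borel_measurable_scaleR flag_c sh u) auto
 have v: "(%p. gs_vol m (%i. (1 / shell K (fst p) (snd (snd p) i)) *\<^sub>R fst p + orth_proj L (fst (snd p) i))) \<in> bmeas flags"
  by (intro gs_vol_measurable borel_measurable_add borel_measurable_scaleR borel_measurable_divide borel_measurable_const flag_c sh pu)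
 show ?thesis unfolding thick_def
  by (intro borel_measurable_times_ennreal measurable_compose[OF x F] measurable_compose[OF _ measurable_ennreal] borel_measurable_times v
    borel_measurable_prod borel_measurable_power sh borel_measurable_prod_ennreal measurable_compose[OF s borel_measurable_indicator]) auto
qed

lemma centre_measurable: "(%q. \<lambda>i\<in>{..<m}. fst q + rad (fst q) *\<^sub>R snd q i) \<in> leb L \<Otimes>\<^sub>M spheres \<rightarrow>\<^sub>M bPi {..<m}"
 using measurable_compose[OF flag_c' rad_measurable]
 by (intro measurable_restrict borel_measurable_add borel_measurable_scaleR flag_c' flag_u') auto

lemma centre_weight_measurable: "(%q. ennreal (gs_vol m (%i. (1 / rad (fst q)) *\<^sub>R fst q + orth_proj L (snd q i)) * rad (fst q) ^ (m * (dim W - 1))))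
 \<in> bmeas (leb L \<Otimes>\<^sub>M spheres)"
proof -
 have r: "(%q. rad (fst q)) \<in> bmeas (leb L \<Otimes>\<^sub>M spheres)" by (rule measurable_compose[OF flag_c' rad_measurable])
 show ?thesis
  by (intro measurable_compose[OF _ measurable_ennreal] borel_measurable_times borel_measurable_power r gs_vol_measurable borel_measurable_add
   borel_measurable_scaleR borel_measurable_divide borel_measurable_const flag_c' measurable_compose[OF flag_u' orth_proj_measurable[OF L]])
qed

lemma thin_measurable:
 assumes F: "F \<in> bmeas (bPi {..<m})"
 shows "(%q. thin F (fst q) (snd q)) \<in> bmeas (leb L \<Otimes>\<^sub>M spheres)"
 unfolding thin_def by (intro borel_measurable_times_ennreal measurable_compose[OF centre_measurable F] centre_weight_measurable)

lemma unit_box: "(INT+ s. (\<Prod>i<m. indicator {0<..<1} (s i)) wrt reals) = 1"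
proof -
 interpret P: product_sigma_finite "%_. lborel :: real measure" by standard
 show ?thesis by (subst P.product_nn_integral_prod) auto
qed

lemma unit_box_measurable: "(%s. \<Prod>i<m. indicator {0<..<1} (s i) :: ennreal) \<in> bmeas reals"
 by (intro borel_measurable_prod_ennreal measurable_compose[OF measurable_component_singleton]) auto

lemma shell_tendsto: "(%k. shell (real (Suc k)) c s) \<longlonglongrightarrow> rad c"
proof -
 have "(%k. s / real (Suc k)) \<longlonglongrightarrow> 0" by (rule LIMSEQ_Suc[OF lim_const_over_n])
 then have "(%k. sqrt ((rad c)\<^sup>2 + s / real (Suc k))) \<longlonglongrightarrow> sqrt ((rad c)\<^sup>2 + 0)"
  by (intro tendsto_real_sqrt tendsto_add tendsto_const)
 then show ?thesis using rad_nonneg[of c] by (simp add: shell_def)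
qed

lemma thick_tendsto:
 assumes f: "\<And>i. continuous_on UNIV (f i)" "\<And>i x. 0 \<le> f i x \<and> f i x \<le> (1::real)"
 defines "F \<equiv> %x. ennreal (\<Prod>i<m. f i (x i))"
 shows "(%k. thick F (real (Suc k)) c u s) \<longlonglongrightarrow> thin F c u * (\<Prod>i<m. indicator {0<..<1} (s i))"
proof -
 let ?t = "%k i. shell (real (Suc k)) c (s i)" and ?B = "(\<Prod>i<m. indicator {0<..<1} (s i)) :: ennreal"
 let ?v = "%t. gs_vol m (%i. (1 / t i) *\<^sub>R c + orth_proj L (u i))"
 have "?B = ennreal (\<Prod>i<m. indicator {0<..<1} (s i))" by (subst prod_ennreal[symmetric]) (simp_all add: ennreal_indicator)
 then have B: "?B < top" by simp
 have 1: "(%k. f i (c + ?t k i *\<^sub>R u i)) \<longlonglongrightarrow> f i (c + rad c *\<^sub>R u i)" for i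
  by (intro continuous_on_tendsto_compose[OF f(1)] tendsto_add tendsto_scaleR tendsto_const shell_tendsto) auto
 have 2: "(%k. ?v (?t k)) \<longlonglongrightarrow> ?v (%_. rad c)"
 proof (intro gs_vol_tendsto tendsto_add tendsto_const)
  fix i
  show "(%k. (1 / ?t k i) *\<^sub>R c) \<longlonglongrightarrow> (1 / rad c) *\<^sub>R c"
  \<comment> \<open>The quotient is discontinuous where the limit radius is 0, but there
    \<open>c = 0\<close> and the vector is constantly 0.\<close>
  proof (cases "rad c = 0")
   case True
   then have "c = 0" using norm_le_rad[of c] by simp
   then show ?thesis by simp
  qed (intro tendsto_scaleR tendsto_divide tendsto_const shell_tendsto)
 qed
 have "(%k. \<Prod>i<m. ?t k i ^ (dim W - 1)) \<longlonglongrightarrow> (\<Prod>i<m. rad c ^ (dim W - 1))" by (intro tendsto_prod tendsto_power shell_tendsto)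
 then have 3: "(%k. \<Prod>i<m. ?t k i ^ (dim W - 1)) \<longlonglongrightarrow> rad c ^ (m * (dim W - 1))"
  by (simp add: power_mult[symmetric] mult.commute[of m])
 have "(%k. ?B * ennreal ((\<Prod>i<m. f i (c + ?t k i *\<^sub>R u i)) * (?v (?t k) * (\<Prod>i<m. ?t k i ^ (dim W - 1)))))
  \<longlonglongrightarrow> ?B * ennreal ((\<Prod>i<m. f i (c + rad c *\<^sub>R u i)) * (?v (%_. rad c) * rad c ^ (m * (dim W - 1))))"
  by (intro ennreal_tendsto_cmult[OF B] tendsto_ennrealI tendsto_mult tendsto_prod 1 2 3)
 moreover have "thick F (real (Suc k)) c u s = ?B * ennreal ((\<Prod>i<m. f i (c + ?t k i *\<^sub>R u i)) * (?v (?t k) * (\<Prod>i<m. ?t k i ^ (dim W - 1))))" for k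
  unfolding thick_def F_def using f(2) by (subst ennreal_mult') (auto simp: prod_nonneg mult_ac)
 moreover have "thin F c u * ?B = ?B * ennreal ((\<Prod>i<m. f i (c + rad c *\<^sub>R u i)) * (?v (%_. rad c) * rad c ^ (m * (dim W - 1))))"
  unfolding thin_def F_def using f(2) by (subst ennreal_mult') (auto simp: prod_nonneg mult_ac)
 ultimately show ?thesis by simp
qed

text \<open>The radius of a shell is at least \<open>norm c\<close>, so each vector in
  \<open>gs_vol\<close> is a sum of two vectors of norm at most 1, which yields the factor
  \<open>2 ^ m\<close>. The bound does not involve \<open>K\<close> and serves as the dominating
  function.\<close>

lemma thick_bound:
 assumes F: "\<And>x. F x \<le> 1" and c: "norm c \<le> C" and u: "\<And>i. i < m ==> norm (u i) = 1" and K: "1 \<le> K"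
 shows "thick F K c u s \<le> ennreal (2 ^ m * sqrt (C\<^sup>2 + r0\<^sup>2 + 1) ^ (m * (dim W - 1))) * (\<Prod>i<m. indicator {0<..<1} (s i))"
proof (cases "\<forall>i<m. s i \<in> {0<..<1}")
 case True
 let ?t = "%i. shell K c (s i)" and ?T = "sqrt (C\<^sup>2 + r0\<^sup>2 + 1)"
 have t: "norm c \<le> ?t i" "0 < ?t i" "?t i \<le> ?T" if "i < m" for i
 proof -
  have si: "0 < s i" "s i < 1" using True that by auto
  then have q: "0 < s i / K" "s i / K \<le> 1" using K by (auto simp: divide_le_eq)
  show "norm c \<le> ?t i" unfolding shell_def rad_sq by (rule real_le_rsqrt) (use q in simp)
  show "0 < ?t i" unfolding shell_def using q by (intro real_sqrt_gt_zero add_nonneg_pos) auto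
  have "(norm c)\<^sup>2 \<le> C\<^sup>2" using c by (intro power_mono) auto
  then show "?t i \<le> ?T" unfolding shell_def rad_sq using q by (intro real_sqrt_le_mono) linarith
 qed
 have "gs_vol m (%i. (1 / ?t i) *\<^sub>R c + orth_proj L (u i)) \<le> (\<Prod>i<m. norm ((1 / ?t i) *\<^sub>R c + orth_proj L (u i)))" by (rule gs_vol_le)
 also have "... \<le> (\<Prod>i<m. 2)"
 proof (intro prod_mono conjI norm_ge_zero)
  fix i assume "i \<in> {..<m}"
  then have i: "i < m" by simp
  have "norm ((1 / ?t i) *\<^sub>R c) \<le> 1" using t[OF i] by (simp add: divide_le_eq)
  moreover have "norm (orth_proj L (u i)) \<le> 1" using norm_orth_proj_le[OF L, of "u i"] u[OF i] by simp
  ultimately show "norm ((1 / ?t i) *\<^sub>R c + orth_proj L (u i)) \<le> 2" using norm_triangle_ineq[of "(1 / ?t i) *\<^sub>R c" "orth_proj L (u i)"] by linarith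
 qed
 finally have v: "gs_vol m (%i. (1 / ?t i) *\<^sub>R c + orth_proj L (u i)) \<le> 2 ^ m" by simp
 have "(\<Prod>i<m. ?t i ^ (dim W - 1)) \<le> (\<Prod>i<m. ?T ^ (dim W - 1))"
  using t by (intro prod_mono conjI power_mono zero_le_power) (auto intro: less_imp_le)
 then have p: "(\<Prod>i<m. ?t i ^ (dim W - 1)) \<le> ?T ^ (m * (dim W - 1))" by (simp add: power_mult[symmetric] mult.commute[of m])
 have "thick F K c u s \<le> 1 * ennreal (2 ^ m * ?T ^ (m * (dim W - 1))) * (\<Prod>i<m. indicator {0<..<1} (s i))"
  unfolding thick_def using t
  by (intro mult_mono F ennreal_leI v p order_refl gs_vol_nonneg prod_nonneg) (auto intro: less_imp_le)
 then show ?thesis by simp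
next
 case False
 then obtain j where j: "j < m" "s j \<notin> {0<..<1}" by blast
 have "(\<Prod>i<m. indicator {0<..<1} (s i)) = (0 :: ennreal)" by (intro prod_zero[OF finite_lessThan] bexI[of _ j]) (use j in simp_all)
 then show ?thesis unfolding thick_def by (simp only: mult_zero_right order_refl)
qed

text \<open>Dominated convergence is applied once, on the triple product of centres, directions and
  shell positions; the cutoff makes the dominating function integrable.\<close>

lemma thick_integral_tendsto:
 assumes f: "\<And>i. continuous_on UNIV (f i)" "\<And>i x. 0 \<le> f i x \<and> f i x \<le> (1::real)" and C: "0 < C"
 defines "F \<equiv> %x. ennreal (\<Prod>i<m. f i (x i))"
 assumes F: "F \<in> bmeas (bPi {..<m})"
 shows "(%k. INT+ c. indicator (cball 0 C) c * (INT+ u. (INT+ s. thick F (real (Suc k)) c u s wrt reals) wrt spheres) wrt leb L)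
  \<longlonglongrightarrow> (INT+ c. indicator (cball 0 C) c * (INT+ u. thin F c u wrt spheres) wrt leb L)"
proof -
 let ?I = "%c. indicator (cball 0 C) c :: ennreal" and ?B = "%s. (\<Prod>i<m. indicator {0<..<1} (s i)) :: ennreal"
 let ?J = "%k p. ?I (fst p) * thick F (real (Suc k)) (fst p) (fst (snd p)) (snd (snd p))"
 let ?J' = "%p. ?I (fst p) * (thin F (fst p) (fst (snd p)) * ?B (snd (snd p)))"
 define b where "b = ennreal (2 ^ m * sqrt (C\<^sup>2 + r0\<^sup>2 + 1) ^ (m * (dim W - 1)))"
 let ?w = "%p. ?I (fst p) * (b * ?B (snd (snd p)))"
 have Im: "(%p. ?I (fst p)) \<in> bmeas flags" by (rule measurable_compose[OF flag_c borel_measurable_indicator]) simp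
 have Bm: "(%p. ?B (snd (snd p))) \<in> bmeas flags"
  by (rule measurable_compose[OF measurable_compose[OF measurable_snd measurable_snd] unit_box_measurable])
 have Jm: "?J k \<in> bmeas flags" for k by (intro borel_measurable_times_ennreal Im thick_measurable[OF F])
 have wm: "?w \<in> bmeas flags" by (intro borel_measurable_times_ennreal Im Bm borel_measurable_const)
 have "(%p. (fst p, fst (snd p))) \<in> flags \<rightarrow>\<^sub>M leb L \<Otimes>\<^sub>M spheres"
  by (intro measurable_Pair measurable_fst measurable_compose[OF measurable_snd measurable_fst])
 from measurable_compose[OF this thin_measurable[OF F]]
 have tm: "(%p. thin F (fst p) (fst (snd p))) \<in> bmeas flags" by simp
 have J'm: "?J' \<in> bmeas flags" by (intro borel_measurable_times_ennreal Im Bm tm)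
 have nest: "(INT+ p. ?I (fst p) * G (fst p) (fst (snd p)) (snd (snd p)) wrt flags) = (INT+ c. ?I c * (INT+ u. (INT+ s. G c u s wrt reals) wrt spheres) wrt leb L)"
  if G: "(%p. ?I (fst p) * G (fst p) (fst (snd p)) (snd (snd p))) \<in> bmeas flags" for G
  unfolding nn_integral_flags[OF G] by (intro nn_integral_cong) (simp add: indicator_def)
 have Bint: "(INT+ s. d * ?B s wrt reals) = d" for d
  unfolding nn_integral_cmult[OF unit_box_measurable] unit_box by simp
 have "(%k. INT+ p. ?J k p wrt flags) \<longlonglongrightarrow> (INT+ p. ?J' p wrt flags)"
 proof (rule nn_integral_dominated_convergence[where w = ?w])
  show "AE p in flags. ?J k p \<le> ?w p" for k
  proof (rule AE_I2)
   fix p assume p: "p \<in> space flags"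
   have un: "norm (fst (snd p) i) = 1" if "i < m" for i
   proof -
    have "fst (snd p) \<in> space spheres" using p by (simp add: space_pair_measure mem_Times_iff)
    then have "fst (snd p) \<in> PiE {..<m} (%_. unit_sphere W)" by (simp only: space_PiM space_unit_sphere_measure)
    from PiE_mem[OF this, of i] that show ?thesis by (simp add: unit_sphere_def)
   qed
   show "?J k p \<le> ?w p"
   proof (cases "fst p \<in> cball 0 C")
    case True
    have "F x \<le> 1" for x unfolding F_def using f(2) by (auto intro!: prod_le_1)
    then have "thick F (real (Suc k)) (fst p) (fst (snd p)) (snd (snd p)) \<le> b * ?B (snd (snd p))"
     unfolding b_def by (rule thick_bound) (use True un in simp_all)
    then show ?thesis using True by simp
   qed simp
  qed
  have "(INT+ p. ?w p wrt flags) = (INT+ c. ?I c * (b * emeasure spheres (space spheres)) wrt leb L)"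
   unfolding nest[of "%_ _ s. b * ?B s", OF wm] Bint by simp
  also have "... = emeasure (leb L) (cball 0 C) * (b * emeasure spheres (space spheres))"
   by (subst nn_integral_multc[OF borel_measurable_indicator]) simp_all
  also have "... < \<infinity>" unfolding emeasure_leb_cball[OF L C] using emeasure_spheres by (simp add: ennreal_mult_less_top b_def)
  finally show "(INT+ p. ?w p wrt flags) < \<infinity>" .
  show "AE p in flags. (%k. ?J k p) \<longlonglongrightarrow> ?J' p"
   unfolding F_def by (intro AE_I2 ennreal_tendsto_cmult thick_tendsto f) (simp add: indicator_def)
 qed (use Jm J'm wm in auto)
 moreover have "(INT+ p. ?J k p wrt flags) = (INT+ c. ?I c * (INT+ u. (INT+ s. thick F (real (Suc k)) c u s wrt reals) wrt spheres) wrt leb L)" for k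
  by (rule nest[OF Jm])
 moreover have "(INT+ p. ?J' p wrt flags) = (INT+ c. ?I c * (INT+ u. thin F c u wrt spheres) wrt leb L)"
  unfolding nest[of "%c u s. thin F c u * ?B s", OF J'm] Bint ..
 ultimately show ?thesis by simp
qed

text \<open>Two limits are taken: the shells shrink for a fixed cutoff, then the cutoff grows. Since
  \<open>cap\<close> lies between 0 and 1, the truncated limit \<open>R C\<close> never exceeds the
  integral over the points; the other inequality needs a lower bound for \<open>cap\<close> that is
  uniform in \<open>K\<close>.\<close>

lemma points_integral_product:
 assumes f: "\<And>i. continuous_on UNIV (f i)" "\<And>i x. 0 \<le> f i x \<and> f i x \<le> (1::real)"
 defines "F \<equiv> %x. ennreal (\<Prod>i<m. f i (x i))"
 shows "(INT+ x. F x wrt points) = (INT+ c. (INT+ u. thin F c u wrt spheres) wrt leb L)"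
proof -
 let ?P = "PiM {..<m} (%_. borel :: 'a measure)"
 have F: "F \<in> bmeas ?P" unfolding F_def
 proof (intro measurable_compose[OF _ measurable_ennreal] borel_measurable_prod)
  fix i assume "i \<in> {..<m}"
  then have "(%x. x i) \<in> ?P \<rightarrow>\<^sub>M borel" by (rule measurable_component_singleton)
  then show "(%x. f i (x i)) \<in> bmeas ?P" by (rule measurable_compose) (rule borel_measurable_continuous_onI[OF f(1)])
 qed
 have AEv: "AE x in points. gs_vol m (%i. orth_proj L (x i)) \<noteq> 0" by (rule AE_gs_vol_neq_0[OF L dim_L subspace_W L_W])
 \<comment> \<open>The infimum over all thicknesses is independent of \<open>k\<close> and increases
   with the cutoff. It reaches 1 for almost every tuple, because the threshold in
   \<open>cap_eventually_1\<close> does not depend on \<open>K\<close>.\<close>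
 define \<Psi> where "\<Psi> C x = (INF k. cap (real (Suc k)) (real (Suc C)) x)" for C x
 define R where "R C = (INT+ c. indicator (cball 0 (real (Suc C))) c * (INT+ u. thin F c u wrt spheres) wrt leb L)" for C
 have Fp: "F \<in> bmeas points" using F by (simp add: measurable_cong_sets[OF sets_points refl])
 have \<Psi>m: "\<Psi> C \<in> bmeas points" for C
  unfolding \<Psi>_def measurable_cong_sets[OF sets_points refl] by (intro borel_measurable_INF cap_measurable) simp
 have lim: "(%k. INT+ x. F x * cap (real (Suc k)) (real (Suc C)) x wrt points) \<longlonglongrightarrow> R C" for C
  unfolding R_def thick_identity[OF F of_nat_0_less_iff[THEN iffD2, OF zero_less_Suc]] unfolding F_def
  by (rule thick_integral_tendsto[OF f _ F[unfolded F_def]]) simp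
 have lo: "(INT+ x. F x * \<Psi> C x wrt points) \<le> R C" for C
  by (rule LIMSEQ_le_const[OF lim]) (auto intro!: exI[of _ 0] nn_integral_mono mult_left_mono INF_lower simp: \<Psi>_def)
 have hi: "R C \<le> (INT+ x. F x wrt points)" for C
 proof (rule LIMSEQ_le_const2[OF lim], intro exI allI impI)
  fix k
  show "(INT+ x. F x * cap (real (Suc k)) (real (Suc C)) x wrt points) \<le> (INT+ x. F x wrt points)"
  proof (rule nn_integral_mono_AE, use AEv in eventually_elim)
   case (elim x)
   show ?case using mult_left_mono[OF cap_le_1[OF elim, of "real (Suc k)" "real (Suc C)"], of "F x"] by simp
  qed
 qed
 have "(INT+ x. F x wrt points) = (INT+ x. (SUP C. F x * \<Psi> C x) wrt points)"
 proof (rule nn_integral_cong_AE, use AEv in eventually_elim)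
  case (elim x)
  obtain C0 where C0: "\<And>C K. C0 \<le> C ==> 1 \<le> K ==> cap K C x = 1" using cap_eventually_1[OF elim] by blast
  obtain n :: nat where n: "C0 \<le> real n" using real_arch_simple by blast
  have "\<Psi> n x = 1" unfolding \<Psi>_def using n by (subst C0) auto
  moreover have "\<Psi> C x \<le> 1" for C
   unfolding \<Psi>_def by (rule INF_lower2[of 0]) (use cap_le_1[OF elim, of 1] in auto)
  ultimately have "F x = F x * \<Psi> n x" "F x * \<Psi> C x \<le> F x" for C
   using mult_left_mono[of "\<Psi> C x" 1 "F x"] by simp_all
  then show ?case by (intro antisym SUP_least) (auto intro: SUP_upper2[of n])
 qed
 also have "... = (SUP C. INT+ x. F x * \<Psi> C x wrt points)"
 proof (rule nn_integral_monotone_convergence_SUP)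
  show "incseq (%C x. F x * \<Psi> C x)"
   unfolding \<Psi>_def by (intro incseq_SucI le_funI mult_left_mono INF_superset_mono order_refl cap_mono) simp_all
 qed (use Fp \<Psi>m in auto)
 finally have I: "(INT+ x. F x wrt points) = (SUP C. INT+ x. F x * \<Psi> C x wrt points)" .
 interpret S: sigma_finite_measure spheres by (rule sigma_finite_spheres)
 have gm: "(%c. INT+ u. thin F c u wrt spheres) \<in> bmeas (leb L)"
  using thin_measurable[OF F] by (intro S.borel_measurable_nn_integral) (simp add: case_prod_beta')
 have "(INT+ c. (INT+ u. thin F c u wrt spheres) wrt leb L)
  = (INT+ c. (SUP C. indicator (cball 0 (real (Suc C))) c * (INT+ u. thin F c u wrt spheres)) wrt leb L)"
 proof (rule nn_integral_cong)
  fix c :: 'a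
  obtain n :: nat where "norm c \<le> real n" using real_arch_simple by blast
  then show "(INT+ u. thin F c u wrt spheres) = (SUP C. indicator (cball 0 (real (Suc C))) c * (INT+ u. thin F c u wrt spheres))"
   by (intro antisym SUP_least SUP_upper2[of n]) (auto simp: indicator_def)
 qed
 also have "... = (SUP C. R C)" unfolding R_def
 proof (rule nn_integral_monotone_convergence_SUP)
  show "incseq (%C c. indicator (cball 0 (real (Suc C))) c * (INT+ u. thin F c u wrt spheres))"
   by (intro incseq_SucI le_funI mult_right_mono) (auto simp: indicator_def)
 qed (use gm in \<open>intro borel_measurable_times_ennreal borel_measurable_indicator, simp_all\<close>)
 finally have "(INT+ c. (INT+ u. thin F c u wrt spheres) wrt leb L) = (SUP C. R C)" .
 moreover have "(SUP C. R C) \<le> (INT+ x. F x wrt points)" by (rule SUP_least) (rule hi)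
 moreover have "(INT+ x. F x wrt points) \<le> (SUP C. R C)" unfolding I by (rule SUP_mono) (use lo in blast)
 ultimately show ?thesis by simp
qed

text \<open>The right side is the integral with respect to a measure \<open>N\<close>; agreement on
  products of continuous functions identifies \<open>N\<close> with the product of Lebesgue
  measures.\<close>

theorem nn_integral_points:
 assumes F: "F \<in> bmeas (bPi {..<m})"
 shows "(INT+ x. F x wrt points) = (INT+ c. (INT+ u. thin F c u wrt spheres) wrt leb L)"
proof -
 let ?P = "PiM {..<m} (%_. borel :: 'a measure)" and ?M = "leb L \<Otimes>\<^sub>M spheres"
 let ?h = "%q. \<lambda>i\<in>{..<m}. fst q + rad (fst q) *\<^sub>R snd q i"
 let ?w = "%q. ennreal (gs_vol m (%i. (1 / rad (fst q)) *\<^sub>R fst q + orth_proj L (snd q i)) * rad (fst q) ^ (m * (dim W - 1)))"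
 interpret S: sigma_finite_measure spheres by (rule sigma_finite_spheres)
 define N where "N = distr (density ?M ?w) ?P ?h"
 have N: "(INT+ x. G x wrt N) = (INT+ c. (INT+ u. thin G c u wrt spheres) wrt leb L)" if G: "G \<in> bmeas ?P" for G
 proof -
  have "(INT+ x. G x wrt N) = (INT+ q. G (?h q) wrt density ?M ?w)"
   unfolding N_def using G centre_measurable by (intro nn_integral_distr) auto
  also have "... = (INT+ q. ?w q * G (?h q) wrt ?M)"
   by (rule nn_integral_density[OF centre_weight_measurable measurable_compose[OF centre_measurable G]])
  also have "... = (INT+ q. thin G (fst q) (snd q) wrt ?M)" by (simp only: thin_def mult.commute)
  also have "... = (INT+ c. (INT+ u. thin G c u wrt spheres) wrt leb L)"
   using S.nn_integral_fst[OF thin_measurable[OF G]] by simp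
  finally show ?thesis .
 qed
 have "points = N"
 proof (rule PiM_borel_eqI_continuous[OF finite_lessThan sets_points])
  show "sets N = sets ?P" by (simp add: N_def)
  interpret P: product_sigma_finite "%_. leb W"
   using sigma_finite_leb[OF subspace_W] by (simp add: product_sigma_finite_def)
  have "emeasure (leb W) (ball 0 (real k)) < \<infinity>" for k
  proof -
   have "emeasure (leb W) (ball 0 (real k)) \<le> emeasure (leb W) (cball 0 (real (Suc k)))"
    by (intro emeasure_mono) auto
   also have "... < \<infinity>" by (subst emeasure_leb_cball[OF subspace_W]) auto
   finally show ?thesis .
  qed
  then show "emeasure points (PiE {..<m} (%_. ball 0 (real k))) \<noteq> \<infinity>" for k
   by (subst P.emeasure_PiM) (auto simp: power_less_top_ennreal less_top)
  fix f :: "nat => 'a => real" assume f: "\<And>i. continuous_on UNIV (f i)" "\<And>i x. 0 \<le> f i x \<and> f i x \<le> 1"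
  have "(%x. ennreal (\<Prod>i<m. f i (x i))) \<in> bmeas ?P"
  proof (intro measurable_compose[OF _ measurable_ennreal] borel_measurable_prod)
   fix i assume "i \<in> {..<m}"
   then have "(%x. x i) \<in> ?P \<rightarrow>\<^sub>M borel" by (rule measurable_component_singleton)
   then show "(%x. f i (x i)) \<in> bmeas ?P" by (rule measurable_compose) (rule borel_measurable_continuous_onI[OF f(1)])
  qed
  from N[OF this] points_integral_product[OF f]
  show "(INT+ x. ennreal (\<Prod>i<m. f i (x i)) wrt points) = (INT+ x. ennreal (\<Prod>i<m. f i (x i)) wrt N)" by simp
 qed
 then show ?thesis using N[OF F] by simp
qed

end

text \<open>With \<open>t = sqrt (r\<^sup>2 - r0\<^sup>2)\<close> one has
  \<open>t dt = r dr\<close>, so \<open>t ^ (m - 1) dt\<close> becomes \<open>r\<close> times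
  \<open>t\<close> to the power \<open>m - 2\<close> times \<open>dr\<close>. For
  \<open>m = 1\<close> this power is negative, hence \<open>powr\<close>.\<close>

lemma nn_integral_radius_substitution:
 fixes h :: "real => ennreal"
 assumes r0: "0 \<le> r0" and m: "1 \<le> m" and h[measurable]: "h \<in> bmeas borel"
 shows "(INT+ t. h t * (ennreal (t ^ (m - 1)) * indicator {0<..} t) wrt lborel)
  = (INT+ r. h (sqrt (r\<^sup>2 - r0\<^sup>2)) * ennreal (r * (r\<^sup>2 - r0\<^sup>2) powr ((real m - 2) / 2)) * indicator {r0<..} r wrt lborel)"
proof -
 define f where "f r = h (sqrt (r\<^sup>2 - r0\<^sup>2)) * ennreal (r * (r\<^sup>2 - r0\<^sup>2) powr ((real m - 2) / 2))" for r
 define g where "g t = sqrt (t\<^sup>2 + r0\<^sup>2)" for t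
 have fm[measurable]: "f \<in> bmeas borel" unfolding f_def by measurable
 \<comment> \<open>The substitution is made on compact intervals away from \<open>t = 0\<close>,
   where \<open>t / g t\<close> is singular if \<open>r0 = 0\<close>; they exhaust the positive
   half-line. The shift by two makes even the first interval nondegenerate.\<close>
 let ?a = "%j::nat. 1 / real (j + 2)" and ?b = "%j::nat. real (j + 2)"
 have ab: "0 < ?a j" "?a j < ?b j" for j :: nat
 proof -
  show "0 < ?a j" by simp
  have "?a j < 1" by simp
  also have "1 < ?b j" by simp
  finally show "?a j < ?b j" .
 qed
 have pos: "0 < t\<^sup>2 + r0\<^sup>2" if "0 < t" for t using that by (intro add_pos_nonneg) auto
 have eq: "(INT+ r. f r * indicator {g (?a j)..g (?b j)} r wrt lborel)
  = (INT+ t. h t * ennreal (t ^ (m - 1)) * indicator {?a j..?b j} t wrt lborel)" for j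
 proof -
  have "(INT+ r. f r * indicator {g (?a j)..g (?b j)} r wrt lborel) = (INT+ t. f (g t) * ennreal (t / g t) * indicator {?a j..?b j} t wrt lborel)"
  proof (rule nn_integral_substitution_aux[OF fm _ _ _ _ ab(2)])
   fix t assume "t \<in> {?a j..?b j}"
   then have t: "0 < t" by (metis ab(1) atLeastAtMost_iff less_le_trans)
   show "(g has_real_derivative t / g t) (at t)"
    unfolding g_def using pos[OF t] by (auto intro!: derivative_eq_intros simp: field_simps)
   show "0 \<le> t / g t" using t by (simp add: g_def)
  next
   show "continuous_on {?a j..?b j} (%t. t / g t)" unfolding g_def
   proof (intro continuous_intros ballI)
    fix t assume "t \<in> {?a j..?b j}"
    then have "0 < t" by (metis ab(1) atLeastAtMost_iff less_le_trans)
    then show "sqrt (t\<^sup>2 + r0\<^sup>2) \<noteq> 0" using pos[of t] by simp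
   qed
  qed simp
  also have "... = (INT+ t. h t * ennreal (t ^ (m - 1)) * indicator {?a j..?b j} t wrt lborel)"
  proof (rule nn_integral_cong)
   fix t
   show "f (g t) * ennreal (t / g t) * indicator {?a j..?b j} t = h t * ennreal (t ^ (m - 1)) * indicator {?a j..?b j} t"
   proof (cases "t \<in> {?a j..?b j}")
    case True
    then have t: "0 < t" by (metis ab(1) atLeastAtMost_iff less_le_trans)
    have gp: "0 < g t" using pos[OF t] by (simp add: g_def)
    have g2: "(g t)\<^sup>2 - r0\<^sup>2 = t\<^sup>2" by (simp add: g_def)
    have e: "2 * ((real m - 2) / 2) = real m - 2" by (simp add: field_simps)
    have p: "(t\<^sup>2) powr ((real m - 2) / 2) = t powr (2 * ((real m - 2) / 2))"
     using t by (simp only: powr_powr[symmetric] powr_numeral)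
    have "(t\<^sup>2) powr ((real m - 2) / 2) * t = t powr (real m - 2) * t powr 1" unfolding p e using t by simp
    also have "... = t powr (real (m - 1))" by (subst powr_add[symmetric]) (use m in \<open>simp add: of_nat_diff\<close>)
    finally have p: "(t\<^sup>2) powr ((real m - 2) / 2) * t = t ^ (m - 1)" using t by (simp add: powr_realpow)
    have "f (g t) = h t * ennreal (g t * (t\<^sup>2) powr ((real m - 2) / 2))" unfolding f_def g2 using t by simp
    moreover have "ennreal (g t * (t\<^sup>2) powr ((real m - 2) / 2)) * ennreal (t / g t) = ennreal (t ^ (m - 1))"
     unfolding p[symmetric] using gp t by (simp add: ennreal_mult[symmetric])
    ultimately show ?thesis by (simp add: mult.assoc)
   qed simp
  qed
  finally show ?thesis .
 qed
 have gmono: "g s \<le> g t" if "0 \<le> s" "s \<le> t" for s t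
  unfolding g_def using that by (intro real_sqrt_le_mono add_right_mono power_mono)
 have I2: "indicator {0<..} t = (SUP j. indicator {?a j..?b j} t :: ennreal)" for t :: real
 proof (cases "0 < t")
  case True
  obtain j1 :: nat where j1: "t \<le> real j1" using real_arch_simple by blast
  obtain j2 :: nat where j2: "1 / t \<le> real j2" using real_arch_simple by blast
  have "1 / t \<le> real (max j1 j2 + 2)" using j2 by simp
  then have "?a (max j1 j2) \<le> t" using True by (simp add: field_simps)
  moreover have "t \<le> ?b (max j1 j2)" using j1 by simp
  ultimately show ?thesis using True by (intro antisym SUP_least SUP_upper2[of "max j1 j2"]) (auto simp: indicator_def)
 next
  case False
  then have "t \<notin> {?a j..?b j}" for j by (metis ab(1) atLeastAtMost_iff less_le_trans)
  then show ?thesis using False by simp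
 qed
 have I1: "indicator {r0<..} r = (SUP j. indicator {g (?a j)..g (?b j)} r :: ennreal)" for r
 proof (cases "r0 < r")
  case True
  define t where "t = sqrt (r\<^sup>2 - r0\<^sup>2)"
  have "r0\<^sup>2 < r\<^sup>2" using True r0 by (intro power_strict_mono) auto
  then have t: "0 < t" "g t = r" using True r0 by (auto simp: t_def g_def)
  have "(1::ennreal) = (SUP j. indicator {?a j..?b j} t)" using I2[of t] t by simp
  also have "... \<le> (SUP j. indicator {g (?a j)..g (?b j)} r)"
  proof (intro SUP_mono bexI[of _ "j" for j])
   fix j :: nat
   show "indicator {?a j..?b j} t \<le> (indicator {g (?a j)..g (?b j)} r :: ennreal)"
    using gmono[of "?a j" t] gmono[of t "?b j"] t ab(1)[of j] by (auto simp: indicator_def)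
  qed simp
  finally have ge: "1 \<le> (SUP j. indicator {g (?a j)..g (?b j)} r :: ennreal)" .
  have "indicator {r0<..} r = (1::ennreal)" using True by simp
  also have "1 = (SUP j. indicator {g (?a j)..g (?b j)} r :: ennreal)"
   by (intro antisym ge SUP_least) (simp add: indicator_def)
  finally show ?thesis .
 next
  case False
  have "r0 < g (?a j)" for j unfolding g_def using ab(1)[of j] by (intro real_less_rsqrt) auto
  then have "r \<notin> {g (?a j)..g (?b j)}" for j by (metis False atLeastAtMost_iff less_le_trans)
  then show ?thesis using False by simp
 qed
 have inc2: "incseq (%j t. indicator {?a j..?b j} t :: ennreal)"
 proof (intro incseq_SucI le_funI)
  fix j :: nat and t :: real
  have "{?a j..?b j} \<subseteq> {?a (Suc j)..?b (Suc j)}"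
   by (intro atLeastatMost_subset_iff[THEN iffD2] disjI2 conjI frac_le) auto
  then show "indicator {?a j..?b j} t \<le> (indicator {?a (Suc j)..?b (Suc j)} t :: ennreal)"
   by (auto split: split_indicator)
 qed
 have inc1: "incseq (%j r. indicator {g (?a j)..g (?b j)} r :: ennreal)"
 proof (intro incseq_SucI le_funI)
  fix j r
  have "g (?a (Suc j)) \<le> g (?a j)" by (rule gmono) (auto simp: frac_le)
  moreover have "g (?b j) \<le> g (?b (Suc j))" by (rule gmono) auto
  ultimately show "indicator {g (?a j)..g (?b j)} r \<le> (indicator {g (?a (Suc j))..g (?b (Suc j))} r :: ennreal)"
   by (auto simp: indicator_def)
 qed
 have mc: "(INT+ x. k x * (SUP j. I j x) wrt lborel) = (SUP j. INT+ x. k x * I j x wrt lborel)"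
  if "incseq I" "k \<in> bmeas borel" "\<And>j. I j \<in> bmeas borel" for k :: "real => ennreal" and I :: "nat => real => ennreal"
  unfolding SUP_mult_left_ennreal
  using that by (intro nn_integral_monotone_convergence_SUP) (auto intro!: mult_left_mono simp: incseq_def le_fun_def)
 have km: "(%t. h t * ennreal (t ^ (m - 1))) \<in> bmeas borel" by measurable
 have "(INT+ t. h t * ennreal (t ^ (m - 1)) * indicator {0<..} t wrt lborel) = (INT+ r. f r * indicator {r0<..} r wrt lborel)"
  unfolding I1 I2 by (subst mc[OF inc2 km], simp) (subst mc[OF inc1 fm], simp, simp only: eq)
 then show ?thesis by (simp add: f_def mult.assoc)
qed

section \<open>Assembly of the spherical formula\<close>

context grassmann_frame
begin

definition kernel :: "real => (real ^ 'n) set => real => real ^ 'n => (nat => real ^ 'n) => real" where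
 "kernel r0 L r z u = r ^ (m * (CARD('n) - 1) + 1) * (r\<^sup>2 - r0\<^sup>2) powr ((real m - 2) / 2)
   * (fact m * simplex_volume m (- (sqrt (r\<^sup>2 - r0\<^sup>2) / r) *\<^sub>R z) (%i. orth_proj L (u i))) ^ (CARD('n) - dim Q - m + 1)"

lemma dim_V: "dim V + dim Q = CARD('n)"
 using dim_orthogonal_comp[OF Q] dim_subset_UNIV[of Q] by simp

lemma fibre_integral:
 assumes L: "L \<in> space \<nu>" and m1: "1 \<le> m" and r0: "0 \<le> r0" and g: "g \<in> bmeas (bPi {..<m})"
 shows "(INT+ x. g x * ennreal (vol m x ^ (dim V - m)) wrt PiM {..<m} (%_. leb (subspace_sum L Q)))
  = (\<integral>\<^sup>+ r\<in>{r0..}. (INT+ z. (INT+ u. g (\<lambda>i\<in>{..<m}. sqrt (r\<^sup>2 - r0\<^sup>2) *\<^sub>R z + r *\<^sub>R u i) * ennreal (kernel r0 L r z u)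
    wrt PiM {..<m} (%_. unit_sphere_measure (subspace_sum L Q))) wrt unit_sphere_measure L) \<partial>lborel)"
proof -
 have sL: "subspace L" "L \<subseteq> V" "dim L = m" using L by (auto simp: in_\<nu>)
 have oLQ: "\<forall>x\<in>L. \<forall>y\<in>Q. x \<bullet> y = 0" using sL(2) orth_VQ by blast
 interpret S: shell_pencil L Q r0 m using sL Q oLQ m1 r0 by unfold_locales auto
 interpret sp: sigma_finite_measure S.spheres by (rule S.sigma_finite_spheres)
 interpret usL: sigma_finite_measure "unit_sphere_measure L" by (rule sigma_finite_unit_sphere_measure[OF sL(1)])
 interpret lu: pair_sigma_finite "unit_sphere_measure L" "lborel :: real measure" ..
 define G where "G x = g x * ennreal (vol m x ^ (dim V - m))" for x
 have G: "G \<in> bmeas (bPi {..<m})" unfolding G_def by (intro borel_measurable_times_ennreal g vol_power_measurable)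
 define H where "H c = (INT+ u. S.thin G c u wrt S.spheres)" for c
 have "(%c. H c) \<in> bmeas (leb L)"
  unfolding H_def using S.thin_measurable[OF G] by (intro sp.borel_measurable_nn_integral) (simp add: case_prod_beta')
 then have Hm: "H \<in> bmeas borel" by (simp add: measurable_cong_sets[OF sets_leb refl])
 have fu: "(%p. fst p) \<in> bmeas (unit_sphere_measure L \<Otimes>\<^sub>M (lborel :: real measure))"
  by (rule measurable_unit_sphere_measure[OF measurable_fst])
 have "(%p. snd p *\<^sub>R fst p) \<in> bmeas (unit_sphere_measure L \<Otimes>\<^sub>M (lborel :: real measure))"
  by (rule borel_measurable_scaleR[OF _ fu]) measurable
 note Hp = measurable_compose[OF this Hm]
 have Hp': "(%(t, z). H (t *\<^sub>R z)) \<in> bmeas (lborel \<Otimes>\<^sub>M unit_sphere_measure L)"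
  using measurable_compose[OF measurable_pair_swap' Hp] by (simp add: case_prod_beta')
 have h1m: "(%t. INT+ z. H (t *\<^sub>R z) wrt unit_sphere_measure L) \<in> bmeas borel"
  using usL.borel_measurable_nn_integral[OF Hp'] by simp
 have Hz: "(%z. H (t *\<^sub>R z)) \<in> bmeas (unit_sphere_measure L)" for t
  using measurable_compose[OF measurable_ident_unit_sphere measurable_compose[OF borel_measurable_scaleR[OF borel_measurable_const measurable_ident] Hm]] by simp
 have "(INT+ x. G x wrt S.points) = (INT+ c. H c wrt leb L)" unfolding H_def by (rule S.nn_integral_points[OF G])
 also have "... = (INT+ z. (INT+ t. H (t *\<^sub>R z) * (ennreal (t ^ (dim L - 1)) * indicator {0<..} t) wrt lborel) wrt unit_sphere_measure L)"
  by (rule nn_integral_polar[OF sL(1) _ Hm]) (use sL(3) m1 in simp)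
 also have "... = (INT+ t. (INT+ z. H (t *\<^sub>R z) * (ennreal (t ^ (m - 1)) * indicator {0<..} t) wrt unit_sphere_measure L) wrt lborel)"
 proof (unfold sL(3), rule lu.Fubini'[symmetric])
  have "(%p. H (snd p *\<^sub>R fst p) * (ennreal (snd p ^ (m - 1)) * indicator {0<..} (snd p))) \<in> bmeas (unit_sphere_measure L \<Otimes>\<^sub>M lborel)"
   by (rule borel_measurable_times_ennreal[OF Hp]) measurable
  then show "(%(z, t). H (t *\<^sub>R z) * (ennreal (t ^ (m - 1)) * indicator {0<..} t)) \<in> bmeas (unit_sphere_measure L \<Otimes>\<^sub>M lborel)"
   by (simp add: case_prod_beta')
 qed
 also have "... = (INT+ t. (INT+ z. H (t *\<^sub>R z) wrt unit_sphere_measure L) * (ennreal (t ^ (m - 1)) * indicator {0<..} t) wrt lborel)"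
  by (intro nn_integral_cong nn_integral_multc Hz)
 also have "... = (INT+ r. (INT+ z. H (sqrt (r\<^sup>2 - r0\<^sup>2) *\<^sub>R z) wrt unit_sphere_measure L) * ennreal (r * (r\<^sup>2 - r0\<^sup>2) powr ((real m - 2) / 2)) * indicator {r0<..} r wrt lborel)"
  by (rule nn_integral_radius_substitution[OF r0 m1 h1m])
 also have "... = (INT+ r. (INT+ z. (INT+ u. g (\<lambda>i\<in>{..<m}. sqrt (r\<^sup>2 - r0\<^sup>2) *\<^sub>R z + r *\<^sub>R u i) * ennreal (kernel r0 L r z u) wrt S.spheres) wrt unit_sphere_measure L) * indicator {r0..} r wrt lborel)"
 proof (rule nn_integral_cong_AE)
  \<comment> \<open>The substitution produces the open half-line; the endpoint is a null set, and
    beyond it \<open>r\<close> is positive, so the division by \<open>r\<close> is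
    legitimate.\<close>
  have "AE r in lborel. r \<noteq> r0" by (rule AE_lborel_singleton)
  then show "AE r in lborel. (INT+ z. H (sqrt (r\<^sup>2 - r0\<^sup>2) *\<^sub>R z) wrt unit_sphere_measure L) * ennreal (r * (r\<^sup>2 - r0\<^sup>2) powr ((real m - 2) / 2)) * indicator {r0<..} r
   = (INT+ z. (INT+ u. g (\<lambda>i\<in>{..<m}. sqrt (r\<^sup>2 - r0\<^sup>2) *\<^sub>R z + r *\<^sub>R u i) * ennreal (kernel r0 L r z u) wrt S.spheres) wrt unit_sphere_measure L) * indicator {r0..} r"
  proof eventually_elim
   case (elim r)
   show ?case
   proof (cases "r0 < r")
    case True
    let ?s = "sqrt (r\<^sup>2 - r0\<^sup>2)" and ?w = "r * (r\<^sup>2 - r0\<^sup>2) powr ((real m - 2) / 2)"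
    have rp: "0 < r" using True r0 by simp
    have s2: "?s\<^sup>2 = r\<^sup>2 - r0\<^sup>2" using True r0 by (simp add: power_mono)
    have "(INT+ z. H (?s *\<^sub>R z) wrt unit_sphere_measure L) * ennreal ?w = (INT+ z. H (?s *\<^sub>R z) * ennreal ?w wrt unit_sphere_measure L)"
     by (rule nn_integral_multc[OF Hz, symmetric])
    also have "... = (INT+ z. (INT+ u. g (\<lambda>i\<in>{..<m}. ?s *\<^sub>R z + r *\<^sub>R u i) * ennreal (kernel r0 L r z u) wrt S.spheres) wrt unit_sphere_measure L)"
    proof (rule nn_integral_cong)
     fix z assume "z \<in> space (unit_sphere_measure L)"
     then have z: "z \<in> L" "norm z = 1" by (auto simp: unit_sphere_def)
     have c: "?s *\<^sub>R z \<in> L" by (rule subspace_scale[OF sL(1) z(1)])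
     have rad: "S.rad (?s *\<^sub>R z) = r" unfolding S.rad_def using z(2) s2 rp by simp
     have "(%u. S.thin G (?s *\<^sub>R z) u) \<in> bmeas S.spheres"
      using measurable_compose[OF measurable_Pair1' S.thin_measurable[OF G], of "?s *\<^sub>R z"] by simp
     then have "H (?s *\<^sub>R z) * ennreal ?w = (INT+ u. S.thin G (?s *\<^sub>R z) u * ennreal ?w wrt S.spheres)"
      unfolding H_def by (rule nn_integral_multc[symmetric])
     also have "... = (INT+ u. g (\<lambda>i\<in>{..<m}. ?s *\<^sub>R z + r *\<^sub>R u i) * ennreal (kernel r0 L r z u) wrt S.spheres)"
     proof (rule nn_integral_cong)
      fix u assume "u \<in> space S.spheres"
      then have u: "u i \<in> S.W" if "i < m" for i using that by (auto simp: space_PiM PiE_iff unit_sphere_def)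
      let ?x = "\<lambda>i\<in>{..<m}. ?s *\<^sub>R z + r *\<^sub>R u i"
      define v where "v = gs_vol m (%i. (1 / r) *\<^sub>R (?s *\<^sub>R z) + orth_proj L (u i))"
      have v0: "0 \<le> v" unfolding v_def by (rule gs_vol_nonneg)
      have "fact m * simplex_volume m (- (?s / r) *\<^sub>R z) (%i. orth_proj L (u i)) = gs_vol m (%i. orth_proj L (u i) - (- (?s / r) *\<^sub>R z))"
       by (rule simplex_volume_eq_gs_vol[OF sL(1,3)]) (auto intro!: subspace_neg[OF sL(1)] subspace_scale[OF sL(1) z(1)] orth_proj_in[OF sL(1)])
      also have "(%i. orth_proj L (u i) - (- (?s / r) *\<^sub>R z)) = (%i. (1 / r) *\<^sub>R (?s *\<^sub>R z) + orth_proj L (u i))"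
       by (simp add: fun_eq_iff)
      finally have sv: "fact m * simplex_volume m (- (?s / r) *\<^sub>R z) (%i. orth_proj L (u i)) = v" unfolding v_def .
      have "vol m ?x = gs_vol m (%i. r *\<^sub>R ((1 / r) *\<^sub>R (?s *\<^sub>R z) + orth_proj L (u i)))"
      proof (rule gs_vol_cong)
       fix i assume i: "i < m"
       note lin = linear_orth_proj[OF subspace_V]
       have "orth_proj V (?x i) = ?s *\<^sub>R z + r *\<^sub>R orth_proj L (u i)"
        using i c sL(2) orth_proj_V_in_L(2)[OF sL(1,2) u[OF i]]
        by (simp only: restrict_apply lessThan_iff if_True linear_add[OF lin] linear_cmul[OF lin, of r] orth_proj_ident[OF subspace_V subsetD[OF sL(2) c]])
       then show "orth_proj V (?x i) = r *\<^sub>R ((1 / r) *\<^sub>R (?s *\<^sub>R z) + orth_proj L (u i))"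
        using rp by (simp add: scaleR_add_right)
      qed
      also have "... = (\<Prod>i<m. \<bar>r\<bar>) * v" unfolding v_def by (rule gs_scale) (use rp in simp)
      finally have vol: "vol m ?x = r ^ m * v" using rp by simp
      have n: "CARD('n) - dim Q - m = dim V - m" using dim_V by simp
      \<comment> \<open>The density \<open>vol ^ (dim V - m)\<close> scales with the power
        \<open>m * (dim V - m)\<close> of \<open>r\<close>, and the \<open>m\<close> spheres
        contribute \<open>m * (dim S.W - 1)\<close>. As \<open>dim S.W = m + dim Q\<close>, the
        dimension of \<open>Q\<close> cancels.\<close>
      have e: "m * (dim V - m) + m * (dim S.W - 1) = m * (CARD('n) - 1)"
      proof -
       have "dim V - m + (dim S.W - 1) = CARD('n) - 1" using dim_V S.dim_W m m1 by simp
       then show ?thesis by (simp only: add_mult_distrib2[symmetric])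
      qed
      \<comment> \<open>The volume occurs once more through the Jacobian in \<open>thin\<close>,
        which accounts for the final \<open>+ 1\<close> in its exponent; the \<open>+ 1\<close> in
        the exponent of \<open>r\<close> comes from the substitution of the radius.\<close>
      have pw: "vol m ?x ^ (dim V - m) * (v * r ^ (m * (dim S.W - 1))) * ?w = kernel r0 L r z u"
      proof -
       have "vol m ?x ^ (dim V - m) * (v * r ^ (m * (dim S.W - 1))) * ?w
        = r ^ (m * (dim V - m) + m * (dim S.W - 1)) * r * (r\<^sup>2 - r0\<^sup>2) powr ((real m - 2) / 2) * (v ^ (dim V - m) * v)"
        unfolding vol by (simp add: power_mult_distrib power_mult power_add mult_ac)
       then show ?thesis unfolding e kernel_def sv n by simp
      qed
      have "ennreal (vol m ?x ^ (dim V - m)) * (ennreal (v * r ^ (m * (dim S.W - 1))) * ennreal ?w) = ennreal (kernel r0 L r z u)"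
       unfolding pw[symmetric] using rp v0 by (simp add: ennreal_mult gs_vol_nonneg mult.assoc)
      then show "S.thin G (?s *\<^sub>R z) u * ennreal ?w = g ?x * ennreal (kernel r0 L r z u)"
       unfolding S.thin_def rad G_def v_def[symmetric] by (simp only: mult.assoc)
     qed
     finally show "H (?s *\<^sub>R z) * ennreal ?w = (INT+ u. g (\<lambda>i\<in>{..<m}. ?s *\<^sub>R z + r *\<^sub>R u i) * ennreal (kernel r0 L r z u) wrt S.spheres)" .
    qed
    finally show ?thesis using True by simp
   qed (use elim in simp)
  qed
 qed
 finally show ?thesis unfolding G_def .
qed

lemma spherical_formula_borel:
 assumes m1: "1 \<le> m" and r0: "0 \<le> r0" and g: "g \<in> bmeas (bPi {..<m})"
 shows "(INT+ x. g x wrt lPi {..<m}) =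
  (INT+ L. (\<integral>\<^sup>+ r\<in>{r0..}. (INT+ z. (INT+ u. g (\<lambda>i\<in>{..<m}. sqrt (r\<^sup>2 - r0\<^sup>2) *\<^sub>R z + r *\<^sub>R u i) * ennreal (kernel r0 L r z u)
    wrt PiM {..<m} (%_. unit_sphere_measure (subspace_sum L Q))) wrt unit_sphere_measure L) \<partial>lborel) wrt \<nu>)"
 unfolding blaschke_petkantschin[OF g] by (intro nn_integral_cong fibre_integral[OF _ m1 r0 g])

text \<open>A Lebesgue measurable \<open>f\<close> may be non-measurable on individual spheres. It
  is enclosed between two Borel functions with the same integral; the upper integral defined by the
  iterated right side is monotone for arbitrary functions, so it is enclosed as well.\<close>

theorem spherical_formula_completion:
 assumes m1: "1 \<le> m" and r0: "0 \<le> r0" and f: "f \<in> bmeas (completion (lPi {..<m}))"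
  and f0: "\<And>x. x \<in> space (PiM {..<m} (%_. lborel :: (real ^ 'n) measure)) ==> 0 \<le> f x"
 shows "(INT+ x. ennreal (f x) wrt completion (lPi {..<m})) =
  (INT+ L. (\<integral>\<^sup>+ r\<in>{r0..}. (INT+ z. (INT+ u. ennreal (f (\<lambda>i\<in>{..<m}. sqrt (r\<^sup>2 - r0\<^sup>2) *\<^sub>R z + r *\<^sub>R u i) * kernel r0 L r z u)
    wrt PiM {..<m} (%_. unit_sphere_measure (subspace_sum L Q))) wrt unit_sphere_measure L) \<partial>lborel) wrt \<nu>)"
proof -
 let ?M = "PiM {..<m} (%_. lborel :: (real ^ 'n) measure)"
 define J where "J g = (INT+ L. (\<integral>\<^sup>+ r\<in>{r0..}. (INT+ z. (INT+ u. g (\<lambda>i\<in>{..<m}. sqrt (r\<^sup>2 - r0\<^sup>2) *\<^sub>R z + r *\<^sub>R u i) * ennreal (kernel r0 L r z u)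
    wrt PiM {..<m} (%_. unit_sphere_measure (subspace_sum L Q))) wrt unit_sphere_measure L) \<partial>lborel) wrt \<nu>)" for g
 have J_mono: "J g \<le> J g'" if "\<And>x. x \<in> space ?M ==> g x \<le> g' x" for g g'
  unfolding J_def by (intro nn_integral_mono mult_right_mono that) (simp_all add: space_PiM)
 obtain g where g: "g \<in> bmeas ?M" "AE x in ?M. f x = g x" using completion_ex_borel_measurable_real[OF f] by blast
 obtain N where N: "{x \<in> space ?M. f x \<noteq> g x} \<subseteq> N" "N \<in> null_sets ?M" using g(2) by (auto simp: eventually_ae_filter)
 have Nm: "indicator N \<in> bmeas ?M" "indicator (space ?M - N) \<in> bmeas ?M"
  using N(2) by (auto intro!: borel_measurable_indicator sets.compl_sets)
 have fg: "f x = g x" if "x \<in> space ?M" "x \<notin> N" for x using N(1) that by blast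
 \<comment> \<open>On the exceptional null set \<open>N\<close> the lower function is 0 and the
   upper one is infinite, so that \<open>f\<close> lies between them at every point of the
   space.\<close>
 let ?g1 = "%x. ennreal (g x) * indicator (space ?M - N) x" and ?g2 = "%x. ennreal (g x) * indicator (space ?M - N) x + \<infinity> * indicator N x"
 have AEN: "AE x in ?M. x \<notin> N" by (rule AE_not_in[OF N(2)])
 have m1': "?g1 \<in> bmeas ?M" "?g2 \<in> bmeas ?M" using g(1) N(2) Nm by measurable
 have "(INT+ x. ?g1 x wrt ?M) = (INT+ x. ennreal (f x) wrt ?M)" "(INT+ x. ?g2 x wrt ?M) = (INT+ x. ennreal (f x) wrt ?M)"
  using AEN g(2) by (auto intro!: nn_integral_cong_AE elim: eventually_elim2)
 moreover have "(INT+ x. ennreal (f x) wrt completion ?M) = (INT+ x. ennreal (g x) wrt ?M)"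
 proof -
  have "(INT+ x. ennreal (f x) wrt completion ?M) = (INT+ x. ennreal (g x) wrt completion ?M)"
   using AE_completion[OF g(2)] by (intro nn_integral_cong_AE) auto
  then show ?thesis using g(1) by (simp add: nn_integral_completion)
 qed
 moreover have "(INT+ x. ennreal (f x) wrt ?M) = (INT+ x. ennreal (g x) wrt ?M)"
  using g(2) by (intro nn_integral_cong_AE) auto
 moreover have J: "(INT+ x. h x wrt ?M) = J h" if "h \<in> bmeas ?M" for h
  unfolding J_def using that by (intro spherical_formula_borel[OF m1 r0]) (simp add: measurable_cong_sets[OF sets_PiM_lborel refl])
 moreover have "J ?g1 \<le> J (%x. ennreal (f x))" "J (%x. ennreal (f x)) \<le> J ?g2"
  by (auto intro!: J_mono simp: indicator_def fg)
 ultimately have "(INT+ x. ennreal (f x) wrt completion ?M) = J (%x. ennreal (f x))"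
  using J[OF m1'(1)] J[OF m1'(2)] by (intro antisym) simp_all
 also have "... = (INT+ L. (\<integral>\<^sup>+ r\<in>{r0..}. (INT+ z. (INT+ u. ennreal (f (\<lambda>i\<in>{..<m}. sqrt (r\<^sup>2 - r0\<^sup>2) *\<^sub>R z + r *\<^sub>R u i) * kernel r0 L r z u)
    wrt PiM {..<m} (%_. unit_sphere_measure (subspace_sum L Q))) wrt unit_sphere_measure L) \<partial>lborel) wrt \<nu>)"
  unfolding J_def using f0 by (intro nn_integral_cong arg_cong2[where f = "(*)"] refl ennreal_mult'[symmetric]) (simp add: space_PiM)
 finally show ?thesis .
qed

end

section \<open>The integral formula\<close>

theorem theorem5:
  fixes Q :: "(real ^ 'n) set"
    and m q :: nat
    and r0 :: real
    and \<nu> :: "(real ^ 'n) set measure"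
    and f :: "(nat \<Rightarrow> real ^ 'n) \<Rightarrow> real"
  assumes "1 \<le> m"
    and "m + q \<le> CARD('n)"
    and "subspace Q"
    and "dim Q = q"
    and "0 \<le> r0"
    and "is_grassmannian_measure m (orthogonal_comp Q) \<nu>"
    and "f \<in> borel_measurable (completion (\<Pi>\<^sub>M i\<in>{..<m}. lborel))"
    and "\<And>x. x \<in> space (\<Pi>\<^sub>M i\<in>{..<m}. (lborel :: (real ^ 'n) measure)) \<Longrightarrow> 0 \<le> f x"
  shows "(\<integral>\<^sup>+ x. ennreal (f x) \<partial>completion (\<Pi>\<^sub>M i\<in>{..<m}. lborel)) =
    (\<integral>\<^sup>+ L. (\<integral>\<^sup>+ r\<in>{r0..}. (\<integral>\<^sup>+ z. (\<integral>\<^sup>+ u.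
        ennreal (f (\<lambda>i\<in>{..<m}. sqrt (r\<^sup>2 - r0\<^sup>2) *\<^sub>R z + r *\<^sub>R u i)
          * r ^ (m * (CARD('n) - 1) + 1)
          * (r\<^sup>2 - r0\<^sup>2) powr ((real m - 2) / 2)
          * (fact m * simplex_volume m (- (sqrt (r\<^sup>2 - r0\<^sup>2) / r) *\<^sub>R z) (\<lambda>i. orth_proj L (u i)))
              ^ (CARD('n) - q - m + 1))
        \<partial>(\<Pi>\<^sub>M i\<in>{..<m}. unit_sphere_measure (subspace_sum L Q)))
        \<partial>unit_sphere_measure L) \<partial>lborel) \<partial>\<nu>)"
proof -
  obtain b where b: "onb (dim (orthogonal_comp Q)) b (orthogonal_comp Q)"
    using onb_exists[OF subspace_orthogonal_comp] .
  interpret grassmann_frame Q b m \<nu>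
    using assms b dim_orthogonal_comp[OF assms(3)] by unfold_locales auto
  show ?thesis
    by (subst spherical_formula_completion[OF assms(1,5,7)]) (use assms(8) in \<open>simp_all only: kernel_def assms(4) mult.assoc\<close>)
qed

end
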